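(* Let $\mathcal{A}$ be a locally noetherian Grothendieck category. If $\gamma$ is a left exact radical functor on $\mathcal{A}$ preserving injective objects, then the right derived functor $\mathbf{R}\gamma:\mathcal{D}^+(\mathcal{A})\to\mathcal{D}^+(\mathcal{A})$ is an abstract local cohomology functor.
   Context: A preradical functor on $\mathcal{A}$ is a subobject $\gamma$ of the identity functor; it is radical if $\gamma(M/\gamma(M))=0$ for every object $M$. $\mathcal{D}^+(\mathcal{A})$ is the derived category of left bounded complexes of objects of $\mathcal{A}$. A triangle functor is an additive functor commuting with the shift $[1]$ up to isomorphism and preserving triangles. For a triangle functor $\delta:\mathcal{T}\to\mathcal{T}$ with $\mathcal{T}=\mathcal{D}^+(\mathcal{A})$, $\mathrm{Im}(\delta)$ is the full subcategory of objects isomorphic to $\delta(X)$ for some $X$, and $\mathrm{Ker}(\delta)$ is the full subcategory of objects $X$ with $\delta(X)\cong0$. $\delta$ is an abstract local cohomology functor if: (1) the natural embedding $i:\mathrm{Im}(\delta)\to\mathcal{T}$ has a right adjoint $\rho:\mathcal{T}\to\mathrm{Im}(\delta)$ and $\delta\cong i\circ\rho$ (hence, by a theorem of Miyachi, $(\mathrm{Im}(\delta),\mathrm{Ker}(\delta))$ is a stable t-structure on $\mathcal{T}$, i.e. a pair $(\mathcal{U},\mathcal{V})$ of full triangulated subcategories with $\mathrm{Hom}_{\mathcal{T}}(U,V)=0$ for all $U\in\mathcal{U}$, $V\in\mathcal{V}$, and such that every $X$ fits in a triangle $U\to X\to V\to U[1]$ with $U\in\mathcal{U}$, $V\in\mathcal{V}$);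 (2) every indecomposable injective object of $\mathcal{A}$ (viewed as a complex in degree $0$) belongs either to $\mathrm{Im}(\delta)$ or to $\mathrm{Ker}(\delta)$. *)

theory Defs
  imports Main "HOL-Library.Equipollence"
begin

section \<open>Categories, functors, natural transformations\<close>

record ('o, 'm) cat =
  Ob :: "'o set"
  Arr :: "'m set"
  Dom :: "'m \<Rightarrow> 'o"
  Cod :: "'m \<Rightarrow> 'o"
  Id :: "'o \<Rightarrow> 'm"
  Comp :: "'m \<Rightarrow> 'm \<Rightarrow> 'm"  (infixl \<open>\<cdot>\<index>\<close> 70)

text \<open>Composition is written in the usual order: \<open>g \<cdot> f\<close> is ``first f, then g''.\<close>

definition Hom :: "('o, 'm, 'z) cat_scheme \<Rightarrow> 'o \<Rightarrow> 'o \<Rightarrow> 'm set" where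
  "Hom C X Y = {f \<in> Arr C. Dom C f = X \<and> Cod C f = Y}"

locale category =
  fixes C :: "('o, 'm, 'z) cat_scheme" (structure)
  assumes Dom_Ob: "f \<in> Arr C \<Longrightarrow> Dom C f \<in> Ob C"
    and Cod_Ob: "f \<in> Arr C \<Longrightarrow> Cod C f \<in> Ob C"
    and Id_Hom: "X \<in> Ob C \<Longrightarrow> Id C X \<in> Hom C X X"
    and Comp_Hom: "\<lbrakk>f \<in> Hom C X Y; g \<in> Hom C Y Z\<rbrakk> \<Longrightarrow> g \<cdot> f \<in> Hom C X Z"
    and Comp_Id: "f \<in> Hom C X Y \<Longrightarrow> f \<cdot> Id C X = f"
    and Id_Comp: "f \<in> Hom C X Y \<Longrightarrow> Id C Y \<cdot> f = f"
    and Comp_assoc: "\<lbrakk>f \<in> Hom C W X; g \<in> Hom C X Y; h \<in> Hom C Y Z\<rbrakk>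
      \<Longrightarrow> (h \<cdot> g) \<cdot> f = h \<cdot> (g \<cdot> f)"

definition is_iso :: "('o, 'm, 'z) cat_scheme \<Rightarrow> 'm \<Rightarrow> bool" where
  "is_iso C f \<longleftrightarrow> f \<in> Arr C \<and> (\<exists>g \<in> Hom C (Cod C f) (Dom C f).
     g \<cdot> f = Id C (Dom C f) \<and> f \<cdot> g = Id C (Cod C f))"
  for C (structure)

definition isomorphic :: "('o, 'm, 'z) cat_scheme \<Rightarrow> 'o \<Rightarrow> 'o \<Rightarrow> bool" where
  "isomorphic C X Y \<longleftrightarrow> (\<exists>f \<in> Hom C X Y. is_iso C f)"

definition is_mono :: "('o, 'm, 'z) cat_scheme \<Rightarrow> 'm \<Rightarrow> bool" where
  "is_mono C f \<longleftrightarrow> f \<in> Arr C \<and>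
     (\<forall>W. \<forall>g \<in> Hom C W (Dom C f). \<forall>h \<in> Hom C W (Dom C f). f \<cdot> g = f \<cdot> h \<longrightarrow> g = h)"
  for C (structure)

definition is_epi :: "('o, 'm, 'z) cat_scheme \<Rightarrow> 'm \<Rightarrow> bool" where
  "is_epi C f \<longleftrightarrow> f \<in> Arr C \<and>
     (\<forall>W. \<forall>g \<in> Hom C (Cod C f) W. \<forall>h \<in> Hom C (Cod C f) W. g \<cdot> f = h \<cdot> f \<longrightarrow> g = h)"
  for C (structure)

definition is_zero_object :: "('o, 'm, 'z) cat_scheme \<Rightarrow> 'o \<Rightarrow> bool" where
  "is_zero_object C Z \<longleftrightarrow> Z \<in> Ob C \<and>
     (\<forall>X \<in> Ob C. (\<exists>!f. f \<in> Hom C X Z) \<and> (\<exists>!f. f \<in> Hom C Z X))"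

definition is_zero_arrow :: "('o, 'm, 'z) cat_scheme \<Rightarrow> 'm \<Rightarrow> bool" where
  "is_zero_arrow C f \<longleftrightarrow> (\<exists>Z g h. is_zero_object C Z \<and>
     g \<in> Hom C (Dom C f) Z \<and> h \<in> Hom C Z (Cod C f) \<and> f = h \<cdot> g)"
  for C (structure)

text \<open>\<open>P\<close> with injections \<open>i\<close>, \<open>j\<close> and projections \<open>p\<close>, \<open>q\<close> is a direct sum of
  \<open>X\<close> and \<open>Y\<close>.\<close>

definition is_biproduct ::
  "('o, 'm, 'z) cat_scheme \<Rightarrow> 'o \<Rightarrow> 'm \<Rightarrow> 'm \<Rightarrow> 'm \<Rightarrow> 'm \<Rightarrow> 'o \<Rightarrow> 'o \<Rightarrow> bool" where
  "is_biproduct C P i j p q X Y \<longleftrightarrow>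
     i \<in> Hom C X P \<and> j \<in> Hom C Y P \<and> p \<in> Hom C P X \<and> q \<in> Hom C P Y \<and>
     p \<cdot> i = Id C X \<and> q \<cdot> j = Id C Y \<and> is_zero_arrow C (p \<cdot> j) \<and> is_zero_arrow C (q \<cdot> i) \<and>
     (\<forall>W. \<forall>f \<in> Hom C W X. \<forall>g \<in> Hom C W Y. \<exists>!u. u \<in> Hom C W P \<and> p \<cdot> u = f \<and> q \<cdot> u = g) \<and>
     (\<forall>W. \<forall>f \<in> Hom C X W. \<forall>g \<in> Hom C Y W. \<exists>!u. u \<in> Hom C P W \<and> u \<cdot> i = f \<and> u \<cdot> j = g)"
  for C (structure)

text \<open>In an additive category the sum of parallel arrows is determined by the category:
  \<open>f + g\<close> is the composite of \<open>(f, g) : X \<rightarrow> Y \<oplus> Y\<close> with the codiagonal of \<open>Y\<close>.\<close>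

definition is_sum_of_arrows :: "('o, 'm, 'z) cat_scheme \<Rightarrow> 'm \<Rightarrow> 'm \<Rightarrow> 'm \<Rightarrow> bool" where
  "is_sum_of_arrows C f g h \<longleftrightarrow> (\<exists>X Y P i j p q u s.
     f \<in> Hom C X Y \<and> g \<in> Hom C X Y \<and> is_biproduct C P i j p q Y Y \<and>
     u \<in> Hom C X P \<and> p \<cdot> u = f \<and> q \<cdot> u = g \<and>
     s \<in> Hom C P Y \<and> s \<cdot> i = Id C Y \<and> s \<cdot> j = Id C Y \<and> h = s \<cdot> u)"
  for C (structure)

record ('o, 'm, 'p, 'n) fctr =
  FOb :: "'o \<Rightarrow> 'p"
  FArr :: "'m \<Rightarrow> 'n"

locale cat_functor = C: category C + D: category D
  for C :: "('o, 'm, 'y) cat_scheme" and D :: "('p, 'n, 'z) cat_scheme" +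
  fixes F :: "('o, 'm, 'p, 'n) fctr"
  assumes FOb_Ob: "X \<in> Ob C \<Longrightarrow> FOb F X \<in> Ob D"
    and FArr_Hom: "f \<in> Hom C X Y \<Longrightarrow> FArr F f \<in> Hom D (FOb F X) (FOb F Y)"
    and FArr_Id: "X \<in> Ob C \<Longrightarrow> FArr F (Id C X) = Id D (FOb F X)"
    and FArr_Comp: "\<lbrakk>f \<in> Hom C X Y; g \<in> Hom C Y Z\<rbrakk>
      \<Longrightarrow> FArr F (g \<cdot>\<^bsub>C\<^esub> f) = FArr F g \<cdot>\<^bsub>D\<^esub> FArr F f"

definition id_functor :: "('o, 'm, 'o, 'm) fctr" where
  "id_functor = \<lparr>FOb = (\<lambda>X. X), FArr = (\<lambda>f. f)\<rparr>"

definition comp_functor ::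
  "('p, 'n, 'q, 'k) fctr \<Rightarrow> ('o, 'm, 'p, 'n) fctr \<Rightarrow> ('o, 'm, 'q, 'k) fctr" (infixl \<open>\<circ>\<^sub>F\<close> 70) where
  "G \<circ>\<^sub>F F = \<lparr>FOb = (\<lambda>X. FOb G (FOb F X)), FArr = (\<lambda>f. FArr G (FArr F f))\<rparr>"

definition nat_trans :: "('o, 'm, 'y) cat_scheme \<Rightarrow> ('p, 'n, 'z) cat_scheme \<Rightarrow>
    ('o, 'm, 'p, 'n) fctr \<Rightarrow> ('o, 'm, 'p, 'n) fctr \<Rightarrow> ('o \<Rightarrow> 'n) \<Rightarrow> bool" where
  "nat_trans C D F G \<tau> \<longleftrightarrow> cat_functor C D F \<and> cat_functor C D G \<and>
     (\<forall>X \<in> Ob C. \<tau> X \<in> Hom D (FOb F X) (FOb G X)) \<and>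
     (\<forall>f \<in> Arr C. \<tau> (Cod C f) \<cdot>\<^bsub>D\<^esub> FArr F f = FArr G f \<cdot>\<^bsub>D\<^esub> \<tau> (Dom C f))"

definition nat_iso :: "('o, 'm, 'y) cat_scheme \<Rightarrow> ('p, 'n, 'z) cat_scheme \<Rightarrow>
    ('o, 'm, 'p, 'n) fctr \<Rightarrow> ('o, 'm, 'p, 'n) fctr \<Rightarrow> ('o \<Rightarrow> 'n) \<Rightarrow> bool" where
  "nat_iso C D F G \<tau> \<longleftrightarrow> nat_trans C D F G \<tau> \<and> (\<forall>X \<in> Ob C. is_iso D (\<tau> X))"

definition naturally_isomorphic :: "('o, 'm, 'y) cat_scheme \<Rightarrow> ('p, 'n, 'z) cat_scheme \<Rightarrow>
    ('o, 'm, 'p, 'n) fctr \<Rightarrow> ('o, 'm, 'p, 'n) fctr \<Rightarrow> bool" where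
  "naturally_isomorphic C D F G \<longleftrightarrow> (\<exists>\<tau>. nat_iso C D F G \<tau>)"

text \<open>\<open>G : D \<rightarrow> C\<close> is right adjoint to \<open>F : C \<rightarrow> D\<close> (unit, counit, triangle identities).\<close>

definition is_right_adjoint :: "('o, 'm, 'y) cat_scheme \<Rightarrow> ('p, 'n, 'z) cat_scheme \<Rightarrow>
    ('o, 'm, 'p, 'n) fctr \<Rightarrow> ('p, 'n, 'o, 'm) fctr \<Rightarrow> bool" where
  "is_right_adjoint C D F G \<longleftrightarrow> (\<exists>\<eta> \<epsilon>.
     nat_trans C C id_functor (G \<circ>\<^sub>F F) \<eta> \<and> nat_trans D D (F \<circ>\<^sub>F G) id_functor \<epsilon> \<and>
     (\<forall>X \<in> Ob C. \<epsilon> (FOb F X) \<cdot>\<^bsub>D\<^esub> FArr F (\<eta> X) = Id D (FOb F X)) \<and>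
     (\<forall>Y \<in> Ob D. FArr G (\<epsilon> Y) \<cdot>\<^bsub>C\<^esub> \<eta> (FOb G Y) = Id C (FOb G Y)))"

definition full_subcategory :: "('o, 'm) cat \<Rightarrow> 'o set \<Rightarrow> ('o, 'm) cat" where
  "full_subcategory C S =
     C\<lparr>Ob := Ob C \<inter> S, Arr := {f \<in> Arr C. Dom C f \<in> S \<and> Cod C f \<in> S}\<rparr>"

definition additive_functor :: "('o, 'm, 'y) cat_scheme \<Rightarrow> ('p, 'n, 'z) cat_scheme \<Rightarrow>
    ('o, 'm, 'p, 'n) fctr \<Rightarrow> bool" where
  "additive_functor C D F \<longleftrightarrow> cat_functor C D F \<and>
     (\<forall>f g h. is_sum_of_arrows C f g h
        \<longrightarrow> is_sum_of_arrows D (FArr F f) (FArr F g) (FArr F h))"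


section \<open>Abelian categories\<close>

record ('o, 'm) abcat = "('o, 'm) cat" +
  Add :: "'m \<Rightarrow> 'm \<Rightarrow> 'm"  (infixl \<open>\<oplus>\<index>\<close> 65)
  Zero :: "'o \<Rightarrow> 'o \<Rightarrow> 'm"
  Neg :: "'m \<Rightarrow> 'm"

locale preadditive_category = category A for A :: "('o, 'm) abcat" (structure) +
  assumes Add_Hom: "\<lbrakk>f \<in> Hom A X Y; g \<in> Hom A X Y\<rbrakk> \<Longrightarrow> f \<oplus> g \<in> Hom A X Y"
    and Zero_Hom: "\<lbrakk>X \<in> Ob A; Y \<in> Ob A\<rbrakk> \<Longrightarrow> Zero A X Y \<in> Hom A X Y"
    and Neg_Hom: "f \<in> Hom A X Y \<Longrightarrow> Neg A f \<in> Hom A X Y"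
    and Add_assoc: "\<lbrakk>f \<in> Hom A X Y; g \<in> Hom A X Y; h \<in> Hom A X Y\<rbrakk>
      \<Longrightarrow> (f \<oplus> g) \<oplus> h = f \<oplus> (g \<oplus> h)"
    and Add_commute: "\<lbrakk>f \<in> Hom A X Y; g \<in> Hom A X Y\<rbrakk> \<Longrightarrow> f \<oplus> g = g \<oplus> f"
    and Add_Zero: "f \<in> Hom A X Y \<Longrightarrow> f \<oplus> Zero A X Y = f"
    and Add_Neg: "f \<in> Hom A X Y \<Longrightarrow> f \<oplus> Neg A f = Zero A X Y"
    and Comp_Add: "\<lbrakk>f \<in> Hom A X Y; g \<in> Hom A X Y; h \<in> Hom A Y Z\<rbrakk>
      \<Longrightarrow> h \<cdot> (f \<oplus> g) = (h \<cdot> f) \<oplus> (h \<cdot> g)"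
    and Add_Comp: "\<lbrakk>f \<in> Hom A X Y; g \<in> Hom A Y Z; h \<in> Hom A Y Z\<rbrakk>
      \<Longrightarrow> (g \<oplus> h) \<cdot> f = (g \<cdot> f) \<oplus> (h \<cdot> f)"

definition is_kernel :: "('o, 'm) abcat \<Rightarrow> 'm \<Rightarrow> 'm \<Rightarrow> bool" where
  "is_kernel A k f \<longleftrightarrow> f \<in> Arr A \<and> k \<in> Arr A \<and> Cod A k = Dom A f \<and>
     f \<cdot> k = Zero A (Dom A k) (Cod A f) \<and>
     (\<forall>W. \<forall>g \<in> Hom A W (Dom A f). f \<cdot> g = Zero A W (Cod A f)
        \<longrightarrow> (\<exists>!u. u \<in> Hom A W (Dom A k) \<and> k \<cdot> u = g))"
  for A (structure)

definition is_cokernel :: "('o, 'm) abcat \<Rightarrow> 'm \<Rightarrow> 'm \<Rightarrow> bool" where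
  "is_cokernel A c f \<longleftrightarrow> f \<in> Arr A \<and> c \<in> Arr A \<and> Dom A c = Cod A f \<and>
     c \<cdot> f = Zero A (Dom A f) (Cod A c) \<and>
     (\<forall>W. \<forall>g \<in> Hom A (Cod A f) W. g \<cdot> f = Zero A (Dom A f) W
        \<longrightarrow> (\<exists>!u. u \<in> Hom A (Cod A c) W \<and> u \<cdot> c = g))"
  for A (structure)

locale abelian_category = preadditive_category +
  assumes ex_zero_object: "\<exists>Z. is_zero_object A Z"
    and ex_biproduct: "\<lbrakk>X \<in> Ob A; Y \<in> Ob A\<rbrakk> \<Longrightarrow> \<exists>P i j p q. is_biproduct A P i j p q X Y"
    and ex_kernel: "f \<in> Arr A \<Longrightarrow> \<exists>k. is_kernel A k f"
    and ex_cokernel: "f \<in> Arr A \<Longrightarrow> \<exists>c. is_cokernel A c f"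
    and mono_is_kernel: "is_mono A k \<Longrightarrow> \<exists>f. is_kernel A k f"
    and epi_is_cokernel: "is_epi A c \<Longrightarrow> \<exists>f. is_cokernel A c f"

definition short_exact :: "('o, 'm) abcat \<Rightarrow> 'm \<Rightarrow> 'm \<Rightarrow> bool" where
  "short_exact A f g \<longleftrightarrow> is_kernel A f g \<and> is_cokernel A g f"

definition injective_object :: "('o, 'm) abcat \<Rightarrow> 'o \<Rightarrow> bool" where
  "injective_object A E \<longleftrightarrow> E \<in> Ob A \<and>
     (\<forall>m f. is_mono A m \<and> f \<in> Hom A (Dom A m) E
        \<longrightarrow> (\<exists>g \<in> Hom A (Cod A m) E. g \<cdot> m = f))"
  for A (structure)

definition indecomposable_object :: "('o, 'm) abcat \<Rightarrow> 'o \<Rightarrow> bool" where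
  "indecomposable_object A E \<longleftrightarrow> E \<in> Ob A \<and> \<not> is_zero_object A E \<and>
     (\<forall>X Y i j p q. is_biproduct A E i j p q X Y \<longrightarrow> is_zero_object A X \<or> is_zero_object A Y)"

text \<open>Ascending chain condition on subobjects, a subobject being represented by a monomorphism.\<close>

definition noetherian_object :: "('o, 'm) abcat \<Rightarrow> 'o \<Rightarrow> bool" where
  "noetherian_object A X \<longleftrightarrow> X \<in> Ob A \<and>
     (\<forall>m :: nat \<Rightarrow> 'm.
        (\<forall>n. is_mono A (m n) \<and> Cod A (m n) = X) \<and>
        (\<forall>n. \<exists>u \<in> Hom A (Dom A (m n)) (Dom A (m (Suc n))). m n = m (Suc n) \<cdot> u)
        \<longrightarrow> (\<exists>N. \<forall>n \<ge> N. \<exists>u \<in> Hom A (Dom A (m (Suc n))) (Dom A (m n)). m (Suc n) = m n \<cdot> u))"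
  for A (structure)


section \<open>Grothendieck categories\<close>

text \<open>Smallness is relative to a type \<open>'u\<close> playing the role of a Grothendieck universe: a set is
  small if its cardinality is strictly less than that of \<open>'u\<close>, and the cardinality of \<open>'u\<close> is
  required to be (uncountable, strongly) inaccessible.\<close>

definition small :: "'u itself \<Rightarrow> 'a set \<Rightarrow> bool" where
  "small U S \<longleftrightarrow> S \<prec> (UNIV :: 'u set)"

definition universe_type :: "'u itself \<Rightarrow> bool" where
  "universe_type U \<longleftrightarrow>
     small U (UNIV :: nat set) \<and>
     (\<forall>S :: 'u set. small U S \<longrightarrow> small U (Pow S)) \<and>
     (\<forall>(I :: 'u set) (S :: 'u \<Rightarrow> 'u set).
        small U I \<and> (\<forall>i \<in> I. small U (S i)) \<longrightarrow> small U (\<Union>i \<in> I. S i))"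

definition is_coproduct ::
  "('o, 'm) abcat \<Rightarrow> 'i set \<Rightarrow> ('i \<Rightarrow> 'o) \<Rightarrow> 'o \<Rightarrow> ('i \<Rightarrow> 'm) \<Rightarrow> bool" where
  "is_coproduct A I X L \<iota> \<longleftrightarrow> L \<in> Ob A \<and> (\<forall>i \<in> I. \<iota> i \<in> Hom A (X i) L) \<and>
     (\<forall>W \<in> Ob A. \<forall>f. (\<forall>i \<in> I. f i \<in> Hom A (X i) W)
        \<longrightarrow> (\<exists>!u. u \<in> Hom A L W \<and> (\<forall>i \<in> I. u \<cdot> \<iota> i = f i)))"
  for A (structure)

definition directed_set :: "'i set \<Rightarrow> ('i \<Rightarrow> 'i \<Rightarrow> bool) \<Rightarrow> bool" where
  "directed_set I le \<longleftrightarrow> I \<noteq> {} \<and> (\<forall>i \<in> I. le i i) \<and>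
     (\<forall>i \<in> I. \<forall>j \<in> I. \<forall>k \<in> I. le i j \<and> le j k \<longrightarrow> le i k) \<and>
     (\<forall>i \<in> I. \<forall>j \<in> I. \<exists>k \<in> I. le i k \<and> le j k)"

definition direct_system :: "('o, 'm) abcat \<Rightarrow> 'i set \<Rightarrow> ('i \<Rightarrow> 'i \<Rightarrow> bool) \<Rightarrow>
    ('i \<Rightarrow> 'o) \<Rightarrow> ('i \<Rightarrow> 'i \<Rightarrow> 'm) \<Rightarrow> bool" where
  "direct_system A I le X t \<longleftrightarrow> directed_set I le \<and>
     (\<forall>i \<in> I. X i \<in> Ob A \<and> t i i = Id A (X i)) \<and>
     (\<forall>i \<in> I. \<forall>j \<in> I. le i j \<longrightarrow> t i j \<in> Hom A (X i) (X j)) \<and>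
     (\<forall>i \<in> I. \<forall>j \<in> I. \<forall>k \<in> I. le i j \<and> le j k \<longrightarrow> t j k \<cdot> t i j = t i k)"
  for A (structure)

definition system_morphism :: "('o, 'm) abcat \<Rightarrow> 'i set \<Rightarrow> ('i \<Rightarrow> 'i \<Rightarrow> bool) \<Rightarrow>
    ('i \<Rightarrow> 'o) \<Rightarrow> ('i \<Rightarrow> 'i \<Rightarrow> 'm) \<Rightarrow> ('i \<Rightarrow> 'o) \<Rightarrow> ('i \<Rightarrow> 'i \<Rightarrow> 'm) \<Rightarrow> ('i \<Rightarrow> 'm) \<Rightarrow> bool" where
  "system_morphism A I le X t Y s f \<longleftrightarrow> (\<forall>i \<in> I. f i \<in> Hom A (X i) (Y i)) \<and>
     (\<forall>i \<in> I. \<forall>j \<in> I. le i j \<longrightarrow> s i j \<cdot> f i = f j \<cdot> t i j)"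
  for A (structure)

definition is_direct_limit :: "('o, 'm) abcat \<Rightarrow> 'i set \<Rightarrow> ('i \<Rightarrow> 'i \<Rightarrow> bool) \<Rightarrow>
    ('i \<Rightarrow> 'o) \<Rightarrow> ('i \<Rightarrow> 'i \<Rightarrow> 'm) \<Rightarrow> 'o \<Rightarrow> ('i \<Rightarrow> 'm) \<Rightarrow> bool" where
  "is_direct_limit A I le X t L l \<longleftrightarrow> L \<in> Ob A \<and> (\<forall>i \<in> I. l i \<in> Hom A (X i) L) \<and>
     (\<forall>i \<in> I. \<forall>j \<in> I. le i j \<longrightarrow> l j \<cdot> t i j = l i) \<and>
     (\<forall>W \<in> Ob A. \<forall>f. (\<forall>i \<in> I. f i \<in> Hom A (X i) W) \<and>
          (\<forall>i \<in> I. \<forall>j \<in> I. le i j \<longrightarrow> f j \<cdot> t i j = f i)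
        \<longrightarrow> (\<exists>!u. u \<in> Hom A L W \<and> (\<forall>i \<in> I. u \<cdot> l i = f i)))"
  for A (structure)

definition has_small_coproducts :: "'u itself \<Rightarrow> ('o, 'm) abcat \<Rightarrow> bool" where
  "has_small_coproducts U A \<longleftrightarrow> (\<forall>(I :: 'u set) X. small U I \<and> (\<forall>i \<in> I. X i \<in> Ob A)
     \<longrightarrow> (\<exists>L \<iota>. is_coproduct A I X L \<iota>))"

definition exact_direct_limits :: "'u itself \<Rightarrow> ('o, 'm) abcat \<Rightarrow> bool" where
  "exact_direct_limits U A \<longleftrightarrow>
     (\<forall>(I :: 'u set) le X s Y t Z r f g LX x LY y LZ z \<phi> \<psi>.
        small U I \<and>
        direct_system A I le X s \<and> direct_system A I le Y t \<and> direct_system A I le Z r \<and>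
        system_morphism A I le X s Y t f \<and> system_morphism A I le Y t Z r g \<and>
        (\<forall>i \<in> I. short_exact A (f i) (g i)) \<and>
        is_direct_limit A I le X s LX x \<and> is_direct_limit A I le Y t LY y \<and>
        is_direct_limit A I le Z r LZ z \<and>
        \<phi> \<in> Hom A LX LY \<and> (\<forall>i \<in> I. \<phi> \<cdot> x i = y i \<cdot> f i) \<and>
        \<psi> \<in> Hom A LY LZ \<and> (\<forall>i \<in> I. \<psi> \<cdot> y i = z i \<cdot> g i)
        \<longrightarrow> short_exact A \<phi> \<psi>)"
  for A (structure)

definition generating_set :: "('o, 'm) abcat \<Rightarrow> 'o set \<Rightarrow> bool" where
  "generating_set A S \<longleftrightarrow> S \<subseteq> Ob A \<and>
     (\<forall>X Y. \<forall>f \<in> Hom A X Y. \<forall>g \<in> Hom A X Y.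
        f \<noteq> g \<longrightarrow> (\<exists>G \<in> S. \<exists>h \<in> Hom A G X. f \<cdot> h \<noteq> g \<cdot> h))"
  for A (structure)

definition grothendieck_category :: "'u itself \<Rightarrow> ('o, 'm) abcat \<Rightarrow> bool" where
  "grothendieck_category U A \<longleftrightarrow> abelian_category A \<and>
     (\<forall>X \<in> Ob A. \<forall>Y \<in> Ob A. small U (Hom A X Y)) \<and>
     has_small_coproducts U A \<and> exact_direct_limits U A \<and>
     (\<exists>G. generating_set A {G})"

definition locally_noetherian_grothendieck_category :: "'u itself \<Rightarrow> ('o, 'm) abcat \<Rightarrow> bool" where
  "locally_noetherian_grothendieck_category U A \<longleftrightarrow> grothendieck_category U A \<and>
     (\<exists>S. small U S \<and> generating_set A S \<and> (\<forall>G \<in> S. noetherian_object A G))"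


section \<open>Left exact radical functors\<close>

text \<open>A subobject of the identity functor is represented by a functor \<open>\<gamma>\<close> together with a natural
  transformation \<open>\<iota> : \<gamma> \<rightarrow> id\<close> whose components are monomorphisms.\<close>

definition preradical_functor ::
  "('o, 'm) abcat \<Rightarrow> ('o, 'm, 'o, 'm) fctr \<Rightarrow> ('o \<Rightarrow> 'm) \<Rightarrow> bool" where
  "preradical_functor A \<gamma> \<iota> \<longleftrightarrow> nat_trans A A \<gamma> id_functor \<iota> \<and> (\<forall>M \<in> Ob A. is_mono A (\<iota> M))"

definition radical_functor ::
  "('o, 'm) abcat \<Rightarrow> ('o, 'm, 'o, 'm) fctr \<Rightarrow> ('o \<Rightarrow> 'm) \<Rightarrow> bool" where
  "radical_functor A \<gamma> \<iota> \<longleftrightarrow> preradical_functor A \<gamma> \<iota> \<and>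
     (\<forall>M \<in> Ob A. \<forall>c. is_cokernel A c (\<iota> M) \<longrightarrow> is_zero_object A (FOb \<gamma> (Cod A c)))"

definition left_exact_functor :: "('o, 'm) abcat \<Rightarrow> ('o, 'm, 'o, 'm) fctr \<Rightarrow> bool" where
  "left_exact_functor A F \<longleftrightarrow> additive_functor A A F \<and>
     (\<forall>k f. is_kernel A k f \<longrightarrow> is_kernel A (FArr F k) (FArr F f))"

definition preserves_injectives :: "('o, 'm) abcat \<Rightarrow> ('o, 'm, 'o, 'm) fctr \<Rightarrow> bool" where
  "preserves_injectives A F \<longleftrightarrow> (\<forall>E. injective_object A E \<longrightarrow> injective_object A (FOb F E))"


section \<open>Left bounded complexes\<close>

record ('o, 'm) cpx =
  Obj :: "int \<Rightarrow> 'o"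
  Diff :: "int \<Rightarrow> 'm"

type_synonym ('o, 'm) cmap = "('o, 'm) cpx \<times> (int \<Rightarrow> 'm) \<times> ('o, 'm) cpx"

definition left_bounded_complex :: "('o, 'm) abcat \<Rightarrow> ('o, 'm) cpx \<Rightarrow> bool" where
  "left_bounded_complex A X \<longleftrightarrow>
     (\<forall>n. Obj X n \<in> Ob A \<and> Diff X n \<in> Hom A (Obj X n) (Obj X (n + 1)) \<and>
        Diff X (n + 1) \<cdot> Diff X n = Zero A (Obj X n) (Obj X (n + 2))) \<and>
     (\<exists>N. \<forall>n < N. is_zero_object A (Obj X n))"
  for A (structure)

definition Cplus :: "('o, 'm) abcat \<Rightarrow> (('o, 'm) cpx, ('o, 'm) cmap) cat" where
  "Cplus A = \<lparr>
     Ob = {X. left_bounded_complex A X},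
     Arr = {(X, f, Y). left_bounded_complex A X \<and> left_bounded_complex A Y \<and>
              (\<forall>n. f n \<in> Hom A (Obj X n) (Obj Y n) \<and> Diff Y n \<cdot> f n = f (n + 1) \<cdot> Diff X n)},
     Dom = (\<lambda>(X, f, Y). X),
     Cod = (\<lambda>(X, f, Y). Y),
     Id = (\<lambda>X. (X, \<lambda>n. Id A (Obj X n), X)),
     Comp = (\<lambda>(Y', g, Z) (X, f, Y). (X, \<lambda>n. g n \<cdot> f n, Z))\<rparr>"
  for A (structure)

text \<open>\<open>H\<^sup>n(X)\<close> is the cokernel of the map \<open>b : X\<^sup>n\<^sup>-\<^sup>1 \<rightarrow> Z\<^sup>n\<close> induced by the differential, where
  \<open>z : Z\<^sup>n \<rightarrow> X\<^sup>n\<close> is the kernel of the differential; \<open>c\<close> is the projection \<open>Z\<^sup>n \<rightarrow> H\<^sup>n(X)\<close>.\<close>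

definition is_cohomology ::
  "('o, 'm) abcat \<Rightarrow> ('o, 'm) cpx \<Rightarrow> int \<Rightarrow> 'm \<Rightarrow> 'm \<Rightarrow> bool" where
  "is_cohomology A X n z c \<longleftrightarrow> is_kernel A z (Diff X n) \<and>
     (\<exists>b \<in> Hom A (Obj X (n - 1)) (Dom A z). z \<cdot> b = Diff X (n - 1) \<and> is_cokernel A c b)"
  for A (structure)

definition quasi_isos :: "('o, 'm) abcat \<Rightarrow> ('o, 'm) cmap set" where
  "quasi_isos A = {(X, f, Y). (X, f, Y) \<in> Arr (Cplus A) \<and>
     (\<forall>n z c z' c' u h.
        is_cohomology A X n z c \<and> is_cohomology A Y n z' c' \<and>
        u \<in> Hom A (Dom A z) (Dom A z') \<and> z' \<cdot> u = f n \<cdot> z \<and>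
        h \<in> Hom A (Cod A c) (Cod A c') \<and> h \<cdot> c = c' \<cdot> u
        \<longrightarrow> is_iso A h)}"
  for A (structure)

definition shift_cpx :: "('o, 'm) abcat \<Rightarrow> ('o, 'm) cpx \<Rightarrow> ('o, 'm) cpx" where
  "shift_cpx A X = \<lparr>Obj = (\<lambda>n. Obj X (n + 1)), Diff = (\<lambda>n. Neg A (Diff X (n + 1)))\<rparr>"

definition Cplus_shift ::
  "('o, 'm) abcat \<Rightarrow> (('o, 'm) cpx, ('o, 'm) cmap, ('o, 'm) cpx, ('o, 'm) cmap) fctr" where
  "Cplus_shift A = \<lparr>FOb = shift_cpx A,
     FArr = (\<lambda>(X, f, Y). (shift_cpx A X, \<lambda>n. f (n + 1), shift_cpx A Y))\<rparr>"

definition Cplus_functor ::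
  "('o, 'm, 'o, 'm) fctr \<Rightarrow> (('o, 'm) cpx, ('o, 'm) cmap, ('o, 'm) cpx, ('o, 'm) cmap) fctr" where
  "Cplus_functor F =
     (let FC = (\<lambda>X. \<lparr>Obj = (\<lambda>n. FOb F (Obj X n)), Diff = (\<lambda>n. FArr F (Diff X n))\<rparr>)
      in \<lparr>FOb = FC, FArr = (\<lambda>(X, f, Y). (FC X, \<lambda>n. FArr F (f n), FC Y))\<rparr>)"

text \<open>\<open>K\<close> is a mapping cone of \<open>f : X \<rightarrow> Y\<close>: \<open>K\<^sup>n = X\<^sup>n\<^sup>+\<^sup>1 \<oplus> Y\<^sup>n\<close> with injections \<open>i\<close>, \<open>j\<close>,
  projections \<open>p\<close>, \<open>q\<close>, and differential \<open>(x, y) \<mapsto> (- d x, f x + d y)\<close>.\<close>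

definition is_mapping_cone :: "('o, 'm) abcat \<Rightarrow> ('o, 'm) cpx \<Rightarrow> (int \<Rightarrow> 'm) \<Rightarrow> ('o, 'm) cpx \<Rightarrow>
    ('o, 'm) cpx \<Rightarrow> (int \<Rightarrow> 'm) \<Rightarrow> (int \<Rightarrow> 'm) \<Rightarrow> (int \<Rightarrow> 'm) \<Rightarrow> (int \<Rightarrow> 'm) \<Rightarrow> bool" where
  "is_mapping_cone A X f Y K i j p q \<longleftrightarrow>
     (X, f, Y) \<in> Arr (Cplus A) \<and> left_bounded_complex A K \<and>
     (\<forall>n. is_biproduct A (Obj K n) (i n) (j n) (p n) (q n) (Obj X (n + 1)) (Obj Y n) \<and>
        Diff K n = (i (n + 1) \<cdot> Neg A (Diff X (n + 1)) \<cdot> p n)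
                   \<oplus> (j (n + 1) \<cdot> f (n + 1) \<cdot> p n)
                   \<oplus> (j (n + 1) \<cdot> Diff Y n \<cdot> q n))"
  for A (structure)


section \<open>Localization and the derived category\<close>

text \<open>The localization \<open>C[W\<^sup>-\<^sup>1]\<close>: arrows are classes of zigzags, i.e. of composable finite sequences
  of arrows of \<open>C\<close> and formal inverses of arrows in \<open>W\<close> (listed in the order in which they are
  traversed), modulo the congruence generated by the relations of \<open>C\<close> and by the requirement that
  the formal inverses are inverses.\<close>

datatype 'm letter = Fwd 'm | Bwd 'm

fun is_letter :: "('o, 'm) cat \<Rightarrow> 'm set \<Rightarrow> 'm letter \<Rightarrow> 'o \<Rightarrow> 'o \<Rightarrow> bool" where
  "is_letter C W (Fwd f) X Y \<longleftrightarrow> f \<in> Hom C X Y"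
| "is_letter C W (Bwd w) X Y \<longleftrightarrow> w \<in> W \<and> w \<in> Hom C Y X"

fun is_zigzag :: "('o, 'm) cat \<Rightarrow> 'm set \<Rightarrow> 'o \<Rightarrow> 'm letter list \<Rightarrow> 'o \<Rightarrow> bool" where
  "is_zigzag C W X [] Y \<longleftrightarrow> X \<in> Ob C \<and> X = Y"
| "is_zigzag C W X (l # ls) Z \<longleftrightarrow> (\<exists>Y. is_letter C W l X Y \<and> is_zigzag C W Y ls Z)"

inductive zigzag_rel :: "('o, 'm) cat \<Rightarrow> 'm set \<Rightarrow> 'm letter list \<Rightarrow> 'm letter list \<Rightarrow> bool"
  for C (structure) and W where
  "X \<in> Ob C \<Longrightarrow> zigzag_rel C W [Fwd (Id C X)] []"
| "\<lbrakk>f \<in> Hom C X Y; g \<in> Hom C Y Z\<rbrakk> \<Longrightarrow> zigzag_rel C W [Fwd f, Fwd g] [Fwd (g \<cdot> f)]"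
| "w \<in> W \<Longrightarrow> zigzag_rel C W [Fwd w, Bwd w] []"
| "w \<in> W \<Longrightarrow> zigzag_rel C W [Bwd w, Fwd w] []"

inductive zigzag_equiv ::
  "('o, 'm) cat \<Rightarrow> 'm set \<Rightarrow> 'o \<Rightarrow> 'o \<Rightarrow> 'm letter list \<Rightarrow> 'm letter list \<Rightarrow> bool"
  for C W X Y where
  zigzag_step: "\<lbrakk>is_zigzag C W X (a @ l @ b) Y; is_zigzag C W X (a @ r @ b) Y; zigzag_rel C W l r\<rbrakk>
    \<Longrightarrow> zigzag_equiv C W X Y (a @ l @ b) (a @ r @ b)"
| zigzag_refl: "is_zigzag C W X a Y \<Longrightarrow> zigzag_equiv C W X Y a a"
| zigzag_sym: "zigzag_equiv C W X Y a b \<Longrightarrow> zigzag_equiv C W X Y b a"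
| zigzag_trans: "\<lbrakk>zigzag_equiv C W X Y a b; zigzag_equiv C W X Y b c\<rbrakk> \<Longrightarrow> zigzag_equiv C W X Y a c"

definition zigzag_class :: "('o, 'm) cat \<Rightarrow> 'm set \<Rightarrow> 'o \<Rightarrow> 'm letter list \<Rightarrow> 'o \<Rightarrow> 'm letter list set"
  where "zigzag_class C W X a Y = {b. zigzag_equiv C W X Y a b}"

type_synonym ('o, 'm) larr = "'o \<times> 'm letter list set \<times> 'o"

definition localization :: "('o, 'm) cat \<Rightarrow> 'm set \<Rightarrow> ('o, ('o, 'm) larr) cat" where
  "localization C W = \<lparr>
     Ob = Ob C,
     Arr = {(X, zigzag_class C W X a Y, Y) | X a Y. is_zigzag C W X a Y},
     Dom = (\<lambda>(X, P, Y). X),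
     Cod = (\<lambda>(X, P, Y). Y),
     Id = (\<lambda>X. (X, zigzag_class C W X [] X, X)),
     Comp = (\<lambda>(Y', Q, Z) (X, P, Y). (X, \<Union>a \<in> P. \<Union>b \<in> Q. zigzag_class C W X (a @ b) Z, Z))\<rparr>"

definition loc_functor :: "('o, 'm) cat \<Rightarrow> 'm set \<Rightarrow> ('o, 'm, 'o, ('o, 'm) larr) fctr" where
  "loc_functor C W = \<lparr>FOb = (\<lambda>X. X),
     FArr = (\<lambda>f. (Dom C f, zigzag_class C W (Dom C f) [Fwd f] (Cod C f), Cod C f))\<rparr>"

text \<open>The functor on localizations induced by a functor \<open>F\<close> that maps \<open>W\<close> to \<open>W\<close>.\<close>

definition localized_functor ::
  "('o, 'm) cat \<Rightarrow> 'm set \<Rightarrow> ('o, 'm, 'o, 'm) fctr \<Rightarrow> ('o, ('o, 'm) larr, 'o, ('o, 'm) larr) fctr" where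
  "localized_functor C W F = \<lparr>FOb = FOb F,
     FArr = (\<lambda>(X, P, Y). (FOb F X,
        \<Union>a \<in> P. zigzag_class C W (FOb F X) (map (map_letter (FArr F)) a) (FOb F Y), FOb F Y))\<rparr>"

type_synonym ('o, 'm) darr = "(('o, 'm) cpx, ('o, 'm) cmap) larr"

type_synonym ('o, 'm) dfctr = "(('o, 'm) cpx, ('o, 'm) darr, ('o, 'm) cpx, ('o, 'm) darr) fctr"

text \<open>\<open>D\<^sup>+(A)\<close> is the localization of the category of left bounded complexes at the
  quasi-isomorphisms (Gelfand--Manin). Passing through the homotopy category first gives the same
  category, because homotopic maps become equal in this localization.\<close>

definition Dplus :: "('o, 'm) abcat \<Rightarrow> (('o, 'm) cpx, ('o, 'm) darr) cat" where
  "Dplus A = localization (Cplus A) (quasi_isos A)"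

definition Dplus_loc ::
  "('o, 'm) abcat \<Rightarrow> (('o, 'm) cpx, ('o, 'm) cmap, ('o, 'm) cpx, ('o, 'm) darr) fctr" where
  "Dplus_loc A = loc_functor (Cplus A) (quasi_isos A)"

definition Dplus_shift :: "('o, 'm) abcat \<Rightarrow> ('o, 'm) dfctr" where
  "Dplus_shift A = localized_functor (Cplus A) (quasi_isos A) (Cplus_shift A)"

text \<open>The triangles are the sequences \<open>X' \<rightarrow> Y' \<rightarrow> Z' \<rightarrow> X'[1]\<close> of arrows \<open>u\<close>, \<open>v\<close>, \<open>w\<close> isomorphic to a
  standard sequence \<open>X \<rightarrow> Y \<rightarrow> K \<rightarrow> X[1]\<close> with \<open>K\<close> the mapping cone of a chain map \<open>f : X \<rightarrow> Y\<close>.\<close>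

definition distinguished_triangle ::
  "('o, 'm) abcat \<Rightarrow> ('o, 'm) darr \<Rightarrow> ('o, 'm) darr \<Rightarrow> ('o, 'm) darr \<Rightarrow> bool" where
  "distinguished_triangle A u v w \<longleftrightarrow> (\<exists>X' Y' Z' X f Y K i j p q \<alpha> \<beta> \<theta>.
     u \<in> Hom (Dplus A) X' Y' \<and> v \<in> Hom (Dplus A) Y' Z' \<and>
     w \<in> Hom (Dplus A) Z' (FOb (Dplus_shift A) X') \<and>
     is_mapping_cone A X f Y K i j p q \<and>
     \<alpha> \<in> Hom (Dplus A) X' X \<and> is_iso (Dplus A) \<alpha> \<and>
     \<beta> \<in> Hom (Dplus A) Y' Y \<and> is_iso (Dplus A) \<beta> \<and>
     \<theta> \<in> Hom (Dplus A) Z' K \<and> is_iso (Dplus A) \<theta> \<and>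
     \<beta> \<cdot>\<^bsub>Dplus A\<^esub> u = FArr (Dplus_loc A) (X, f, Y) \<cdot>\<^bsub>Dplus A\<^esub> \<alpha> \<and>
     \<theta> \<cdot>\<^bsub>Dplus A\<^esub> v = FArr (Dplus_loc A) (Y, j, K) \<cdot>\<^bsub>Dplus A\<^esub> \<beta> \<and>
     FArr (Dplus_shift A) \<alpha> \<cdot>\<^bsub>Dplus A\<^esub> w
       = FArr (Dplus_loc A) (K, p, shift_cpx A X) \<cdot>\<^bsub>Dplus A\<^esub> \<theta>)"

definition triangle_functor :: "('o, 'm) abcat \<Rightarrow> ('o, 'm) dfctr \<Rightarrow> bool" where
  "triangle_functor A \<delta> \<longleftrightarrow> additive_functor (Dplus A) (Dplus A) \<delta> \<and>
     (\<exists>\<phi>. nat_iso (Dplus A) (Dplus A) (\<delta> \<circ>\<^sub>F Dplus_shift A) (Dplus_shift A \<circ>\<^sub>F \<delta>) \<phi> \<and>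
        (\<forall>u v w. distinguished_triangle A u v w
           \<longrightarrow> distinguished_triangle A (FArr \<delta> u) (FArr \<delta> v)
                 (\<phi> (Dom (Dplus A) u) \<cdot>\<^bsub>Dplus A\<^esub> FArr \<delta> w)))"

text \<open>The right derived functor of \<open>F\<close> is the initial pair \<open>(R, \<xi>)\<close> consisting of a functor
  \<open>R : D\<^sup>+(A) \<rightarrow> D\<^sup>+(A)\<close> and a natural transformation \<open>\<xi> : Q \<circ> F \<rightarrow> R \<circ> Q\<close>, where \<open>Q\<close> is the
  localization functor. (That \<open>R\<close> is a triangle functor is not part of the definition.)\<close>

definition is_right_derived_functor :: "('o, 'm) abcat \<Rightarrow> ('o, 'm, 'o, 'm) fctr \<Rightarrow>
    ('o, 'm) dfctr \<Rightarrow> (('o, 'm) cpx \<Rightarrow> ('o, 'm) darr) \<Rightarrow> bool" where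
  "is_right_derived_functor A F R \<xi> \<longleftrightarrow>
     cat_functor (Dplus A) (Dplus A) R \<and>
     nat_trans (Cplus A) (Dplus A)
       (Dplus_loc A \<circ>\<^sub>F Cplus_functor F) (R \<circ>\<^sub>F Dplus_loc A) \<xi> \<and>
     (\<forall>S \<zeta>.
        cat_functor (Dplus A) (Dplus A) S \<and>
        nat_trans (Cplus A) (Dplus A)
          (Dplus_loc A \<circ>\<^sub>F Cplus_functor F) (S \<circ>\<^sub>F Dplus_loc A) \<zeta>
        \<longrightarrow> (\<exists>\<eta>. nat_trans (Dplus A) (Dplus A) R S \<eta> \<and>
               (\<forall>X \<in> Ob (Cplus A). \<zeta> X = \<eta> X \<cdot>\<^bsub>Dplus A\<^esub> \<xi> X) \<and>
               (\<forall>\<eta>'. nat_trans (Dplus A) (Dplus A) R S \<eta>' \<and>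
                  (\<forall>X \<in> Ob (Cplus A). \<zeta> X = \<eta>' X \<cdot>\<^bsub>Dplus A\<^esub> \<xi> X)
                  \<longrightarrow> (\<forall>X \<in> Ob (Dplus A). \<eta>' X = \<eta> X))))"


section \<open>Abstract local cohomology functors\<close>

definition Im_objects :: "('o, 'm) abcat \<Rightarrow> ('o, 'm) dfctr \<Rightarrow> ('o, 'm) cpx set" where
  "Im_objects A \<delta> = {Y \<in> Ob (Dplus A). \<exists>X \<in> Ob (Dplus A). isomorphic (Dplus A) Y (FOb \<delta> X)}"

definition Ker_objects :: "('o, 'm) abcat \<Rightarrow> ('o, 'm) dfctr \<Rightarrow> ('o, 'm) cpx set" where
  "Ker_objects A \<delta> = {X \<in> Ob (Dplus A). is_zero_object (Dplus A) (FOb \<delta> X)}"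

definition Im_category ::
  "('o, 'm) abcat \<Rightarrow> ('o, 'm) dfctr \<Rightarrow> (('o, 'm) cpx, ('o, 'm) darr) cat" where
  "Im_category A \<delta> = full_subcategory (Dplus A) (Im_objects A \<delta>)"

definition is_stalk_complex :: "('o, 'm) abcat \<Rightarrow> 'o \<Rightarrow> ('o, 'm) cpx \<Rightarrow> bool" where
  "is_stalk_complex A E X \<longleftrightarrow> left_bounded_complex A X \<and> Obj X 0 = E \<and>
     (\<forall>n. n \<noteq> 0 \<longrightarrow> is_zero_object A (Obj X n))"

text \<open>The embedding \<open>i : Im(\<delta>) \<rightarrow> D\<^sup>+(A)\<close> acts as the identity on objects and arrows, so it is
  \<open>id_functor\<close>, seen as a functor from \<open>Im_category A \<delta>\<close> to \<open>Dplus A\<close>.\<close>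

definition abstract_local_cohomology_functor :: "('o, 'm) abcat \<Rightarrow> ('o, 'm) dfctr \<Rightarrow> bool" where
  "abstract_local_cohomology_functor A \<delta> \<longleftrightarrow> triangle_functor A \<delta> \<and>
     (\<exists>\<rho>. is_right_adjoint (Im_category A \<delta>) (Dplus A) id_functor \<rho> \<and>
        naturally_isomorphic (Dplus A) (Dplus A) \<delta> (id_functor \<circ>\<^sub>F \<rho>)) \<and>
     (\<forall>E X. injective_object A E \<and> indecomposable_object A E \<and> is_stalk_complex A E X
        \<longrightarrow> X \<in> Im_objects A \<delta> \<or> X \<in> Ker_objects A \<delta>)"

end

theory Submission imports Defs begin

text \<open>By Baer's criterion, the union of a countable chain of extensions that solve all extension problems
  posed by subobjects of noetherian generators is injective, so left bounded complexes have injective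
  resolutions. Arrows of the derived category with values in a left bounded complex \<open>I\<close> of injectives
  are homotopy classes of chain maps. Hence \<open>R X = \<gamma> I\<close>, for a resolution \<open>X \<rightarrow> I\<close>, is a right derived
  functor, and \<open>\<xi>\<^sub>I\<close> is invertible for every right derived functor \<open>(R, \<xi>)\<close>. Cones of maps between complexes
  of injectives then show that \<open>R\<close> preserves triangles.

  Left exactness and the radical property make \<open>\<gamma> (\<iota>\<^sub>M) = \<iota>\<^sub>\<gamma>\<^sub>M\<close> invertible, and \<open>\<gamma> I\<close> consists again of injectives;
  therefore the transformation \<open>\<epsilon> : R \<rightarrow> id\<close> induced by \<open>\<iota>\<close> has \<open>\<epsilon> R\<close> and \<open>R \<epsilon>\<close> invertible, which makes \<open>R\<close> a
  coreflection onto its image. For an indecomposable injective \<open>E\<close> the injective \<open>\<gamma> E\<close> is a direct summand of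
  \<open>E\<close>, hence zero or everything.\<close>

section \<open>Categories\<close>

definition inv_arr :: "('o, 'm, 'z) cat_scheme \<Rightarrow> 'm \<Rightarrow> 'm" where
  "inv_arr C f = (SOME g. g \<in> Hom C (Cod C f) (Dom C f) \<and>
     g \<cdot> f = Id C (Dom C f) \<and> f \<cdot> g = Id C (Cod C f))"
  for C (structure)

declare Hom_def [simp]

context category
begin

lemma Hom_Ob: "f \<in> Hom C X Y \<Longrightarrow> X \<in> Ob C" "f \<in> Hom C X Y \<Longrightarrow> Y \<in> Ob C"
  using Dom_Ob Cod_Ob by auto

lemma Arr_Hom: "f \<in> Arr C \<Longrightarrow> f \<in> Hom C (Dom C f) (Cod C f)"
  by simp

declare Dom_Ob [simp] Cod_Ob [simp]

lemma Comp_simps [simp]: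
  assumes "f \<in> Arr C" "g \<in> Arr C" "Dom C g = Cod C f"
  shows "g \<cdot> f \<in> Arr C" "Dom C (g \<cdot> f) = Dom C f" "Cod C (g \<cdot> f) = Cod C g"
  using Comp_Hom[of f "Dom C f" "Cod C f" g "Cod C g"] assms by auto

lemma Id_simps [simp]:
  assumes "X \<in> Ob C"
  shows "Id C X \<in> Arr C" "Dom C (Id C X) = X" "Cod C (Id C X) = X"
  using Id_Hom[OF assms] by auto

lemma Comp_Id' [simp]: "f \<in> Arr C \<Longrightarrow> Dom C f = X \<Longrightarrow> f \<cdot> Id C X = f"
  using Comp_Id[of f X "Cod C f"] by simp

lemma Id_Comp' [simp]: "f \<in> Arr C \<Longrightarrow> Cod C f = Y \<Longrightarrow> Id C Y \<cdot> f = f"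
  using Id_Comp[of f "Dom C f" Y] by simp

lemma assoc [simp]:
  "\<lbrakk>f \<in> Arr C; g \<in> Arr C; h \<in> Arr C; Dom C g = Cod C f; Dom C h = Cod C g\<rbrakk>
    \<Longrightarrow> (h \<cdot> g) \<cdot> f = h \<cdot> (g \<cdot> f)"
  using Comp_assoc[of f "Dom C f" "Cod C f" g "Cod C g" h "Cod C h"] by simp

lemma reassoc:
  "h \<cdot> g = k \<Longrightarrow> \<lbrakk>f \<in> Arr C; g \<in> Arr C; h \<in> Arr C; Dom C g = Cod C f; Dom C h = Cod C g\<rbrakk>
    \<Longrightarrow> h \<cdot> (g \<cdot> f) = k \<cdot> f"
  by (drule sym) simp

lemma is_isoI:
  assumes "f \<in> Hom C X Y" "g \<in> Hom C Y X" "g \<cdot> f = Id C X" "f \<cdot> g = Id C Y"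
  shows "is_iso C f"
  using assms unfolding is_iso_def by auto

lemma inv_arr:
  assumes "is_iso C f"
  shows "inv_arr C f \<in> Hom C (Cod C f) (Dom C f) \<and>
     inv_arr C f \<cdot> f = Id C (Dom C f) \<and> f \<cdot> inv_arr C f = Id C (Cod C f)"
proof -
  have "\<exists>g. g \<in> Hom C (Cod C f) (Dom C f) \<and> g \<cdot> f = Id C (Dom C f) \<and> f \<cdot> g = Id C (Cod C f)"
    using assms unfolding is_iso_def by blast
  from someI_ex[OF this] show ?thesis unfolding inv_arr_def .
qed

lemma is_iso_Arr [simp]: "is_iso C f \<Longrightarrow> f \<in> Arr C"
  by (simp add: is_iso_def)

lemma inv_arr_simps [simp]:
  assumes "is_iso C f"
  shows "inv_arr C f \<in> Arr C" "Dom C (inv_arr C f) = Cod C f" "Cod C (inv_arr C f) = Dom C f"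
    "inv_arr C f \<cdot> f = Id C (Dom C f)" "f \<cdot> inv_arr C f = Id C (Cod C f)"
  using inv_arr[OF assms] by auto

lemma inv_arr_assoc [simp]:
  assumes "is_iso C f" "g \<in> Arr C"
  shows "Cod C g = Dom C f \<Longrightarrow> inv_arr C f \<cdot> (f \<cdot> g) = g"
    "Cod C g = Cod C f \<Longrightarrow> f \<cdot> (inv_arr C f \<cdot> g) = g"
  using assms by (simp_all flip: assoc)

lemma inv_arr_unique:
  assumes "is_iso C f" "g \<in> Hom C (Cod C f) (Dom C f)" "g \<cdot> f = Id C (Dom C f)"
  shows "inv_arr C f = g"
proof -
  have "(g \<cdot> f) \<cdot> inv_arr C f = inv_arr C f"
    using assms by (simp add: del: assoc)
  moreover have "(g \<cdot> f) \<cdot> inv_arr C f = g" using assms(1,2) by simp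
  ultimately show ?thesis by simp
qed

lemma iso_cancel_left:
  assumes "is_iso C f" "g \<in> Arr C" "h \<in> Arr C" "Cod C g = Dom C f" "Cod C h = Dom C f"
    "f \<cdot> g = f \<cdot> h"
  shows "g = h"
  by (metis assms inv_arr_assoc(1))

lemma iso_cancel_right:
  assumes f: "is_iso C f" and gh: "g \<in> Arr C" "h \<in> Arr C" "Dom C g = Cod C f" "Dom C h = Cod C f"
    "g \<cdot> f = h \<cdot> f"
  shows "g = h"
proof -
  have "(g \<cdot> f) \<cdot> inv_arr C f = (h \<cdot> f) \<cdot> inv_arr C f" by (simp only: gh(5))
  then show ?thesis using f gh(1-4) by simp
qed

lemma is_iso_Id [simp]: "X \<in> Ob C \<Longrightarrow> is_iso C (Id C X)"
  by (intro is_isoI[of _ X X "Id C X"]) auto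

lemma is_iso_Comp [simp]:
  assumes "is_iso C f" "is_iso C g" "Dom C g = Cod C f"
  shows "is_iso C (g \<cdot> f)"
  by (rule is_isoI[of _ "Dom C f" "Cod C g" "inv_arr C f \<cdot> inv_arr C g"])
     (use assms in simp_all)

lemma is_iso_inv [simp]: "is_iso C f \<Longrightarrow> is_iso C (inv_arr C f)"
  by (rule is_isoI[of _ "Cod C f" "Dom C f" f]) auto

lemma is_iso_right_factor:
  assumes "is_iso C (g \<cdot> f)" "is_iso C g" "f \<in> Arr C" "Dom C g = Cod C f"
  shows "is_iso C f"
proof -
  have "is_iso C (inv_arr C g \<cdot> (g \<cdot> f))" using assms by (intro is_iso_Comp[of "g \<cdot> f" "inv_arr C g"]) auto
  moreover have "inv_arr C g \<cdot> (g \<cdot> f) = f" using assms by simp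
  ultimately show ?thesis by (simp only:)
qed

lemma is_iso_left_factor:
  assumes "is_iso C (g \<cdot> f)" "is_iso C f" "g \<in> Arr C" "Dom C g = Cod C f"
  shows "is_iso C g"
proof -
  have "is_iso C ((g \<cdot> f) \<cdot> inv_arr C f)" using assms by (intro is_iso_Comp[of "inv_arr C f" "g \<cdot> f"]) auto
  moreover have "(g \<cdot> f) \<cdot> inv_arr C f = g" using assms by simp
  ultimately show ?thesis by (simp only:)
qed

lemma monoD:
  "\<lbrakk>is_mono C m; f \<in> Arr C; g \<in> Arr C; Dom C f = Dom C g; Cod C f = Dom C m; Cod C g = Dom C m;
    m \<cdot> f = m \<cdot> g\<rbrakk> \<Longrightarrow> f = g"
  unfolding is_mono_def Hom_def by auto

lemma epiD:
  "\<lbrakk>is_epi C e; f \<in> Arr C; g \<in> Arr C; Cod C f = Cod C g; Dom C f = Cod C e; Dom C g = Cod C e;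
    f \<cdot> e = g \<cdot> e\<rbrakk> \<Longrightarrow> f = g"
  unfolding is_epi_def Hom_def by auto

lemma is_mono_Arr [simp]: "is_mono C f \<Longrightarrow> f \<in> Arr C"
  by (simp add: is_mono_def)

lemma is_epi_Arr [simp]: "is_epi C f \<Longrightarrow> f \<in> Arr C"
  by (simp add: is_epi_def)

lemma is_mono_Comp:
  assumes "is_mono C f" "is_mono C g" "Dom C g = Cod C f"
  shows "is_mono C (g \<cdot> f)"
  unfolding is_mono_def
proof (intro conjI allI ballI impI)
  show "g \<cdot> f \<in> Arr C" using assms by simp
  fix W h k assume h: "h \<in> Hom C W (Dom C (g \<cdot> f))" "k \<in> Hom C W (Dom C (g \<cdot> f))"
    and eq: "g \<cdot> f \<cdot> h = g \<cdot> f \<cdot> k"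
  have "f \<cdot> h = f \<cdot> k"
    using assms h eq by (intro monoD[of g "f \<cdot> h" "f \<cdot> k"]) auto
  then show "h = k" using assms h by (intro monoD[of f h k]) auto
qed

lemma is_epi_Comp:
  assumes "is_epi C f" "is_epi C g" "Dom C g = Cod C f"
  shows "is_epi C (g \<cdot> f)"
  unfolding is_epi_def
proof (intro conjI allI ballI impI)
  show "g \<cdot> f \<in> Arr C" using assms by simp
  fix W h k assume h: "h \<in> Hom C (Cod C (g \<cdot> f)) W" "k \<in> Hom C (Cod C (g \<cdot> f)) W"
    and eq: "h \<cdot> (g \<cdot> f) = k \<cdot> (g \<cdot> f)"
  have "h \<cdot> g = k \<cdot> g"
    using assms h eq by (intro epiD[of f "h \<cdot> g" "k \<cdot> g"]) auto
  then show "h = k" using assms h by (intro epiD[of g h k]) auto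
qed

lemma iso_is_mono [simp]: "is_iso C f \<Longrightarrow> is_mono C f"
  unfolding is_mono_def by (auto simp: intro: iso_cancel_left)

lemma iso_is_epi [simp]: "is_iso C f \<Longrightarrow> is_epi C f"
  unfolding is_epi_def by (auto simp: intro: iso_cancel_right)

end

context cat_functor
begin

lemma FArr_simps [simp]:
  assumes "f \<in> Arr C"
  shows "FArr F f \<in> Arr D" "Dom D (FArr F f) = FOb F (Dom C f)" "Cod D (FArr F f) = FOb F (Cod C f)"
  using FArr_Hom[OF C.Arr_Hom[OF assms]] by auto

lemma FArr_Comp': "\<lbrakk>f \<in> Arr C; g \<in> Arr C; Dom C g = Cod C f\<rbrakk>
      \<Longrightarrow> FArr F (g \<cdot>\<^bsub>C\<^esub> f) = FArr F g \<cdot>\<^bsub>D\<^esub> FArr F f"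
  using FArr_Comp[of f "Dom C f" "Cod C f" g "Cod C g"] by simp

lemma FArr_iso:
  assumes "is_iso C f" shows "is_iso D (FArr F f)" "inv_arr D (FArr F f) = FArr F (inv_arr C f)"
proof -
  have 1: "FArr F (inv_arr C f) \<cdot>\<^bsub>D\<^esub> FArr F f = Id D (FOb F (Dom C f))"
    "FArr F f \<cdot>\<^bsub>D\<^esub> FArr F (inv_arr C f) = Id D (FOb F (Cod C f))"
    using assms FArr_Id by (simp_all flip: FArr_Comp')
  then show "is_iso D (FArr F f)"
    using assms by (intro D.is_isoI[of _ "FOb F (Dom C f)" "FOb F (Cod C f)" "FArr F (inv_arr C f)"])
      auto
  then show "inv_arr D (FArr F f) = FArr F (inv_arr C f)"
    using 1 assms by (intro D.inv_arr_unique) auto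
qed

end

section \<open>Preadditive categories\<close>

context preadditive_category
begin

lemma Add_simps [simp]:
  assumes "f \<in> Arr A" "g \<in> Arr A" "Dom A f = Dom A g" "Cod A f = Cod A g"
  shows "f \<oplus> g \<in> Arr A" "Dom A (f \<oplus> g) = Dom A g" "Cod A (f \<oplus> g) = Cod A g"
  using Add_Hom[of f "Dom A f" "Cod A f" g] assms by auto

lemma Zero_simps [simp]:
  assumes "X \<in> Ob A" "Y \<in> Ob A"
  shows "Zero A X Y \<in> Arr A" "Dom A (Zero A X Y) = X" "Cod A (Zero A X Y) = Y"
  using Zero_Hom[OF assms] by auto

lemma Neg_simps [simp]:
  assumes "f \<in> Arr A"
  shows "Neg A f \<in> Arr A" "Dom A (Neg A f) = Dom A f" "Cod A (Neg A f) = Cod A f"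
  using Neg_Hom[of f "Dom A f" "Cod A f"] assms by auto

lemma Add_assoc' [simp]:
  "\<lbrakk>f \<in> Arr A; g \<in> Arr A; h \<in> Arr A; Dom A f = Dom A g; Dom A g = Dom A h;
    Cod A f = Cod A g; Cod A g = Cod A h\<rbrakk> \<Longrightarrow> (f \<oplus> g) \<oplus> h = f \<oplus> (g \<oplus> h)"
  by (rule Add_assoc[of f "Dom A f" "Cod A f"]) simp_all

lemma Add_commute':
  "\<lbrakk>f \<in> Arr A; g \<in> Arr A; Dom A f = Dom A g; Cod A f = Cod A g\<rbrakk> \<Longrightarrow> f \<oplus> g = g \<oplus> f"
  by (rule Add_commute[of f "Dom A f" "Cod A f"]) simp_all

lemma Add_left_commute:
  "\<lbrakk>f \<in> Arr A; g \<in> Arr A; h \<in> Arr A; Dom A f = Dom A g; Dom A g = Dom A h;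
    Cod A f = Cod A g; Cod A g = Cod A h\<rbrakk> \<Longrightarrow> f \<oplus> (g \<oplus> h) = g \<oplus> (f \<oplus> h)"
  using Add_commute'[of f g] by (simp flip: Add_assoc')

lemmas Add_ac = Add_commute' Add_left_commute

lemma Add_Zero' [simp]:
  "f \<in> Arr A \<Longrightarrow> Dom A f = X \<Longrightarrow> Cod A f = Y \<Longrightarrow> f \<oplus> Zero A X Y = f"
  using Add_Zero[of f X Y] by simp

lemma Zero_Add' [simp]:
  "f \<in> Arr A \<Longrightarrow> Dom A f = X \<Longrightarrow> Cod A f = Y \<Longrightarrow> Zero A X Y \<oplus> f = f"
  using Add_commute'[of "Zero A X Y" f] by auto

lemma Add_Neg' [simp]: "f \<in> Arr A \<Longrightarrow> f \<oplus> Neg A f = Zero A (Dom A f) (Cod A f)"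
  using Add_Neg[of f "Dom A f" "Cod A f"] by simp

lemma Neg_Add' [simp]: "f \<in> Arr A \<Longrightarrow> Neg A f \<oplus> f = Zero A (Dom A f) (Cod A f)"
  using Add_commute'[of "Neg A f" f] by simp

lemma Add_cancel [simp]:
  assumes "f \<in> Arr A" "g \<in> Arr A" "Dom A f = Dom A g" "Cod A f = Cod A g"
  shows "f \<oplus> (Neg A f \<oplus> g) = g" "Neg A f \<oplus> (f \<oplus> g) = g"
  using assms by (simp_all flip: Add_assoc')

lemma Add_left_cancel:
  assumes "f \<in> Arr A" "g \<in> Arr A" "h \<in> Arr A" "Dom A f = Dom A g" "Cod A f = Cod A g"
    "Dom A f = Dom A h" "Cod A f = Cod A h" "f \<oplus> g = f \<oplus> h"
  shows "g = h"
  by (metis assms Add_cancel(2))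

lemma Add_Comp' [simp]:
  "\<lbrakk>f \<in> Arr A; g \<in> Arr A; h \<in> Arr A; Dom A g = Cod A f; Dom A h = Cod A f; Cod A g = Cod A h\<rbrakk>
    \<Longrightarrow> (g \<oplus> h) \<cdot> f = (g \<cdot> f) \<oplus> (h \<cdot> f)"
  by (rule Add_Comp[of f "Dom A f" "Cod A f" g "Cod A g" h]) simp_all

lemma Comp_Add' [simp]:
  "\<lbrakk>f \<in> Arr A; g \<in> Arr A; h \<in> Arr A; Dom A f = Dom A g; Cod A f = Dom A h; Cod A g = Dom A h\<rbrakk>
    \<Longrightarrow> h \<cdot> (f \<oplus> g) = (h \<cdot> f) \<oplus> (h \<cdot> g)"
  by (rule Comp_Add[of f "Dom A f" "Cod A f" g h "Cod A h"]) simp_all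

lemma idem_Zero: "f \<in> Arr A \<Longrightarrow> f \<oplus> f = f \<Longrightarrow> f = Zero A (Dom A f) (Cod A f)"
  by (rule Add_left_cancel[of f]) auto

lemma Comp_Zero [simp]:
  assumes "h \<in> Arr A" "X \<in> Ob A" "Dom A h = Y"
  shows "h \<cdot> Zero A X Y = Zero A X (Cod A h)"
proof -
  let ?z = "Zero A X (Dom A h)"
  have Y: "Y \<in> Ob A" using assms Dom_Ob[of h] by simp
  have "?z \<oplus> ?z = ?z" using assms by (intro Add_Zero') auto
  then have "h \<cdot> ?z \<oplus> h \<cdot> ?z = h \<cdot> ?z"
    using assms Y Comp_Add'[of ?z ?z h] by simp
  then show ?thesis using idem_Zero[of "h \<cdot> ?z"] assms Y by auto
qed

lemma Zero_Comp [simp]: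
  assumes "f \<in> Arr A" "Z \<in> Ob A" "Cod A f = Y"
  shows "Zero A Y Z \<cdot> f = Zero A (Dom A f) Z"
proof -
  let ?z = "Zero A (Cod A f) Z"
  have Y: "Y \<in> Ob A" using assms Cod_Ob[of f] by simp
  have "?z \<oplus> ?z = ?z" using assms by (intro Add_Zero') auto
  then have "?z \<cdot> f \<oplus> ?z \<cdot> f = ?z \<cdot> f"
    using assms Y Add_Comp'[of f ?z ?z] by simp
  then show ?thesis using idem_Zero[of "?z \<cdot> f"] assms Y by auto
qed

lemma Neg_unique:
  assumes "f \<in> Arr A" "g \<in> Arr A" "Dom A f = Dom A g" "Cod A f = Cod A g"
    "f \<oplus> g = Zero A (Dom A g) (Cod A g)"
  shows "Neg A f = g"
  by (rule Add_left_cancel[of f]) (use assms in auto)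

lemma Neg_Neg [simp]: "f \<in> Arr A \<Longrightarrow> Neg A (Neg A f) = f"
  by (rule Neg_unique) auto

lemma Neg_Zero [simp]: "X \<in> Ob A \<Longrightarrow> Y \<in> Ob A \<Longrightarrow> Neg A (Zero A X Y) = Zero A X Y"
  by (rule Neg_unique) auto

lemma Comp_Neg [simp]:
  assumes "f \<in> Arr A" "h \<in> Arr A" "Dom A h = Cod A f"
  shows "h \<cdot> Neg A f = Neg A (h \<cdot> f)"
proof -
  have "h \<cdot> (f \<oplus> Neg A f) = h \<cdot> f \<oplus> h \<cdot> Neg A f" using assms by (intro Comp_Add') auto
  then show ?thesis using assms by (intro Neg_unique[symmetric]) auto
qed

lemma Neg_Comp [simp]:
  assumes "f \<in> Arr A" "h \<in> Arr A" "Dom A h = Cod A f"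
  shows "Neg A h \<cdot> f = Neg A (h \<cdot> f)"
proof -
  have "(h \<oplus> Neg A h) \<cdot> f = h \<cdot> f \<oplus> Neg A h \<cdot> f" using assms by (intro Add_Comp') auto
  then show ?thesis using assms by (intro Neg_unique[symmetric]) auto
qed

lemma Neg_Add_distrib [simp]:
  assumes "f \<in> Arr A" "g \<in> Arr A" "Dom A f = Dom A g" "Cod A f = Cod A g"
  shows "Neg A (f \<oplus> g) = Neg A f \<oplus> Neg A g"
  by (rule Neg_unique) (use assms in \<open>simp_all add: Add_left_commute[of g]\<close>)

lemma Neg_inject: "\<lbrakk>f \<in> Arr A; g \<in> Arr A; Neg A f = Neg A g\<rbrakk> \<Longrightarrow> f = g"
  using Neg_Neg by metis

lemma eq_iff_diff:
  assumes "f \<in> Arr A" "g \<in> Arr A" "Dom A f = Dom A g" "Cod A f = Cod A g"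
  shows "f = g \<longleftrightarrow> f \<oplus> Neg A g = Zero A (Dom A g) (Cod A g)"
proof
  assume "f \<oplus> Neg A g = Zero A (Dom A g) (Cod A g)"
  then have "Neg A f = Neg A g" using assms by (intro Neg_unique) auto
  then show "f = g" using assms Neg_inject by blast
qed (use assms in auto)

lemma mono_Zero:
  "\<lbrakk>is_mono A m; f \<in> Arr A; Cod A f = Dom A m; Dom A f = X; m \<cdot> f = Zero A X (Cod A m)\<rbrakk>
   \<Longrightarrow> f = Zero A X (Dom A m)"
  by (rule monoD[of m]) auto

lemma epi_Zero:
  "\<lbrakk>is_epi A e; f \<in> Arr A; Dom A f = Cod A e; Cod A f = X; f \<cdot> e = Zero A (Dom A e) X\<rbrakk>
   \<Longrightarrow> f = Zero A (Cod A e) X"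
  by (rule epiD[of e]) auto

lemma is_monoI:
  assumes "m \<in> Arr A"
    and "\<And>f. \<lbrakk>f \<in> Arr A; Cod A f = Dom A m; m \<cdot> f = Zero A (Dom A f) (Cod A m)\<rbrakk>
       \<Longrightarrow> f = Zero A (Dom A f) (Dom A m)"
  shows "is_mono A m"
  unfolding is_mono_def
proof (intro conjI allI ballI impI)
  fix W g h assume gh: "g \<in> Hom A W (Dom A m)" "h \<in> Hom A W (Dom A m)" and eq: "m \<cdot> g = m \<cdot> h"
  have "g \<oplus> Neg A h = Zero A W (Dom A m)"
    using assms(1) gh assms(2)[of "g \<oplus> Neg A h"] eq by auto
  then show "g = h" using gh eq_iff_diff[of g h] by simp
qed (use assms in simp)

lemma is_epiI:
  assumes "e \<in> Arr A"
    and "\<And>f. \<lbrakk>f \<in> Arr A; Dom A f = Cod A e; f \<cdot> e = Zero A (Dom A e) (Cod A f)\<rbrakk>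
       \<Longrightarrow> f = Zero A (Cod A e) (Cod A f)"
  shows "is_epi A e"
  unfolding is_epi_def
proof (intro conjI allI ballI impI)
  fix W g h assume gh: "g \<in> Hom A (Cod A e) W" "h \<in> Hom A (Cod A e) W" and eq: "g \<cdot> e = h \<cdot> e"
  have "g \<oplus> Neg A h = Zero A (Cod A e) W"
    using assms(1) gh assms(2)[of "g \<oplus> Neg A h"] eq by auto
  then show "g = h" using gh eq_iff_diff[of g h] by simp
qed (use assms in simp)

lemma zero_object_Ob [simp]: "is_zero_object A Z \<Longrightarrow> Z \<in> Ob A"
  by (simp add: is_zero_object_def)

lemma to_zero_object:
  assumes "is_zero_object A Z" "f \<in> Arr A" "Cod A f = Z" "Dom A f = X"
  shows "f = Zero A X Z"
proof -
  have X: "X \<in> Ob A" using assms Dom_Ob[of f] by simp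
  then have "\<exists>!f'. f' \<in> Hom A X Z" using assms(1) unfolding is_zero_object_def by blast
  moreover have "f \<in> Hom A X Z" "Zero A X Z \<in> Hom A X Z"
    using assms X by auto
  ultimately show ?thesis by blast
qed

lemma from_zero_object:
  assumes "is_zero_object A Z" "f \<in> Arr A" "Dom A f = Z" "Cod A f = X"
  shows "f = Zero A Z X"
proof -
  have X: "X \<in> Ob A" using assms Cod_Ob[of f] by simp
  then have "\<exists>!f'. f' \<in> Hom A Z X" using assms(1) unfolding is_zero_object_def by blast
  moreover have "f \<in> Hom A Z X" "Zero A Z X \<in> Hom A Z X"
    using assms X by auto
  ultimately show ?thesis by blast
qed

lemma zero_object_iff:
  assumes Z: "Z \<in> Ob A"
  shows "is_zero_object A Z \<longleftrightarrow> Id A Z = Zero A Z Z"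
proof
  assume "is_zero_object A Z" then show "Id A Z = Zero A Z Z"
    by (intro to_zero_object) auto
next
  assume eq: "Id A Z = Zero A Z Z"
  have 1: "f = Zero A X Z" if "f \<in> Hom A X Z" for f X
    using that Id_Comp'[of f Z] eq Z by auto
  have 2: "f = Zero A Z X" if "f \<in> Hom A Z X" for f X
    using that Comp_Id'[of f Z] eq Z by auto
  show "is_zero_object A Z"
    unfolding is_zero_object_def using Z 1 2 Zero_Hom by blast
qed

lemma zero_arrow_eq:
  assumes "is_zero_arrow A f" "f \<in> Hom A X Y"
  shows "f = Zero A X Y"
proof -
  obtain Z g h where 1: "is_zero_object A Z" "g \<in> Hom A X Z" "h \<in> Hom A Z Y" "f = h \<cdot> g"
    using assms unfolding is_zero_arrow_def Hom_def by auto
  have "g = Zero A X Z" using 1 by (intro to_zero_object) auto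
  then show ?thesis using 1 Hom_Ob[OF assms(2)] by simp
qed

definition biprod :: "'o \<Rightarrow> 'm \<Rightarrow> 'm \<Rightarrow> 'm \<Rightarrow> 'm \<Rightarrow> 'o \<Rightarrow> 'o \<Rightarrow> bool" where
  "biprod P i j p q X Y \<longleftrightarrow> i \<in> Hom A X P \<and> j \<in> Hom A Y P \<and> p \<in> Hom A P X \<and> q \<in> Hom A P Y \<and>
     p \<cdot> i = Id A X \<and> q \<cdot> j = Id A Y \<and> p \<cdot> j = Zero A Y X \<and> q \<cdot> i = Zero A X Y \<and>
     (i \<cdot> p) \<oplus> (j \<cdot> q) = Id A P"

lemma biprod_simps:
  assumes "biprod P i j p q X Y"
  shows "X \<in> Ob A" "Y \<in> Ob A" "P \<in> Ob A"
    "i \<in> Arr A" "j \<in> Arr A" "p \<in> Arr A" "q \<in> Arr A"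
    "Dom A i = X" "Cod A i = P" "Dom A j = Y" "Cod A j = P" "Dom A p = P" "Cod A p = X"
    "Dom A q = P" "Cod A q = Y"
    "p \<cdot> i = Id A X" "q \<cdot> j = Id A Y" "p \<cdot> j = Zero A Y X" "q \<cdot> i = Zero A X Y"
    "x \<in> Arr A \<Longrightarrow> Cod A x = X \<Longrightarrow> p \<cdot> (i \<cdot> x) = x"
    "x \<in> Arr A \<Longrightarrow> Cod A x = Y \<Longrightarrow> q \<cdot> (j \<cdot> x) = x"
    "x \<in> Arr A \<Longrightarrow> Cod A x = Y \<Longrightarrow> p \<cdot> (j \<cdot> x) = Zero A (Dom A x) X"
    "x \<in> Arr A \<Longrightarrow> Cod A x = X \<Longrightarrow> q \<cdot> (i \<cdot> x) = Zero A (Dom A x) Y"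
proof -
  show 1: "X \<in> Ob A" "Y \<in> Ob A" "P \<in> Ob A"
    using assms Hom_Ob unfolding biprod_def by blast+
  show 2: "i \<in> Arr A" "j \<in> Arr A" "p \<in> Arr A" "q \<in> Arr A"
    "Dom A i = X" "Cod A i = P" "Dom A j = Y" "Cod A j = P" "Dom A p = P" "Cod A p = X"
    "Dom A q = P" "Cod A q = Y"
    "p \<cdot> i = Id A X" "q \<cdot> j = Id A Y" "p \<cdot> j = Zero A Y X" "q \<cdot> i = Zero A X Y"
    using assms unfolding biprod_def Hom_def by auto
  show "x \<in> Arr A \<Longrightarrow> Cod A x = X \<Longrightarrow> p \<cdot> (i \<cdot> x) = x"
    "x \<in> Arr A \<Longrightarrow> Cod A x = Y \<Longrightarrow> q \<cdot> (j \<cdot> x) = x"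
    "x \<in> Arr A \<Longrightarrow> Cod A x = Y \<Longrightarrow> p \<cdot> (j \<cdot> x) = Zero A (Dom A x) X"
    "x \<in> Arr A \<Longrightarrow> Cod A x = X \<Longrightarrow> q \<cdot> (i \<cdot> x) = Zero A (Dom A x) Y"
    using 1 2 by (simp_all flip: assoc)
qed

lemma biprod_decompose_into:
  assumes b: "biprod P i j p q X Y" and u: "u \<in> Arr A" "Cod A u = P"
  shows "(i \<cdot> (p \<cdot> u)) \<oplus> (j \<cdot> (q \<cdot> u)) = u"
proof -
  have "((i \<cdot> p) \<oplus> (j \<cdot> q)) \<cdot> u = Id A P \<cdot> u" using b by (simp add: biprod_def)
  then show ?thesis using u biprod_simps[OF b] by simp
qed

lemma biprod_decompose_from:
  assumes b: "biprod P i j p q X Y" and u: "u \<in> Arr A" "Dom A u = P"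
  shows "((u \<cdot> i) \<cdot> p) \<oplus> ((u \<cdot> j) \<cdot> q) = u"
proof -
  have "u \<cdot> ((i \<cdot> p) \<oplus> (j \<cdot> q)) = u \<cdot> Id A P" using b by (simp add: biprod_def)
  then show ?thesis using u biprod_simps[OF b] by simp
qed

lemma biprod_ext_into:
  assumes b: "biprod P i j p q X Y" and u: "u \<in> Arr A" "Cod A u = P" "v \<in> Arr A" "Cod A v = P"
    and "p \<cdot> u = p \<cdot> v" "q \<cdot> u = q \<cdot> v"
  shows "u = v"
  by (metis biprod_decompose_into[OF b u(1,2)] biprod_decompose_into[OF b u(3,4)] assms(6,7))

lemma biproduct_biprod:
  assumes "is_biproduct A P i j p q X Y"
  shows "biprod P i j p q X Y"
proof -
  have 1: "i \<in> Hom A X P" "j \<in> Hom A Y P" "p \<in> Hom A P X" "q \<in> Hom A P Y"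
     "p \<cdot> i = Id A X" "q \<cdot> j = Id A Y"
    and z: "is_zero_arrow A (p \<cdot> j)" "is_zero_arrow A (q \<cdot> i)"
    and u: "\<And>W f g. f \<in> Hom A W X \<Longrightarrow> g \<in> Hom A W Y \<Longrightarrow> \<exists>!u. u \<in> Hom A W P \<and> p \<cdot> u = f \<and> q \<cdot> u = g"
    using assms unfolding is_biproduct_def by auto
  have Ob: "X \<in> Ob A" "Y \<in> Ob A" "P \<in> Ob A" using 1 Hom_Ob by blast+
  have z': "p \<cdot> j = Zero A Y X" "q \<cdot> i = Zero A X Y"
    using zero_arrow_eq[OF z(1)] zero_arrow_eq[OF z(2)] 1(1-4) Comp_Hom by blast+
  have pi: "p \<cdot> (i \<cdot> x) = x" if "x \<in> Arr A" "Cod A x = X" for x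
    using that 1 by (simp add: flip: assoc)
  have qj: "q \<cdot> (j \<cdot> x) = x" if "x \<in> Arr A" "Cod A x = Y" for x
    using that 1 by (simp add: flip: assoc)
  have pj: "p \<cdot> (j \<cdot> x) = Zero A (Dom A x) X" if "x \<in> Arr A" "Cod A x = Y" for x
    using that 1 z' Ob by (simp add: flip: assoc)
  have qi: "q \<cdot> (i \<cdot> x) = Zero A (Dom A x) Y" if "x \<in> Arr A" "Cod A x = X" for x
    using that 1 z' Ob by (simp add: flip: assoc)
  have "(i \<cdot> p) \<oplus> (j \<cdot> q) \<in> Hom A P P \<and> p \<cdot> ((i \<cdot> p) \<oplus> (j \<cdot> q)) = p \<and> q \<cdot> ((i \<cdot> p) \<oplus> (j \<cdot> q)) = q"
    using 1 Ob by (simp add: pi qj pj qi)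
  moreover have "Id A P \<in> Hom A P P \<and> p \<cdot> Id A P = p \<and> q \<cdot> Id A P = q"
    using 1 Ob by auto
  ultimately have "(i \<cdot> p) \<oplus> (j \<cdot> q) = Id A P" using u[OF 1(3,4)] by blast
  then show ?thesis unfolding biprod_def using 1 z' by simp
qed

lemma biprod_biproduct:
  assumes b: "biprod P i j p q X Y" and "is_zero_arrow A (p \<cdot> j)" "is_zero_arrow A (q \<cdot> i)"
  shows "is_biproduct A P i j p q X Y"
  unfolding is_biproduct_def
proof (intro conjI allI ballI)
  note [simp] = biprod_simps[OF b]
  show "\<exists>!u. u \<in> Hom A W P \<and> p \<cdot> u = f \<and> q \<cdot> u = g" if "f \<in> Hom A W X" "g \<in> Hom A W Y" for W f g
  proof (rule ex1I[of _ "(i \<cdot> f) \<oplus> (j \<cdot> g)"])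
    show "(i \<cdot> f) \<oplus> (j \<cdot> g) \<in> Hom A W P \<and> p \<cdot> ((i \<cdot> f) \<oplus> (j \<cdot> g)) = f \<and> q \<cdot> ((i \<cdot> f) \<oplus> (j \<cdot> g)) = g"
      using that by auto
    show "u = (i \<cdot> f) \<oplus> (j \<cdot> g)" if "u \<in> Hom A W P \<and> p \<cdot> u = f \<and> q \<cdot> u = g" for u
      using that biprod_decompose_into[OF b, of u] by auto
  qed
  show "\<exists>!u. u \<in> Hom A P W \<and> u \<cdot> i = f \<and> u \<cdot> j = g" if "f \<in> Hom A X W" "g \<in> Hom A Y W" for W f g
  proof (rule ex1I[of _ "(f \<cdot> p) \<oplus> (g \<cdot> q)"])
    show "(f \<cdot> p) \<oplus> (g \<cdot> q) \<in> Hom A P W \<and> ((f \<cdot> p) \<oplus> (g \<cdot> q)) \<cdot> i = f \<and> ((f \<cdot> p) \<oplus> (g \<cdot> q)) \<cdot> j = g"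
      using that by auto
    show "u = (f \<cdot> p) \<oplus> (g \<cdot> q)" if "u \<in> Hom A P W \<and> u \<cdot> i = f \<and> u \<cdot> j = g" for u
      using that biprod_decompose_from[OF b, of u] by (auto simp: simp del: assoc)
  qed
qed (use assms in \<open>auto simp: biprod_def\<close>)

lemma sum_of_arrows_Add:
  assumes "is_sum_of_arrows A f g h"
  shows "h = f \<oplus> g"
proof -
  obtain X Y P i j p q u s where 1: "f \<in> Hom A X Y" "g \<in> Hom A X Y" "is_biproduct A P i j p q Y Y"
     "u \<in> Hom A X P" "p \<cdot> u = f" "q \<cdot> u = g"
     "s \<in> Hom A P Y" "s \<cdot> i = Id A Y" "s \<cdot> j = Id A Y" "h = s \<cdot> u"
    using assms unfolding is_sum_of_arrows_def by blast
  have b: "biprod P i j p q Y Y" using 1(3) by (rule biproduct_biprod)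
  note [simp] = biprod_simps[OF b]
  have "s = p \<oplus> q" using 1 biprod_decompose_from[OF b, of s] by (auto simp: simp del: assoc)
  then show ?thesis using 1 by simp
qed

end

section \<open>Abelian categories\<close>

context preadditive_category
begin

lemma kernelD:
  assumes "is_kernel A k f"
  shows "f \<in> Arr A" "k \<in> Arr A" "Cod A k = Dom A f" "f \<cdot> k = Zero A (Dom A k) (Cod A f)"
  using assms by (auto simp: is_kernel_def)

lemma cokernelD:
  assumes "is_cokernel A c f"
  shows "f \<in> Arr A" "c \<in> Arr A" "Dom A c = Cod A f" "c \<cdot> f = Zero A (Dom A f) (Cod A c)"
  using assms by (auto simp: is_cokernel_def)

lemma kernel_lift:
  assumes "is_kernel A k f" "g \<in> Hom A W (Dom A f)" "f \<cdot> g = Zero A W (Cod A f)"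
  obtains u where "u \<in> Hom A W (Dom A k)" "k \<cdot> u = g"
  using assms unfolding is_kernel_def by blast

lemma cokernel_desc:
  assumes "is_cokernel A c f" "g \<in> Hom A (Cod A f) W" "g \<cdot> f = Zero A (Dom A f) W"
  obtains u where "u \<in> Hom A (Cod A c) W" "u \<cdot> c = g"
  using assms unfolding is_cokernel_def by blast

lemma kernel_mono:
  assumes "is_kernel A k f" shows "is_mono A k"
proof (rule is_monoI)
  note k = kernelD[OF assms]
  show "k \<in> Arr A" by fact
  fix x assume x: "x \<in> Arr A" "Cod A x = Dom A k" "k \<cdot> x = Zero A (Dom A x) (Cod A k)"
  have "\<exists>!u. u \<in> Hom A (Dom A x) (Dom A k) \<and> k \<cdot> u = k \<cdot> x"
  proof -
    have "k \<cdot> x \<in> Hom A (Dom A x) (Dom A f)" "f \<cdot> (k \<cdot> x) = Zero A (Dom A x) (Cod A f)"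
      using x k by auto
    then show ?thesis using assms unfolding is_kernel_def by blast
  qed
  moreover have "x \<in> Hom A (Dom A x) (Dom A k) \<and> k \<cdot> x = k \<cdot> x" using x by simp
  moreover have "Zero A (Dom A x) (Dom A k) \<in> Hom A (Dom A x) (Dom A k) \<and>
      k \<cdot> Zero A (Dom A x) (Dom A k) = k \<cdot> x" using x k by simp
  ultimately show "x = Zero A (Dom A x) (Dom A k)" by blast
qed

lemma cokernel_epi:
  assumes "is_cokernel A c f" shows "is_epi A c"
proof (rule is_epiI)
  note c = cokernelD[OF assms]
  show "c \<in> Arr A" by fact
  fix x assume x: "x \<in> Arr A" "Dom A x = Cod A c" "x \<cdot> c = Zero A (Dom A c) (Cod A x)"
  have "\<exists>!u. u \<in> Hom A (Cod A c) (Cod A x) \<and> u \<cdot> c = x \<cdot> c"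
  proof -
    have "x \<cdot> c \<in> Hom A (Cod A f) (Cod A x)" "(x \<cdot> c) \<cdot> f = Zero A (Dom A f) (Cod A x)"
      using x c by auto
    then show ?thesis using assms unfolding is_cokernel_def by blast
  qed
  moreover have "x \<in> Hom A (Cod A c) (Cod A x) \<and> x \<cdot> c = x \<cdot> c" using x by simp
  moreover have "Zero A (Cod A c) (Cod A x) \<in> Hom A (Cod A c) (Cod A x) \<and>
      Zero A (Cod A c) (Cod A x) \<cdot> c = x \<cdot> c" using x c by simp
  ultimately show "x = Zero A (Cod A c) (Cod A x)" by blast
qed

lemma is_kernelI:
  assumes "is_mono A k" "f \<in> Hom A (Cod A k) Y" "f \<cdot> k = Zero A (Dom A k) Y"
    and "\<And>W g. g \<in> Hom A W (Cod A k) \<Longrightarrow> f \<cdot> g = Zero A W Y \<Longrightarrow>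
      \<exists>u \<in> Hom A W (Dom A k). k \<cdot> u = g"
  shows "is_kernel A k f"
  unfolding is_kernel_def
proof (intro conjI allI ballI impI)
  fix W g assume g: "g \<in> Hom A W (Dom A f)" "f \<cdot> g = Zero A W (Cod A f)"
  then obtain u where u: "u \<in> Hom A W (Dom A k)" "k \<cdot> u = g"
    using assms(4)[of g W] assms(2) by auto
  show "\<exists>!u. u \<in> Hom A W (Dom A k) \<and> k \<cdot> u = g"
  proof (rule ex1I)
    show "v = u" if "v \<in> Hom A W (Dom A k) \<and> k \<cdot> v = g" for v
      using that u by - (rule monoD[OF assms(1)], auto)
  qed (use u in auto)
qed (use assms(1-3) in auto)

lemma is_cokernelI:
  assumes "is_epi A c" "f \<in> Hom A X (Dom A c)" "c \<cdot> f = Zero A X (Cod A c)"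
    and "\<And>W g. g \<in> Hom A (Dom A c) W \<Longrightarrow> g \<cdot> f = Zero A X W \<Longrightarrow>
      \<exists>u \<in> Hom A (Cod A c) W. u \<cdot> c = g"
  shows "is_cokernel A c f"
  unfolding is_cokernel_def
proof (intro conjI allI ballI impI)
  fix W g assume g: "g \<in> Hom A (Cod A f) W" "g \<cdot> f = Zero A (Dom A f) W"
  then obtain u where u: "u \<in> Hom A (Cod A c) W" "u \<cdot> c = g"
    using assms(4)[of g W] assms(2) by auto
  show "\<exists>!u. u \<in> Hom A (Cod A c) W \<and> u \<cdot> c = g"
  proof (rule ex1I)
    show "v = u" if "v \<in> Hom A (Cod A c) W \<and> v \<cdot> c = g" for v
      using that u by - (rule epiD[OF assms(1)], auto)
  qed (use u in auto)
qed (use assms(1-3) in auto)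

end

context abelian_category
begin

lemma zero_arrow_Zero: "X \<in> Ob A \<Longrightarrow> Y \<in> Ob A \<Longrightarrow> is_zero_arrow A (Zero A X Y)"
proof -
  assume XY: "X \<in> Ob A" "Y \<in> Ob A"
  obtain Z where "is_zero_object A Z" using ex_zero_object by blast
  then show ?thesis unfolding is_zero_arrow_def using XY
    by (intro exI[of _ Z] exI[of _ "Zero A X Z"] exI[of _ "Zero A Z Y"]) auto
qed

lemma biproduct_iff: "is_biproduct A P i j p q X Y \<longleftrightarrow> biprod P i j p q X Y"
proof
  assume b: "biprod P i j p q X Y"
  then show "is_biproduct A P i j p q X Y"
    using biprod_simps[OF b] by (intro biprod_biproduct) (auto simp: zero_arrow_Zero)
qed (rule biproduct_biprod)

lemma ex_biprod:
  assumes "X \<in> Ob A" "Y \<in> Ob A"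
  obtains P i j p q where "biprod P i j p q X Y"
  using ex_biproduct[OF assms] biproduct_iff by blast

lemma Add_sum_of_arrows:
  assumes f: "f \<in> Hom A X Y" and g: "g \<in> Hom A X Y"
  shows "is_sum_of_arrows A f g (f \<oplus> g)"
proof -
  have Y: "Y \<in> Ob A" using Hom_Ob f by blast
  obtain P i j p q where b: "biprod P i j p q Y Y" using ex_biprod[OF Y Y] .
  note [simp] = biprod_simps[OF b]
  have bp: "is_biproduct A P i j p q Y Y" using b biproduct_iff by blast
  have fg: "f \<in> Arr A" "g \<in> Arr A" "Dom A f = X" "Dom A g = X" "Cod A f = Y" "Cod A g = Y"
    using f g by auto
  let ?u = "(i \<cdot> f) \<oplus> (j \<cdot> g)" and ?s = "p \<oplus> q"
  have u: "?u \<in> Hom A X P" "p \<cdot> ?u = f" "q \<cdot> ?u = g"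
    using fg Y by simp_all
  have s: "?s \<in> Hom A P Y" "?s \<cdot> i = Id A Y" "?s \<cdot> j = Id A Y"
    using Y by simp_all
  have "?s \<cdot> ?u = p \<cdot> ?u \<oplus> q \<cdot> ?u"
    using fg by (intro Add_Comp') simp_all
  then have "f \<oplus> g = ?s \<cdot> ?u" unfolding u(2,3) by simp
  then show ?thesis unfolding is_sum_of_arrows_def using f g bp u s by blast
qed

lemma mono_epi_iso:
  assumes m: "is_mono A f" and e: "is_epi A f"
  shows "is_iso A f"
proof -
  obtain g where g: "is_kernel A f g" using mono_is_kernel[OF m] by blast
  note k = kernelD[OF g]
  have g0: "g = Zero A (Cod A f) (Cod A g)"
    using e k by - (rule epi_Zero, auto)
  have "g \<cdot> Id A (Dom A g) = Zero A (Dom A g) (Cod A g)"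
    using g0 k by simp
  then obtain u where u: "u \<in> Hom A (Dom A g) (Dom A f)" "f \<cdot> u = Id A (Dom A g)"
    using kernel_lift[OF g, of "Id A (Dom A g)" "Dom A g"] k by auto
  have "f \<cdot> (u \<cdot> f) = f \<cdot> Id A (Dom A f)"
    using u k by (simp add: flip: assoc)
  then have "u \<cdot> f = Id A (Dom A f)"
    using u k by - (rule monoD[OF m, of "u \<cdot> f"], auto)
  then show ?thesis
    using u k by (intro is_isoI[of f "Dom A f" "Cod A f" u]) auto
qed

lemma image_factorization:
  assumes f: "f \<in> Arr A"
  obtains m c where "is_mono A m" "is_epi A c" "Dom A c = Dom A f" "Cod A c = Dom A m"
    "Cod A m = Cod A f" "m \<cdot> c = f" "\<And>k. is_kernel A k f \<Longrightarrow> is_cokernel A c k"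
proof -
  obtain k where k: "is_kernel A k f" using ex_kernel[OF f] by blast
  note kD = kernelD[OF k]
  obtain c where c: "is_cokernel A c k" using ex_cokernel kD by blast
  note cD = cokernelD[OF c]
  obtain m where m: "m \<in> Hom A (Cod A c) (Cod A f)" "m \<cdot> c = f"
    using cokernel_desc[OF c, of f "Cod A f"] kD by auto
  have ce: "is_epi A c" using c by (rule cokernel_epi)
  have mono: "is_mono A m"
  proof (rule is_monoI)
    show mA: "m \<in> Arr A" using m by simp
    fix x assume x: "x \<in> Arr A" "Cod A x = Dom A m" "m \<cdot> x = Zero A (Dom A x) (Cod A m)"
    obtain q where q: "is_cokernel A q x" using ex_cokernel x by blast
    note qD = cokernelD[OF q]
    obtain m' where m': "m' \<in> Hom A (Cod A q) (Cod A m)" "m' \<cdot> q = m"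
      using cokernel_desc[OF q, of m "Cod A m"] x mA by auto
    have "is_epi A (q \<cdot> c)"
      using cokernel_epi[OF q] ce qD x m by (intro is_epi_Comp) auto
    then obtain h where h: "is_cokernel A (q \<cdot> c) h" using epi_is_cokernel by blast
    note hD = cokernelD[OF h]
    have [simp]: "Dom A q = Cod A c" "Dom A m = Cod A c" "Dom A m' = Cod A q" "m' \<in> Arr A" "q \<in> Arr A"
      "Cod A h = Dom A c" "Dom A c = Dom A f" "c \<in> Arr A"
      using qD x m m' hD cD kD by auto
    have fm: "f = m' \<cdot> (q \<cdot> c)"
      using m(2) by (simp flip: m'(2))
    have "f \<cdot> h = m' \<cdot> ((q \<cdot> c) \<cdot> h)" using hD(1) unfolding fm by simp
    also have "\<dots> = Zero A (Dom A h) (Cod A m')" unfolding hD(4) using hD(1) by simp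
    also have "Cod A m' = Cod A f" using m m' by simp
    finally have 1: "f \<cdot> h = Zero A (Dom A h) (Cod A f)" .
    have 2: "h \<in> Hom A (Dom A h) (Dom A f)" using hD(1) by simp
    obtain t where t: "t \<in> Hom A (Dom A h) (Dom A k)" "k \<cdot> t = h"
      using kernel_lift[OF k 2 1] .
    have "c \<cdot> h = (c \<cdot> k) \<cdot> t" using t(1) kD(1-3) by (simp add: flip: t(2))
    also have "\<dots> = Zero A (Dom A h) (Cod A c)"
      unfolding cD(4) using cD(1-3) t(1) kD by simp
    finally have "c \<cdot> h = Zero A (Dom A h) (Cod A c)" .
    then obtain r where r: "r \<in> Hom A (Cod A q) (Cod A c)" "r \<cdot> (q \<cdot> c) = c"
      using cokernel_desc[OF h, of c "Cod A c"] by auto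
    have "r \<cdot> q = Id A (Cod A c)"
      using r ce by - (rule epiD[OF ce], auto)
    then have "x = (r \<cdot> q) \<cdot> x" using x by simp
    also have "\<dots> = Zero A (Dom A x) (Dom A m)"
      using r qD x by simp
    finally show "x = Zero A (Dom A x) (Dom A m)" .
  qed
  have ck: "is_cokernel A c k'" if k': "is_kernel A k' f" for k'
  proof -
    note kD' = kernelD[OF k']
    obtain u where u: "u \<in> Hom A (Dom A k) (Dom A k')" "k' \<cdot> u = k"
      using kernel_lift[OF k', of k "Dom A k"] kD by auto
    obtain u' where u': "u' \<in> Hom A (Dom A k') (Dom A k)" "k \<cdot> u' = k'"
      using kernel_lift[OF k, of k' "Dom A k'"] kD' by auto
    show ?thesis
    proof (rule is_cokernelI[OF ce])
      show "k' \<in> Hom A (Dom A k') (Dom A c)" using kD kD' cD by simp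
      have "c \<cdot> k' = (c \<cdot> k) \<cdot> u'" using u'(1) cD(1-3) kD(1-3) by (simp add: flip: u'(2))
      then show "c \<cdot> k' = Zero A (Dom A k') (Cod A c)" unfolding cD(4) using cD(1-3) kD u'(1) by simp
      fix W g assume g: "g \<in> Hom A (Dom A c) W" "g \<cdot> k' = Zero A (Dom A k') W"
      have W: "W \<in> Ob A" using g Hom_Ob by blast
      have "g \<cdot> k = (g \<cdot> k') \<cdot> u" using u(1) g(1) kD'(1-3) kD(1-3) cD(1-3) by (simp add: flip: u(2))
      then have "g \<cdot> k = Zero A (Dom A k) W" using g u(1) W by simp
      then show "\<exists>v\<in>Hom A (Cod A c) W. v \<cdot> c = g"
        using cokernel_desc[OF c, of g W] g cD by (metis (no_types, lifting))
    qed
  qed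
  show thesis
    by (rule that[OF mono ce]) (use m cD kD ck in auto)
qed

lemma epi_coker_kernel:
  assumes e: "is_epi A e" and k: "is_kernel A k e"
  shows "is_cokernel A e k"
proof -
  obtain f where f: "is_cokernel A e f" using epi_is_cokernel[OF e] by blast
  note fD = cokernelD[OF f] and kD = kernelD[OF k]
  obtain u where u: "u \<in> Hom A (Dom A f) (Dom A k)" "k \<cdot> u = f"
    using kernel_lift[OF k, of f "Dom A f"] fD by auto
  show ?thesis
  proof (rule is_cokernelI[OF e])
    show "k \<in> Hom A (Dom A k) (Dom A e)" "e \<cdot> k = Zero A (Dom A k) (Cod A e)"
      using kD by auto
    fix W g assume g: "g \<in> Hom A (Dom A e) W" "g \<cdot> k = Zero A (Dom A k) W"
    have W: "W \<in> Ob A" using g Hom_Ob by blast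
    have "g \<cdot> f = (g \<cdot> k) \<cdot> u" using u(1) g(1) kD(1-3) by (simp add: flip: u(2))
    then have "g \<cdot> f = Zero A (Dom A f) W" using g u(1) W by simp
    then show "\<exists>v\<in>Hom A (Cod A e) W. v \<cdot> e = g"
      using cokernel_desc[OF f, of g W] g fD by (metis (no_types, lifting))
  qed
qed

lemma mono_kernel_coker:
  assumes m: "is_mono A m" and c: "is_cokernel A c m"
  shows "is_kernel A m c"
proof -
  obtain f where f: "is_kernel A m f" using mono_is_kernel[OF m] by blast
  note fD = kernelD[OF f] and cD = cokernelD[OF c]
  obtain u where u: "u \<in> Hom A (Cod A c) (Cod A f)" "u \<cdot> c = f"
    using cokernel_desc[OF c, of f "Cod A f"] fD by auto
  show ?thesis
  proof (rule is_kernelI[OF m])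
    show "c \<in> Hom A (Cod A m) (Cod A c)" "c \<cdot> m = Zero A (Dom A m) (Cod A c)"
      using cD by auto
    fix W g assume g: "g \<in> Hom A W (Cod A m)" "c \<cdot> g = Zero A W (Cod A c)"
    have W: "W \<in> Ob A" using g Hom_Ob by blast
    have "f \<cdot> g = u \<cdot> (c \<cdot> g)" using u(1) g(1) cD(1-3) by (simp add: flip: u(2))
    then have "f \<cdot> g = Zero A W (Cod A f)" using g u(1) W by simp
    then show "\<exists>v\<in>Hom A W (Dom A m). m \<cdot> v = g"
      using kernel_lift[OF f, of g W] g fD by (metis (no_types, lifting))
  qed
qed

text \<open>Diagram chases use generalized elements, which lift along an epimorphism only after passing to a
  cover of their domain.\<close>

lemma epi_cover:
  assumes c: "is_epi A c" and y: "y \<in> Hom A W (Cod A c)"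
  obtains V e x where "e \<in> Hom A V W" "is_epi A e" "x \<in> Hom A V (Dom A c)" "c \<cdot> x = y \<cdot> e"
proof -
  have Ob: "Dom A c \<in> Ob A" "W \<in> Ob A" "Cod A c \<in> Ob A" using c y Hom_Ob by auto
  obtain P i j p q where b: "biprod P i j p q (Dom A c) W" using ex_biprod Ob by blast
  note [simp] = biprod_simps[OF b] and cA = is_epi_Arr[OF c]
  have [simp]: "y \<in> Arr A" "Dom A y = W" "Cod A y = Cod A c" using y by auto
  define f where "f = c \<cdot> p \<oplus> Neg A (y \<cdot> q)"
  have [simp]: "f \<in> Arr A" "Dom A f = P" "Cod A f = Cod A c" using cA by (auto simp: f_def)
  have fi: "f \<cdot> i = c" using cA Ob by (simp add: f_def)
  have fe: "is_epi A f"
  proof (rule is_epiI)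
    fix t assume t: "t \<in> Arr A" "Dom A t = Cod A f" "t \<cdot> f = Zero A (Dom A f) (Cod A t)"
    have "t \<cdot> c = (t \<cdot> f) \<cdot> i" using t(1,2) by (simp add: fi)
    also have "\<dots> = Zero A (Dom A c) (Cod A t)" unfolding t(3) using t by simp
    finally show "t = Zero A (Cod A f) (Cod A t)" using t epi_Zero[OF c, of t "Cod A t"] by simp
  qed simp
  obtain k where k: "is_kernel A k f" using ex_kernel[of f] by auto
  note kD = kernelD[OF k]
  have fk: "is_cokernel A f k" using fe k by (rule epi_coker_kernel)
  have "is_epi A (q \<cdot> k)"
  proof (rule is_epiI)
    show "q \<cdot> k \<in> Arr A" using kD by simp
    fix g assume g: "g \<in> Arr A" "Dom A g = Cod A (q \<cdot> k)"
      "g \<cdot> (q \<cdot> k) = Zero A (Dom A (q \<cdot> k)) (Cod A g)"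
    have gD: "Dom A g = W" using g kD by simp
    obtain t where t: "t \<in> Hom A (Cod A f) (Cod A g)" "t \<cdot> f = g \<cdot> q"
      using cokernel_desc[OF fk, of "g \<cdot> q" "Cod A g"] g gD kD by auto
    have "t \<cdot> c = (t \<cdot> f) \<cdot> i" using t(1) by (simp add: fi)
    also have "\<dots> = Zero A (Dom A c) (Cod A g)" unfolding t(2) using g gD by simp
    finally have "t = Zero A (Cod A c) (Cod A g)" using t by - (rule epi_Zero[OF c], auto)
    then have "g \<cdot> q = Zero A P (Cod A g)" using t(2) g by simp
    then have "(g \<cdot> q) \<cdot> j = Zero A W (Cod A g)" using g by simp
    then show "g = Zero A (Cod A (q \<cdot> k)) (Cod A g)" using g gD kD by simp
  qed
  moreover have "c \<cdot> (p \<cdot> k) = y \<cdot> (q \<cdot> k)"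
    using kD(2,3,4) cA by (subst eq_iff_diff) (auto simp: f_def)
  ultimately show thesis
    using kD cA by (intro that[of "q \<cdot> k" "Dom A k" "p \<cdot> k"]) auto
qed

lemma exact_cover:
  assumes c: "is_cokernel A c b" and x: "x \<in> Hom A W (Cod A b)" "c \<cdot> x = Zero A W (Cod A c)"
  obtains V e y where "e \<in> Hom A V W" "is_epi A e" "y \<in> Hom A V (Dom A b)" "b \<cdot> y = x \<cdot> e"
proof -
  note cD = cokernelD[OF c]
  obtain m d where md: "is_mono A m" "is_epi A d" "Dom A d = Dom A b" "Cod A d = Dom A m"
    "Cod A m = Cod A b" "m \<cdot> d = b" using image_factorization[OF cD(1)] by metis
  have "is_cokernel A c m"
  proof (rule is_cokernelI)
    show "is_epi A c" using c by (rule cokernel_epi)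
    show "m \<in> Hom A (Dom A m) (Dom A c)" using md cD by simp
    have "(c \<cdot> m) \<cdot> d = Zero A (Dom A d) (Cod A c)" using md cD by simp
    then show "c \<cdot> m = Zero A (Dom A m) (Cod A c)"
      using md cD epi_Zero[OF md(2), of "c \<cdot> m" "Cod A c"] by simp
    fix W g assume g: "g \<in> Hom A (Dom A c) W" "g \<cdot> m = Zero A (Dom A m) W"
    have W: "W \<in> Ob A" using g Hom_Ob by blast
    have "g \<cdot> b = (g \<cdot> m) \<cdot> d"
    proof -
      have "g \<cdot> b = g \<cdot> (m \<cdot> d)" by (simp only: md(6))
      then show ?thesis using g(1) md(1-5) cD(3) by simp
    qed
    also have "\<dots> = Zero A (Dom A b) W" unfolding g(2) using md W by simp
    finally show "\<exists>u\<in>Hom A (Cod A c) W. u \<cdot> c = g"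
      using cokernel_desc[OF c, of g W] g cD by (metis (no_types, lifting))
  qed
  then have "is_kernel A m c" using md mono_kernel_coker by blast
  then obtain x' where x': "x' \<in> Hom A W (Dom A m)" "m \<cdot> x' = x"
    using kernel_lift[of m c x W] x cD by auto
  obtain V e y where e: "e \<in> Hom A V W" "is_epi A e" "y \<in> Hom A V (Dom A d)" "d \<cdot> y = x' \<cdot> e"
  proof -
    have "x' \<in> Hom A W (Cod A d)" using x'(1) md(4) by simp
    from epi_cover[OF md(2) this] that show thesis by metis
  qed
  have "b \<cdot> y = (m \<cdot> d) \<cdot> y" by (simp only: md(6))
  also have "\<dots> = m \<cdot> (d \<cdot> y)" using md(1-5) e(1-3) by simp
  also have "\<dots> = (m \<cdot> x') \<cdot> e" using e(1) md(1-5) x'(1) by (simp add: e(4))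
  finally show thesis using that[of e V y] e md x' by simp
qed

lemma pushout_mono:
  assumes k: "is_mono A k" and f: "f \<in> Hom A (Dom A k) M"
  obtains m g where "is_mono A m" "Dom A m = M" "g \<in> Hom A (Cod A k) (Cod A m)" "g \<cdot> k = m \<cdot> f"
proof -
  have Ob: "Cod A k \<in> Ob A" "M \<in> Ob A" using k f Hom_Ob by auto
  have kA: "k \<in> Arr A" using k by simp
  obtain P i j p q where b: "biprod P i j p q M (Cod A k)" using ex_biprod Ob by blast
  note [simp] = biprod_simps[OF b]
  note [simp] = f[simplified]
  define h where "h = i \<cdot> f \<oplus> Neg A (j \<cdot> k)"
  have [simp]: "h \<in> Arr A" "Dom A h = Dom A k" "Cod A h = P" using kA by (auto simp: h_def)
  have qh: "q \<cdot> h = Neg A k" using kA Ob by (simp add: h_def)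
  have hm: "is_mono A h"
  proof (rule is_monoI)
    fix t assume t: "t \<in> Arr A" "Cod A t = Dom A h" "h \<cdot> t = Zero A (Dom A t) (Cod A h)"
    have "Neg A (k \<cdot> t) = q \<cdot> (h \<cdot> t)" using t(1,2) qh kA by (simp flip: assoc)
    also have "\<dots> = Zero A (Dom A t) (Cod A k)" unfolding t(3) using t by simp
    finally have "Neg A (Neg A (k \<cdot> t)) = Zero A (Dom A t) (Cod A k)" using t kA by (simp del: Neg_Neg)
    then show "t = Zero A (Dom A t) (Dom A h)" using t kA mono_Zero[OF k, of t "Dom A t"] by simp
  qed simp
  obtain c where c: "is_cokernel A c h" using ex_cokernel[of h] by auto
  note cD = cokernelD[OF c]
  have hk: "is_kernel A h c" using hm c by (rule mono_kernel_coker)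
  have "is_mono A (c \<cdot> i)"
  proof (rule is_monoI)
    show "c \<cdot> i \<in> Arr A" using cD by simp
    fix g assume g: "g \<in> Arr A" "Cod A g = Dom A (c \<cdot> i)"
      "(c \<cdot> i) \<cdot> g = Zero A (Dom A g) (Cod A (c \<cdot> i))"
    have gD: "Cod A g = M" using g cD by simp
    obtain t where t: "t \<in> Hom A (Dom A g) (Dom A h)" "h \<cdot> t = i \<cdot> g"
      using kernel_lift[OF hk, of "i \<cdot> g" "Dom A g"] g gD cD by auto
    have "Neg A (k \<cdot> t) = q \<cdot> (h \<cdot> t)" using t(1) qh kA by (simp add: flip: assoc)
    also have "\<dots> = Zero A (Dom A g) (Cod A k)" unfolding t(2) using g gD by simp
    finally have "Neg A (Neg A (k \<cdot> t)) = Zero A (Dom A g) (Cod A k)" using g kA by (simp del: Neg_Neg)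
    then have "t = Zero A (Dom A g) (Dom A k)"
      using t kA by - (rule mono_Zero[OF k], auto)
    then have "i \<cdot> g = Zero A (Dom A g) P" using t(2) g kA by simp
    then have "p \<cdot> (i \<cdot> g) = Zero A (Dom A g) M" using g by simp
    then show "g = Zero A (Dom A g) (Dom A (c \<cdot> i))" using g gD cD by simp
  qed
  moreover have "(c \<cdot> j) \<cdot> k = (c \<cdot> i) \<cdot> f"
  proof -
    have "(c \<cdot> i) \<cdot> f \<oplus> Neg A ((c \<cdot> j) \<cdot> k) = Zero A (Dom A k) (Cod A c)"
      using cD kA by (simp add: h_def)
    then show ?thesis using cD kA eq_iff_diff[of "(c \<cdot> i) \<cdot> f" "(c \<cdot> j) \<cdot> k"] by simp
  qed
  ultimately show thesis
    using cD kA by (intro that[of "c \<cdot> i" "c \<cdot> j"]) auto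
qed

lemma pullback_mono:
  assumes k: "is_mono A k" and h: "h \<in> Hom A W (Cod A k)"
  obtains n v where "is_mono A n" "Cod A n = W" "v \<in> Hom A (Dom A n) (Dom A k)" "k \<cdot> v = h \<cdot> n"
    "\<And>T x y. x \<in> Hom A T W \<Longrightarrow> y \<in> Hom A T (Dom A k) \<Longrightarrow> h \<cdot> x = k \<cdot> y \<Longrightarrow>
       \<exists>t \<in> Hom A T (Dom A n). n \<cdot> t = x \<and> v \<cdot> t = y"
proof -
  have kA: "k \<in> Arr A" using k by simp
  obtain c where c: "is_cokernel A c k" using ex_cokernel[OF kA] by blast
  note cD = cokernelD[OF c]
  have kc: "is_kernel A k c" using k c by (rule mono_kernel_coker)
  note [simp] = h[simplified]
  have [simp]: "c \<in> Arr A" "Dom A c = Cod A k" using cD by auto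
  obtain n where n: "is_kernel A n (c \<cdot> h)" using ex_kernel[of "c \<cdot> h"] by auto
  note nD = kernelD[OF n]
  have [simp]: "n \<in> Arr A" "Cod A n = W" using nD by auto
  obtain v where v: "v \<in> Hom A (Dom A n) (Dom A k)" "k \<cdot> v = h \<cdot> n"
    using kernel_lift[OF kc, of "h \<cdot> n" "Dom A n"] nD by auto
  show thesis
  proof (rule that[OF kernel_mono[OF n] _ v])
    fix T x y assume x: "x \<in> Hom A T W" and y: "y \<in> Hom A T (Dom A k)" and eq: "h \<cdot> x = k \<cdot> y"
    have T: "T \<in> Ob A" using x Hom_Ob by blast
    have "c \<cdot> (k \<cdot> y) = (c \<cdot> k) \<cdot> y" using y kA by simp
    also have "\<dots> = Zero A T (Cod A c)" unfolding cD(4) using y kA by simp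
    finally have "(c \<cdot> h) \<cdot> x = Zero A T (Cod A c)" using x eq by simp
    then obtain t where t: "t \<in> Hom A T (Dom A n)" "n \<cdot> t = x"
      using kernel_lift[OF n, of x T] x by auto
    have "k \<cdot> (v \<cdot> t) = (h \<cdot> n) \<cdot> t" using v(1) t(1) kA by (simp add: flip: v(2))
    also have "\<dots> = k \<cdot> y" using t eq by simp
    finally have "v \<cdot> t = y" using v t y by - (rule monoD[OF k], auto)
    then show "\<exists>t \<in> Hom A T (Dom A n). n \<cdot> t = x \<and> v \<cdot> t = y" using t by blast
  qed simp
qed

lemma factor_through_image:
  assumes f: "f \<in> Hom A X Y" and g: "g \<in> Hom A X E"
    and kill: "\<And>W x. x \<in> Hom A W X \<Longrightarrow> f \<cdot> x = Zero A W Y \<Longrightarrow> g \<cdot> x = Zero A W E"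
  obtains m c g' where "is_mono A m" "is_epi A c" "c \<in> Hom A X (Dom A m)" "Cod A m = Y" "m \<cdot> c = f"
    "g' \<in> Hom A (Dom A m) E" "g' \<cdot> c = g"
proof -
  have fA: "f \<in> Arr A" "Dom A f = X" "Cod A f = Y" using f by auto
  obtain k where k: "is_kernel A k f" using ex_kernel[OF fA(1)] by blast
  note kD = kernelD[OF k]
  obtain m c where mc: "is_mono A m" "is_epi A c" "Dom A c = X" "Cod A c = Dom A m"
    "Cod A m = Y" "m \<cdot> c = f" "is_cokernel A c k"
    using image_factorization[OF fA(1)] k fA(2,3) by metis
  have "g \<cdot> k = Zero A (Dom A k) E" using kD fA by (intro kill) auto
  then obtain g' where "g' \<in> Hom A (Dom A m) E" "g' \<cdot> c = g"
    using cokernel_desc[OF mc(7), of g E] g kD fA mc by auto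
  then show thesis using mc that[of m c g'] by simp
qed

lemma injective_extend:
  assumes E: "injective_object A E" and f: "f \<in> Hom A X Y" and g: "g \<in> Hom A X E"
    and kill: "\<And>W x. x \<in> Hom A W X \<Longrightarrow> f \<cdot> x = Zero A W Y \<Longrightarrow> g \<cdot> x = Zero A W E"
  obtains h where "h \<in> Hom A Y E" "h \<cdot> f = g"
proof -
  obtain m c g' where mc: "is_mono A m" "is_epi A c" "c \<in> Hom A X (Dom A m)" "Cod A m = Y" "m \<cdot> c = f"
    "g' \<in> Hom A (Dom A m) E" "g' \<cdot> c = g" using factor_through_image[OF f g kill] by metis
  obtain h where h: "h \<in> Hom A Y E" "h \<cdot> m = g'" using E mc unfolding injective_object_def by metis
  have "h \<cdot> f = h \<cdot> (m \<cdot> c)" by (simp only: mc(5))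
  also have "\<dots> = (h \<cdot> m) \<cdot> c" using h(1) mc(1-4) by simp
  finally have "h \<cdot> f = (h \<cdot> m) \<cdot> c" .
  then show thesis using that h mc by simp
qed

end

section \<open>Small sets\<close>

lemma small_lepoll: "T \<lesssim> S \<Longrightarrow> small U S \<Longrightarrow> small U T"
  unfolding small_def using lesspoll_trans1 by blast

lemma small_subset: "T \<subseteq> S \<Longrightarrow> small U S \<Longrightarrow> small U T"
  using small_lepoll subset_imp_lepoll by blast

lemma small_image: "small U S \<Longrightarrow> small U (f ` S)"
  using small_lepoll image_lepoll by blast

lemma small_copy:
  fixes U :: "'u itself"
  assumes "small U S"
  obtains J :: "'u set" and b where "bij_betw b J S" "small U J"
proof -
  have "S \<lesssim> (UNIV :: 'u set)" using assms lesspoll_imp_lepoll unfolding small_def by blast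
  then obtain f :: "_ \<Rightarrow> 'u" where f: "inj_on f S" unfolding lepoll_def by blast
  then have "bij_betw (inv_into S f) (f ` S) S" by (simp add: bij_betw_inv_into inj_on_imp_bij_betw)
  then show thesis using that assms small_image by blast
qed

context
  fixes U :: "'u itself"
  assumes U: "universe_type U"
begin

lemma small_nat: "small U (UNIV :: nat set)"
  using U unfolding universe_type_def by blast

lemma small_finite: "finite S \<Longrightarrow> small U S"
proof -
  have "infinite (UNIV :: 'u set)"
    using small_nat lesspoll_imp_lepoll infinite_le_lepoll unfolding small_def by blast
  then show "finite S \<Longrightarrow> small U S" unfolding small_def using finite_lesspoll_infinite by blast
qed

lemma small_Pow:
  assumes "small U S" shows "small U (Pow S)"
proof -
  obtain J :: "'u set" and b where b: "bij_betw b J S" "small U J" using small_copy[OF assms] .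
  have "Pow S = (\<lambda>T. b ` T) ` Pow J" using b(1) image_Pow_surj unfolding bij_betw_def by metis
  moreover have "small U (Pow J)" using U b(2) unfolding universe_type_def by blast
  ultimately show ?thesis using small_image by metis
qed

lemma small_square:
  assumes "small U K" shows "small U (K \<times> K)"
proof (cases "finite K")
  case False
  then have "K \<times> K \<approx> K" unfolding eqpoll_iff_card_of_ordIso by (rule card_of_Times_same_infinite)
  then show ?thesis using assms small_lepoll eqpoll_imp_lepoll by blast
qed (simp add: small_finite)

lemma small_Times:
  assumes "small U I" "small U J" shows "small U (I \<times> J)"
proof -
  obtain I' :: "'u set" and a where a: "bij_betw a I' I" "small U I'" using small_copy[OF assms(1)] .
  obtain J' :: "'u set" and b where b: "bij_betw b J' J" "small U J'" using small_copy[OF assms(2)] .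
  have "I' \<lesssim> J' \<or> J' \<lesssim> I'"
    using ordLeq_total[OF card_of_Well_order[of I'] card_of_Well_order[of J']]
    unfolding lepoll_def card_of_ordLeq[symmetric] .
  then have "small U (I' \<times> J')"
  proof
    assume "I' \<lesssim> J'"
    then have "I' \<times> J' \<lesssim> J' \<times> J'" by (intro times_lepoll_mono) auto
    then show ?thesis using small_square[OF b(2)] small_lepoll by blast
  next
    assume "J' \<lesssim> I'"
    then have "I' \<times> J' \<lesssim> I' \<times> I'" by (intro times_lepoll_mono) auto
    then show ?thesis using small_square[OF a(2)] small_lepoll by blast
  qed
  moreover have "I \<times> J = map_prod a b ` (I' \<times> J')"
    using a(1) b(1) by (simp add: bij_betw_def map_prod_surj_on)
  ultimately show ?thesis using small_image by metis
qed

lemma small_Sigma: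
  assumes I: "small U I" and S: "\<And>i. i \<in> I \<Longrightarrow> small U (S i)"
  shows "small U (Sigma I S)"
proof -
  obtain J :: "'u set" and b where b: "bij_betw b J I" "small U J" using small_copy[OF I] .
  have "\<exists>T :: 'u set. S (b j) \<lesssim> T \<and> small U T" if "j \<in> J" for j
  proof -
    have "small U (S (b j))" using S that b(1) by (auto simp: bij_betw_def)
    from small_copy[OF this] obtain T :: "'u set" and c where "bij_betw c T (S (b j))" "small U T" .
    then show ?thesis using bij_betw_inv eqpoll_def eqpoll_imp_lepoll by blast
  qed
  then obtain T :: "'u \<Rightarrow> 'u set" where T: "\<And>j. j \<in> J \<Longrightarrow> S (b j) \<lesssim> T j \<and> small U (T j)"
    by metis
  have B: "small U (\<Union>j\<in>J. T j)" using U b(2) T unfolding universe_type_def by blast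
  have "Sigma I S \<lesssim> J \<times> (\<Union>j\<in>J. T j)"
  proof (rule lepoll_trans)
    have "Sigma I S \<subseteq> (\<lambda>(j, s). (b j, s)) ` (SIGMA j:J. S (b j))"
      using b(1) by (force simp: bij_betw_def)
    then show "Sigma I S \<lesssim> (SIGMA j:J. S (b j))" by (rule subset_image_lepoll)
    have "S (b j) \<lesssim> (\<Union>j\<in>J. T j)" if "j \<in> J" for j
      using T[OF that] that lepoll_trans subset_imp_lepoll by (metis UN_upper)
    then show "(SIGMA j:J. S (b j)) \<lesssim> J \<times> (\<Union>j\<in>J. T j)" by (intro Sigma_lepoll_mono) auto
  qed
  then show ?thesis using small_Times[OF b(2) B] small_lepoll by blast
qed

end

section \<open>Direct limits in Grothendieck categories\<close>

context abelian_category
begin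

lemma coproduct_ex1:
  assumes L: "is_coproduct A I X L \<iota>" and W: "W \<in> Ob A" and f: "\<And>i. i \<in> I \<Longrightarrow> f i \<in> Hom A (X i) W"
  shows "\<exists>!u. u \<in> Hom A L W \<and> (\<forall>i\<in>I. u \<cdot> \<iota> i = f i)"
proof -
  have "\<forall>W \<in> Ob A. \<forall>f. (\<forall>i \<in> I. f i \<in> Hom A (X i) W)
        \<longrightarrow> (\<exists>!u. u \<in> Hom A L W \<and> (\<forall>i \<in> I. u \<cdot> \<iota> i = f i))"
    using L unfolding is_coproduct_def by (elim conjE)
  from this[rule_format, OF W f] show ?thesis by assumption
qed

lemma limit_ex1:
  assumes L: "is_direct_limit A I le X t L l" and W: "W \<in> Ob A" and f: "\<And>i. i \<in> I \<Longrightarrow> f i \<in> Hom A (X i) W"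
    "\<And>i j. \<lbrakk>i \<in> I; j \<in> I; le i j\<rbrakk> \<Longrightarrow> f j \<cdot> t i j = f i"
  shows "\<exists>!u. u \<in> Hom A L W \<and> (\<forall>i\<in>I. u \<cdot> l i = f i)"
proof -
  have "\<forall>W \<in> Ob A. \<forall>f. (\<forall>i \<in> I. f i \<in> Hom A (X i) W) \<and>
          (\<forall>i \<in> I. \<forall>j \<in> I. le i j \<longrightarrow> f j \<cdot> t i j = f i)
        \<longrightarrow> (\<exists>!u. u \<in> Hom A L W \<and> (\<forall>i \<in> I. u \<cdot> l i = f i))"
    using L unfolding is_direct_limit_def by (elim conjE)
  note * = mp[OF spec[OF bspec[OF this W], of f]]
  show ?thesis by (rule *) (intro conjI ballI impI f)
qed

lemma coproduct_desc:
  assumes "is_coproduct A I X L \<iota>" "W \<in> Ob A" "\<And>i. i \<in> I \<Longrightarrow> f i \<in> Hom A (X i) W"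
  obtains u where "u \<in> Hom A L W" "\<And>i. i \<in> I \<Longrightarrow> u \<cdot> \<iota> i = f i"
  using assms unfolding is_coproduct_def by metis

lemma coproduct_desc_ex:
  assumes "is_coproduct A I X L \<iota>" "W \<in> Ob A" "\<And>i. i \<in> I \<Longrightarrow> f i \<in> Hom A (X i) W"
  shows "\<exists>u\<in>Hom A L W. \<forall>i\<in>I. u \<cdot> \<iota> i = f i"
  using ex1_implies_ex[OF coproduct_ex1[where f = f, OF assms]] unfolding Bex_def .

lemma coproduct_ext:
  assumes "is_coproduct A I X L \<iota>" "u \<in> Hom A L W" "v \<in> Hom A L W"
    "\<And>i. i \<in> I \<Longrightarrow> u \<cdot> \<iota> i = v \<cdot> \<iota> i"
  shows "u = v"
proof -
  have "W \<in> Ob A" "\<forall>i\<in>I. u \<cdot> \<iota> i \<in> Hom A (X i) W"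
    using assms(1,2) Comp_Hom Hom_Ob unfolding is_coproduct_def by blast+
  then have "\<exists>!w. w \<in> Hom A L W \<and> (\<forall>i\<in>I. w \<cdot> \<iota> i = u \<cdot> \<iota> i)"
    by (intro coproduct_ex1[OF assms(1)]) auto
  then obtain w where "\<And>w'. w' \<in> Hom A L W \<and> (\<forall>i\<in>I. w' \<cdot> \<iota> i = u \<cdot> \<iota> i) \<Longrightarrow> w' = w" by blast
  from this[of u] this[of v] show ?thesis using assms(2-4) by simp
qed

lemma limit_desc:
  assumes "is_direct_limit A I le X t L l" "W \<in> Ob A" "\<And>i. i \<in> I \<Longrightarrow> f i \<in> Hom A (X i) W"
    "\<And>i j. \<lbrakk>i \<in> I; j \<in> I; le i j\<rbrakk> \<Longrightarrow> f j \<cdot> t i j = f i"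
  obtains u where "u \<in> Hom A L W" "\<And>i. i \<in> I \<Longrightarrow> u \<cdot> l i = f i"
proof -
  have "\<exists>!u. u \<in> Hom A L W \<and> (\<forall>i \<in> I. u \<cdot> l i = f i)"
    using assms by (rule limit_ex1)
  then show thesis using that by blast
qed

lemma limit_Hom: "is_direct_limit A I le X t L l \<Longrightarrow> i \<in> I \<Longrightarrow> l i \<in> Hom A (X i) L"
  unfolding is_direct_limit_def by blast

lemma limit_comp:
  "is_direct_limit A I le X t L l \<Longrightarrow> i \<in> I \<Longrightarrow> j \<in> I \<Longrightarrow> le i j \<Longrightarrow> l j \<cdot> t i j = l i"
  unfolding is_direct_limit_def by blast

lemma limit_ext:
  assumes L: "is_direct_limit A I le X t L l" and S: "direct_system A I le X t"
    and u: "u \<in> Hom A L W" "v \<in> Hom A L W" "\<And>i. i \<in> I \<Longrightarrow> u \<cdot> l i = v \<cdot> l i"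
  shows "u = v"
proof -
  have W: "W \<in> Ob A" "\<forall>i\<in>I. u \<cdot> l i \<in> Hom A (X i) W"
    using limit_Hom[OF L] u(1) Comp_Hom Hom_Ob by blast+
  have "u \<cdot> l j \<cdot> t i j = u \<cdot> l i" if "i \<in> I" "j \<in> I" "le i j" for i j
  proof -
    have "t i j \<in> Hom A (X i) (X j)" using S that unfolding direct_system_def by blast
    then have "u \<cdot> l j \<cdot> t i j = u \<cdot> (l j \<cdot> t i j)"
      using limit_Hom[OF L that(2)] u(1) by simp
    then show ?thesis using limit_comp[OF L that] by simp
  qed
  then have "\<exists>!w. w \<in> Hom A L W \<and> (\<forall>i\<in>I. w \<cdot> l i = u \<cdot> l i)"
    using W by (intro limit_ex1[OF L]) auto
  then obtain w where "\<And>w'. w' \<in> Hom A L W \<and> (\<forall>i\<in>I. w' \<cdot> l i = u \<cdot> l i) \<Longrightarrow> w' = w" by blast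
  from this[of u] this[of v] show ?thesis using u by simp
qed

lemma is_direct_limitI:
  assumes "L \<in> Ob A" "\<And>i. i \<in> I \<Longrightarrow> l i \<in> Hom A (X i) L"
    "\<And>i j. i \<in> I \<Longrightarrow> j \<in> I \<Longrightarrow> le i j \<Longrightarrow> l j \<cdot> t i j = l i"
    "\<And>W f. W \<in> Ob A \<Longrightarrow> (\<And>i. i \<in> I \<Longrightarrow> f i \<in> Hom A (X i) W) \<Longrightarrow>
       (\<And>i j. i \<in> I \<Longrightarrow> j \<in> I \<Longrightarrow> le i j \<Longrightarrow> f j \<cdot> t i j = f i) \<Longrightarrow>
       \<exists>u \<in> Hom A L W. \<forall>i \<in> I. u \<cdot> l i = f i"
    "\<And>W u v. u \<in> Hom A L W \<Longrightarrow> v \<in> Hom A L W \<Longrightarrow> (\<And>i. i \<in> I \<Longrightarrow> u \<cdot> l i = v \<cdot> l i) \<Longrightarrow> u = v"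
  shows "is_direct_limit A I le X t L l"
  unfolding is_direct_limit_def
proof (intro conjI ballI impI allI)
  fix W f assume W: "W \<in> Ob A" "(\<forall>i\<in>I. f i \<in> Hom A (X i) W) \<and> (\<forall>i\<in>I. \<forall>j\<in>I. le i j \<longrightarrow> f j \<cdot> t i j = f i)"
  then obtain u where "u \<in> Hom A L W" "\<forall>i \<in> I. u \<cdot> l i = f i" using assms(4)[of W f] by blast
  then show "\<exists>!u. u \<in> Hom A L W \<and> (\<forall>i\<in>I. u \<cdot> l i = f i)"
    using assms(5)[of _ W] by metis
qed (use assms in auto)

lemma direct_systemD:
  assumes "direct_system A I le X t"
  shows "i \<in> I \<Longrightarrow> X i \<in> Ob A" "i \<in> I \<Longrightarrow> t i i = Id A (X i)"
    "i \<in> I \<Longrightarrow> j \<in> I \<Longrightarrow> le i j \<Longrightarrow> t i j \<in> Hom A (X i) (X j)"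
    "i \<in> I \<Longrightarrow> j \<in> I \<Longrightarrow> k \<in> I \<Longrightarrow> le i j \<Longrightarrow> le j k \<Longrightarrow> t j k \<cdot> t i j = t i k"
    "I \<noteq> {}" "i \<in> I \<Longrightarrow> le i i"
    "i \<in> I \<Longrightarrow> j \<in> I \<Longrightarrow> k \<in> I \<Longrightarrow> le i j \<Longrightarrow> le j k \<Longrightarrow> le i k"
    "i \<in> I \<Longrightarrow> j \<in> I \<Longrightarrow> \<exists>k\<in>I. le i k \<and> le j k"
  using assms unfolding direct_system_def directed_set_def by blast+

lemma constant_system:
  assumes "directed_set I le" "Y \<in> Ob A"
  shows "direct_system A I le (\<lambda>_. Y) (\<lambda>_ _. Id A Y)" "is_direct_limit A I le (\<lambda>_. Y) (\<lambda>_ _. Id A Y) Y (\<lambda>_. Id A Y)"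
proof -
  show 1: "direct_system A I le (\<lambda>_. Y) (\<lambda>_ _. Id A Y)"
    using assms unfolding direct_system_def by simp
  obtain i where i: "i \<in> I" using assms(1) unfolding directed_set_def by blast
  show "is_direct_limit A I le (\<lambda>_. Y) (\<lambda>_ _. Id A Y) Y (\<lambda>_. Id A Y)"
  proof (rule is_direct_limitI)
    fix W f assume f: "\<And>i. i \<in> I \<Longrightarrow> f i \<in> Hom A Y W"
      "\<And>i j. i \<in> I \<Longrightarrow> j \<in> I \<Longrightarrow> le i j \<Longrightarrow> f j \<cdot> Id A Y = f i"
    have "f j = f i" if j: "j \<in> I" for j
    proof -
      obtain k where k: "k \<in> I" "le i k" "le j k" using direct_systemD(8)[OF 1 i j] by blast
      then show ?thesis using f(2)[OF i k(1,2)] f(2)[OF j k(1,3)] by simp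
    qed
    moreover have "f i \<cdot> Id A Y = f i" using f(1)[OF i] by simp
    ultimately show "\<exists>u\<in>Hom A Y W. \<forall>i\<in>I. u \<cdot> Id A Y = f i" using f(1)[OF i] by metis
  next
    fix W u v assume "u \<in> Hom A Y W" "v \<in> Hom A Y W" "\<And>i. i \<in> I \<Longrightarrow> u \<cdot> Id A Y = v \<cdot> Id A Y"
    then show "u = v" using i Comp_Id by metis
  qed (use assms in auto)
qed

lemma limit_cokernel:
  assumes X: "direct_system A I le X s" and Y: "direct_system A I le Y t"
    and f: "system_morphism A I le X s Y t f"
    and LX: "is_direct_limit A I le X s LX x" and LY: "is_direct_limit A I le Y t LY y"
    and \<phi>: "\<phi> \<in> Hom A LX LY" "\<And>i. i \<in> I \<Longrightarrow> \<phi> \<cdot> x i = y i \<cdot> f i"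
    and c: "\<And>i. i \<in> I \<Longrightarrow> is_cokernel A (c i) (f i)" and q: "is_cokernel A q \<phi>"
  obtains r z where "direct_system A I le (\<lambda>i. Cod A (c i)) r"
    "system_morphism A I le Y t (\<lambda>i. Cod A (c i)) r c"
    "is_direct_limit A I le (\<lambda>i. Cod A (c i)) r (Cod A q) z"
    "\<And>i. i \<in> I \<Longrightarrow> q \<cdot> y i = z i \<cdot> c i"
proof -
  note XD = direct_systemD[OF X] and YD = direct_systemD[OF Y]
  have fH: "f i \<in> Hom A (X i) (Y i)" if "i \<in> I" for i
    using f that unfolding system_morphism_def by blast
  have fc: "t i j \<cdot> f i = f j \<cdot> s i j" if "i \<in> I" "j \<in> I" "le i j" for i j
    using f that unfolding system_morphism_def by blast
  note yH = limit_Hom[OF LY] and xH = limit_Hom[OF LX]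
  note qD = cokernelD[OF q]
  have cH: "c i \<in> Hom A (Y i) (Cod A (c i))" "c i \<cdot> f i = Zero A (X i) (Cod A (c i))" if "i \<in> I" for i
    using cokernelD[OF c[OF that]] fH[OF that] by auto
  have qH: "q \<in> Hom A LY (Cod A q)" "q \<cdot> \<phi> = Zero A LX (Cod A q)"
    using qD \<phi>(1) by auto
  have desc: "\<exists>u\<in>Hom A (Cod A (c i)) W. u \<cdot> c i = g"
    if "i \<in> I" "g \<in> Hom A (Y i) W" "g \<cdot> f i = Zero A (X i) W" for i g W
    using cokernel_desc[OF c[OF that(1)], of g W] that fH[OF that(1)] by auto
  have ce: "u = v" if "i \<in> I" "u \<in> Hom A (Cod A (c i)) W" "v \<in> Hom A (Cod A (c i)) W"
    "u \<cdot> c i = v \<cdot> c i" for i u v W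
    using cokernel_epi[OF c[OF that(1)]] that(2-4) cH[OF that(1)]
    by - (rule epiD[of "c i"], auto)
  have "\<exists>u\<in>Hom A (Cod A (c i)) (Cod A (c j)). u \<cdot> c i = c j \<cdot> t i j" if ij: "i \<in> I" "j \<in> I" "le i j" for i j
  proof (rule desc[OF ij(1)])
    show "c j \<cdot> t i j \<in> Hom A (Y i) (Cod A (c j))" using cH(1)[OF ij(2)] YD(3)[OF ij] Comp_Hom by blast
    have "(c j \<cdot> t i j) \<cdot> f i = c j \<cdot> (t i j \<cdot> f i)"
      using cH(1)[OF ij(2)] YD(3)[OF ij] fH[OF ij(1)] by simp
    also have "\<dots> = (c j \<cdot> f j) \<cdot> s i j" unfolding fc[OF ij]
      using cH(1)[OF ij(2)] XD(3)[OF ij] fH[OF ij(2)] by simp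
    also have "\<dots> = Zero A (X i) (Cod A (c j))" unfolding cH(2)[OF ij(2)]
      using XD(3)[OF ij] cH(1)[OF ij(2)] by simp
    finally show "(c j \<cdot> t i j) \<cdot> f i = Zero A (X i) (Cod A (c j))" .
  qed
  then obtain r where r: "\<And>i j. i \<in> I \<Longrightarrow> j \<in> I \<Longrightarrow> le i j \<Longrightarrow>
      r i j \<in> Hom A (Cod A (c i)) (Cod A (c j)) \<and> r i j \<cdot> c i = c j \<cdot> t i j" by metis
  have "\<exists>u\<in>Hom A (Cod A (c i)) (Cod A q). u \<cdot> c i = q \<cdot> y i" if i: "i \<in> I" for i
  proof (rule desc[OF i])
    show "q \<cdot> y i \<in> Hom A (Y i) (Cod A q)" using qH(1) yH[OF i] Comp_Hom by blast
    have "(q \<cdot> y i) \<cdot> f i = q \<cdot> (y i \<cdot> f i)"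
      using qH(1) yH[OF i] fH[OF i] by simp
    also have "\<dots> = (q \<cdot> \<phi>) \<cdot> x i" unfolding \<phi>(2)[OF i, symmetric]
      using qH(1) xH[OF i] \<phi>(1) by simp
    also have "\<dots> = Zero A (X i) (Cod A q)" unfolding qH(2)
      using xH[OF i] qD by simp
    finally show "(q \<cdot> y i) \<cdot> f i = Zero A (X i) (Cod A q)" .
  qed
  then obtain z where z: "\<And>i. i \<in> I \<Longrightarrow> z i \<in> Hom A (Cod A (c i)) (Cod A q) \<and> z i \<cdot> c i = q \<cdot> y i"
    by metis
  have sys: "direct_system A I le (\<lambda>i. Cod A (c i)) r"
    unfolding direct_system_def
  proof (intro conjI ballI impI)
    show "directed_set I le" using X unfolding direct_system_def by blast
    fix i assume i: "i \<in> I"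
    show "Cod A (c i) \<in> Ob A" using cH(1)[OF i] Hom_Ob by blast
    show "r i i = Id A (Cod A (c i))"
    proof (rule ce[OF i])
      show "r i i \<in> Hom A (Cod A (c i)) (Cod A (c i))" using r[OF i i XD(6)[OF i]] by blast
      show "Id A (Cod A (c i)) \<in> Hom A (Cod A (c i)) (Cod A (c i))" using cH(1)[OF i] Id_Hom Hom_Ob by blast
      show "r i i \<cdot> c i = Id A (Cod A (c i)) \<cdot> c i"
        unfolding conjunct2[OF r[OF i i XD(6)[OF i]]] YD(2)[OF i] using cH(1)[OF i] by simp
    qed
    fix j assume j: "j \<in> I"
    show "r i j \<in> Hom A (Cod A (c i)) (Cod A (c j))" if "le i j" using r[OF i j that] by blast
    fix k assume k: "k \<in> I" and le: "le i j \<and> le j k"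
    note rij = r[OF i j conjunct1[OF le]] and rjk = r[OF j k conjunct2[OF le]]
      and rik = r[OF i k XD(7)[OF i j k conjunct1[OF le] conjunct2[OF le]]]
    show "r j k \<cdot> r i j = r i k"
    proof (rule ce[OF i])
      show "r j k \<cdot> r i j \<in> Hom A (Cod A (c i)) (Cod A (c k))" using rij rjk Comp_Hom by blast
      show "r i k \<in> Hom A (Cod A (c i)) (Cod A (c k))" using rik by blast
      have "(r j k \<cdot> r i j) \<cdot> c i = r j k \<cdot> (r i j \<cdot> c i)"
        using rij rjk cH(1)[OF i] by simp
      also have "\<dots> = (r j k \<cdot> c j) \<cdot> t i j"
        using conjunct2[OF rij] conjunct1[OF rjk] cH(1)[OF j] YD(3)[OF i j] le by simp
      also have "\<dots> = c k \<cdot> (t j k \<cdot> t i j)"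
        using conjunct2[OF rjk] cH(1)[OF k] YD(3)[OF i j] YD(3)[OF j k] le by simp
      also have "\<dots> = r i k \<cdot> c i" using YD(4)[OF i j k] le rik by simp
      finally show "(r j k \<cdot> r i j) \<cdot> c i = r i k \<cdot> c i" .
    qed
  qed
  have mor: "system_morphism A I le Y t (\<lambda>i. Cod A (c i)) r c"
    unfolding system_morphism_def using cH(1) r by blast
  have lim: "is_direct_limit A I le (\<lambda>i. Cod A (c i)) r (Cod A q) z"
  proof (rule is_direct_limitI)
    show "Cod A q \<in> Ob A" using qD by simp
    show "z i \<in> Hom A (Cod A (c i)) (Cod A q)" if "i \<in> I" for i using z that by blast
    show "z j \<cdot> r i j = z i" if ij: "i \<in> I" "j \<in> I" "le i j" for i j
    proof (rule ce[OF ij(1)])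
      show "z j \<cdot> r i j \<in> Hom A (Cod A (c i)) (Cod A q)" using z[OF ij(2)] r[OF ij] Comp_Hom by blast
      show "z i \<in> Hom A (Cod A (c i)) (Cod A q)" using z[OF ij(1)] by blast
      have "(z j \<cdot> r i j) \<cdot> c i = z j \<cdot> (r i j \<cdot> c i)"
        using z[OF ij(2)] r[OF ij] cH(1)[OF ij(1)] by simp
      also have "\<dots> = (z j \<cdot> c j) \<cdot> t i j"
        using conjunct2[OF r[OF ij]] conjunct1[OF z[OF ij(2)]] cH(1)[OF ij(2)] YD(3)[OF ij]
        by simp
      also have "\<dots> = q \<cdot> (y j \<cdot> t i j)"
        using conjunct2[OF z[OF ij(2)]] qH(1) YD(3)[OF ij] yH[OF ij(2)] by simp
      also have "\<dots> = z i \<cdot> c i" using limit_comp[OF LY ij] z[OF ij(1)] by simp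
      finally show "(z j \<cdot> r i j) \<cdot> c i = z i \<cdot> c i" .
    qed
  next
    fix W g assume W: "W \<in> Ob A" and g: "\<And>i. i \<in> I \<Longrightarrow> g i \<in> Hom A (Cod A (c i)) W"
      "\<And>i j. i \<in> I \<Longrightarrow> j \<in> I \<Longrightarrow> le i j \<Longrightarrow> g j \<cdot> r i j = g i"
    have 1: "(g j \<cdot> c j) \<cdot> t i j = g i \<cdot> c i" if ij: "i \<in> I" "j \<in> I" "le i j" for i j
    proof -
      have "(g j \<cdot> c j) \<cdot> t i j = g j \<cdot> (c j \<cdot> t i j)"
        using g(1)[OF ij(2)] cH(1)[OF ij(2)] YD(3)[OF ij] by simp
      also have "\<dots> = (g j \<cdot> r i j) \<cdot> c i"
        using g(1)[OF ij(2)] cH(1)[OF ij(1)] r[OF ij] by simp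
      finally show ?thesis using g(2)[OF ij] by simp
    qed
    obtain h where h: "h \<in> Hom A LY W" "\<And>i. i \<in> I \<Longrightarrow> h \<cdot> y i = g i \<cdot> c i"
      using limit_desc[OF LY W, of "\<lambda>i. g i \<cdot> c i"] 1 Comp_Hom[OF cH(1) g(1)] by blast
    have "h \<cdot> \<phi> = Zero A LX W"
    proof (rule limit_ext[OF LX X])
      show "h \<cdot> \<phi> \<in> Hom A LX W" using h(1) \<phi>(1) Comp_Hom by blast
      show "Zero A LX W \<in> Hom A LX W" using W \<phi>(1) Hom_Ob Zero_Hom by blast
      fix i assume i: "i \<in> I"
      have "(h \<cdot> \<phi>) \<cdot> x i = h \<cdot> (\<phi> \<cdot> x i)"
        using h(1) \<phi>(1) xH[OF i] by simp
      also have "\<dots> = (h \<cdot> y i) \<cdot> f i"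
        unfolding \<phi>(2)[OF i] using h(1) yH[OF i] fH[OF i] by simp
      also have "\<dots> = g i \<cdot> (c i \<cdot> f i)"
        unfolding h(2)[OF i] using g(1)[OF i] cH(1)[OF i] fH[OF i] by simp
      also have "\<dots> = Zero A (X i) W"
        unfolding cH(2)[OF i] using g(1)[OF i] XD(1)[OF i] by simp
      also have "\<dots> = Zero A LX W \<cdot> x i" using xH[OF i] W by simp
      finally show "(h \<cdot> \<phi>) \<cdot> x i = Zero A LX W \<cdot> x i" .
    qed
    then obtain u where u: "u \<in> Hom A (Cod A q) W" "u \<cdot> q = h"
      using cokernel_desc[OF q, of h W] h(1) \<phi>(1) by auto
    have "u \<cdot> z i = g i" if i: "i \<in> I" for i
    proof (rule ce[OF i])
      show "u \<cdot> z i \<in> Hom A (Cod A (c i)) W" using z[OF i] u(1) Comp_Hom by blast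
      show "g i \<in> Hom A (Cod A (c i)) W" using g(1)[OF i] .
      have "(u \<cdot> z i) \<cdot> c i = u \<cdot> (z i \<cdot> c i)"
        using u(1) z[OF i] cH(1)[OF i] by simp
      also have "\<dots> = (u \<cdot> q) \<cdot> y i"
        using conjunct2[OF z[OF i]] u(1) qH(1) yH[OF i] by simp
      also have "\<dots> = g i \<cdot> c i" unfolding u(2) using h(2)[OF i] .
      finally show "(u \<cdot> z i) \<cdot> c i = g i \<cdot> c i" .
    qed
    then show "\<exists>u\<in>Hom A (Cod A q) W. \<forall>i\<in>I. u \<cdot> z i = g i" using u(1) by blast
  next
    fix W u v assume uv: "u \<in> Hom A (Cod A q) W" "v \<in> Hom A (Cod A q) W"
      and eq: "\<And>i. i \<in> I \<Longrightarrow> u \<cdot> z i = v \<cdot> z i"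
    have "u \<cdot> q = v \<cdot> q"
    proof (rule limit_ext[OF LY Y])
      show "u \<cdot> q \<in> Hom A LY W" "v \<cdot> q \<in> Hom A LY W" using uv qH(1) Comp_Hom by blast+
      fix i assume i: "i \<in> I"
      have *: "(w \<cdot> q) \<cdot> y i = (w \<cdot> z i) \<cdot> c i" if w: "w \<in> Hom A (Cod A q) W" for w
      proof -
        have "(w \<cdot> q) \<cdot> y i = w \<cdot> (q \<cdot> y i)" using w qH(1) yH[OF i] by simp
        also have "\<dots> = w \<cdot> (z i \<cdot> c i)" using z[OF i] by simp
        also have "\<dots> = (w \<cdot> z i) \<cdot> c i" using w z[OF i] cH(1)[OF i] by simp
        finally show ?thesis .
      qed
      show "(u \<cdot> q) \<cdot> y i = (v \<cdot> q) \<cdot> y i" unfolding *[OF uv(1)] *[OF uv(2)] eq[OF i] ..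
    qed
    then show "u = v" using uv qH(1) cokernel_epi[OF q] by - (rule epiD[of q], auto)
  qed
  show thesis using that[OF sys mor lim] z by metis
qed

lemma is_coproductI:
  assumes "L \<in> Ob A" "\<And>i. i \<in> I \<Longrightarrow> \<iota> i \<in> Hom A (X i) L"
    "\<And>W f. W \<in> Ob A \<Longrightarrow> (\<And>i. i \<in> I \<Longrightarrow> f i \<in> Hom A (X i) W) \<Longrightarrow>
       \<exists>u \<in> Hom A L W. \<forall>i \<in> I. u \<cdot> \<iota> i = f i"
    "\<And>W u v. u \<in> Hom A L W \<Longrightarrow> v \<in> Hom A L W \<Longrightarrow> (\<And>i. i \<in> I \<Longrightarrow> u \<cdot> \<iota> i = v \<cdot> \<iota> i) \<Longrightarrow> u = v"
  shows "is_coproduct A I X L \<iota>"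
  unfolding is_coproduct_def
proof (intro conjI ballI impI allI)
  fix W f assume W: "W \<in> Ob A" "\<forall>i\<in>I. f i \<in> Hom A (X i) W"
  then obtain u where "u \<in> Hom A L W" "\<forall>i \<in> I. u \<cdot> \<iota> i = f i" using assms(3)[of W f] by blast
  then show "\<exists>!u. u \<in> Hom A L W \<and> (\<forall>i\<in>I. u \<cdot> \<iota> i = f i)"
    using assms(4)[of _ W] by metis
qed (use assms in auto)

lemma reindex_coproduct:
  assumes b: "bij_betw b J I" and L: "is_coproduct A J (\<lambda>j. X (b j)) L \<iota>"
  shows "is_coproduct A I X L (\<lambda>i. \<iota> (inv_into J b i))"
proof -
  have bi: "b (inv_into J b i) = i" "inv_into J b i \<in> J" if "i \<in> I" for i
    using b that by (auto simp: bij_betw_def f_inv_into_f inv_into_into)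
  have ib: "inv_into J b (b j) = j" "b j \<in> I" if "j \<in> J" for j
    using b that by (auto simp: bij_betw_def)
  show ?thesis
  proof (rule is_coproductI)
    show "L \<in> Ob A" using L unfolding is_coproduct_def by blast
    show "\<iota> (inv_into J b i) \<in> Hom A (X i) L" if "i \<in> I" for i
      using L bi[OF that] unfolding is_coproduct_def by metis
    fix W f assume W: "W \<in> Ob A" and f: "\<And>i. i \<in> I \<Longrightarrow> f i \<in> Hom A (X i) W"
    obtain u where "u \<in> Hom A L W" "\<And>j. j \<in> J \<Longrightarrow> u \<cdot> \<iota> j = f (b j)"
      using coproduct_desc[OF L W, of "\<lambda>j. f (b j)"] f ib by blast
    then show "\<exists>u\<in>Hom A L W. \<forall>i\<in>I. u \<cdot> \<iota> (inv_into J b i) = f i" using bi by (intro bexI[of _ u]) auto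
  next
    fix W u v assume "u \<in> Hom A L W" "v \<in> Hom A L W"
      "\<And>i. i \<in> I \<Longrightarrow> u \<cdot> \<iota> (inv_into J b i) = v \<cdot> \<iota> (inv_into J b i)"
    then show "u = v" using coproduct_ext[OF L] ib by metis
  qed
qed

lemma reindex_system:
  assumes b: "bij_betw b J I" and X: "direct_system A I le X s"
  shows "direct_system A J (\<lambda>i j. le (b i) (b j)) (\<lambda>j. X (b j)) (\<lambda>i j. s (b i) (b j))"
proof -
  note XD = direct_systemD[OF X]
  have bJ: "b j \<in> I" if "j \<in> J" for j using b that by (auto simp: bij_betw_def)
  have "J \<noteq> {}" using b XD(5) by (auto simp: bij_betw_def)
  moreover have "\<exists>k\<in>J. le (b i) (b k) \<and> le (b j) (b k)" if "i \<in> J" "j \<in> J" for i j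
    using XD(8)[OF bJ[OF that(1)] bJ[OF that(2)]] b by (auto simp: bij_betw_def)
  ultimately show ?thesis
    unfolding direct_system_def directed_set_def
  proof (intro conjI ballI impI)
    fix i j k assume ijk: "i \<in> J" "j \<in> J" "k \<in> J"
    note I = bJ[OF ijk(1)] bJ[OF ijk(2)] bJ[OF ijk(3)]
    show "le (b i) (b k)" if "le (b i) (b j) \<and> le (b j) (b k)" using XD(7)[OF I] that by blast
    show "s (b j) (b k) \<cdot> s (b i) (b j) = s (b i) (b k)" if "le (b i) (b j) \<and> le (b j) (b k)"
      using XD(4)[OF I] that by blast
  qed (use XD(1-3,6) bJ in auto)
qed

lemma reindex_limit:
  assumes b: "bij_betw b J I" and X: "direct_system A I le X s" and L: "is_direct_limit A I le X s L l"
  shows "is_direct_limit A J (\<lambda>i j. le (b i) (b j)) (\<lambda>j. X (b j)) (\<lambda>i j. s (b i) (b j)) L (\<lambda>j. l (b j))"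
proof (rule is_direct_limitI)
  have bJ: "b j \<in> I" if "j \<in> J" for j using b that by (auto simp: bij_betw_def)
  have bi: "b (inv_into J b i) = i" "inv_into J b i \<in> J" if "i \<in> I" for i
    using b that by (auto simp: bij_betw_def f_inv_into_f inv_into_into)
  have ib: "inv_into J b (b j) = j" if "j \<in> J" for j
    using b that by (auto simp: bij_betw_def)
  show "L \<in> Ob A" using L unfolding is_direct_limit_def by blast
  show "l (b j) \<in> Hom A (X (b j)) L" if "j \<in> J" for j using limit_Hom[OF L bJ[OF that]] .
  show "l (b j) \<cdot> s (b i) (b j) = l (b i)" if "i \<in> J" "j \<in> J" "le (b i) (b j)" for i j
    using limit_comp[OF L] bJ that by blast
  show "\<exists>u\<in>Hom A L W. \<forall>i\<in>J. u \<cdot> l (b i) = f i"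
    if W: "W \<in> Ob A" and f: "\<And>j. j \<in> J \<Longrightarrow> f j \<in> Hom A (X (b j)) W"
      "\<And>i j. i \<in> J \<Longrightarrow> j \<in> J \<Longrightarrow> le (b i) (b j) \<Longrightarrow> f j \<cdot> s (b i) (b j) = f i" for W f
  proof -
    have 1: "f (inv_into J b i) \<in> Hom A (X i) W" if "i \<in> I" for i
      using f(1)[OF bi(2)[OF that]] bi(1)[OF that] by simp
    have 2: "f (inv_into J b j) \<cdot> s i j = f (inv_into J b i)" if "i \<in> I" "j \<in> I" "le i j" for i j
      using f(2)[OF bi(2)[OF that(1)] bi(2)[OF that(2)]] bi(1) that by simp
    obtain u where "u \<in> Hom A L W" "\<And>i. i \<in> I \<Longrightarrow> u \<cdot> l i = f (inv_into J b i)"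
      using limit_desc[OF L W, of "\<lambda>i. f (inv_into J b i)"] 1 2 by blast
    then show ?thesis using ib bJ by (intro bexI[of _ u]) auto
  qed
  show "u = v" if "u \<in> Hom A L W" "v \<in> Hom A L W" "\<And>j. j \<in> J \<Longrightarrow> u \<cdot> l (b j) = v \<cdot> l (b j)" for W u v
    by (rule limit_ext[OF L X that(1,2)]) (use that(3) bi in metis)
qed

lemma nat_chain_system:
  assumes st: "\<And>n. st n \<in> Hom A (M n) (M (Suc n))"
  obtains t where "direct_system A (UNIV :: nat set) (\<le>) M t" "\<And>n. t n (Suc n) = st n"
    "(\<And>n. is_mono A (st n)) \<Longrightarrow> (\<And>n m. n \<le> m \<Longrightarrow> is_mono A (t n m))"
proof -
  have Ob: "M n \<in> Ob A" for n using st Hom_Ob by blast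
  define T where "T n k = rec_nat (Id A (M n)) (\<lambda>k a. st (n + k) \<cdot> a) k" for n k
  have T0: "T n 0 = Id A (M n)" and TS: "T n (Suc k) = st (n + k) \<cdot> T n k" for n k
    by (simp_all add: T_def)
  have TH: "T n k \<in> Hom A (M n) (M (n + k))" for n k
  proof (induction k)
    case (Suc k) then show ?case unfolding TS using Comp_Hom[OF Suc st[of "n + k"]] by simp
  qed (simp add: T0 Id_Hom Ob)
  have TT: "T (n + k) l \<cdot> T n k = T n (k + l)" for n k l
  proof (induction l)
    case 0 show ?case using TH[of n k] by (simp add: T0)
  next
    case (Suc l)
    have "T (n + k) (Suc l) \<cdot> T n k = st (n + k + l) \<cdot> (T (n + k) l \<cdot> T n k)"
      unfolding TS using TH[of "n + k" l] TH[of n k] st[of "n + k + l"] by simp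
    then show ?case using Suc by (simp add: TS add.assoc)
  qed
  have "direct_system A (UNIV :: nat set) (\<le>) M (\<lambda>n m. T n (m - n))"
    unfolding direct_system_def directed_set_def
  proof (intro conjI ballI impI)
    fix i j :: nat
    show "\<exists>k\<in>UNIV. i \<le> k \<and> j \<le> k" by (intro bexI[of _ "max i j"]) auto
    show "T i (j - i) \<in> Hom A (M i) (M j)" if "i \<le> j" using TH[of i "j - i"] that by simp
    fix k assume "i \<le> j \<and> j \<le> k"
    then show "T j (k - j) \<cdot> T i (j - i) = T i (k - i)" using TT[of i "j - i" "k - j"] by simp
  qed (use Ob T0 in auto)
  moreover have "T n (Suc n - n) = st n" for n
  proof -
    have "T n (Suc 0) = st n" using st[of n] by (simp add: TS T0)
    then show ?thesis by simp
  qed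
  moreover have "is_mono A (T n (m - n))" if "\<And>n. is_mono A (st n)" "n \<le> m" for n m
  proof -
    have "is_mono A (T n k)" for k
    proof (induction k)
      case (Suc k) then show ?case unfolding TS
        using that(1) TH[of n k] st[of "n + k"] by (intro is_mono_Comp) auto
    qed (simp add: T0 Ob)
    then show ?thesis .
  qed
  ultimately show thesis using that[of "\<lambda>n m. T n (m - n)"] by blast
qed

lemma finite_coproduct_Zero:
  assumes L: "is_coproduct A F X L \<iota>" and F: "finite F"
    and p: "\<And>i. i \<in> F \<Longrightarrow> p i \<in> Hom A L (X i)" "\<And>i. i \<in> F \<Longrightarrow> p i \<cdot> \<iota> i = Id A (X i)"
      "\<And>i j. i \<in> F \<Longrightarrow> j \<in> F \<Longrightarrow> i \<noteq> j \<Longrightarrow> p i \<cdot> \<iota> j = Zero A (X j) (X i)"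
    and x: "x \<in> Hom A W L" "\<And>i. i \<in> F \<Longrightarrow> p i \<cdot> x = Zero A W (X i)"
  shows "x = Zero A W L"
proof -
  have LOb: "L \<in> Ob A" and \<iota>: "\<And>i. i \<in> F \<Longrightarrow> \<iota> i \<in> Hom A (X i) L"
    using L unfolding is_coproduct_def by blast+
  have W: "W \<in> Ob A" using x Hom_Ob by blast
  have "\<exists>e\<in>Hom A L L. (\<forall>i\<in>F. e \<cdot> \<iota> i = (if i \<in> F' then \<iota> i else Zero A (X i) L)) \<and> e \<cdot> x = Zero A W L"
    if "finite F'" "F' \<subseteq> F" for F'
    using that
  proof (induction F')
    case empty
    have "Zero A L L \<cdot> \<iota> i = Zero A (X i) L" if "i \<in> F" for i using \<iota>[OF that] LOb by simp
    moreover have "Zero A L L \<cdot> x = Zero A W L" using x LOb by simp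
    ultimately show ?case using LOb by (intro bexI[of _ "Zero A L L"]) (auto simp: Zero_Hom)
  next
    case (insert a F')
    then obtain e where e: "e \<in> Hom A L L" "\<forall>i\<in>F. e \<cdot> \<iota> i = (if i \<in> F' then \<iota> i else Zero A (X i) L)"
      "e \<cdot> x = Zero A W L" by auto
    have a: "a \<in> F" "a \<notin> F'" using insert by auto
    define e' where "e' = e \<oplus> \<iota> a \<cdot> p a"
    have e': "e' \<cdot> w = e \<cdot> w \<oplus> \<iota> a \<cdot> (p a \<cdot> w)" if "w \<in> Hom A V L" for w V
      using that e(1) \<iota>[OF a(1)] p(1)[OF a(1)] by (simp add: e'_def)
    have "e' \<in> Hom A L L" using e(1) \<iota>[OF a(1)] p(1)[OF a(1)] by (simp add: e'_def)
    moreover have "e' \<cdot> x = Zero A W L"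
      unfolding e'[OF x(1)] e(3) x(2)[OF a(1)] using \<iota>[OF a(1)] W LOb by simp
    moreover have "e' \<cdot> \<iota> i = (if i \<in> insert a F' then \<iota> i else Zero A (X i) L)" if i: "i \<in> F" for i
    proof (cases "i = a")
      case True
      then show ?thesis unfolding e'[OF \<iota>[OF i]] using a e(2) p(2)[OF i] \<iota>[OF i] by simp
    next
      case False
      have Xi: "X i \<in> Ob A" using \<iota>[OF i] Hom_Ob by blast
      have "\<iota> a \<cdot> (p a \<cdot> \<iota> i) = Zero A (X i) L"
        using p(3)[OF a(1) i] False \<iota>[OF a(1)] Xi by simp
      then show ?thesis unfolding e'[OF \<iota>[OF i]] using False e(2) i \<iota>[OF i] Xi LOb by simp
    qed
    ultimately show ?case by blast
  qed
  from this[OF F subset_refl] obtain e where e: "e \<in> Hom A L L" "\<And>i. i \<in> F \<Longrightarrow> e \<cdot> \<iota> i = \<iota> i"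
    "e \<cdot> x = Zero A W L" by auto
  have "e = Id A L"
    by (rule coproduct_ext[OF L e(1)]) (use LOb Id_Hom e \<iota> in auto)
  then show ?thesis using e(3) x(1) by simp
qed

lemma finite_coproduct_mono:
  assumes L: "is_coproduct A F X L \<iota>" and L': "is_coproduct A F Y L' \<iota>'" and F: "finite F"
    and f: "\<And>i. i \<in> F \<Longrightarrow> is_mono A (f i)" "\<And>i. i \<in> F \<Longrightarrow> f i \<in> Hom A (X i) (Y i)"
    and \<phi>: "\<phi> \<in> Hom A L L'" "\<And>i. i \<in> F \<Longrightarrow> \<phi> \<cdot> \<iota> i = \<iota>' i \<cdot> f i"
  shows "is_mono A \<phi>"
proof (rule is_monoI)
  have \<iota>: "\<And>i. i \<in> F \<Longrightarrow> \<iota> i \<in> Hom A (X i) L" and \<iota>': "\<And>i. i \<in> F \<Longrightarrow> \<iota>' i \<in> Hom A (Y i) L'"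
    using L L' unfolding is_coproduct_def by blast+
  have XO: "X i \<in> Ob A" "Y i \<in> Ob A" if "i \<in> F" for i using f(2)[OF that] Hom_Ob by blast+
  have "\<exists>p\<in>Hom A L (X i). \<forall>j\<in>F. p \<cdot> \<iota> j = (if i = j then Id A (X i) else Zero A (X j) (X i))" if "i \<in> F" for i
    by (rule coproduct_desc_ex[OF L XO(1)[OF that]]) (use XO that Id_Hom Zero_Hom in auto)
  then obtain p where p: "\<And>i. i \<in> F \<Longrightarrow> p i \<in> Hom A L (X i)"
    "\<And>i j. i \<in> F \<Longrightarrow> j \<in> F \<Longrightarrow> p i \<cdot> \<iota> j = (if i = j then Id A (X i) else Zero A (X j) (X i))" by metis
  have "\<exists>p\<in>Hom A L' (Y i). \<forall>j\<in>F. p \<cdot> \<iota>' j = (if i = j then Id A (Y i) else Zero A (Y j) (Y i))" if "i \<in> F" for i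
    by (rule coproduct_desc_ex[OF L' XO(2)[OF that]]) (use XO that Id_Hom Zero_Hom in auto)
  then obtain p' where p': "\<And>i. i \<in> F \<Longrightarrow> p' i \<in> Hom A L' (Y i)"
    "\<And>i j. i \<in> F \<Longrightarrow> j \<in> F \<Longrightarrow> p' i \<cdot> \<iota>' j = (if i = j then Id A (Y i) else Zero A (Y j) (Y i))" by metis
  have pp: "p' i \<cdot> \<phi> = f i \<cdot> p i" if i: "i \<in> F" for i
  proof (rule coproduct_ext[OF L])
    show "p' i \<cdot> \<phi> \<in> Hom A L (Y i)" "f i \<cdot> p i \<in> Hom A L (Y i)"
      using p'(1)[OF i] \<phi>(1) f(2)[OF i] p(1)[OF i] Comp_Hom by blast+
    fix j assume j: "j \<in> F"
    have "(p' i \<cdot> \<phi>) \<cdot> \<iota> j = p' i \<cdot> (\<phi> \<cdot> \<iota> j)"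
      using p'(1)[OF i] \<phi>(1) \<iota>[OF j] by simp
    also have "\<dots> = (p' i \<cdot> \<iota>' j) \<cdot> f j"
      unfolding \<phi>(2)[OF j] using p'(1)[OF i] \<iota>'[OF j] f(2)[OF j] by simp
    also have "\<dots> = f i \<cdot> (p i \<cdot> \<iota> j)"
      unfolding p'(2)[OF i j] p(2)[OF i j] using f(2)[OF i] f(2)[OF j] XO[OF i] XO[OF j] by simp
    also have "\<dots> = (f i \<cdot> p i) \<cdot> \<iota> j" using f(2)[OF i] p(1)[OF i] \<iota>[OF j] by simp
    finally show "(p' i \<cdot> \<phi>) \<cdot> \<iota> j = (f i \<cdot> p i) \<cdot> \<iota> j" .
  qed
  show "\<phi> \<in> Arr A" using \<phi> by simp
  fix x assume x: "x \<in> Arr A" "Cod A x = Dom A \<phi>" "\<phi> \<cdot> x = Zero A (Dom A x) (Cod A \<phi>)"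
  have xH: "x \<in> Hom A (Dom A x) L" using x \<phi> by simp
  have "x = Zero A (Dom A x) L"
  proof (rule finite_coproduct_Zero[OF L F, of p])
    show "p i \<in> Hom A L (X i)" if "i \<in> F" for i using p(1)[OF that] .
    show "p i \<cdot> \<iota> i = Id A (X i)" if "i \<in> F" for i using p(2)[OF that that] by simp
    show "p i \<cdot> \<iota> j = Zero A (X j) (X i)" if "i \<in> F" "j \<in> F" "i \<noteq> j" for i j
      using p(2)[OF that(1,2)] that(3) by simp
    show "p i \<cdot> x = Zero A (Dom A x) (X i)" if i: "i \<in> F" for i
    proof -
      have "f i \<cdot> (p i \<cdot> x) = (p' i \<cdot> \<phi>) \<cdot> x"
        unfolding pp[OF i] using f(2)[OF i] p(1)[OF i] xH by simp
      also have "\<dots> = p' i \<cdot> (\<phi> \<cdot> x)" using p'(1)[OF i] \<phi>(1) xH by simp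
      also have "\<dots> = Zero A (Dom A x) (Y i)"
        unfolding x(3) using p'(1)[OF i] \<phi>(1) x(1) by simp
      finally show ?thesis
        using f(2)[OF i] p(1)[OF i] xH mono_Zero[OF f(1)[OF i], of "p i \<cdot> x" "Dom A x"]
        by simp
    qed
  qed (rule xH)
  then show "x = Zero A (Dom A x) (Dom A \<phi>)" using \<phi>(1) by simp
qed

end

locale locally_noetherian_category = abelian_category A for A :: "('o, 'm) abcat" (structure) +
  fixes U :: "'u itself"
  assumes universe: "universe_type U" and loc_noeth: "locally_noetherian_grothendieck_category U A"
begin

lemma small_Hom: "X \<in> Ob A \<Longrightarrow> Y \<in> Ob A \<Longrightarrow> small U (Hom A X Y)"
  using loc_noeth unfolding locally_noetherian_grothendieck_category_def grothendieck_category_def by blast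

lemma small_coproduct:
  assumes "small U T" "\<And>t. t \<in> T \<Longrightarrow> X t \<in> Ob A"
  obtains L \<iota> where "is_coproduct A T X L \<iota>"
proof -
  obtain J :: "'u set" and b where b: "bij_betw b J T" "small U J" using small_copy[OF assms(1)] .
  have "has_small_coproducts U A"
    using loc_noeth unfolding locally_noetherian_grothendieck_category_def grothendieck_category_def by blast
  moreover have "\<forall>j\<in>J. X (b j) \<in> Ob A" using b assms(2) by (auto simp: bij_betw_def)
  ultimately have "\<exists>L \<iota>. is_coproduct A J (\<lambda>j. X (b j)) L \<iota>"
    using b(2) unfolding has_small_coproducts_def by (elim allE[of _ J] allE[of _ "\<lambda>j. X (b j)"]) simp
  then obtain L \<iota> where "is_coproduct A J (\<lambda>j. X (b j)) L \<iota>" by blast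
  from reindex_coproduct[OF b(1) this] show thesis by (rule that)
qed

lemma small_limit:
  assumes I: "small U I" and X: "direct_system A I le X t"
  obtains L l where "is_direct_limit A I le X t L l"
proof -
  note XD = direct_systemD[OF X]
  define R where "R = {(i, j) \<in> I \<times> I. le i j}"
  have "small U R" using small_subset[of R "I \<times> I"] small_Times[OF universe I I] by (auto simp: R_def)
  then obtain B \<beta> where B: "is_coproduct A R (\<lambda>(i, j). X i) B \<beta>"
    using small_coproduct[of R "\<lambda>(i, j). X i"] XD(1) by (auto simp: R_def)
  obtain P \<iota> where P: "is_coproduct A I X P \<iota>" using small_coproduct[OF I XD(1)] .
  have \<iota>: "\<iota> i \<in> Hom A (X i) P" if "i \<in> I" for i using P that unfolding is_coproduct_def by blast
  have \<beta>: "\<beta> (i, j) \<in> Hom A (X i) B" if "(i, j) \<in> R" for i j using B that unfolding is_coproduct_def by fastforce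
  have PO: "P \<in> Ob A" using P unfolding is_coproduct_def by blast
  have "case r of (i, j) \<Rightarrow> \<iota> i \<oplus> Neg A (\<iota> j \<cdot> t i j) \<in> Hom A (X i) P" if "r \<in> R" for r
    using that \<iota> XD(3) by (fastforce simp: R_def)
  then obtain \<delta> where \<delta>: "\<delta> \<in> Hom A B P"
    "\<And>r. r \<in> R \<Longrightarrow> \<delta> \<cdot> \<beta> r = (case r of (i, j) \<Rightarrow> \<iota> i \<oplus> Neg A (\<iota> j \<cdot> t i j))"
    using coproduct_desc[OF B PO, of "\<lambda>(i, j). \<iota> i \<oplus> Neg A (\<iota> j \<cdot> t i j)"]
    by (auto simp: case_prod_beta)
  obtain c where c: "is_cokernel A c \<delta>" using ex_cokernel \<delta>(1) by auto
  have cH: "c \<in> Hom A P (Cod A c)" "c \<cdot> \<delta> = Zero A B (Cod A c)"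
    using cokernelD[OF c] \<delta>(1) by auto
  have \<delta>': "\<delta> \<cdot> \<beta> (i, j) = \<iota> i \<oplus> Neg A (\<iota> j \<cdot> t i j)" if "i \<in> I" "j \<in> I" "le i j" for i j
    using \<delta>(2)[of "(i, j)"] that by (simp add: R_def)
  have "is_direct_limit A I le X t (Cod A c) (\<lambda>i. c \<cdot> \<iota> i)"
  proof (rule is_direct_limitI)
    show "Cod A c \<in> Ob A" using cH Hom_Ob by blast
    show "c \<cdot> \<iota> i \<in> Hom A (X i) (Cod A c)" if "i \<in> I" for i using \<iota>[OF that] cH(1) Comp_Hom by blast
    show "(c \<cdot> \<iota> j) \<cdot> t i j = c \<cdot> \<iota> i" if ij: "i \<in> I" "j \<in> I" "le i j" for i j
    proof -
      have R: "(i, j) \<in> R" using ij by (simp add: R_def)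
      have "c \<cdot> (\<delta> \<cdot> \<beta> (i, j)) = (c \<cdot> \<delta>) \<cdot> \<beta> (i, j)"
        using cH(1) \<delta>(1) \<beta>[OF R] by simp
      also have "\<dots> = Zero A (X i) (Cod A c)" unfolding cH(2) using \<beta>[OF R] cH(1) by simp
      finally have "c \<cdot> \<iota> i \<oplus> Neg A ((c \<cdot> \<iota> j) \<cdot> t i j) = Zero A (X i) (Cod A c)"
        unfolding \<delta>'[OF ij] using cH(1) \<iota>[OF ij(1)] \<iota>[OF ij(2)] XD(3)[OF ij] by simp
      then show ?thesis
        using eq_iff_diff[of "c \<cdot> \<iota> i" "(c \<cdot> \<iota> j) \<cdot> t i j"] cH(1) \<iota>[OF ij(1)] \<iota>[OF ij(2)] XD(3)[OF ij]
        by simp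
    qed
  next
    fix W f assume W: "W \<in> Ob A" and f: "\<And>i. i \<in> I \<Longrightarrow> f i \<in> Hom A (X i) W"
      "\<And>i j. i \<in> I \<Longrightarrow> j \<in> I \<Longrightarrow> le i j \<Longrightarrow> f j \<cdot> t i j = f i"
    obtain u where u: "u \<in> Hom A P W" "\<And>i. i \<in> I \<Longrightarrow> u \<cdot> \<iota> i = f i"
      using coproduct_desc[OF P W f(1)] by blast
    have "u \<cdot> \<delta> = Zero A B W"
    proof (rule coproduct_ext[OF B])
      show "u \<cdot> \<delta> \<in> Hom A B W" using u(1) \<delta>(1) Comp_Hom by blast
      show "Zero A B W \<in> Hom A B W" using W \<delta>(1) Hom_Ob Zero_Hom by blast
      fix r assume "r \<in> R"
      then obtain i j where r: "r = (i, j)" and R: "(i, j) \<in> R" and ij: "i \<in> I" "j \<in> I" "le i j"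
        by (auto simp: R_def)
      have "(u \<cdot> \<delta>) \<cdot> \<beta> r = u \<cdot> (\<delta> \<cdot> \<beta> (i, j))" using u(1) \<delta>(1) \<beta>[OF R] r by simp
      also have "\<dots> = (u \<cdot> \<iota> i) \<oplus> Neg A ((u \<cdot> \<iota> j) \<cdot> t i j)" unfolding \<delta>'[OF ij]
        using u(1) \<iota>[OF ij(1)] \<iota>[OF ij(2)] XD(3)[OF ij] by simp
      also have "\<dots> = Zero A (X i) W"
        unfolding u(2)[OF ij(1)] u(2)[OF ij(2)] f(2)[OF ij] using f(1)[OF ij(1)] by simp
      also have "\<dots> = Zero A B W \<cdot> \<beta> r" using W \<beta>[OF R] r by simp
      finally show "(u \<cdot> \<delta>) \<cdot> \<beta> r = Zero A B W \<cdot> \<beta> r" .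
    qed
    then obtain v where v: "v \<in> Hom A (Cod A c) W" "v \<cdot> c = u"
      using cokernel_desc[OF c, of u W] u(1) \<delta>(1) by auto
    have "v \<cdot> (c \<cdot> \<iota> i) = f i" if "i \<in> I" for i
    proof -
      have "v \<cdot> (c \<cdot> \<iota> i) = (v \<cdot> c) \<cdot> \<iota> i" using v(1) cH(1) \<iota>[OF that] by simp
      then show ?thesis using v(2) u(2)[OF that] by simp
    qed
    then show "\<exists>u\<in>Hom A (Cod A c) W. \<forall>i\<in>I. u \<cdot> (c \<cdot> \<iota> i) = f i" using v(1) by blast
  next
    fix W u v assume uv: "u \<in> Hom A (Cod A c) W" "v \<in> Hom A (Cod A c) W"
      and eq: "\<And>i. i \<in> I \<Longrightarrow> u \<cdot> (c \<cdot> \<iota> i) = v \<cdot> (c \<cdot> \<iota> i)"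
    have "u \<cdot> c = v \<cdot> c"
    proof (rule coproduct_ext[OF P])
      show "u \<cdot> c \<in> Hom A P W" "v \<cdot> c \<in> Hom A P W" using uv cH(1) Comp_Hom by blast+
      show "(u \<cdot> c) \<cdot> \<iota> i = (v \<cdot> c) \<cdot> \<iota> i" if "i \<in> I" for i
        using eq[OF that] uv cH(1) \<iota>[OF that] by simp
    qed
    then show "u = v" using uv cH(1) cokernel_epi[OF c] by - (rule epiD[of c], auto)
  qed
  then show thesis by (rule that)
qed

lemma limit_short_exact:
  assumes I: "small U I" and X: "direct_system A I le X s" and Y: "direct_system A I le Y t"
    and Z: "direct_system A I le Z r"
    and f: "system_morphism A I le X s Y t f" and g: "system_morphism A I le Y t Z r g"
    and ex: "\<And>i. i \<in> I \<Longrightarrow> short_exact A (f i) (g i)"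
    and LX: "is_direct_limit A I le X s LX x" and LY: "is_direct_limit A I le Y t LY y"
    and LZ: "is_direct_limit A I le Z r LZ z"
    and \<phi>: "\<phi> \<in> Hom A LX LY" "\<And>i. i \<in> I \<Longrightarrow> \<phi> \<cdot> x i = y i \<cdot> f i"
    and \<psi>: "\<psi> \<in> Hom A LY LZ" "\<And>i. i \<in> I \<Longrightarrow> \<psi> \<cdot> y i = z i \<cdot> g i"
  shows "short_exact A \<phi> \<psi>"
proof -
  obtain J :: "'u set" and b where b: "bij_betw b J I" "small U J" using small_copy[OF I] .
  have bJ: "b j \<in> I" if "j \<in> J" for j using b(1) that by (auto simp: bij_betw_def)
  have "exact_direct_limits U A"
    using loc_noeth unfolding locally_noetherian_grothendieck_category_def grothendieck_category_def by blast
  note E = this[unfolded exact_direct_limits_def, rule_format, of J "\<lambda>i j. le (b i) (b j)"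
      "\<lambda>j. X (b j)" "\<lambda>i j. s (b i) (b j)" "\<lambda>j. Y (b j)" "\<lambda>i j. t (b i) (b j)"
      "\<lambda>j. Z (b j)" "\<lambda>i j. r (b i) (b j)" "\<lambda>j. f (b j)" "\<lambda>j. g (b j)"
      LX "\<lambda>j. x (b j)" LY "\<lambda>j. y (b j)" LZ "\<lambda>j. z (b j)" \<phi> \<psi>]
  show ?thesis
  proof (rule E, intro conjI)
    show "system_morphism A J (\<lambda>i j. le (b i) (b j)) (\<lambda>j. X (b j)) (\<lambda>i j. s (b i) (b j))
        (\<lambda>j. Y (b j)) (\<lambda>i j. t (b i) (b j)) (\<lambda>j. f (b j))"
      "system_morphism A J (\<lambda>i j. le (b i) (b j)) (\<lambda>j. Y (b j)) (\<lambda>i j. t (b i) (b j))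
        (\<lambda>j. Z (b j)) (\<lambda>i j. r (b i) (b j)) (\<lambda>j. g (b j))"
      using f g bJ unfolding system_morphism_def by blast+
    show "\<forall>i\<in>J. short_exact A (f (b i)) (g (b i))" "\<forall>i\<in>J. \<phi> \<cdot> x (b i) = y (b i) \<cdot> f (b i)"
      "\<forall>i\<in>J. \<psi> \<cdot> y (b i) = z (b i) \<cdot> g (b i)"
      using ex \<phi>(2) \<psi>(2) bJ by blast+
  qed (rule b(2) reindex_system[OF b(1) X] reindex_system[OF b(1) Y] reindex_system[OF b(1) Z]
      reindex_limit[OF b(1) X LX] reindex_limit[OF b(1) Y LY] reindex_limit[OF b(1) Z LZ] \<phi>(1) \<psi>(1))+
qed

lemma limit_mono:
  assumes I: "small U I" and X: "direct_system A I le X s" and Y: "direct_system A I le Y t"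
    and f: "system_morphism A I le X s Y t f" and m: "\<And>i. i \<in> I \<Longrightarrow> is_mono A (f i)"
    and LX: "is_direct_limit A I le X s LX x" and LY: "is_direct_limit A I le Y t LY y"
    and \<phi>: "\<phi> \<in> Hom A LX LY" "\<And>i. i \<in> I \<Longrightarrow> \<phi> \<cdot> x i = y i \<cdot> f i"
  shows "is_mono A \<phi>"
proof -
  have "\<exists>c. is_cokernel A c (f i)" if "i \<in> I" for i using ex_cokernel m[OF that] by simp
  then obtain c where c: "\<And>i. i \<in> I \<Longrightarrow> is_cokernel A (c i) (f i)" by metis
  obtain q where q: "is_cokernel A q \<phi>" using ex_cokernel \<phi>(1) by auto
  obtain r z where rz: "direct_system A I le (\<lambda>i. Cod A (c i)) r"
    "system_morphism A I le Y t (\<lambda>i. Cod A (c i)) r c"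
    "is_direct_limit A I le (\<lambda>i. Cod A (c i)) r (Cod A q) z"
    "\<And>i. i \<in> I \<Longrightarrow> q \<cdot> y i = z i \<cdot> c i"
    using limit_cokernel[OF X Y f LX LY \<phi> c q] by blast
  have "short_exact A (f i) (c i)" if "i \<in> I" for i
    unfolding short_exact_def using c[OF that] mono_kernel_coker[OF m[OF that] c[OF that]] by blast
  moreover have "q \<in> Hom A LY (Cod A q)" using cokernelD[OF q] \<phi>(1) by auto
  ultimately have "short_exact A \<phi> q"
    using limit_short_exact[OF I X Y rz(1) f rz(2) _ LX LY rz(3) \<phi> _ rz(4)] by blast
  then show ?thesis using kernel_mono unfolding short_exact_def by blast
qed

lemma limit_kernel:
  assumes I: "small U I" and X: "direct_system A I le X s" and Y: "direct_system A I le Y t"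
    and Z: "direct_system A I le Z r"
    and f: "system_morphism A I le X s Y t f" and g: "system_morphism A I le Y t Z r g"
    and ker: "\<And>i. i \<in> I \<Longrightarrow> is_kernel A (f i) (g i)"
    and LX: "is_direct_limit A I le X s LX x" and LY: "is_direct_limit A I le Y t LY y"
    and LZ: "is_direct_limit A I le Z r LZ z"
    and \<phi>: "\<phi> \<in> Hom A LX LY" "\<And>i. i \<in> I \<Longrightarrow> \<phi> \<cdot> x i = y i \<cdot> f i"
    and \<psi>: "\<psi> \<in> Hom A LY LZ" "\<And>i. i \<in> I \<Longrightarrow> \<psi> \<cdot> y i = z i \<cdot> g i"
  shows "is_kernel A \<phi> \<psi>"
proof -
  note XD = direct_systemD[OF X] and YD = direct_systemD[OF Y] and ZD = direct_systemD[OF Z]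
  have gH: "g i \<in> Hom A (Y i) (Z i)" if "i \<in> I" for i
    using g that unfolding system_morphism_def by blast
  have gc: "r i j \<cdot> g i = g j \<cdot> t i j" if "i \<in> I" "j \<in> I" "le i j" for i j
    using g that unfolding system_morphism_def by blast
  note yH = limit_Hom[OF LY] and zH = limit_Hom[OF LZ]
  have "\<exists>m c. is_mono A m \<and> is_epi A c \<and> c \<in> Hom A (Y i) (Cod A c) \<and> m \<in> Hom A (Cod A c) (Z i) \<and> m \<cdot> c = g i
     \<and> is_cokernel A c (f i)" if i: "i \<in> I" for i
  proof -
    have "g i \<in> Arr A" using gH[OF i] by simp
    from image_factorization[OF this] obtain m c where mc: "is_mono A m" "is_epi A c"
      "Dom A c = Dom A (g i)" "Cod A c = Dom A m" "Cod A m = Cod A (g i)" "m \<cdot> c = g i"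
      "\<And>k. is_kernel A k (g i) \<Longrightarrow> is_cokernel A c k" by blast
    show ?thesis using mc gH[OF i] ker[OF i] by (intro exI[of _ m] exI[of _ c]) auto
  qed
  then obtain m c where mc: "\<And>i. i \<in> I \<Longrightarrow> is_mono A (m i) \<and> is_epi A (c i) \<and> c i \<in> Hom A (Y i) (Cod A (c i)) \<and>
      m i \<in> Hom A (Cod A (c i)) (Z i) \<and> m i \<cdot> c i = g i \<and> is_cokernel A (c i) (f i)" by metis
  then have cok: "\<And>i. i \<in> I \<Longrightarrow> is_cokernel A (c i) (f i)"
    and mono: "\<And>i. i \<in> I \<Longrightarrow> is_mono A (m i)" and epi: "\<And>i. i \<in> I \<Longrightarrow> is_epi A (c i)"
    and cH: "\<And>i. i \<in> I \<Longrightarrow> c i \<in> Hom A (Y i) (Cod A (c i))"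
    and mH: "\<And>i. i \<in> I \<Longrightarrow> m i \<in> Hom A (Cod A (c i)) (Z i)"
    and mcg: "\<And>i. i \<in> I \<Longrightarrow> m i \<cdot> c i = g i" by blast+
  obtain q where q: "is_cokernel A q \<phi>" using ex_cokernel \<phi>(1) by auto
  have qH: "q \<in> Hom A LY (Cod A q)" using cokernelD[OF q] \<phi>(1) by auto
  obtain r' z' where rz: "direct_system A I le (\<lambda>i. Cod A (c i)) r'"
    "system_morphism A I le Y t (\<lambda>i. Cod A (c i)) r' c"
    "is_direct_limit A I le (\<lambda>i. Cod A (c i)) r' (Cod A q) z'"
    "\<And>i. i \<in> I \<Longrightarrow> q \<cdot> y i = z' i \<cdot> c i"
    using limit_cokernel[OF X Y f LX LY \<phi> cok q] by blast
  have rc: "r' i j \<cdot> c i = c j \<cdot> t i j" if "i \<in> I" "j \<in> I" "le i j" for i j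
    using rz(2) that unfolding system_morphism_def by blast
  have mr: "r i j \<cdot> m i = m j \<cdot> r' i j" if ij: "i \<in> I" "j \<in> I" "le i j" for i j
  proof -
    note H = ZD(3)[OF ij] YD(3)[OF ij] direct_systemD(3)[OF rz(1) ij] mH[OF ij(1)] mH[OF ij(2)]
      cH[OF ij(1)] cH[OF ij(2)]
    have "(r i j \<cdot> m i) \<cdot> c i = r i j \<cdot> (m i \<cdot> c i)" using H by simp
    also have "\<dots> = (m j \<cdot> c j) \<cdot> t i j" unfolding mcg[OF ij(1)] mcg[OF ij(2)] gc[OF ij] ..
    also have "\<dots> = m j \<cdot> (c j \<cdot> t i j)" using H by simp
    also have "\<dots> = (m j \<cdot> r' i j) \<cdot> c i" unfolding rc[OF ij, symmetric] using H by simp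
    finally show ?thesis using H epi[OF ij(1)] by - (rule epiD[of "c i"], auto)
  qed
  then have mor: "system_morphism A I le (\<lambda>i. Cod A (c i)) r' Z r m"
    unfolding system_morphism_def using mH by blast
  have LZO: "LZ \<in> Ob A" using \<psi>(1) Hom_Ob by blast
  have "(z j \<cdot> m j) \<cdot> r' i j = z i \<cdot> m i" if ij: "i \<in> I" "j \<in> I" "le i j" for i j
  proof -
    note H = ZD(3)[OF ij] direct_systemD(3)[OF rz(1) ij] mH[OF ij(1)] mH[OF ij(2)] zH[OF ij(1)] zH[OF ij(2)]
    have "(z j \<cdot> m j) \<cdot> r' i j = z j \<cdot> (m j \<cdot> r' i j)" using H by simp
    also have "\<dots> = (z j \<cdot> r i j) \<cdot> m i" unfolding mr[OF ij, symmetric] using H by simp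
    finally show ?thesis unfolding limit_comp[OF LZ ij] .
  qed
  then obtain \<mu> where \<mu>: "\<mu> \<in> Hom A (Cod A q) LZ" "\<And>i. i \<in> I \<Longrightarrow> \<mu> \<cdot> z' i = z i \<cdot> m i"
    using limit_desc[OF rz(3) LZO, of "\<lambda>i. z i \<cdot> m i"] Comp_Hom[OF mH zH] by blast
  have \<mu>m: "is_mono A \<mu>" using limit_mono[OF I rz(1) Z mor mono rz(3) LZ \<mu>] .
  have \<mu>q: "\<mu> \<cdot> q = \<psi>"
  proof (rule limit_ext[OF LY Y])
    show "\<mu> \<cdot> q \<in> Hom A LY LZ" using \<mu>(1) qH Comp_Hom by blast
    show "\<psi> \<in> Hom A LY LZ" by fact
    fix i assume i: "i \<in> I"
    note H = \<mu>(1) qH yH[OF i] zH[OF i] mH[OF i] cH[OF i] limit_Hom[OF rz(3) i]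
    have "(\<mu> \<cdot> q) \<cdot> y i = \<mu> \<cdot> (q \<cdot> y i)" using H by simp
    also have "\<dots> = (\<mu> \<cdot> z' i) \<cdot> c i" unfolding rz(4)[OF i] using H by simp
    also have "\<dots> = z i \<cdot> (m i \<cdot> c i)" unfolding \<mu>(2)[OF i] using H by simp
    finally show "(\<mu> \<cdot> q) \<cdot> y i = \<psi> \<cdot> y i" unfolding mcg[OF i] \<psi>(2)[OF i] .
  qed
  have \<phi>m: "is_mono A \<phi>" using limit_mono[OF I X Y f kernel_mono[OF ker] LX LY \<phi>] .
  have \<phi>q: "is_kernel A \<phi> q" using \<phi>m q by (rule mono_kernel_coker)
  show ?thesis
  proof (rule is_kernelI[OF \<phi>m])
    show "\<psi> \<in> Hom A (Cod A \<phi>) LZ" using \<psi>(1) \<phi>(1) by simp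
    have "\<psi> \<cdot> \<phi> = \<mu> \<cdot> (q \<cdot> \<phi>)" unfolding \<mu>q[symmetric] using \<mu>(1) qH \<phi>(1) by simp
    then show "\<psi> \<cdot> \<phi> = Zero A (Dom A \<phi>) LZ"
      unfolding kernelD(4)[OF \<phi>q] using \<mu>(1) \<phi>(1) Hom_Ob[OF \<phi>(1)] by simp
    fix W h assume h: "h \<in> Hom A W (Cod A \<phi>)" "\<psi> \<cdot> h = Zero A W LZ"
    have hH: "h \<in> Hom A W LY" using h(1) \<phi>(1) by simp
    have "\<mu> \<cdot> (q \<cdot> h) = Zero A W LZ" using h(2) unfolding \<mu>q[symmetric] using \<mu>(1) qH hH by simp
    then have "q \<cdot> h = Zero A W (Cod A q)"
      using mono_Zero[OF \<mu>m, of "q \<cdot> h" W] \<mu>(1) qH hH by simp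
    then obtain u where "u \<in> Hom A W (Dom A \<phi>)" "\<phi> \<cdot> u = h"
      using kernel_lift[OF \<phi>q, of h W] hH qH by auto
    then show "\<exists>u\<in>Hom A W (Dom A \<phi>). \<phi> \<cdot> u = h" by blast
  qed
qed

lemma coproduct_mono:
  assumes T: "small U T" and L: "is_coproduct A T X L \<iota>" and L': "is_coproduct A T Y L' \<iota>'"
    and f: "\<And>i. i \<in> T \<Longrightarrow> is_mono A (f i)" "\<And>i. i \<in> T \<Longrightarrow> f i \<in> Hom A (X i) (Y i)"
    and \<phi>: "\<phi> \<in> Hom A L L'" "\<And>i. i \<in> T \<Longrightarrow> \<phi> \<cdot> \<iota> i = \<iota>' i \<cdot> f i"
  shows "is_mono A \<phi>"
proof -
  define I where "I = {F. F \<subseteq> T \<and> finite F}"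
  have I: "small U I" using small_subset[of I "Pow T"] small_Pow[OF universe T] by (auto simp: I_def)
  have sT: "small U F" if "F \<in> I" for F using small_subset[OF _ T] that by (auto simp: I_def)
  have sub: "\<exists>LX x s l. (\<forall>F\<in>I. is_coproduct A F X (LX F) (x F)) \<and> direct_system A I (\<subseteq>) LX s \<and>
      is_direct_limit A I (\<subseteq>) LX s L l \<and> (\<forall>F\<in>I. \<forall>i\<in>F. l F \<cdot> x F i = \<iota> i) \<and>
      (\<forall>F\<in>I. \<forall>G\<in>I. F \<subseteq> G \<longrightarrow> (\<forall>i\<in>F. s F G \<cdot> x F i = x G i))"
    if L: "is_coproduct A T X L \<iota>" and XO: "\<forall>i\<in>T. X i \<in> Ob A" for X L and \<iota> :: "_ \<Rightarrow> 'm"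
  proof -
    note X = bspec[OF XO]
    have \<iota>H: "\<And>i. i \<in> T \<Longrightarrow> \<iota> i \<in> Hom A (X i) L" and LO: "L \<in> Ob A"
      using L unfolding is_coproduct_def by blast+
    have "\<exists>L \<iota>. is_coproduct A F X L \<iota>" if F: "F \<in> I" for F
    proof -
      have "X i \<in> Ob A" if "i \<in> F" for i using X that F by (auto simp: I_def)
      from small_coproduct[of F X, OF sT[OF F] this] show ?thesis by blast
    qed
    then obtain LX x where LX: "\<And>F. F \<in> I \<Longrightarrow> is_coproduct A F X (LX F) (x F)" by metis
    have xH: "x F i \<in> Hom A (X i) (LX F)" if "F \<in> I" "i \<in> F" for F i
      using LX[OF that(1)] that(2) unfolding is_coproduct_def by blast
    have LXO: "LX F \<in> Ob A" if "F \<in> I" for F using LX[OF that] unfolding is_coproduct_def by blast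
    have "\<exists>u\<in>Hom A (LX F) (LX G). \<forall>i\<in>F. u \<cdot> x F i = x G i" if FG: "F \<in> I" "G \<in> I" "F \<subseteq> G" for F G
      by (rule coproduct_desc_ex[OF LX[OF FG(1)] LXO[OF FG(2)]]) (use xH FG in blast)
    then obtain s where s: "\<And>F G. F \<in> I \<Longrightarrow> G \<in> I \<Longrightarrow> F \<subseteq> G \<Longrightarrow>
        s F G \<in> Hom A (LX F) (LX G) \<and> (\<forall>i\<in>F. s F G \<cdot> x F i = x G i)" by metis
    have "\<exists>u\<in>Hom A (LX F) L. \<forall>i\<in>F. u \<cdot> x F i = \<iota> i" if F: "F \<in> I" for F
      by (rule coproduct_desc_ex[OF LX[OF F] LO]) (use \<iota>H F in \<open>auto simp: I_def\<close>)
    then obtain l where l: "\<And>F. F \<in> I \<Longrightarrow> l F \<in> Hom A (LX F) L \<and> (\<forall>i\<in>F. l F \<cdot> x F i = \<iota> i)" by metis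
    have sys: "direct_system A I (\<subseteq>) LX s"
      unfolding direct_system_def directed_set_def
    proof (intro conjI ballI impI)
      show "I \<noteq> {}" unfolding I_def by blast
      fix F assume F: "F \<in> I"
      show "LX F \<in> Ob A" by (rule LXO[OF F])
      show "s F F = Id A (LX F)"
        by (rule coproduct_ext[OF LX[OF F]])
          (use s[OF F F] LXO[OF F] xH[OF F] in \<open>auto simp: Id_Hom\<close>)
      fix G assume G: "G \<in> I"
      show "\<exists>k\<in>I. F \<subseteq> k \<and> G \<subseteq> k" using F G by (intro bexI[of _ "F \<union> G"]) (auto simp: I_def)
      show "s F G \<in> Hom A (LX F) (LX G)" if "F \<subseteq> G" using s[OF F G that] by blast
      fix H assume H: "H \<in> I" and le: "F \<subseteq> G \<and> G \<subseteq> H"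
      note sFG = s[OF F G conjunct1[OF le]] and sGH = s[OF G H conjunct2[OF le]]
        and sFH = s[OF F H subset_trans[OF conjunct1[OF le] conjunct2[OF le]]]
      show "s G H \<cdot> s F G = s F H"
      proof (rule coproduct_ext[OF LX[OF F]])
        show "s G H \<cdot> s F G \<in> Hom A (LX F) (LX H)" using sFG sGH Comp_Hom by blast
        show "s F H \<in> Hom A (LX F) (LX H)" using sFH by blast
        fix i assume i: "i \<in> F"
        have "(s G H \<cdot> s F G) \<cdot> x F i = s G H \<cdot> (s F G \<cdot> x F i)"
          using sFG sGH xH[OF F i] by simp
        also have "\<dots> = x H i" using sFG sGH i le by auto
        finally show "(s G H \<cdot> s F G) \<cdot> x F i = s F H \<cdot> x F i" using sFH i by simp
      qed
    qed (use subset_trans in auto)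
    have sing: "{i} \<in> I" if "i \<in> T" for i using that by (simp add: I_def)
    have "is_direct_limit A I (\<subseteq>) LX s L l"
    proof (rule is_direct_limitI)
      show "l F \<in> Hom A (LX F) L" if "F \<in> I" for F using l[OF that] by blast
      show "l G \<cdot> s F G = l F" if F: "F \<in> I" and G: "G \<in> I" and le: "F \<subseteq> G" for F G
      proof (rule coproduct_ext[OF LX[OF F]])
        show "l G \<cdot> s F G \<in> Hom A (LX F) L" using s[OF F G le] l[OF G] Comp_Hom by blast
        show "l F \<in> Hom A (LX F) L" using l[OF F] by blast
        fix i assume i: "i \<in> F"
        have "(l G \<cdot> s F G) \<cdot> x F i = l G \<cdot> (s F G \<cdot> x F i)"
          using s[OF F G le] l[OF G] xH[OF F i] by simp
        also have "\<dots> = \<iota> i" using s[OF F G le] l[OF G] i le by auto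
        finally show "(l G \<cdot> s F G) \<cdot> x F i = l F \<cdot> x F i" using l[OF F] i by simp
      qed
    next
      fix W g assume W: "W \<in> Ob A" and g: "\<And>F. F \<in> I \<Longrightarrow> g F \<in> Hom A (LX F) W"
        "\<And>F G. F \<in> I \<Longrightarrow> G \<in> I \<Longrightarrow> F \<subseteq> G \<Longrightarrow> g G \<cdot> s F G = g F"
      have "g {i} \<cdot> x {i} i \<in> Hom A (X i) W" if "i \<in> T" for i
        using g(1)[OF sing[OF that]] xH[OF sing[OF that]] Comp_Hom by blast
      then obtain u where u: "u \<in> Hom A L W" "\<And>i. i \<in> T \<Longrightarrow> u \<cdot> \<iota> i = g {i} \<cdot> x {i} i"
        using coproduct_desc[OF L W, of "\<lambda>i. g {i} \<cdot> x {i} i"] by blast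
      have "u \<cdot> l F = g F" if F: "F \<in> I" for F
      proof (rule coproduct_ext[OF LX[OF F]])
        show "u \<cdot> l F \<in> Hom A (LX F) W" using u(1) l[OF F] Comp_Hom by blast
        show "g F \<in> Hom A (LX F) W" by (rule g(1)[OF F])
        fix i assume i: "i \<in> F"
        have iT: "i \<in> T" and iF: "{i} \<subseteq> F" using i F by (auto simp: I_def)
        note si = s[OF sing[OF iT] F iF]
        have xi: "x {i} i \<in> Hom A (X i) (LX {i})" using xH[OF sing[OF iT]] by simp
        have "(u \<cdot> l F) \<cdot> x F i = u \<cdot> (l F \<cdot> x F i)"
          using u(1) l[OF F] xH[OF F i] by simp
        also have "\<dots> = g {i} \<cdot> x {i} i" using l[OF F] i u(2)[OF iT] by simp
        also have "\<dots> = (g F \<cdot> s {i} F) \<cdot> x {i} i" unfolding g(2)[OF sing[OF iT] F iF] ..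
        also have "\<dots> = g F \<cdot> (s {i} F \<cdot> x {i} i)" using g(1)[OF F] si xi by simp
        also have "\<dots> = g F \<cdot> x F i" using si by simp
        finally show "(u \<cdot> l F) \<cdot> x F i = g F \<cdot> x F i" .
      qed
      then show "\<exists>u\<in>Hom A L W. \<forall>F\<in>I. u \<cdot> l F = g F" using u(1) by blast
    next
      fix W u v assume uv: "u \<in> Hom A L W" "v \<in> Hom A L W" and eq: "\<And>F. F \<in> I \<Longrightarrow> u \<cdot> l F = v \<cdot> l F"
      show "u = v"
      proof (rule coproduct_ext[OF L uv])
        fix i assume i: "i \<in> T"
        have li: "l {i} \<in> Hom A (LX {i}) L" "l {i} \<cdot> x {i} i = \<iota> i" using l[OF sing[OF i]] by auto
        have xi: "x {i} i \<in> Hom A (X i) (LX {i})" using xH[OF sing[OF i]] by simp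
        have "w \<cdot> \<iota> i = (w \<cdot> l {i}) \<cdot> x {i} i" if "w \<in> Hom A L W" for w
          unfolding li(2)[symmetric] using that li(1) xi by simp
        then show "u \<cdot> \<iota> i = v \<cdot> \<iota> i" using uv eq[OF sing[OF i]] by simp
      qed
    qed (rule LO)
    then show ?thesis using LX sys l s by blast
  qed
  have XO: "X i \<in> Ob A" "Y i \<in> Ob A" if "i \<in> T" for i using f(2)[OF that] Hom_Ob by blast+
  have XB: "\<forall>i\<in>T. X i \<in> Ob A" and YB: "\<forall>i\<in>T. Y i \<in> Ob A" using XO by blast+
  from sub[OF L XB] obtain LX x s l where LX':
      "\<forall>F\<in>I. is_coproduct A F X (LX F) (x F)" "direct_system A I (\<subseteq>) LX s"
      "is_direct_limit A I (\<subseteq>) LX s L l" "\<forall>F\<in>I. \<forall>i\<in>F. l F \<cdot> x F i = \<iota> i"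
      "\<forall>F\<in>I. \<forall>G\<in>I. F \<subseteq> G \<longrightarrow> (\<forall>i\<in>F. s F G \<cdot> x F i = x G i)"
    by (elim exE conjE)
  have LX: "\<And>F. F \<in> I \<Longrightarrow> is_coproduct A F X (LX F) (x F)" "direct_system A I (\<subseteq>) LX s"
      "is_direct_limit A I (\<subseteq>) LX s L l" "\<And>F i. F \<in> I \<Longrightarrow> i \<in> F \<Longrightarrow> l F \<cdot> x F i = \<iota> i"
      "\<And>F G i. F \<in> I \<Longrightarrow> G \<in> I \<Longrightarrow> F \<subseteq> G \<Longrightarrow> i \<in> F \<Longrightarrow> s F G \<cdot> x F i = x G i"
    using LX' by simp_all
  from sub[OF L' YB] obtain LY y t k where LY':
      "\<forall>F\<in>I. is_coproduct A F Y (LY F) (y F)" "direct_system A I (\<subseteq>) LY t"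
      "is_direct_limit A I (\<subseteq>) LY t L' k" "\<forall>F\<in>I. \<forall>i\<in>F. k F \<cdot> y F i = \<iota>' i"
      "\<forall>F\<in>I. \<forall>G\<in>I. F \<subseteq> G \<longrightarrow> (\<forall>i\<in>F. t F G \<cdot> y F i = y G i)"
    by (elim exE conjE)
  have LY: "\<And>F. F \<in> I \<Longrightarrow> is_coproduct A F Y (LY F) (y F)" "direct_system A I (\<subseteq>) LY t"
      "is_direct_limit A I (\<subseteq>) LY t L' k" "\<And>F i. F \<in> I \<Longrightarrow> i \<in> F \<Longrightarrow> k F \<cdot> y F i = \<iota>' i"
      "\<And>F G i. F \<in> I \<Longrightarrow> G \<in> I \<Longrightarrow> F \<subseteq> G \<Longrightarrow> i \<in> F \<Longrightarrow> t F G \<cdot> y F i = y G i"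
    using LY' by simp_all
  note sD = direct_systemD[OF LX(2)] and tD = direct_systemD[OF LY(2)]
  have xH: "x F i \<in> Hom A (X i) (LX F)" and yH: "y F i \<in> Hom A (Y i) (LY F)" and fH: "f i \<in> Hom A (X i) (Y i)"
    if "F \<in> I" "i \<in> F" for F i
    using LX(1)[OF that(1)] LY(1)[OF that(1)] that f(2) unfolding is_coproduct_def I_def by blast+
  have "\<exists>u\<in>Hom A (LX F) (LY F). \<forall>i\<in>F. u \<cdot> x F i = y F i \<cdot> f i" if F: "F \<in> I" for F
    by (rule coproduct_desc_ex[OF LX(1)[OF F] tD(1)[OF F]]) (use Comp_Hom[OF fH yH] F in blast)
  then obtain h where h: "\<And>F. F \<in> I \<Longrightarrow> h F \<in> Hom A (LX F) (LY F) \<and> (\<forall>i\<in>F. h F \<cdot> x F i = y F i \<cdot> f i)"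
    by metis
  have mono: "is_mono A (h F)" if F: "F \<in> I" for F
    using finite_coproduct_mono[OF LX(1)[OF F] LY(1)[OF F], of f "h F"] f h[OF F] F unfolding I_def by blast
  have "t F G \<cdot> h F = h G \<cdot> s F G" if F: "F \<in> I" and G: "G \<in> I" and le: "F \<subseteq> G" for F G
  proof (rule coproduct_ext[OF LX(1)[OF F]])
    show "t F G \<cdot> h F \<in> Hom A (LX F) (LY G)" "h G \<cdot> s F G \<in> Hom A (LX F) (LY G)"
      using h[OF F] h[OF G] sD(3)[OF F G le] tD(3)[OF F G le] Comp_Hom by blast+
    fix i assume i: "i \<in> F"
    then have iG: "i \<in> G" using le by blast
    note H = conjunct1[OF h[OF F]] conjunct1[OF h[OF G]] sD(3)[OF F G le] tD(3)[OF F G le]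
       xH[OF F i] yH[OF F i] fH[OF F i]
    have "(t F G \<cdot> h F) \<cdot> x F i = t F G \<cdot> (h F \<cdot> x F i)" using H by simp
    also have "\<dots> = (t F G \<cdot> y F i) \<cdot> f i"
      unfolding bspec[OF conjunct2[OF h[OF F]] i] using H by simp
    also have "\<dots> = h G \<cdot> x G i"
      unfolding LY(5)[OF F G le i] bspec[OF conjunct2[OF h[OF G]] iG] ..
    also have "\<dots> = (h G \<cdot> s F G) \<cdot> x F i"
      unfolding LX(5)[OF F G le i, symmetric] using H by simp
    finally show "(t F G \<cdot> h F) \<cdot> x F i = (h G \<cdot> s F G) \<cdot> x F i" .
  qed
  then have mor: "system_morphism A I (\<subseteq>) LX s LY t h" unfolding system_morphism_def using h by blast
  have "\<phi> \<cdot> l F = k F \<cdot> h F" if F: "F \<in> I" for F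
  proof (rule coproduct_ext[OF LX(1)[OF F]])
    show "\<phi> \<cdot> l F \<in> Hom A (LX F) L'" "k F \<cdot> h F \<in> Hom A (LX F) L'"
      using \<phi>(1) h[OF F] limit_Hom[OF LX(3) F] limit_Hom[OF LY(3) F] Comp_Hom by blast+
    fix i assume i: "i \<in> F"
    then have iT: "i \<in> T" using F by (auto simp: I_def)
    note H = \<phi>(1) conjunct1[OF h[OF F]] limit_Hom[OF LX(3) F] limit_Hom[OF LY(3) F]
       xH[OF F i] yH[OF F i] fH[OF F i]
    have "(\<phi> \<cdot> l F) \<cdot> x F i = \<phi> \<cdot> (l F \<cdot> x F i)" using H by simp
    also have "\<dots> = \<iota>' i \<cdot> f i" unfolding LX(4)[OF F i] \<phi>(2)[OF iT] ..
    also have "\<dots> = k F \<cdot> (y F i \<cdot> f i)" unfolding LY(4)[OF F i, symmetric] using H by simp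
    also have "\<dots> = (k F \<cdot> h F) \<cdot> x F i"
      unfolding bspec[OF conjunct2[OF h[OF F]] i, symmetric] using H by simp
    finally show "(\<phi> \<cdot> l F) \<cdot> x F i = (k F \<cdot> h F) \<cdot> x F i" .
  qed
  then show ?thesis using limit_mono[OF I LX(2) LY(2) mor mono LX(3) LY(3) \<phi>(1)] by blast
qed

section \<open>Enough injectives\<close>

lemma nat_limit_leg_mono:
  assumes M: "direct_system A (UNIV :: nat set) (\<le>) M t" and m: "\<And>i j. i \<le> j \<Longrightarrow> is_mono A (t i j)"
    and L: "is_direct_limit A UNIV (\<le>) M t L l"
  shows "is_mono A (l n)"
proof -
  note MD = direct_systemD[OF M, simplified UNIV_I True_implies_equals]
  define X where "X k = M (min n k)" for k
  define s where "s i j = t (min n i) (min n j)" for i j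
  have le: "min n i \<le> min n j" if "i \<le> j" for i j using that by simp
  have X: "direct_system A UNIV (\<le>) X s"
    unfolding direct_system_def X_def s_def using M MD(1,2) MD(3)[OF le] MD(4)[OF le le]
    by (simp add: direct_system_def)
  have LX: "is_direct_limit A UNIV (\<le>) X s (M n) (\<lambda>k. t (min n k) n)"
  proof (rule is_direct_limitI)
    show "M n \<in> Ob A" by (rule MD(1))
    show "t (min n i) n \<in> Hom A (X i) (M n)" for i unfolding X_def by (rule MD(3)) simp
    show "t (min n j) n \<cdot> s i j = t (min n i) n" if "i \<le> j" for i j
      unfolding s_def by (rule MD(4)) (use that in auto)
  next
    fix W f assume f: "\<And>i. i \<in> UNIV \<Longrightarrow> f i \<in> Hom A (X i) W"
      "\<And>i j. i \<in> UNIV \<Longrightarrow> j \<in> UNIV \<Longrightarrow> i \<le> j \<Longrightarrow> f j \<cdot> s i j = f i"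
    have fn: "f n \<in> Hom A (M n) W" using f(1)[of n] by (simp add: X_def)
    have "f n \<cdot> t (min n i) n = f i" for i
    proof (cases "i \<le> n")
      case True then show ?thesis using f(2)[of i n] by (simp add: s_def)
    next
      case False
      then have *: "min n i = n" by simp
      have "f i \<in> Hom A (M n) W" using f(1)[of i] * by (simp add: X_def)
      then have "f i = f n" using f(2)[of n i] False * MD(2) by (simp add: s_def)
      then show ?thesis using * MD(2) fn by simp
    qed
    then show "\<exists>u\<in>Hom A (M n) W. \<forall>i\<in>UNIV. u \<cdot> t (min n i) n = f i" using fn by blast
  next
    fix W u v assume uv: "u \<in> Hom A (M n) W" "v \<in> Hom A (M n) W"
      "\<And>i. i \<in> UNIV \<Longrightarrow> u \<cdot> t (min n i) n = v \<cdot> t (min n i) n"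
    show "u = v" using uv(3)[of n] uv(1,2) MD(2) by simp
  qed
  have mor: "system_morphism A UNIV (\<le>) X s M t (\<lambda>k. t (min n k) k)"
    unfolding system_morphism_def X_def s_def using MD(3) MD(4) le by simp
  show ?thesis
  proof (rule limit_mono[OF small_nat[OF universe] X M mor _ LX L])
    show "is_mono A (t (min n i) i)" for i by (rule m) simp
    show "l n \<in> Hom A (M n) L" using limit_Hom[OF L] by simp
    show "l n \<cdot> t (min n i) n = l i \<cdot> t (min n i) i" for i
      using limit_comp[OF L, of "min n i" n] limit_comp[OF L, of "min n i" i] by simp
  qed
qed

text \<open>Noetherian objects are finitely presented relative to unions of chains: the preimages of the
  terms of the chain exhaust the object by exactness of direct limits, and they become stationary.\<close>

lemma noetherian_factor:
  assumes N: "noetherian_object A N" and M: "direct_system A (UNIV :: nat set) (\<le>) M t"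
    and m: "\<And>i j. i \<le> j \<Longrightarrow> is_mono A (t i j)" and L: "is_direct_limit A UNIV (\<le>) M t L l"
    and f: "f \<in> Hom A N L"
  obtains n f' where "f' \<in> Hom A N (M n)" "l n \<cdot> f' = f"
proof -
  note MD = direct_systemD[OF M, simplified UNIV_I True_implies_equals]
  have lH: "l n \<in> Hom A (M n) L" for n using limit_Hom[OF L] by simp
  have lt: "l j \<cdot> t i j = l i" if "i \<le> j" for i j using limit_comp[OF L] that by simp
  have lm: "is_mono A (l n)" for n using nat_limit_leg_mono[OF M m L] .
  have NO: "N \<in> Ob A" and LO: "L \<in> Ob A" using f Hom_Ob by blast+
  have "\<exists>q. is_cokernel A q (l n)" for n using ex_cokernel lm by simp
  then obtain q where q: "\<And>n. is_cokernel A (q n) (l n)" by metis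
  have qH: "q n \<in> Hom A L (Cod A (q n))" "q n \<cdot> l n = Zero A (M n) (Cod A (q n))" for n
    using cokernelD[OF q[of n]] lH[of n] by auto
  have lker: "is_kernel A (l n) (q n)" for n using lm q by (rule mono_kernel_coker)
  define g where "g n = q n \<cdot> f" for n
  have gH: "g n \<in> Hom A N (Cod A (q n))" for n unfolding g_def using f qH(1) Comp_Hom by blast
  have "\<exists>p. is_kernel A p (g n)" for n using ex_kernel gH[of n] by simp
  then obtain p where p: "\<And>n. is_kernel A (p n) (g n)" by metis
  have pH: "p n \<in> Hom A (Dom A (p n)) N" for n
    using kernelD[OF p[of n]] gH[of n] by simp
  have gp: "g n \<cdot> p n = Zero A (Dom A (p n)) (Cod A (q n))" for n
    using kernelD[OF p[of n]] gH[of n] by simp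
  have pm: "is_mono A (p n)" for n using p by (rule kernel_mono)
  have fac: "\<exists>a\<in>Hom A W (M n). l n \<cdot> a = f \<cdot> h" if "h \<in> Hom A W N" "g n \<cdot> h = Zero A W (Cod A (q n))" for n h W
  proof -
    have "q n \<cdot> (f \<cdot> h) = Zero A W (Cod A (q n))"
      using that qH(1)[of n] f by (simp add: g_def)
    moreover have "f \<cdot> h \<in> Hom A W (Dom A (q n))" using that f qH(1)[of n] by simp
    ultimately obtain a where "a \<in> Hom A W (Dom A (l n))" "l n \<cdot> a = f \<cdot> h"
      using kernel_lift[OF lker] by blast
    then show ?thesis using lH[of n] by auto
  qed
  have "\<exists>u\<in>Hom A (Dom A (p i)) (Dom A (p j)). p j \<cdot> u = p i" if ij: "i \<le> j" for i j
  proof -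
    obtain a where a: "a \<in> Hom A (Dom A (p i)) (M i)" "l i \<cdot> a = f \<cdot> p i"
      using fac[OF pH gp] by blast
    have "g j \<cdot> p i = q j \<cdot> (l i \<cdot> a)" unfolding a(2) using qH(1)[of j] f pH[of i] by (simp add: g_def)
    also have "\<dots> = (q j \<cdot> l j) \<cdot> (t i j \<cdot> a)"
      unfolding lt[OF ij, symmetric] using qH(1)[of j] lH[of j] MD(3)[OF ij] a(1) by simp
    also have "\<dots> = Zero A (Dom A (p i)) (Cod A (q j))"
      unfolding qH(2) using qH(1)[of j] MD(3)[OF ij] a(1) by simp
    finally show ?thesis
      using kernel_lift[OF p[of j], of "p i" "Dom A (p i)"] pH[of i] gH[of j] by auto
  qed
  then obtain v where v: "\<And>i j. i \<le> j \<Longrightarrow> v i j \<in> Hom A (Dom A (p i)) (Dom A (p j)) \<and> p j \<cdot> v i j = p i"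
    by metis
  have pe: "a = b" if "a \<in> Hom A W (Dom A (p n))" "b \<in> Hom A W (Dom A (p n))" "p n \<cdot> a = p n \<cdot> b" for a b W n
    using that by - (rule monoD[OF pm[of n]], auto)
  have P: "direct_system A (UNIV :: nat set) (\<le>) (\<lambda>n. Dom A (p n)) v"
    unfolding direct_system_def
  proof (intro conjI ballI impI)
    show "directed_set (UNIV :: nat set) (\<le>)" using M unfolding direct_system_def by blast
    fix i j k :: nat
    show O: "Dom A (p i) \<in> Ob A" using pH Hom_Ob by blast
    show "v i i = Id A (Dom A (p i))"
      by (rule pe[of _ "Dom A (p i)"]) (use v[of i i] pH[of i] O in auto)
    show "v i j \<in> Hom A (Dom A (p i)) (Dom A (p j))" if "i \<le> j" using v[OF that] by blast
    assume "i \<le> j \<and> j \<le> k"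
    then have le: "i \<le> j" "j \<le> k" "i \<le> k" by auto
    note vs = v[OF le(1)] v[OF le(2)] v[OF le(3)]
    have "p k \<cdot> (v j k \<cdot> v i j) = (p k \<cdot> v j k) \<cdot> v i j"
      using vs[THEN conjunct1] pH[of k] by simp
    then have "p k \<cdot> (v j k \<cdot> v i j) = p k \<cdot> v i k" using vs by simp
    then show "v j k \<cdot> v i j = v i k"
      using pe[of "v j k \<cdot> v i j" "Dom A (p i)" k "v i k"] vs Comp_Hom by blast
  qed
  have "\<forall>n. is_mono A (p n) \<and> Cod A (p n) = N" using pm pH by simp
  moreover have "\<forall>n. \<exists>u\<in>Hom A (Dom A (p n)) (Dom A (p (Suc n))). p n = p (Suc n) \<cdot> u"
    using v[of _ "Suc _"] by (metis le_SucI order_refl)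
  ultimately obtain n0 where n0: "\<And>n. n \<ge> n0 \<Longrightarrow> \<exists>u\<in>Hom A (Dom A (p (Suc n))) (Dom A (p n)). p (Suc n) = p n \<cdot> u"
    using N unfolding noetherian_object_def by blast
  have "\<exists>w\<in>Hom A (Dom A (p n)) (Dom A (p n0)). p n0 \<cdot> w = p n" for n
  proof (cases "n \<le> n0")
    case False
    then have "n0 \<le> n" by simp
    then show ?thesis
    proof (induction n rule: dec_induct)
      case base then show ?case using v[of n0 n0] by blast
    next
      case (step n)
      then obtain w u where w: "w \<in> Hom A (Dom A (p n)) (Dom A (p n0))" "p n0 \<cdot> w = p n"
        and u: "u \<in> Hom A (Dom A (p (Suc n))) (Dom A (p n))" "p (Suc n) = p n \<cdot> u" using n0 by blast
      have "p n0 \<cdot> (w \<cdot> u) = (p n0 \<cdot> w) \<cdot> u" using w(1) u(1) pH[of n0] by simp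
      then have "p n0 \<cdot> (w \<cdot> u) = p (Suc n)" using w(2) u(2) by simp
      then show ?case using w(1) u(1) Comp_Hom by blast
    qed
  qed (use v in blast)
  then obtain w where w: "\<And>n. w n \<in> Hom A (Dom A (p n)) (Dom A (p n0)) \<and> p n0 \<cdot> w n = p n" by metis
  have PO: "Dom A (p n0) \<in> Ob A" using pH Hom_Ob by blast
  have wid: "w n0 = Id A (Dom A (p n0))"
    by (rule pe[of _ "Dom A (p n0)" n0]) (use w[of n0] pH[of n0] PO in auto)
  have wv: "w j \<cdot> v i j = w i" if "i \<le> j" for i j
  proof -
    have "p n0 \<cdot> (w j \<cdot> v i j) = (p n0 \<cdot> w j) \<cdot> v i j"
      using conjunct1[OF w[of j]] conjunct1[OF v[OF that]] pH[of n0] by simp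
    also have "\<dots> = p n0 \<cdot> w i" using w[of j] w[of i] v[OF that] by simp
    finally show ?thesis
      using pe[of "w j \<cdot> v i j" "Dom A (p i)" n0 "w i"] w[of i] w[of j] v[OF that] Comp_Hom by blast
  qed
  have LP: "is_direct_limit A (UNIV :: nat set) (\<le>) (\<lambda>n. Dom A (p n)) v (Dom A (p n0)) w"
  proof (rule is_direct_limitI)
    fix W h assume h: "\<And>i. i \<in> UNIV \<Longrightarrow> h i \<in> Hom A (Dom A (p i)) W"
      "\<And>i j. i \<in> UNIV \<Longrightarrow> j \<in> UNIV \<Longrightarrow> i \<le> j \<Longrightarrow> h j \<cdot> v i j = h i"
    have "h n0 \<cdot> w i = h i" for i
    proof -
      let ?k = "max i n0"
      have hk: "h ?k \<in> Hom A (Dom A (p ?k)) W" using h(1) by blast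
      have eq: "v n0 ?k \<cdot> w i = v i ?k"
      proof (rule pe)
        show "v n0 ?k \<cdot> w i \<in> Hom A (Dom A (p i)) (Dom A (p ?k))" "v i ?k \<in> Hom A (Dom A (p i)) (Dom A (p ?k))"
          using v[of n0 ?k] v[of i ?k] w[of i] Comp_Hom by auto
        have "p ?k \<cdot> (v n0 ?k \<cdot> w i) = (p ?k \<cdot> v n0 ?k) \<cdot> w i"
          using conjunct1[OF v[of n0 ?k]] conjunct1[OF w[of i]] pH[of ?k] by simp
        then show "p ?k \<cdot> (v n0 ?k \<cdot> w i) = p ?k \<cdot> v i ?k" using v[of n0 ?k] v[of i ?k] w[of i] by simp
      qed
      have "h n0 \<cdot> w i = (h ?k \<cdot> v n0 ?k) \<cdot> w i" using h(2)[of n0 ?k] by simp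
      also have "\<dots> = h ?k \<cdot> (v n0 ?k \<cdot> w i)"
        using hk conjunct1[OF v[of n0 ?k]] conjunct1[OF w[of i]] by simp
      finally show ?thesis unfolding eq using h(2)[of i ?k] by simp
    qed
    then show "\<exists>u\<in>Hom A (Dom A (p n0)) W. \<forall>i\<in>UNIV. u \<cdot> w i = h i" using h(1) by blast
  next
    fix W a b assume "a \<in> Hom A (Dom A (p n0)) W" "b \<in> Hom A (Dom A (p n0)) W"
      "\<And>i. i \<in> UNIV \<Longrightarrow> a \<cdot> w i = b \<cdot> w i"
    then show "a = b" using wid Comp_Id by (metis UNIV_I)
  qed (use PO w wv in auto)
  have dir: "directed_set (UNIV :: nat set) (\<le>)" using M unfolding direct_system_def by blast
  note cN = constant_system[OF dir NO] and cL = constant_system[OF dir LO]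
  obtain Z where Z: "is_zero_object A Z" using ex_zero_object by blast
  have q0: "is_cokernel A (Zero A L Z) (Id A L)"
  proof (rule is_cokernelI)
    show "is_epi A (Zero A L Z)"
    proof (rule is_epiI)
      show "Zero A L Z \<in> Arr A" using LO Z by simp
      fix h assume h: "h \<in> Arr A" "Dom A h = Cod A (Zero A L Z)"
      show "h = Zero A (Cod A (Zero A L Z)) (Cod A h)"
        by (rule from_zero_object) (use h Z LO in auto)
    qed
    fix W h assume h: "h \<in> Hom A (Dom A (Zero A L Z)) W" "h \<cdot> Id A L = Zero A L W"
    have "W \<in> Ob A" using h(1) by (rule Hom_Ob(2))
    moreover have "h = Zero A L W" using h LO Z by simp
    ultimately show "\<exists>u\<in>Hom A (Cod A (Zero A L Z)) W. u \<cdot> Zero A L Z = h"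
      using LO Z by (intro bexI[of _ "Zero A Z W"]) auto
  qed (use LO Z in auto)
  have mor: "system_morphism A UNIV (\<le>) M t (\<lambda>_. L) (\<lambda>_ _. Id A L) l"
    unfolding system_morphism_def using lH lt by auto
  obtain r z where rz: "direct_system A (UNIV :: nat set) (\<le>) (\<lambda>i. Cod A (q i)) r"
    "system_morphism A (UNIV :: nat set) (\<le>) (\<lambda>_. L) (\<lambda>_ _. Id A L) (\<lambda>i. Cod A (q i)) r q"
    "is_direct_limit A (UNIV :: nat set) (\<le>) (\<lambda>i. Cod A (q i)) r (Cod A (Zero A L Z)) z"
    by (rule limit_cokernel[OF M cL(1) mor L cL(2), of "Id A L" q "Zero A L Z"])
      (use lH LO q q0 in auto)
  have rq: "r i j \<cdot> q i = q j" if "i \<le> j" for i j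
    using rz(2) that qH(1)[of j] unfolding system_morphism_def by simp
  have LZ: "is_direct_limit A (UNIV :: nat set) (\<le>) (\<lambda>i. Cod A (q i)) r Z z"
    using rz(3) LO Z by simp
  have "is_kernel A (p n0) (Zero A N Z)"
  proof (rule limit_kernel[OF small_nat[OF universe] P cN(1) rz(1) _ _ p LP cN(2) LZ])
    show "system_morphism A UNIV (\<le>) (\<lambda>n. Dom A (p n)) v (\<lambda>_. N) (\<lambda>_ _. Id A N) p"
      unfolding system_morphism_def using pH v by auto
    have "r i j \<cdot> g i = g j \<cdot> Id A N" if "i \<le> j" for i j
    proof -
      have "r i j \<cdot> g i = (r i j \<cdot> q i) \<cdot> f"
        using direct_systemD(3)[OF rz(1), of i j] that qH(1)[of i] f by (simp add: g_def)
      then show ?thesis unfolding rq[OF that] using gH[of j] by (simp add: g_def)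
    qed
    then show "system_morphism A UNIV (\<le>) (\<lambda>_. N) (\<lambda>_ _. Id A N) (\<lambda>i. Cod A (q i)) r g"
      unfolding system_morphism_def using gH by simp
    show "p n0 \<in> Hom A (Dom A (p n0)) N" by (rule pH)
    show "p n0 \<cdot> w i = Id A N \<cdot> p i" for i using w[of i] pH[of i] by simp
    show "Zero A N Z \<in> Hom A N Z" using NO Z by simp
    show "Zero A N Z \<cdot> Id A N = z i \<cdot> g i" for i
    proof -
      have "z i \<in> Hom A (Cod A (q i)) Z" using limit_Hom[OF LZ] by simp
      then have "z i \<cdot> g i = Zero A N Z" using gH[of i] Z by (intro to_zero_object) auto
      then show ?thesis using NO Z by simp
    qed
  qed
  then obtain u where u: "u \<in> Hom A N (Dom A (p n0))" "p n0 \<cdot> u = Id A N"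
    using kernel_lift[of "p n0" "Zero A N Z" "Id A N" N] NO Z by auto
  obtain a where a: "a \<in> Hom A (Dom A (p n0)) (M n0)" "l n0 \<cdot> a = f \<cdot> p n0"
    using fac[OF pH gp] by blast
  have "l n0 \<cdot> (a \<cdot> u) = (l n0 \<cdot> a) \<cdot> u" using a(1) u(1) lH[of n0] by simp
  also have "\<dots> = f \<cdot> (p n0 \<cdot> u)" unfolding a(2) using u(1) f pH[of n0] by simp
  also have "\<dots> = f" unfolding u(2) using f by simp
  finally show thesis using that[of "a \<cdot> u" n0] a(1) u(1) Comp_Hom by blast
qed

lemma noetherian_subobject:
  assumes G: "noetherian_object A G" and k: "is_mono A k" "Cod A k = G"
  shows "noetherian_object A (Dom A k)"
  unfolding noetherian_object_def
proof (intro conjI allI impI)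
  show "Dom A k \<in> Ob A" using k by simp
  fix m :: "nat \<Rightarrow> 'm"
  assume m: "(\<forall>n. is_mono A (m n) \<and> Cod A (m n) = Dom A k) \<and>
    (\<forall>n. \<exists>u\<in>Hom A (Dom A (m n)) (Dom A (m (Suc n))). m n = m (Suc n) \<cdot> u)"
  have kA: "k \<in> Arr A" and mA: "\<And>n. m n \<in> Arr A" "\<And>n. Cod A (m n) = Dom A k"
    using k m by auto
  have a: "\<forall>n. is_mono A (k \<cdot> m n) \<and> Cod A (k \<cdot> m n) = G"
    using m k mA by (auto intro: is_mono_Comp)
  have b: "\<forall>n. \<exists>u\<in>Hom A (Dom A (k \<cdot> m n)) (Dom A (k \<cdot> m (Suc n))). k \<cdot> m n = (k \<cdot> m (Suc n)) \<cdot> u"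
  proof
    fix n
    show "\<exists>u\<in>Hom A (Dom A (k \<cdot> m n)) (Dom A (k \<cdot> m (Suc n))). k \<cdot> m n = (k \<cdot> m (Suc n)) \<cdot> u"
  proof -
    obtain u where u: "u \<in> Hom A (Dom A (m n)) (Dom A (m (Suc n)))" "m n = m (Suc n) \<cdot> u" using m by blast
    have "k \<cdot> (m (Suc n) \<cdot> u) = (k \<cdot> m (Suc n)) \<cdot> u"
      using u(1) kA mA(1)[of "Suc n"] mA(2)[of "Suc n"] by simp
    then have "k \<cdot> m n = (k \<cdot> m (Suc n)) \<cdot> u" unfolding u(2)[symmetric] .
    moreover have "u \<in> Hom A (Dom A (k \<cdot> m n)) (Dom A (k \<cdot> m (Suc n)))"
      using u(1) mA[of n] mA[of "Suc n"] kA by simp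
    ultimately show ?thesis by blast
  qed
  qed
  from mp[OF spec[OF conjunct2[OF G[unfolded noetherian_object_def]], of "\<lambda>n. k \<cdot> m n"] conjI[OF a b]]
  obtain n0 where n0: "\<And>n. n \<ge> n0 \<Longrightarrow>
      \<exists>u\<in>Hom A (Dom A (k \<cdot> m (Suc n))) (Dom A (k \<cdot> m n)). k \<cdot> m (Suc n) = (k \<cdot> m n) \<cdot> u" by blast
  have "\<exists>u\<in>Hom A (Dom A (m (Suc n))) (Dom A (m n)). m (Suc n) = m n \<cdot> u" if n: "n \<ge> n0" for n
  proof -
    obtain u where u: "u \<in> Hom A (Dom A (m (Suc n))) (Dom A (m n))" "k \<cdot> m (Suc n) = (k \<cdot> m n) \<cdot> u"
      using n0[OF n] mA kA by auto
    have "k \<cdot> m (Suc n) = k \<cdot> (m n \<cdot> u)" using u mA[of n] kA by simp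
    then have "m (Suc n) = m n \<cdot> u"
      using u(1) mA[of n] mA[of "Suc n"] by - (rule monoD[OF k(1)], auto)
    then show ?thesis using u(1) by blast
  qed
  then show "\<exists>N. \<forall>n\<ge>N. \<exists>u\<in>Hom A (Dom A (m (Suc n))) (Dom A (m n)). m (Suc n) = m n \<cdot> u" by blast
qed

lemma subobject_factor:
  assumes S: "generating_set A S" and u: "u \<in> Hom A X Y" and k: "is_mono A k" "Cod A k = Y"
    and h: "\<And>G h. G \<in> S \<Longrightarrow> h \<in> Hom A G X \<Longrightarrow> \<exists>h'\<in>Hom A G (Dom A k). k \<cdot> h' = u \<cdot> h"
  shows "\<exists>v\<in>Hom A X (Dom A k). k \<cdot> v = u"
proof -
  obtain c where c: "is_cokernel A c k" using ex_cokernel[of k] k(1) by auto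
  have cH: "c \<in> Hom A Y (Cod A c)" "c \<cdot> k = Zero A (Dom A k) (Cod A c)"
    using cokernelD[OF c] k by auto
  have Ob: "X \<in> Ob A" "Cod A c \<in> Ob A" using u cH(1) Hom_Ob by blast+
  have "(c \<cdot> u) \<cdot> h = Zero A X (Cod A c) \<cdot> h" if hG: "G \<in> S" "h \<in> Hom A G X" for G h
  proof -
    obtain h' where h': "h' \<in> Hom A G (Dom A k)" "k \<cdot> h' = u \<cdot> h" using h[OF hG] by blast
    have "(c \<cdot> u) \<cdot> h = c \<cdot> (k \<cdot> h')" unfolding h'(2) using cH(1) u hG(2) by simp
    also have "\<dots> = (c \<cdot> k) \<cdot> h'" using cH(1) k h'(1) by simp
    also have "\<dots> = Zero A X (Cod A c) \<cdot> h" unfolding cH(2) using h'(1) hG(2) Ob by simp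
    finally show ?thesis .
  qed
  moreover have "c \<cdot> u \<in> Hom A X (Cod A c)" "Zero A X (Cod A c) \<in> Hom A X (Cod A c)"
    using cH(1) u Ob Comp_Hom Zero_Hom by blast+
  ultimately have "c \<cdot> u = Zero A X (Cod A c)" using S unfolding generating_set_def by blast
  moreover have "u \<in> Hom A X (Dom A c)" using u cH(1) by simp
  ultimately show ?thesis
    using kernel_lift[OF mono_kernel_coker[OF k(1) c], of u X] by blast
qed

lemma ex_generator:
  obtains G0 where "generating_set A {G0}" "G0 \<in> Ob A"
proof -
  obtain G0 where "generating_set A {G0}"
    using loc_noeth unfolding locally_noetherian_grothendieck_category_def grothendieck_category_def by blast
  then show thesis using that unfolding generating_set_def by blast
qed

lemma ex_noetherian_generators:
  obtains S where "small U S" "generating_set A S" "\<And>G. G \<in> S \<Longrightarrow> noetherian_object A G" "S \<subseteq> Ob A"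
proof -
  obtain S where S: "small U S" "generating_set A S" "\<forall>G\<in>S. noetherian_object A G"
    using loc_noeth unfolding locally_noetherian_grothendieck_category_def by blast
  moreover have "S \<subseteq> Ob A" using S(2) unfolding generating_set_def by blast
  ultimately show thesis using that by blast
qed

lemma small_subobjects:
  assumes S: "small U S" "S \<subseteq> Ob A"
  obtains K where "small U K" "\<And>k. k \<in> K \<Longrightarrow> is_mono A k"
    "\<And>k. is_mono A k \<Longrightarrow> Cod A k \<in> S \<Longrightarrow> \<exists>k'\<in>K. \<exists>u\<in>Hom A (Dom A k) (Dom A k'). \<exists>v\<in>Hom A (Dom A k') (Dom A k).
       k' \<cdot> u = k \<and> k \<cdot> v = k'"
proof -
  obtain G0 where G0: "generating_set A {G0}" "G0 \<in> Ob A" using ex_generator .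
  define key where "key k = (\<lambda>h. k \<cdot> h) ` Hom A G0 (Dom A k)" for k
  define Q where "Q = (\<lambda>(G, B) k. is_mono A k \<and> Cod A k = G \<and> key k = B)"
  define K where "K = {k. is_mono A k} \<inter> (\<lambda>GB. SOME k. Q GB k) ` (SIGMA G:S. Pow (Hom A G0 G))"
  have "small U (SIGMA G:S. Pow (Hom A G0 G))"
    using S G0 small_Hom by (intro small_Sigma[OF universe] small_Pow[OF universe]) auto
  then have "small U K" unfolding K_def by (rule small_subset[OF Int_lower2 small_image])
  moreover have "\<exists>k'\<in>K. \<exists>u\<in>Hom A (Dom A k) (Dom A k'). \<exists>v\<in>Hom A (Dom A k') (Dom A k).
       k' \<cdot> u = k \<and> k \<cdot> v = k'" if k: "is_mono A k" "Cod A k \<in> S" for k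
  proof -
    have "Q (Cod A k, key k) k" unfolding Q_def using k by simp
    then have Q: "Q (Cod A k, key k) (SOME k'. Q (Cod A k, key k) k')" by (rule someI)
    define k' where "k' = (SOME k'. Q (Cod A k, key k) k')"
    have k': "is_mono A k'" "Cod A k' = Cod A k" "key k' = key k"
      using Q unfolding k'_def[symmetric] by (auto simp: Q_def)
    have "key k \<subseteq> Hom A G0 (Cod A k)" unfolding key_def using k(1) by auto
    then have "k' \<in> K" unfolding K_def k'_def[symmetric] using k k'(1)
      by (auto intro!: image_eqI[of _ _ "(Cod A k, key k)"] simp: k'_def)
    have fac: "\<exists>v\<in>Hom A (Dom A a) (Dom A b). b \<cdot> v = a"
      if ab: "is_mono A a" "is_mono A b" "Cod A a = Cod A b" "key a = key b" for a b
    proof -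
      have "\<exists>h'\<in>Hom A G0 (Dom A b). b \<cdot> h' = a \<cdot> h" if "h \<in> Hom A G0 (Dom A a)" for h
        using ab(4) that unfolding key_def by (metis (no_types, lifting) image_iff)
      then have *: "\<exists>h'\<in>Hom A G (Dom A b). b \<cdot> h' = a \<cdot> h" if "G \<in> {G0}" "h \<in> Hom A G (Dom A a)" for G h
        using that by blast
      have "a \<in> Hom A (Dom A a) (Cod A a)" using ab(1) by simp
      from subobject_factor[OF G0(1) this ab(2) ab(3)[symmetric]] show ?thesis using * by blast
    qed
    show ?thesis using \<open>k' \<in> K\<close> fac[of k k'] fac[of k' k] k k' by metis
  qed
  ultimately show thesis using that[of K] unfolding K_def by blast
qed

text \<open>Partial extensions \<open>(u, g)\<close> are compared through their graphs, the sets of pairs \<open>(u h, g h)\<close> with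
  \<open>h\<close> running through the arrows from a generator; this turns the preorder into inclusion of subsets
  of a small set.\<close>

lemma baer_criterion:
  assumes S: "generating_set A S" and E: "E \<in> Ob A"
    and ext: "\<And>k f. is_mono A k \<Longrightarrow> Cod A k \<in> S \<Longrightarrow> f \<in> Hom A (Dom A k) E \<Longrightarrow> \<exists>g\<in>Hom A (Cod A k) E. g \<cdot> k = f"
  shows "injective_object A E"
  unfolding injective_object_def
proof (intro conjI allI impI)
  show "E \<in> Ob A" by fact
  fix m f assume mf: "is_mono A m \<and> f \<in> Hom A (Dom A m) E"
  obtain G0 where G0: "generating_set A {G0}" "G0 \<in> Ob A" using ex_generator .
  define Y where "Y = Cod A m"
  have YO: "Y \<in> Ob A" and mH: "m \<in> Hom A (Dom A m) Y" and fH: "f \<in> Hom A (Dom A m) E"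
    using mf by (auto simp: Y_def)
  define ok where "ok u g \<longleftrightarrow> is_mono A u \<and> Cod A u = Y \<and> g \<in> Hom A (Dom A u) E \<and>
    (\<exists>x\<in>Hom A (Dom A m) (Dom A u). u \<cdot> x = m \<and> g \<cdot> x = f)" for u g
  define graph where "graph u g = (\<lambda>h. (u \<cdot> h, g \<cdot> h)) ` Hom A G0 (Dom A u)" for u g
  have okH: "u \<in> Hom A (Dom A u) Y" "g \<in> Hom A (Dom A u) E" "is_mono A u" if "ok u g" for u g
    using that by (auto simp: ok_def)
  have factor: "\<exists>v\<in>Hom A (Dom A u) (Dom A u'). u' \<cdot> v = u \<and> g' \<cdot> v = g"
    if ok: "ok u g" "ok u' g'" and sub: "graph u g \<subseteq> graph u' g'" for u g u' g'
  proof -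
    note H = okH[OF ok(1)] okH[OF ok(2)]
    have gr: "\<exists>h'\<in>Hom A G0 (Dom A u'). u' \<cdot> h' = u \<cdot> h \<and> g' \<cdot> h' = g \<cdot> h" if "h \<in> Hom A G0 (Dom A u)" for h
    proof -
      have "(u \<cdot> h, g \<cdot> h) \<in> graph u' g'" using sub that unfolding graph_def by blast
      then show ?thesis unfolding graph_def by auto
    qed
    obtain v where v: "v \<in> Hom A (Dom A u) (Dom A u')" "u' \<cdot> v = u"
    proof -
      have "Cod A u' = Y" using H(4) by simp
      moreover have "\<exists>h'\<in>Hom A G (Dom A u'). u' \<cdot> h' = u \<cdot> h" if "G \<in> {G0}" "h \<in> Hom A G (Dom A u)" for G h
        using gr that by blast
      ultimately have "\<exists>v\<in>Hom A (Dom A u) (Dom A u'). u' \<cdot> v = u"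
        by (rule subobject_factor[OF G0(1) H(1) H(6)])
      then show thesis using that by blast
    qed
    have "(g' \<cdot> v) \<cdot> h = g \<cdot> h" if h: "h \<in> Hom A G0 (Dom A u)" for h
    proof -
      obtain h' where h': "h' \<in> Hom A G0 (Dom A u')" "u' \<cdot> h' = u \<cdot> h" "g' \<cdot> h' = g \<cdot> h" using gr[OF h] by blast
      have "u' \<cdot> (v \<cdot> h) = (u' \<cdot> v) \<cdot> h" using v(1) h H(4) by simp
      then have "u' \<cdot> (v \<cdot> h) = u' \<cdot> h'" using v(2) h'(2) by simp
      then have "v \<cdot> h = h'" using v(1) h h'(1) H(6) by - (rule monoD[OF H(6)], auto)
      then show ?thesis using h'(3) v(1) h H(5) by simp
    qed
    moreover have "g' \<cdot> v \<in> Hom A (Dom A u) E" using v(1) H(5) Comp_Hom by blast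
    ultimately have "g' \<cdot> v = g" using G0(1) H(2) unfolding generating_set_def by blast
    then show ?thesis using v by blast
  qed
  have graph_le: "graph u g \<subseteq> graph u' g'"
    if ok: "ok u g" "ok u' g'" and v: "v \<in> Hom A (Dom A u) (Dom A u')" "u' \<cdot> v = u" "g' \<cdot> v = g" for u g u' g' v
  proof
    note H = okH[OF ok(1)] okH[OF ok(2)]
    fix y assume "y \<in> graph u g"
    then obtain h where h: "h \<in> Hom A G0 (Dom A u)" "y = (u \<cdot> h, g \<cdot> h)" unfolding graph_def by blast
    have "u' \<cdot> (v \<cdot> h) = (u' \<cdot> v) \<cdot> h" "g' \<cdot> (v \<cdot> h) = (g' \<cdot> v) \<cdot> h"
      using v(1) h(1) H(4,5) by simp_all
    then have "y = (u' \<cdot> (v \<cdot> h), g' \<cdot> (v \<cdot> h))" using v(2,3) h(2) by simp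
    then show "y \<in> graph u' g'" unfolding graph_def using Comp_Hom[OF h(1) v(1)] by blast
  qed
  define \<G> where "\<G> = {graph u g |u g. ok u g}"
  have "\<exists>x\<in>Hom A (Dom A m) (Dom A m). m \<cdot> x = m \<and> f \<cdot> x = f"
    by (rule bexI[of _ "Id A (Dom A m)"]) (use mH fH Hom_Ob[OF mH] in auto)
  then have okm: "ok m f" unfolding ok_def using mf Y_def by simp
  have "\<exists>B\<in>\<G>. \<forall>c\<in>\<C>. c \<subseteq> B" if chain: "subset.chain \<G> \<C>" for \<C>
  proof (cases "\<C> = {}")
    case True
    then show ?thesis using okm unfolding \<G>_def by blast
  next
    case False
    have sub: "\<C> \<subseteq> \<G>" and tot: "\<And>a b. a \<in> \<C> \<Longrightarrow> b \<in> \<C> \<Longrightarrow> a \<subseteq> b \<or> b \<subseteq> a"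
      using chain unfolding subset_chain_def by blast+
    then have "\<exists>u g. ok u g \<and> graph u g = c" if "c \<in> \<C>" for c using that unfolding \<G>_def by blast
    then obtain uu gg where ug: "\<And>c. c \<in> \<C> \<Longrightarrow> ok (uu c) (gg c) \<and> graph (uu c) (gg c) = c" by metis
    then have ok: "\<And>c. c \<in> \<C> \<Longrightarrow> ok (uu c) (gg c)" and gr: "\<And>c. c \<in> \<C> \<Longrightarrow> graph (uu c) (gg c) = c" by blast+
    have "c \<in> Pow (Hom A G0 Y \<times> Hom A G0 E)" if "c \<in> \<C>" for c
    proof -
      have "graph (uu c) (gg c) \<subseteq> Hom A G0 Y \<times> Hom A G0 E"
        unfolding graph_def
        using Comp_Hom[OF _ okH(1)[OF ok[OF that]]] Comp_Hom[OF _ okH(2)[OF ok[OF that]]] by auto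
      then show ?thesis unfolding gr[OF that] by simp
    qed
    then have small: "small U \<C>"
      using small_Pow[OF universe small_Times[OF universe small_Hom[OF G0(2) YO] small_Hom[OF G0(2) E]]]
        small_subset by (meson subsetI)
    have "\<exists>v\<in>Hom A (Dom A (uu c)) (Dom A (uu d)). uu d \<cdot> v = uu c \<and> gg d \<cdot> v = gg c"
      if "c \<in> \<C>" "d \<in> \<C>" "c \<subseteq> d" for c d
      using factor[OF ok[OF that(1)] ok[OF that(2)]] gr that by simp
    then obtain v where v: "\<And>c d. c \<in> \<C> \<Longrightarrow> d \<in> \<C> \<Longrightarrow> c \<subseteq> d \<Longrightarrow>
       v c d \<in> Hom A (Dom A (uu c)) (Dom A (uu d)) \<and> uu d \<cdot> v c d = uu c \<and> gg d \<cdot> v c d = gg c" by metis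
    have ue: "a = b" if "c \<in> \<C>" "a \<in> Hom A W (Dom A (uu c))" "b \<in> Hom A W (Dom A (uu c))"
      "uu c \<cdot> a = uu c \<cdot> b" for a b W c
      using that by - (rule monoD[OF okH(3)[OF ok[OF that(1)]]], auto)
    have dir: "directed_set \<C> (\<subseteq>)"
      unfolding directed_set_def using False tot by (metis (no_types, lifting) order_refl subset_trans)
    have X: "direct_system A \<C> (\<subseteq>) (\<lambda>c. Dom A (uu c)) v"
      unfolding direct_system_def
    proof (intro conjI ballI impI dir)
      fix c assume c: "c \<in> \<C>"
      note Hc = okH[OF ok[OF c]]
      show O: "Dom A (uu c) \<in> Ob A" using Hc Hom_Ob by blast
      show "v c c = Id A (Dom A (uu c))"
        by (rule ue[OF c, of _ "Dom A (uu c)"]) (use v[OF c c] Hc O in auto)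
      fix d assume d: "d \<in> \<C>"
      show "v c d \<in> Hom A (Dom A (uu c)) (Dom A (uu d))" if "c \<subseteq> d" using v[OF c d that] by blast
      fix e assume e: "e \<in> \<C>" and "c \<subseteq> d \<and> d \<subseteq> e"
      then have vs: "v c d \<in> Hom A (Dom A (uu c)) (Dom A (uu d)) \<and> uu d \<cdot> v c d = uu c"
        "v d e \<in> Hom A (Dom A (uu d)) (Dom A (uu e)) \<and> uu e \<cdot> v d e = uu d"
        "v c e \<in> Hom A (Dom A (uu c)) (Dom A (uu e)) \<and> uu e \<cdot> v c e = uu c"
        using v c d e subset_trans by blast+
      show "v d e \<cdot> v c d = v c e"
      proof (rule ue[OF e])
        have "uu e \<cdot> (v d e \<cdot> v c d) = (uu e \<cdot> v d e) \<cdot> v c d"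
          using vs[THEN conjunct1] okH(1)[OF ok[OF e]] by simp
        then show "uu e \<cdot> (v d e \<cdot> v c d) = uu e \<cdot> v c e" using vs by simp
      qed (use vs Comp_Hom in blast)+
    qed
    obtain L l where L: "is_direct_limit A \<C> (\<subseteq>) (\<lambda>c. Dom A (uu c)) v L l" using small_limit[OF small X] .
    note cY = constant_system[OF dir YO]
    obtain \<mu> where \<mu>: "\<mu> \<in> Hom A L Y" "\<And>c. c \<in> \<C> \<Longrightarrow> \<mu> \<cdot> l c = uu c"
      using limit_desc[OF L YO, of uu] okH(1)[OF ok] v by blast
    obtain \<kappa> where \<kappa>: "\<kappa> \<in> Hom A L E" "\<And>c. c \<in> \<C> \<Longrightarrow> \<kappa> \<cdot> l c = gg c"
      using limit_desc[OF L E, of gg] okH(2)[OF ok] v by blast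
    have "is_mono A \<mu>"
    proof (rule limit_mono[OF small X cY(1) _ okH(3)[OF ok] L cY(2) \<mu>(1)])
      show "system_morphism A \<C> (\<subseteq>) (\<lambda>c. Dom A (uu c)) v (\<lambda>_. Y) (\<lambda>_ _. Id A Y) uu"
        unfolding system_morphism_def using okH(1)[OF ok] v by auto
      show "\<mu> \<cdot> l c = Id A Y \<cdot> uu c" if "c \<in> \<C>" for c using \<mu>(2)[OF that] okH(1)[OF ok[OF that]] by simp
    qed
    moreover have "\<exists>x\<in>Hom A (Dom A m) L. \<mu> \<cdot> x = m \<and> \<kappa> \<cdot> x = f"
    proof -
      obtain c where c: "c \<in> \<C>" using False by blast
      obtain x where x: "x \<in> Hom A (Dom A m) (Dom A (uu c))" "uu c \<cdot> x = m" "gg c \<cdot> x = f"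
        using ok[OF c] unfolding ok_def by blast
      have "\<mu> \<cdot> (l c \<cdot> x) = (\<mu> \<cdot> l c) \<cdot> x" "\<kappa> \<cdot> (l c \<cdot> x) = (\<kappa> \<cdot> l c) \<cdot> x"
        using \<mu>(1) \<kappa>(1) limit_Hom[OF L c] x(1) by simp_all
      then show ?thesis using \<mu>(2)[OF c] \<kappa>(2)[OF c] x Comp_Hom[OF x(1) limit_Hom[OF L c]] by metis
    qed
    ultimately have ok\<mu>: "ok \<mu> \<kappa>" unfolding ok_def using \<mu>(1) \<kappa>(1) by auto
    moreover have "c \<subseteq> graph \<mu> \<kappa>" if c: "c \<in> \<C>" for c
    proof -
      have "l c \<in> Hom A (Dom A (uu c)) (Dom A \<mu>)" using limit_Hom[OF L c] \<mu>(1) by simp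
      then show ?thesis using graph_le[OF ok[OF c] ok\<mu> _ \<mu>(2)[OF c] \<kappa>(2)[OF c]] gr[OF c] by simp
    qed
    ultimately show ?thesis unfolding \<G>_def by blast
  qed
  from subset_Zorn[OF this] obtain B where B: "B \<in> \<G>" "\<And>X. X \<in> \<G> \<Longrightarrow> B \<subseteq> X \<Longrightarrow> X = B" by blast
  then obtain u g where ok: "ok u g" and Bug: "B = graph u g" unfolding \<G>_def by blast
  note H = okH[OF ok]
  obtain x where x: "x \<in> Hom A (Dom A m) (Dom A u)" "u \<cdot> x = m" "g \<cdot> x = f"
    using ok unfolding ok_def by blast
  have UO: "Dom A u \<in> Ob A" using H Hom_Ob by blast
  have "\<exists>h'\<in>Hom A G (Dom A u). u \<cdot> h' = h" if G: "G \<in> S" and h: "h \<in> Hom A G Y" for G h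
  proof -
    have GO: "G \<in> Ob A" using h Hom_Ob by blast
    have hC: "h \<in> Hom A G (Cod A u)" using h H(1) by simp
    obtain n v where n: "is_mono A n" "Cod A n = G" and v: "v \<in> Hom A (Dom A n) (Dom A u)" "u \<cdot> v = h \<cdot> n"
      and pb: "\<And>T x y. x \<in> Hom A T G \<Longrightarrow> y \<in> Hom A T (Dom A u) \<Longrightarrow> h \<cdot> x = u \<cdot> y \<Longrightarrow>
       \<exists>t \<in> Hom A T (Dom A n). n \<cdot> t = x \<and> v \<cdot> t = y"
      using pullback_mono[OF H(3) hC] by metis
    have nH: "n \<in> Hom A (Dom A n) G" using n by simp
    obtain e where e: "e \<in> Hom A G E" "e \<cdot> n = g \<cdot> v"
      using ext[OF n(1), of "g \<cdot> v"] n G v(1) H(2) Comp_Hom by blast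
    obtain P i j p q where b: "biprod P i j p q (Dom A u) G" using ex_biprod[OF UO GO] .
    note [simp] = biprod_simps[OF b]
    have [simp]: "u \<in> Arr A" "Cod A u = Y" "h \<in> Arr A" "Dom A h = G" "Cod A h = Y"
      "g \<in> Arr A" "Dom A g = Dom A u" "Cod A g = E" "e \<in> Arr A" "Dom A e = G" "Cod A e = E"
      using H h e by auto
    define F \<Gamma> where "F = u \<cdot> p \<oplus> h \<cdot> q" and "\<Gamma> = g \<cdot> p \<oplus> e \<cdot> q"
    have FH: "F \<in> Hom A P Y" and \<Gamma>H: "\<Gamma> \<in> Hom A P E" unfolding F_def \<Gamma>_def by auto
    have Fi: "F \<cdot> i = u" "\<Gamma> \<cdot> i = g" "F \<cdot> j = h"
      unfolding F_def \<Gamma>_def using UO GO YO E by simp_all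
    have kill: "\<Gamma> \<cdot> y = Zero A W E" if y: "y \<in> Hom A W P" "F \<cdot> y = Zero A W Y" for W y
    proof -
      note [simp] = y(1)[simplified]
      have W: "W \<in> Ob A" using y Hom_Ob by blast
      have "u \<cdot> (p \<cdot> y) \<oplus> h \<cdot> (q \<cdot> y) = Zero A W Y" using y(2) by (simp add: F_def)
      then have "Neg A (u \<cdot> (p \<cdot> y)) = h \<cdot> (q \<cdot> y)" by (intro Neg_unique) auto
      then have "h \<cdot> (q \<cdot> y) = u \<cdot> Neg A (p \<cdot> y)" by simp
      moreover have "q \<cdot> y \<in> Hom A W G" "Neg A (p \<cdot> y) \<in> Hom A W (Dom A u)" by auto
      ultimately obtain t where t: "t \<in> Hom A W (Dom A n)" "n \<cdot> t = q \<cdot> y" "v \<cdot> t = Neg A (p \<cdot> y)"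
        using pb by blast
      have "e \<cdot> (q \<cdot> y) = (e \<cdot> n) \<cdot> t" unfolding t(2)[symmetric] using t(1) nH by simp
      also have "\<dots> = g \<cdot> (v \<cdot> t)" unfolding e(2) using v(1) t(1) by simp
      also have "\<dots> = Neg A (g \<cdot> (p \<cdot> y))" unfolding t(3) by simp
      finally show ?thesis by (simp add: \<Gamma>_def)
    qed
    obtain m' c g' where mc: "is_mono A m'" "is_epi A c" "c \<in> Hom A P (Dom A m')" "Cod A m' = Y" "m' \<cdot> c = F"
      "g' \<in> Hom A (Dom A m') E" "g' \<cdot> c = \<Gamma>"
      using factor_through_image[OF FH \<Gamma>H kill] by blast
    have m'A: "m' \<in> Arr A" "c \<in> Arr A" "Dom A c = P" "Cod A c = Dom A m'" "g' \<in> Arr A" "Dom A g' = Dom A m'"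
      using mc by auto
    have ci: "c \<cdot> i \<in> Hom A (Dom A u) (Dom A m')" using m'A by simp
    have mci: "m' \<cdot> (c \<cdot> i) = u" "g' \<cdot> (c \<cdot> i) = g" "m' \<cdot> (c \<cdot> j) = h"
    proof -
      have "m' \<cdot> (c \<cdot> i) = (m' \<cdot> c) \<cdot> i" "g' \<cdot> (c \<cdot> i) = (g' \<cdot> c) \<cdot> i" "m' \<cdot> (c \<cdot> j) = (m' \<cdot> c) \<cdot> j"
        using m'A mc(4) by simp_all
      then show "m' \<cdot> (c \<cdot> i) = u" "g' \<cdot> (c \<cdot> i) = g" "m' \<cdot> (c \<cdot> j) = h"
        unfolding mc(5,7) Fi by blast+
    qed
    have "m' \<cdot> ((c \<cdot> i) \<cdot> x) = (m' \<cdot> (c \<cdot> i)) \<cdot> x" "g' \<cdot> ((c \<cdot> i) \<cdot> x) = (g' \<cdot> (c \<cdot> i)) \<cdot> x"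
      using m'A mc(4) x(1) by simp_all
    then have ok': "ok m' g'" unfolding ok_def mci x(2,3)
      using mc(1,4,6) Comp_Hom[OF x(1) ci] by blast
    have "B \<subseteq> graph m' g'" unfolding Bug by (rule graph_le[OF ok ok' ci mci(1,2)])
    then have "graph m' g' = graph u g" using B(2) ok' Bug unfolding \<G>_def by blast
    then obtain w where w: "w \<in> Hom A (Dom A m') (Dom A u)" "u \<cdot> w = m'"
      using factor[OF ok' ok] by blast
    have "u \<cdot> (w \<cdot> (c \<cdot> j)) = (u \<cdot> w) \<cdot> (c \<cdot> j)" using w(1) m'A by simp
    then have "u \<cdot> (w \<cdot> (c \<cdot> j)) = h" unfolding w(2) mci .
    moreover have "w \<cdot> (c \<cdot> j) \<in> Hom A G (Dom A u)" using w(1) m'A by simp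
    ultimately show ?thesis by blast
  qed
  then have "\<exists>h'\<in>Hom A G (Dom A u). u \<cdot> h' = Id A Y \<cdot> h" if "G \<in> S" "h \<in> Hom A G Y" for G h
    unfolding Id_Comp[OF that(2)] using that by blast
  moreover have "Cod A u = Y" using H(1) by simp
  ultimately have "\<exists>w\<in>Hom A Y (Dom A u). u \<cdot> w = Id A Y"
    by (intro subobject_factor[OF S Id_Hom[OF YO] H(3)])
  then obtain w where w: "w \<in> Hom A Y (Dom A u)" "u \<cdot> w = Id A Y" by blast
  have "u \<cdot> (w \<cdot> m) = (u \<cdot> w) \<cdot> m" using w(1) H(1) mH by simp
  also have "\<dots> = u \<cdot> x" unfolding w(2) x(2) using mH by simp
  finally have "w \<cdot> m = x" using w(1) mH x(1) by - (rule monoD[OF H(3)], auto)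
  then have "(g \<cdot> w) \<cdot> m = f" using w(1) mH H(2) x(3) by simp
  then show "\<exists>g\<in>Hom A (Cod A m) E. g \<cdot> m = f" using Comp_Hom[OF w(1) H(2)] Y_def by blast
qed

lemma extension_step:
  assumes S: "small U S" "S \<subseteq> Ob A" and M: "M \<in> Ob A"
  obtains m where "is_mono A m" "Dom A m = M"
    "\<And>k f. is_mono A k \<Longrightarrow> Cod A k \<in> S \<Longrightarrow> f \<in> Hom A (Dom A k) M \<Longrightarrow>
       \<exists>g\<in>Hom A (Cod A k) (Cod A m). g \<cdot> k = m \<cdot> f"
proof -
  obtain K where K: "small U K" "\<And>k. k \<in> K \<Longrightarrow> is_mono A k"
    "\<And>k. is_mono A k \<Longrightarrow> Cod A k \<in> S \<Longrightarrow> \<exists>k'\<in>K. \<exists>u\<in>Hom A (Dom A k) (Dom A k'). \<exists>v\<in>Hom A (Dom A k') (Dom A k).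
       k' \<cdot> u = k \<and> k \<cdot> v = k'" using small_subobjects[OF S] by blast
  define T where "T = (SIGMA k:K. Hom A (Dom A k) M)"
  have T: "small U T" unfolding T_def
    using K(1,2) M small_Hom by (intro small_Sigma[OF universe]) auto
  have tD: "is_mono A (fst t)" "snd t \<in> Hom A (Dom A (fst t)) M" "Dom A (fst t) \<in> Ob A" "Cod A (fst t) \<in> Ob A"
    if "t \<in> T" for t using that K(2) by (auto simp: T_def)
  obtain L \<iota> where L: "is_coproduct A T (\<lambda>t. Dom A (fst t)) L \<iota>" using small_coproduct[OF T tD(3)] .
  obtain L' \<iota>' where L': "is_coproduct A T (\<lambda>t. Cod A (fst t)) L' \<iota>'" using small_coproduct[OF T tD(4)] .
  have \<iota>: "\<And>t. t \<in> T \<Longrightarrow> \<iota> t \<in> Hom A (Dom A (fst t)) L" and \<iota>': "\<And>t. t \<in> T \<Longrightarrow> \<iota>' t \<in> Hom A (Cod A (fst t)) L'"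
    and LO: "L' \<in> Ob A" using L L' unfolding is_coproduct_def by blast+
  have kH: "fst t \<in> Hom A (Dom A (fst t)) (Cod A (fst t))" if "t \<in> T" for t using tD(1)[OF that] by simp
  obtain \<phi> where \<phi>: "\<phi> \<in> Hom A L L'" "\<And>t. t \<in> T \<Longrightarrow> \<phi> \<cdot> \<iota> t = \<iota>' t \<cdot> fst t"
    using coproduct_desc[OF L LO, of "\<lambda>t. \<iota>' t \<cdot> fst t"] Comp_Hom[OF kH \<iota>'] by blast
  obtain F where F: "F \<in> Hom A L M" "\<And>t. t \<in> T \<Longrightarrow> F \<cdot> \<iota> t = snd t"
    using coproduct_desc[OF L M, of snd] tD(2) by blast
  have mono: "is_mono A \<phi>" using coproduct_mono[OF T L L' tD(1) kH \<phi>] .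
  have "F \<in> Hom A (Dom A \<phi>) M" using F(1) \<phi>(1) by simp
  from pushout_mono[OF mono this] obtain m g where m: "is_mono A m" "Dom A m = M"
    "g \<in> Hom A (Cod A \<phi>) (Cod A m)" "g \<cdot> \<phi> = m \<cdot> F" by blast
  have gH: "g \<in> Hom A L' (Cod A m)" and mH: "m \<in> Hom A M (Cod A m)"
    using m \<phi>(1) by auto
  have "\<exists>h\<in>Hom A (Cod A k) (Cod A m). h \<cdot> k = m \<cdot> f"
    if k: "is_mono A k" "Cod A k \<in> S" and f: "f \<in> Hom A (Dom A k) M" for k f
  proof -
    obtain k' u v where k': "k' \<in> K" "u \<in> Hom A (Dom A k) (Dom A k')" "v \<in> Hom A (Dom A k') (Dom A k)"
      "k' \<cdot> u = k" "k \<cdot> v = k'" using K(3)[OF k] by blast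
    have kA: "k \<in> Hom A (Dom A k) (Cod A k)" and kA': "k' \<in> Hom A (Dom A k') (Cod A k')"
      using k(1) K(2)[OF k'(1)] by auto
    have cod: "Cod A k' = Cod A k"
    proof -
      have "Cod A (k \<cdot> v) = Cod A k" using kA k'(3) by simp
      then show ?thesis unfolding k'(5) .
    qed
    have vu: "v \<cdot> u = Id A (Dom A k)"
    proof (rule monoD[OF k(1)])
      have "k \<cdot> (v \<cdot> u) = (k \<cdot> v) \<cdot> u" using kA k'(2,3) by simp
      then show "k \<cdot> (v \<cdot> u) = k \<cdot> Id A (Dom A k)" unfolding k'(4,5) using kA by simp
    qed (use k'(2,3) kA in auto)
    let ?t = "(k', f \<cdot> v)"
    have t: "?t \<in> T" using k'(1) Comp_Hom[OF k'(3) f] by (simp add: T_def)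
    have \<iota>t: "\<iota> ?t \<in> Hom A (Dom A k') L" and \<iota>t': "\<iota>' ?t \<in> Hom A (Cod A k') L'" using \<iota>[OF t] \<iota>'[OF t] by auto
    have "(g \<cdot> \<iota>' ?t) \<cdot> k = ((g \<cdot> \<iota>' ?t) \<cdot> k') \<cdot> u"
      unfolding k'(4)[symmetric] using gH \<iota>t' kA' k'(2) by simp
    also have "(g \<cdot> \<iota>' ?t) \<cdot> k' = g \<cdot> (\<phi> \<cdot> \<iota> ?t)" unfolding \<phi>(2)[OF t] using gH \<iota>t' kA' by simp
    also have "\<dots> = (g \<cdot> \<phi>) \<cdot> \<iota> ?t" using gH \<phi>(1) \<iota>t by simp
    also have "\<dots> = m \<cdot> (F \<cdot> \<iota> ?t)" unfolding m(4) using mH F(1) \<iota>t by simp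
    also have "F \<cdot> \<iota> ?t = f \<cdot> v" using F(2)[OF t] by simp
    also have "(m \<cdot> (f \<cdot> v)) \<cdot> u = m \<cdot> (f \<cdot> (v \<cdot> u))" using mH f k'(2,3) by simp
    also have "\<dots> = m \<cdot> f" unfolding vu using f by simp
    finally show ?thesis using Comp_Hom[OF \<iota>t' gH] cod by (intro bexI[of _ "g \<cdot> \<iota>' ?t"]) simp_all
  qed
  then show thesis using that m(1,2) by blast
qed

theorem enough_injectives:
  assumes X: "X \<in> Ob A"
  obtains m where "is_mono A m" "Dom A m = X" "injective_object A (Cod A m)"
proof -
  obtain S where S: "small U S" "generating_set A S" "\<And>G. G \<in> S \<Longrightarrow> noetherian_object A G" "S \<subseteq> Ob A"
    using ex_noetherian_generators by blast
  have "\<exists>m. is_mono A m \<and> Dom A m = M \<and> (\<forall>k f. is_mono A k \<longrightarrow> Cod A k \<in> S \<longrightarrow> f \<in> Hom A (Dom A k) M \<longrightarrow>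
       (\<exists>g\<in>Hom A (Cod A k) (Cod A m). g \<cdot> k = m \<cdot> f))" if "M \<in> Ob A" for M
    using extension_step[OF S(1,4) that] by metis
  then obtain nx where nx: "\<And>M. M \<in> Ob A \<Longrightarrow> is_mono A (nx M) \<and> Dom A (nx M) = M"
    "\<And>M k f. M \<in> Ob A \<Longrightarrow> is_mono A k \<Longrightarrow> Cod A k \<in> S \<Longrightarrow> f \<in> Hom A (Dom A k) M \<Longrightarrow>
       \<exists>g\<in>Hom A (Cod A k) (Cod A (nx M)). g \<cdot> k = nx M \<cdot> f" by metis
  define M where "M n = ((\<lambda>Y. Cod A (nx Y)) ^^ n) X" for n
  have MS: "M (Suc n) = Cod A (nx (M n))" and M0: "M 0 = X" for n by (simp_all add: M_def)
  have MO: "M n \<in> Ob A" for n by (induction n) (use X nx(1) in \<open>auto simp: MS M0\<close>)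
  have st: "nx (M n) \<in> Hom A (M n) (M (Suc n))" for n
    using nx(1)[OF MO[of n]] by (simp add: MS)
  obtain t where t: "direct_system A (UNIV :: nat set) (\<le>) M t" "\<And>n. t n (Suc n) = nx (M n)"
    "\<And>n m. n \<le> m \<Longrightarrow> is_mono A (t n m)"
    using nat_chain_system[of "\<lambda>n. nx (M n)" M] st nx(1)[OF MO] by metis
  obtain L l where L: "is_direct_limit A UNIV (\<le>) M t L l" using small_limit[OF small_nat[OF universe] t(1)] .
  have lH: "l n \<in> Hom A (M n) L" for n using limit_Hom[OF L] by simp
  have "injective_object A L"
  proof (rule baer_criterion[OF S(2)])
    show "L \<in> Ob A" using lH Hom_Ob by blast
    fix k f assume k: "is_mono A k" "Cod A k \<in> S" and f: "f \<in> Hom A (Dom A k) L"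
    have "noetherian_object A (Dom A k)" using noetherian_subobject[OF S(3)[OF k(2)] k(1)] by simp
    then obtain n f' where f': "f' \<in> Hom A (Dom A k) (M n)" "l n \<cdot> f' = f"
      using noetherian_factor[OF _ t(1,3) L f] by blast
    obtain g where g: "g \<in> Hom A (Cod A k) (M (Suc n))" "g \<cdot> k = nx (M n) \<cdot> f'"
      using nx(2)[OF MO k f'(1)] by (auto simp: MS)
    have "(l (Suc n) \<cdot> g) \<cdot> k = l (Suc n) \<cdot> (g \<cdot> k)" using lH[of "Suc n"] g(1) k(1) by simp
    also have "\<dots> = (l (Suc n) \<cdot> t n (Suc n)) \<cdot> f'"
      unfolding g(2) t(2) using lH[of "Suc n"] st[of n] f'(1) by simp
    also have "\<dots> = f" using limit_comp[OF L, of n "Suc n"] f'(2) by simp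
    finally show "\<exists>g\<in>Hom A (Cod A k) L. g \<cdot> k = f" using Comp_Hom[OF g(1) lH] by blast
  qed
  moreover have "is_mono A (l 0)" using nat_limit_leg_mono[OF t(1,3) L] .
  ultimately show thesis using that[of "l 0"] lH[of 0] M0 by simp
qed

end

section \<open>Complexes, homotopies and quasi-isomorphisms\<close>

context abelian_category
begin

abbreviation "cplx \<equiv> left_bounded_complex A"

definition chmap :: "('a, 'b) cpx \<Rightarrow> (int \<Rightarrow> 'b) \<Rightarrow> ('a, 'b) cpx \<Rightarrow> bool" where
  "chmap X f Y \<longleftrightarrow> cplx X \<and> cplx Y \<and>
     (\<forall>n. f n \<in> Hom A (Obj X n) (Obj Y n) \<and> Diff Y n \<cdot> f n = f (n + 1) \<cdot> Diff X n)"

lemma chmap_iff: "(X, f, Y) \<in> Arr (Cplus A) \<longleftrightarrow> chmap X f Y"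
  by (simp add: Cplus_def chmap_def)

lemma cpx:
  assumes "cplx X"
  shows "Obj X n \<in> Ob A" "Diff X n \<in> Arr A" "Dom A (Diff X n) = Obj X n" "Cod A (Diff X n) = Obj X (n + 1)"
    "Diff X (n + 1) \<cdot> Diff X n = Zero A (Obj X n) (Obj X (n + 2))"
    "x \<in> Arr A \<Longrightarrow> Cod A x = Obj X n \<Longrightarrow> Diff X (n + 1) \<cdot> (Diff X n \<cdot> x) = Zero A (Dom A x) (Obj X (n + 2))"
    "Diff X (n + 2) \<cdot> Diff X (n + 1) = Zero A (Obj X (n + 1)) (Obj X (n + 3))"
    "x \<in> Arr A \<Longrightarrow> Cod A x = Obj X (n + 1) \<Longrightarrow>
       Diff X (n + 2) \<cdot> (Diff X (n + 1) \<cdot> x) = Zero A (Dom A x) (Obj X (n + 3))"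
proof -
  have d: "Diff X n \<in> Hom A (Obj X n) (Obj X (n + 1))"
    "Diff X (n + 1) \<cdot> Diff X n = Zero A (Obj X n) (Obj X (n + 2))" for n
    using assms unfolding left_bounded_complex_def by blast+
  show 1: "Obj X n \<in> Ob A" "Diff X n \<in> Arr A" "Dom A (Diff X n) = Obj X n" "Cod A (Diff X n) = Obj X (n + 1)"
    "Diff X (n + 1) \<cdot> Diff X n = Zero A (Obj X n) (Obj X (n + 2))" for n
    using d[of n] Hom_Ob[OF d(1)[of n]] by auto
  show 2: "x \<in> Arr A \<Longrightarrow> Cod A x = Obj X n \<Longrightarrow>
      Diff X (n + 1) \<cdot> (Diff X n \<cdot> x) = Zero A (Dom A x) (Obj X (n + 2))" for x n
    using 1 by (simp flip: assoc)
  show "Diff X (n + 2) \<cdot> Diff X (n + 1) = Zero A (Obj X (n + 1)) (Obj X (n + 3))"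
    using 1(5)[of "n + 1"] by (simp add: add.assoc)
  show "x \<in> Arr A \<Longrightarrow> Cod A x = Obj X (n + 1) \<Longrightarrow>
       Diff X (n + 2) \<cdot> (Diff X (n + 1) \<cdot> x) = Zero A (Dom A x) (Obj X (n + 3))"
    using 2[of x "n + 1"] by (simp add: add.assoc)
qed

lemma chm:
  assumes "chmap X f Y"
  shows "cplx X" "cplx Y"
    "f n \<in> Arr A" "Dom A (f n) = Obj X n" "Cod A (f n) = Obj Y n"
    "Diff Y n \<cdot> f n = f (n + 1) \<cdot> Diff X n"
    "x \<in> Arr A \<Longrightarrow> Cod A x = Obj X n \<Longrightarrow> Diff Y n \<cdot> (f n \<cdot> x) = f (n + 1) \<cdot> (Diff X n \<cdot> x)"
proof -
  show 1: "cplx X" "cplx Y"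
    "f n \<in> Arr A" "Dom A (f n) = Obj X n" "Cod A (f n) = Obj Y n"
    "Diff Y n \<cdot> f n = f (n + 1) \<cdot> Diff X n" for n
    using assms by (auto simp: chmap_def)
  note c = cpx[OF 1(1)] cpx[OF 1(2)]
  assume x: "x \<in> Arr A" "Cod A x = Obj X n"
  have "Diff Y n \<cdot> (f n \<cdot> x) = (Diff Y n \<cdot> f n) \<cdot> x" using x 1(3-5) c by simp
  also have "\<dots> = f (n + 1) \<cdot> (Diff X n \<cdot> x)" unfolding 1(6) using x 1(3-5) c by simp
  finally show "Diff Y n \<cdot> (f n \<cdot> x) = f (n + 1) \<cdot> (Diff X n \<cdot> x)" .
qed

lemma chmapI:
  assumes "cplx X" "cplx Y"
    "\<And>n. f n \<in> Arr A" "\<And>n. Dom A (f n) = Obj X n" "\<And>n. Cod A (f n) = Obj Y n"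
    "\<And>n. Diff Y n \<cdot> f n = f (n + 1) \<cdot> Diff X n"
  shows "chmap X f Y"
  using assms by (simp add: chmap_def)

lemma chmap_comp:
  assumes f: "chmap X f Y" and g: "chmap Y g Z"
  shows "chmap X (\<lambda>n. g n \<cdot> f n) Z"
proof -
  note [simp] = chm[OF f] chm[OF g] cpx[OF chm(1)[OF f]] cpx[OF chm(2)[OF f]] cpx[OF chm(2)[OF g]]
  show ?thesis by (rule chmapI) simp_all
qed

lemma chmap_Id:
  assumes "cplx X" shows "chmap X (\<lambda>n. Id A (Obj X n)) X"
proof -
  note [simp] = assms cpx[OF assms]
  show ?thesis by (rule chmapI) simp_all
qed

lemma chmap_add:
  assumes f: "chmap X f Y" and g: "chmap X g Y"
  shows "chmap X (\<lambda>n. f n \<oplus> g n) Y"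
proof -
  note [simp] = chm[OF f] chm[OF g] cpx[OF chm(1)[OF f]] cpx[OF chm(2)[OF f]]
  show ?thesis by (rule chmapI) simp_all
qed

lemma chmap_neg:
  assumes f: "chmap X f Y" shows "chmap X (\<lambda>n. Neg A (f n)) Y"
proof -
  note [simp] = chm[OF f] cpx[OF chm(1)[OF f]] cpx[OF chm(2)[OF f]]
  show ?thesis by (rule chmapI) simp_all
qed

lemma chmap_zero:
  assumes X: "cplx X" and Y: "cplx Y"
  shows "chmap X (\<lambda>n. Zero A (Obj X n) (Obj Y n)) Y"
proof -
  note [simp] = X Y cpx[OF X] cpx[OF Y]
  show ?thesis by (rule chmapI) simp_all
qed

definition htp :: "('a, 'b) cpx \<Rightarrow> (int \<Rightarrow> 'b) \<Rightarrow> (int \<Rightarrow> 'b) \<Rightarrow> ('a, 'b) cpx \<Rightarrow> bool" where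
  "htp X f g Y \<longleftrightarrow> (\<exists>k. (\<forall>n. k n \<in> Hom A (Obj X (n + 1)) (Obj Y n)) \<and>
     (\<forall>n. f (n + 1) = g (n + 1) \<oplus> (Diff Y n \<cdot> k n \<oplus> k (n + 1) \<cdot> Diff X (n + 1))))"

lemma htpI:
  assumes "\<And>n. k n \<in> Arr A" "\<And>n. Dom A (k n) = Obj X (n + 1)" "\<And>n. Cod A (k n) = Obj Y n"
    "\<And>n. f (n + 1) = g (n + 1) \<oplus> (Diff Y n \<cdot> k n \<oplus> k (n + 1) \<cdot> Diff X (n + 1))"
  shows "htp X f g Y"
  unfolding htp_def using assms by auto

lemma htpE:
  assumes "htp X f g Y"
  obtains k where "\<And>n. k n \<in> Arr A" "\<And>n. Dom A (k n) = Obj X (n + 1)" "\<And>n. Cod A (k n) = Obj Y n"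
    "\<And>n. f (n + 1) = g (n + 1) \<oplus> (Diff Y n \<cdot> k n \<oplus> k (n + 1) \<cdot> Diff X (n + 1))"
  using assms unfolding htp_def by auto

lemma htp_refl: assumes f: "chmap X f Y" shows "htp X f f Y"
proof -
  note [simp] = chm[OF f] cpx[OF chm(1)[OF f]] cpx[OF chm(2)[OF f]]
  show ?thesis by (rule htpI[where k = "\<lambda>n. Zero A (Obj X (n + 1)) (Obj Y n)"]) (simp_all add: add.assoc)
qed

lemma htp_sym: assumes f: "chmap X f Y" and g: "chmap X g Y" and h: "htp X f g Y" shows "htp X g f Y"
proof -
  note [simp] = chm[OF f] chm[OF g] cpx[OF chm(1)[OF f]] cpx[OF chm(2)[OF f]]
  obtain k where k [simp]: "\<And>n. k n \<in> Arr A" "\<And>n. Dom A (k n) = Obj X (n + 1)" "\<And>n. Cod A (k n) = Obj Y n"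
    and eq: "\<And>n. f (n + 1) = g (n + 1) \<oplus> (Diff Y n \<cdot> k n \<oplus> k (n + 1) \<cdot> Diff X (n + 1))"
    using htpE[OF h] by metis
  show ?thesis
  proof (rule htpI[where k = "\<lambda>n. Neg A (k n)"])
    fix n show "g (n + 1) = f (n + 1) \<oplus> (Diff Y n \<cdot> Neg A (k n) \<oplus> Neg A (k (n + 1)) \<cdot> Diff X (n + 1))"
      unfolding eq by (simp add: add.assoc Add_ac)
  qed (simp_all add: add.assoc)
qed

lemma htp_trans:
  assumes f: "chmap X f Y" and g: "chmap X g Y" and h: "chmap X h Y" and "htp X f g Y" "htp X g h Y"
  shows "htp X f h Y"
proof -
  note [simp] = chm[OF f] chm[OF g] chm[OF h] cpx[OF chm(1)[OF f]] cpx[OF chm(2)[OF f]]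
  obtain k where k [simp]: "\<And>n. k n \<in> Arr A" "\<And>n. Dom A (k n) = Obj X (n + 1)" "\<And>n. Cod A (k n) = Obj Y n"
    and eq: "\<And>n. f (n + 1) = g (n + 1) \<oplus> (Diff Y n \<cdot> k n \<oplus> k (n + 1) \<cdot> Diff X (n + 1))"
    using htpE[OF assms(4)] by metis
  obtain l where l [simp]: "\<And>n. l n \<in> Arr A" "\<And>n. Dom A (l n) = Obj X (n + 1)" "\<And>n. Cod A (l n) = Obj Y n"
    and eq': "\<And>n. g (n + 1) = h (n + 1) \<oplus> (Diff Y n \<cdot> l n \<oplus> l (n + 1) \<cdot> Diff X (n + 1))"
    using htpE[OF assms(5)] by metis
  show ?thesis
  proof (rule htpI[where k = "\<lambda>n. k n \<oplus> l n"])
    fix n show "f (n + 1) = h (n + 1) \<oplus> (Diff Y n \<cdot> (k n \<oplus> l n) \<oplus> (k (n + 1) \<oplus> l (n + 1)) \<cdot> Diff X (n + 1))"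
      unfolding eq eq' by (simp add: add.assoc Add_ac)
  qed (simp_all add: add.assoc)
qed

lemma htp_comp_right:
  assumes f: "chmap X f Y" and g: "chmap X g Y" and u: "chmap W u X" and "htp X f g Y"
  shows "htp W (\<lambda>n. f n \<cdot> u n) (\<lambda>n. g n \<cdot> u n) Y"
proof -
  note [simp] = chm[OF f] chm[OF g] chm[OF u] cpx[OF chm(1)[OF f]] cpx[OF chm(2)[OF f]] cpx[OF chm(1)[OF u]]
  obtain k where k [simp]: "\<And>n. k n \<in> Arr A" "\<And>n. Dom A (k n) = Obj X (n + 1)" "\<And>n. Cod A (k n) = Obj Y n"
    and eq: "\<And>n. f (n + 1) = g (n + 1) \<oplus> (Diff Y n \<cdot> k n \<oplus> k (n + 1) \<cdot> Diff X (n + 1))"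
    using htpE[OF assms(4)] by metis
  show ?thesis
  proof (rule htpI[where k = "\<lambda>n. k n \<cdot> u (n + 1)"])
    fix n show "f (n + 1) \<cdot> u (n + 1) = g (n + 1) \<cdot> u (n + 1) \<oplus>
       (Diff Y n \<cdot> (k n \<cdot> u (n + 1)) \<oplus> (k (n + 1) \<cdot> u (n + 1 + 1)) \<cdot> Diff W (n + 1))"
      unfolding eq using chm(6)[OF u, of "n + 1", symmetric] by (simp add: add.assoc)
  qed (simp_all add: add.assoc)
qed

lemma htp_add:
  assumes f: "chmap X f Y" and f': "chmap X f' Y" and g: "chmap X g Y" and g': "chmap X g' Y"
    and "htp X f f' Y" "htp X g g' Y"
  shows "htp X (\<lambda>n. f n \<oplus> g n) (\<lambda>n. f' n \<oplus> g' n) Y"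
proof -
  note [simp] = chm[OF f] chm[OF g] chm[OF f'] chm[OF g'] cpx[OF chm(1)[OF f]] cpx[OF chm(2)[OF f]]
  obtain k where k [simp]: "\<And>n. k n \<in> Arr A" "\<And>n. Dom A (k n) = Obj X (n + 1)" "\<And>n. Cod A (k n) = Obj Y n"
    and eq: "\<And>n. f (n + 1) = f' (n + 1) \<oplus> (Diff Y n \<cdot> k n \<oplus> k (n + 1) \<cdot> Diff X (n + 1))"
    using htpE[OF assms(5)] by metis
  obtain l where l [simp]: "\<And>n. l n \<in> Arr A" "\<And>n. Dom A (l n) = Obj X (n + 1)" "\<And>n. Cod A (l n) = Obj Y n"
    and eq': "\<And>n. g (n + 1) = g' (n + 1) \<oplus> (Diff Y n \<cdot> l n \<oplus> l (n + 1) \<cdot> Diff X (n + 1))"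
    using htpE[OF assms(6)] by metis
  show ?thesis
  proof (rule htpI[where k = "\<lambda>n. k n \<oplus> l n"])
    fix n show "f (n + 1) \<oplus> g (n + 1) = (f' (n + 1) \<oplus> g' (n + 1)) \<oplus>
        (Diff Y n \<cdot> (k n \<oplus> l n) \<oplus> (k (n + 1) \<oplus> l (n + 1)) \<cdot> Diff X (n + 1))"
      unfolding eq eq' by (simp add: add.assoc Add_ac)
  qed (simp_all add: add.assoc)
qed

definition exact_cpx :: "('a, 'b) cpx \<Rightarrow> bool" where
  "exact_cpx C \<longleftrightarrow> (\<forall>n W x. x \<in> Hom A W (Obj C (n + 1)) \<and> Diff C (n + 1) \<cdot> x = Zero A W (Obj C (n + 2)) \<longrightarrow>
     (\<exists>V e y. e \<in> Hom A V W \<and> is_epi A e \<and> y \<in> Hom A V (Obj C n) \<and> Diff C n \<cdot> y = x \<cdot> e))"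

text \<open>Up to an epimorphism, \<open>(x, y)\<close> is in the image of \<open>(x', y') \<mapsto> (d x', r x' + d' y')\<close>.\<close>

abbreviation covered :: "'b \<Rightarrow> 'b \<Rightarrow> 'b \<Rightarrow> 'a \<Rightarrow> 'a \<Rightarrow> 'a \<Rightarrow> 'b \<Rightarrow> 'b \<Rightarrow> bool" where
  "covered d r d' M N W x y \<equiv> \<exists>e x' y'. is_epi A e \<and> Cod A e = W \<and> x' \<in> Hom A (Dom A e) M \<and>
     y' \<in> Hom A (Dom A e) N \<and> d \<cdot> x' = x \<cdot> e \<and> r \<cdot> x' \<oplus> d' \<cdot> y' = y \<cdot> e"

text \<open>Exactness of the mapping cone of \<open>f\<close> in terms of generalized elements.\<close>

definition qi :: "('a, 'b) cpx \<Rightarrow> (int \<Rightarrow> 'b) \<Rightarrow> ('a, 'b) cpx \<Rightarrow> bool" where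
  "qi X f Y \<longleftrightarrow> (\<forall>n W x y. x \<in> Hom A W (Obj X (n + 2)) \<and> y \<in> Hom A W (Obj Y (n + 1)) \<and>
     Diff X (n + 2) \<cdot> x = Zero A W (Obj X (n + 3)) \<and> f (n + 2) \<cdot> x = Diff Y (n + 1) \<cdot> y \<longrightarrow>
     covered (Diff X (n + 1)) (f (n + 1)) (Diff Y n) (Obj X (n + 1)) (Obj Y n) W x y)"

lemma qiD:
  assumes "qi X f Y" "x \<in> Arr A" "Dom A x = W" "Cod A x = Obj X (n + 2)"
    "y \<in> Arr A" "Dom A y = W" "Cod A y = Obj Y (n + 1)"
    "Diff X (n + 2) \<cdot> x = Zero A W (Obj X (n + 3))" "f (n + 2) \<cdot> x = Diff Y (n + 1) \<cdot> y"
  obtains V e x' y' where "is_epi A e" "Dom A e = V" "Cod A e = W"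
    "x' \<in> Arr A" "Dom A x' = V" "Cod A x' = Obj X (n + 1)"
    "y' \<in> Arr A" "Dom A y' = V" "Cod A y' = Obj Y n"
    "Diff X (n + 1) \<cdot> x' = x \<cdot> e" "f (n + 1) \<cdot> x' \<oplus> Diff Y n \<cdot> y' = y \<cdot> e"
proof -
  have "covered (Diff X (n + 1)) (f (n + 1)) (Diff Y n) (Obj X (n + 1)) (Obj Y n) W x y"
    by (rule assms(1)[unfolded qi_def, THEN spec, THEN spec, THEN spec, THEN spec, THEN mp]) (use assms(2-) in simp)
  then show thesis by (elim exE conjE) (rule that, auto)
qed

lemma null_homotopic:
  assumes f: "chmap C f I" and ex: "exact_cpx C" and inj: "\<And>n. injective_object A (Obj I n)"
  shows "htp C f (\<lambda>n. Zero A (Obj C n) (Obj I n)) I"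
proof -
  note [simp] = chm[OF f] cpx[OF chm(1)[OF f]] cpx[OF chm(2)[OF f]]
  obtain N where N: "\<And>n. n < N \<Longrightarrow> is_zero_object A (Obj C n)"
    using chm(1)[OF f] unfolding left_bounded_complex_def by blast
  define inv where "inv n k \<longleftrightarrow> k \<in> Hom A (Obj C (n + 1)) (Obj I n) \<and>
    (f (n + 1) \<oplus> Neg A (Diff I n \<cdot> k)) \<cdot> Diff C n = Zero A (Obj C n) (Obj I (n + 1))" for n k
  have step: "\<exists>k'. inv (n + 1) k' \<and> f (n + 1) = Diff I n \<cdot> k \<oplus> k' \<cdot> Diff C (n + 1)" if k: "inv n k" for n k
  proof -
    have [simp]: "k \<in> Arr A" "Dom A k = Obj C (n + 1)" "Cod A k = Obj I n"
      and z: "(f (n + 1) \<oplus> Neg A (Diff I n \<cdot> k)) \<cdot> Diff C n = Zero A (Obj C n) (Obj I (n + 1))"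
      using k by (auto simp: inv_def)
    let ?\<phi> = "f (n + 1) \<oplus> Neg A (Diff I n \<cdot> k)"
    have \<phi>: "?\<phi> \<in> Hom A (Obj C (n + 1)) (Obj I (n + 1))" by simp
    have d: "Diff C (n + 1) \<in> Hom A (Obj C (n + 1)) (Obj C (n + 2))" by (simp add: add.assoc)
    have "?\<phi> \<cdot> x = Zero A W (Obj I (n + 1))"
      if x: "x \<in> Hom A W (Obj C (n + 1))" "Diff C (n + 1) \<cdot> x = Zero A W (Obj C (n + 2))" for W x
    proof -
      obtain V e y where e: "e \<in> Hom A V W" "is_epi A e" "y \<in> Hom A V (Obj C n)" "Diff C n \<cdot> y = x \<cdot> e"
        using ex x unfolding exact_cpx_def by blast
      have "(?\<phi> \<cdot> x) \<cdot> e = ?\<phi> \<cdot> (x \<cdot> e)"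
        by (rule assoc) (use x(1) e(1) in auto)
      also have "\<dots> = (?\<phi> \<cdot> Diff C n) \<cdot> y" unfolding e(4)[symmetric]
        by (rule assoc[symmetric]) (use e(3) in auto)
      also have "\<dots> = Zero A V (Obj I (n + 1))" unfolding z using e(3) by simp
      finally have z': "(?\<phi> \<cdot> x) \<cdot> e = Zero A V (Obj I (n + 1))" .
      have "?\<phi> \<cdot> x \<in> Hom A W (Obj I (n + 1))" using Comp_Hom[OF x(1) \<phi>] .
      then show ?thesis using e(1) z' epi_Zero[OF e(2), of "?\<phi> \<cdot> x" "Obj I (n + 1)"] by simp
    qed
    then obtain k' where k': "k' \<in> Hom A (Obj C (n + 2)) (Obj I (n + 1))" "k' \<cdot> Diff C (n + 1) = ?\<phi>"
      using injective_extend[OF inj d \<phi>] by blast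
    note [simp] = k'(1)[simplified]
    have "inv (n + 1) k'"
      unfolding inv_def using k'
      by (simp add: add.assoc)
    moreover have "f (n + 1) = Diff I n \<cdot> k \<oplus> k' \<cdot> Diff C (n + 1)" unfolding k'(2) by (simp add: Add_ac)
    ultimately show ?thesis by blast
  qed
  define M where "M = N - 2"
  have "inv (M + int 0) (Zero A (Obj C (M + 1)) (Obj I M))"
  proof -
    have "is_zero_object A (Obj C M)" by (rule N) (simp add: M_def)
    then show ?thesis unfolding inv_def by (auto simp: intro!: from_zero_object)
  qed
  then have "\<exists>a. \<forall>m. inv (M + int m) (a m) \<and>
      f (M + int m + 1) = Diff I (M + int m) \<cdot> a m \<oplus> a (Suc m) \<cdot> Diff C (M + int m + 1)"
  proof (intro dependent_nat_choice)
    fix k m assume "inv (M + int m) k"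
    moreover have "M + int (Suc m) = M + int m + 1" by simp
    ultimately show "\<exists>k'. inv (M + int (Suc m)) k' \<and>
      f (M + int m + 1) = Diff I (M + int m) \<cdot> k \<oplus> k' \<cdot> Diff C (M + int m + 1)" using step by metis
  qed blast
  then obtain a where a: "\<And>m. inv (M + int m) (a m)"
    "\<And>m. f (M + int m + 1) = Diff I (M + int m) \<cdot> a m \<oplus> a (Suc m) \<cdot> Diff C (M + int m + 1)" by blast
  define k where "k n = (if n < M then Zero A (Obj C (n + 1)) (Obj I n) else a (nat (n - M)))" for n
  have kH: "k n \<in> Hom A (Obj C (n + 1)) (Obj I n)" for n
    using a(1)[of "nat (n - M)"] by (auto simp: k_def inv_def)
  then have [simp]: "k n \<in> Arr A" "Dom A (k n) = Obj C (n + 1)" "Cod A (k n) = Obj I n" for n by auto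
  show ?thesis
  proof (rule htpI[where k = k])
    fix n show "f (n + 1) = Zero A (Obj C (n + 1)) (Obj I (n + 1)) \<oplus> (Diff I n \<cdot> k n \<oplus> k (n + 1) \<cdot> Diff C (n + 1))"
    proof (cases "n < M")
      case True
      then have "is_zero_object A (Obj C (n + 1))" by (intro N) (simp add: M_def)
      then have eq: "u = v" if "u \<in> Hom A (Obj C (n + 1)) (Obj I (n + 1))" "v \<in> Hom A (Obj C (n + 1)) (Obj I (n + 1))" for u v
        using that from_zero_object[of "Obj C (n + 1)" _ "Obj I (n + 1)"] by simp metis
      show ?thesis by (rule eq) (simp_all add: add.assoc)
    next
      case False
      then have "f (n + 1) = Diff I n \<cdot> k n \<oplus> k (n + 1) \<cdot> Diff C (n + 1)"
        using a(2)[of "nat (n - M)"] by (simp add: k_def Suc_nat_eq_nat_zadd1 algebra_simps)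
      then show ?thesis by (simp add: add.assoc)
    qed
  qed simp_all
qed

lemma coneD:
  assumes "is_mapping_cone A X f Y K i j p q"
  shows "chmap X f Y" "cplx K" "biprod (Obj K n) (i n) (j n) (p n) (q n) (Obj X (n + 1)) (Obj Y n)"
    "Diff K n \<cdot> i n = Neg A (i (n + 1) \<cdot> Diff X (n + 1)) \<oplus> j (n + 1) \<cdot> f (n + 1)"
    "Diff K n \<cdot> j n = j (n + 1) \<cdot> Diff Y n"
    "p (n + 1) \<cdot> Diff K n = Neg A (Diff X (n + 1) \<cdot> p n)"
    "q (n + 1) \<cdot> Diff K n = f (n + 1) \<cdot> p n \<oplus> Diff Y n \<cdot> q n"
    "x \<in> Arr A \<Longrightarrow> Cod A x = Obj X (n + 1) \<Longrightarrow>
       Diff K n \<cdot> (i n \<cdot> x) = Neg A (i (n + 1) \<cdot> (Diff X (n + 1) \<cdot> x)) \<oplus> j (n + 1) \<cdot> (f (n + 1) \<cdot> x)"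
    "x \<in> Arr A \<Longrightarrow> Cod A x = Obj Y n \<Longrightarrow> Diff K n \<cdot> (j n \<cdot> x) = j (n + 1) \<cdot> (Diff Y n \<cdot> x)"
    "x \<in> Arr A \<Longrightarrow> Cod A x = Obj K n \<Longrightarrow> p (n + 1) \<cdot> (Diff K n \<cdot> x) = Neg A (Diff X (n + 1) \<cdot> (p n \<cdot> x))"
    "x \<in> Arr A \<Longrightarrow> Cod A x = Obj K n \<Longrightarrow>
       q (n + 1) \<cdot> (Diff K n \<cdot> x) = f (n + 1) \<cdot> (p n \<cdot> x) \<oplus> Diff Y n \<cdot> (q n \<cdot> x)"
proof -
  show f: "chmap X f Y" and "cplx K"
    and b: "biprod (Obj K n) (i n) (j n) (p n) (q n) (Obj X (n + 1)) (Obj Y n)" for n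
    using assms unfolding is_mapping_cone_def chmap_iff biproduct_iff by blast+
  have d: "Diff K n = (i (n + 1) \<cdot> Neg A (Diff X (n + 1)) \<cdot> p n) \<oplus> (j (n + 1) \<cdot> f (n + 1) \<cdot> p n)
                   \<oplus> (j (n + 1) \<cdot> Diff Y n \<cdot> q n)"
    using assms unfolding is_mapping_cone_def by blast
  note [simp] = chm[OF f] cpx[OF chm(1)[OF f]] cpx[OF chm(2)[OF f]] biprod_simps[OF b] biprod_simps[OF b[of "n + 1"], simplified]
  show "Diff K n \<cdot> i n = Neg A (i (n + 1) \<cdot> Diff X (n + 1)) \<oplus> j (n + 1) \<cdot> f (n + 1)"
    "x \<in> Arr A \<Longrightarrow> Cod A x = Obj X (n + 1) \<Longrightarrow>
       Diff K n \<cdot> (i n \<cdot> x) = Neg A (i (n + 1) \<cdot> (Diff X (n + 1) \<cdot> x)) \<oplus> j (n + 1) \<cdot> (f (n + 1) \<cdot> x)"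
    "x \<in> Arr A \<Longrightarrow> Cod A x = Obj Y n \<Longrightarrow> Diff K n \<cdot> (j n \<cdot> x) = j (n + 1) \<cdot> (Diff Y n \<cdot> x)"
    "x \<in> Arr A \<Longrightarrow> Cod A x = Obj K n \<Longrightarrow> p (n + 1) \<cdot> (Diff K n \<cdot> x) = Neg A (Diff X (n + 1) \<cdot> (p n \<cdot> x))"
    "x \<in> Arr A \<Longrightarrow> Cod A x = Obj K n \<Longrightarrow>
       q (n + 1) \<cdot> (Diff K n \<cdot> x) = f (n + 1) \<cdot> (p n \<cdot> x) \<oplus> Diff Y n \<cdot> (q n \<cdot> x)"
    "Diff K n \<cdot> j n = j (n + 1) \<cdot> Diff Y n"
    "p (n + 1) \<cdot> Diff K n = Neg A (Diff X (n + 1) \<cdot> p n)"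
    "q (n + 1) \<cdot> Diff K n = f (n + 1) \<cdot> p n \<oplus> Diff Y n \<cdot> q n"
    unfolding d by simp_all
qed

lemma ex_cone:
  assumes f: "chmap X f Y"
  obtains K i j p q where "is_mapping_cone A X f Y K i j p q"
proof -
  note [simp] = chm[OF f] cpx[OF chm(1)[OF f]] cpx[OF chm(2)[OF f]]
  have "\<exists>P i j p q. biprod P i j p q (Obj X (n + 1)) (Obj Y n)" for n
    using ex_biprod[OF cpx(1)[OF chm(1)[OF f]] cpx(1)[OF chm(2)[OF f]]] by metis
  then obtain P i j p q where b: "\<And>n. biprod (P n) (i n) (j n) (p n) (q n) (Obj X (n + 1)) (Obj Y n)" by metis
  note [simp] = biprod_simps[OF b]
  define K where "K = \<lparr>Obj = P, Diff = (\<lambda>n. (i (n + 1) \<cdot> Neg A (Diff X (n + 1)) \<cdot> p n) \<oplus> (j (n + 1) \<cdot> f (n + 1) \<cdot> p n)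
                   \<oplus> (j (n + 1) \<cdot> Diff Y n \<cdot> q n))\<rparr>"
  have "cplx K"
  proof -
    obtain N where N: "\<And>n. n < N \<Longrightarrow> is_zero_object A (Obj X n)"
      using chm(1)[OF f] unfolding left_bounded_complex_def by blast
    obtain N' where N': "\<And>n. n < N' \<Longrightarrow> is_zero_object A (Obj Y n)"
      using chm(2)[OF f] unfolding left_bounded_complex_def by blast
    have "is_zero_object A (P n)" if n: "n < min (N - 1) N'" for n
    proof -
      have "i n = Zero A (Obj X (n + 1)) (P n)" "j n = Zero A (Obj Y n) (P n)"
        using N[of "n + 1"] N'[of n] n by (auto intro!: from_zero_object)
      then have "Id A (P n) = Zero A (P n) (P n)"
        using b[of n] unfolding biprod_def by auto
      then show ?thesis by (simp add: zero_object_iff)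
    qed
    then show ?thesis unfolding left_bounded_complex_def K_def
      by (auto simp: add.assoc intro!: exI[of _ "min (N - 1) N'"])
  qed
  then have "is_mapping_cone A X f Y K i j p q"
    unfolding is_mapping_cone_def chmap_iff biproduct_iff using f b by (simp add: K_def)
  then show thesis by (rule that)
qed

lemma Add_eq_iff:
  assumes "f \<in> Arr A" "g \<in> Arr A" "h \<in> Arr A" "Dom A f = Dom A g" "Dom A g = Dom A h"
    "Cod A f = Cod A g" "Cod A g = Cod A h"
  shows "f = g \<oplus> h \<longleftrightarrow> f \<oplus> Neg A g = h"
proof
  have "(g \<oplus> h) \<oplus> Neg A g = h" using assms(1-7) by (simp add: Add_commute'[of g h])
  then show "f \<oplus> Neg A g = h" if "f = g \<oplus> h" unfolding that .
  have "g \<oplus> (f \<oplus> Neg A g) = f" using assms by (simp add: Add_left_commute[of g f])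
  then show "f = g \<oplus> h" if "f \<oplus> Neg A g = h" unfolding that ..
qed

lemma shift_cpx_simps [simp]:
  "Obj (shift_cpx A X) n = Obj X (n + 1)" "Diff (shift_cpx A X) n = Neg A (Diff X (n + 1))"
  by (simp_all add: shift_cpx_def)

lemma shift_cpx:
  assumes X: "cplx X" shows "cplx (shift_cpx A X)"
proof -
  note [simp] = cpx[OF X]
  obtain N where "\<And>n. n < N \<Longrightarrow> is_zero_object A (Obj X n)"
    using X unfolding left_bounded_complex_def by blast
  then have "\<forall>n<N - 1. is_zero_object A (Obj X (n + 1))" by simp
  then show ?thesis unfolding left_bounded_complex_def by (auto simp: add.assoc)
qed

lemma chmap_shift: assumes f: "chmap X f Y" shows "chmap (shift_cpx A X) (\<lambda>n. f (n + 1)) (shift_cpx A Y)"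
proof -
  note [simp] = chm[OF f] cpx[OF chm(1)[OF f]] cpx[OF chm(2)[OF f]] shift_cpx
  show ?thesis by (rule chmapI) simp_all
qed

lemma qiI:
  assumes "\<And>n W x y. \<lbrakk>x \<in> Arr A; Dom A x = W; Cod A x = Obj X (n + 2);
    y \<in> Arr A; Dom A y = W; Cod A y = Obj Y (n + 1);
    Diff X (n + 2) \<cdot> x = Zero A W (Obj X (n + 3)); f (n + 2) \<cdot> x = Diff Y (n + 1) \<cdot> y\<rbrakk> \<Longrightarrow>
    covered (Diff X (n + 1)) (f (n + 1)) (Diff Y n) (Obj X (n + 1)) (Obj Y n) W x y"
  shows "qi X f Y"
  unfolding qi_def using assms by simp

lemma qi_shift: assumes f: "chmap X f Y" and "qi X f Y" shows "qi (shift_cpx A X) (\<lambda>n. f (n + 1)) (shift_cpx A Y)"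
proof (rule qiI)
  note [simp] = chm[OF f] cpx[OF chm(1)[OF f]] cpx[OF chm(2)[OF f]]
  fix n W x y
  assume x [simp]: "x \<in> Arr A" "Dom A x = W" "Cod A x = Obj (shift_cpx A X) (n + 2)"
    and y [simp]: "y \<in> Arr A" "Dom A y = W" "Cod A y = Obj (shift_cpx A Y) (n + 1)"
    and dx: "Diff (shift_cpx A X) (n + 2) \<cdot> x = Zero A W (Obj (shift_cpx A X) (n + 3))"
    and xy: "f (n + 2 + 1) \<cdot> x = Diff (shift_cpx A Y) (n + 1) \<cdot> y"
  have "Neg A (Diff X (n + 3) \<cdot> x) = Zero A W (Obj X (n + 4))" using dx by (simp add: add.assoc)
  then have "Neg A (Neg A (Diff X (n + 3) \<cdot> x)) = Neg A (Zero A W (Obj X (n + 4)))" by (simp only:)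
  then have "Diff X (n + 3) \<cdot> x = Zero A W (Obj X (n + 4))" using Dom_Ob[OF x(1)] by (simp add: add.assoc)
  moreover have "f (n + 3) \<cdot> x = Diff Y (n + 2) \<cdot> Neg A y" using xy by (simp add: add.assoc)
  ultimately obtain V e x' y' where *: "is_epi A e" "Dom A e = V" "Cod A e = W"
    "x' \<in> Arr A" "Dom A x' = V" "Cod A x' = Obj X (n + 1 + 1)"
    "y' \<in> Arr A" "Dom A y' = V" "Cod A y' = Obj Y (n + 1)"
    "Diff X (n + 1 + 1) \<cdot> x' = x \<cdot> e" "f (n + 1 + 1) \<cdot> x' \<oplus> Diff Y (n + 1) \<cdot> y' = Neg A y \<cdot> e"
    by - (rule qiD[OF assms(2), of x W "n + 1" "Neg A y"], auto simp: add.assoc)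
  have eA: "e \<in> Arr A" using *(1) by simp
  have "Neg A (f (n + 1 + 1) \<cdot> x' \<oplus> Diff Y (n + 1) \<cdot> y') = y \<cdot> e"
    unfolding *(11) using *(3) eA by (simp add: add.assoc)
  then show "covered (Diff (shift_cpx A X) (n + 1)) (f (n + 1 + 1)) (Diff (shift_cpx A Y) n)
      (Obj (shift_cpx A X) (n + 1)) (Obj (shift_cpx A Y) n) W x y"
    using * by (intro exI[of _ e] exI[of _ "Neg A x'"] exI[of _ y']) (simp add: add.assoc)
qed

lemma qi_cone_exact:
  assumes c: "is_mapping_cone A X s Y K i j p q" and qi: "qi X s Y"
  shows "exact_cpx K"
  unfolding exact_cpx_def
proof (intro allI impI)
  note s = coneD(1)[OF c] and K = coneD(2)[OF c] and b = coneD(3)[OF c]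
  note [simp] = chm[OF s] cpx[OF chm(1)[OF s]] cpx[OF chm(2)[OF s]] cpx[OF K] biprod_simps[OF b]
  note d = coneD[OF c]
  fix n W w assume w: "w \<in> Hom A W (Obj K (n + 1)) \<and> Diff K (n + 1) \<cdot> w = Zero A W (Obj K (n + 2))"
  then have [simp]: "w \<in> Arr A" "Dom A w = W" "Cod A w = Obj K (n + 1)"
    and dw: "Diff K (n + 1) \<cdot> w = Zero A W (Obj K (n + 2))" by auto
  have [simp]: "W \<in> Ob A" using w Hom_Ob by blast
  have "Neg A (Diff X (n + 2) \<cdot> (p (n + 1) \<cdot> w)) = p (n + 2) \<cdot> (Diff K (n + 1) \<cdot> w)"
    using d(10)[of w "n + 1"] by (simp add: add.assoc)
  also have "\<dots> = Zero A W (Obj X (n + 3))" unfolding dw by (simp add: add.assoc)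
  finally have "Neg A (Neg A (Diff X (n + 2) \<cdot> (p (n + 1) \<cdot> w))) = Zero A W (Obj X (n + 3))"
    by (simp add: add.assoc)
  then have x: "Diff X (n + 2) \<cdot> (p (n + 1) \<cdot> w) = Zero A W (Obj X (n + 3))"
    by (simp add: add.assoc)
  have "s (n + 2) \<cdot> (p (n + 1) \<cdot> w) \<oplus> Diff Y (n + 1) \<cdot> (q (n + 1) \<cdot> w) = q (n + 2) \<cdot> (Diff K (n + 1) \<cdot> w)"
    using d(11)[of w "n + 1"] by (simp add: add.assoc)
  also have "\<dots> = Zero A W (Obj Y (n + 2))" unfolding dw by (simp add: add.assoc)
  finally have "s (n + 2) \<cdot> (p (n + 1) \<cdot> w) = Diff Y (n + 1) \<cdot> Neg A (q (n + 1) \<cdot> w)"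
    by (subst eq_iff_diff) (simp_all add: add.assoc)
  then obtain V e x' y' where [simp]: "is_epi A e" "Dom A e = V" "Cod A e = W"
    "x' \<in> Arr A" "Dom A x' = V" "Cod A x' = Obj X (n + 1)" "y' \<in> Arr A" "Dom A y' = V" "Cod A y' = Obj Y n"
    and eq: "Diff X (n + 1) \<cdot> x' = (p (n + 1) \<cdot> w) \<cdot> e"
     "s (n + 1) \<cdot> x' \<oplus> Diff Y n \<cdot> y' = Neg A (q (n + 1) \<cdot> w) \<cdot> e"
    using x by - (rule qiD[OF qi, of "p (n + 1) \<cdot> w" W n "Neg A (q (n + 1) \<cdot> w)"], auto simp: add.assoc)
  have [simp]: "e \<in> Arr A" "V \<in> Ob A" using Dom_Ob[of x'] by simp_all
  let ?w = "Neg A (i n \<cdot> x' \<oplus> j n \<cdot> y')"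
  have "Diff K n \<cdot> ?w = w \<cdot> e"
  proof (rule biprod_ext_into[OF b[of "n + 1"]])
    have "p (n + 1) \<cdot> (Diff K n \<cdot> ?w) = Diff X (n + 1) \<cdot> x'" by (subst d(10)) simp_all
    then show "p (n + 1) \<cdot> (Diff K n \<cdot> ?w) = p (n + 1) \<cdot> (w \<cdot> e)" unfolding eq(1) by simp
    have "q (n + 1) \<cdot> (Diff K n \<cdot> ?w) = Neg A (s (n + 1) \<cdot> x' \<oplus> Diff Y n \<cdot> y')" by (subst d(11)) simp_all
    then show "q (n + 1) \<cdot> (Diff K n \<cdot> ?w) = q (n + 1) \<cdot> (w \<cdot> e)" unfolding eq(2) by simp
  qed simp_all
  then show "\<exists>V e y. e \<in> Hom A V W \<and> is_epi A e \<and> y \<in> Hom A V (Obj K n) \<and> Diff K n \<cdot> y = w \<cdot> e"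
    by (intro exI[of _ V] exI[of _ e] exI[of _ ?w]) simp
qed

text \<open>The two halves of the bijectivity of [Y, I] \<rightarrow> [X, I] for a quasi-isomorphism X \<rightarrow> Y.\<close>

lemma qi_extend:
  assumes s: "chmap X s Y" and qi: "qi X s Y" and g: "chmap X g I" and inj: "\<And>n. injective_object A (Obj I n)"
  obtains h where "chmap Y h I" "htp X (\<lambda>n. h n \<cdot> s n) g I"
proof -
  obtain K i j p q where c: "is_mapping_cone A X s Y K i j p q" using ex_cone[OF s] .
  note K = coneD(2)[OF c] and b = coneD(3)[OF c] and d = coneD[OF c]
  note [simp] = chm[OF s] chm[OF g] cpx[OF chm(1)[OF s]] cpx[OF chm(2)[OF s]] cpx[OF chm(2)[OF g]] cpx[OF K]
    biprod_simps[OF b] biprod_simps[OF b[of "_ + 1"], simplified]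
  note SI = shift_cpx[OF chm(2)[OF g]]
  have \<phi>: "chmap K (\<lambda>n. g (n + 1) \<cdot> p n) (shift_cpx A I)"
  proof (rule chmapI[OF K SI])
    fix n
    have "(g (n + 1 + 1) \<cdot> p (n + 1)) \<cdot> Diff K n = g (n + 1 + 1) \<cdot> (p (n + 1) \<cdot> Diff K n)" by (simp add: add.assoc)
    then show "Diff (shift_cpx A I) n \<cdot> (g (n + 1) \<cdot> p n) = (g (n + 1 + 1) \<cdot> p (n + 1)) \<cdot> Diff K n"
      unfolding d(6) by (simp add: add.assoc)
  qed simp_all
  have "htp K (\<lambda>n. g (n + 1) \<cdot> p n) (\<lambda>n. Zero A (Obj K n) (Obj (shift_cpx A I) n)) (shift_cpx A I)"
    by (rule null_homotopic[OF \<phi> qi_cone_exact[OF c qi]]) (simp add: inj)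
  then obtain k where k: "\<And>n. k n \<in> Arr A" "\<And>n. Dom A (k n) = Obj K (n + 1)" "\<And>n. Cod A (k n) = Obj (shift_cpx A I) n"
    "\<And>n. g (n + 1 + 1) \<cdot> p (n + 1) = Zero A (Obj K (n + 1)) (Obj (shift_cpx A I) (n + 1)) \<oplus>
      (Diff (shift_cpx A I) n \<cdot> k n \<oplus> k (n + 1) \<cdot> Diff K (n + 1))"
    by (rule htpE) blast
  note [simp] = k(1,2) k(3)[simplified]
  have eq: "g (n + 2) \<cdot> p (n + 1) = Neg A (Diff I (n + 1) \<cdot> k n) \<oplus> k (n + 1) \<cdot> Diff K (n + 1)" for n
    using k(4)[of n] by (simp add: add.assoc)
  have eqi: "g (n + 2) = Neg A (Diff I (n + 1) \<cdot> (k n \<cdot> i (n + 1))) \<oplus>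
      (Neg A (k (n + 1) \<cdot> (i (n + 2) \<cdot> Diff X (n + 2))) \<oplus> k (n + 1) \<cdot> (j (n + 2) \<cdot> s (n + 2)))" for n
  proof -
    have "(g (n + 2) \<cdot> p (n + 1)) \<cdot> i (n + 1) = g (n + 2)" by (simp add: add.assoc)
    then show ?thesis unfolding eq using d(4)[of "n + 1"] by (simp add: add.assoc)
  qed
  have eqj: "Diff I (n + 1) \<cdot> (k n \<cdot> j (n + 1)) = k (n + 1) \<cdot> (j (n + 2) \<cdot> Diff Y (n + 1))" for n
  proof -
    have "(g (n + 2) \<cdot> p (n + 1)) \<cdot> j (n + 1) = Zero A (Obj Y (n + 1)) (Obj I (n + 2))" by (simp add: add.assoc)
    then have "k (n + 1) \<cdot> (j (n + 2) \<cdot> Diff Y (n + 1)) \<oplus> Neg A (Diff I (n + 1) \<cdot> (k n \<cdot> j (n + 1))) =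
        Zero A (Obj Y (n + 1)) (Obj I (n + 2))"
      unfolding eq using d(5)[of "n + 1"] by (simp add: add.assoc Add_ac)
    then show ?thesis
      using eq_iff_diff[of "k (n + 1) \<cdot> (j (n + 2) \<cdot> Diff Y (n + 1))" "Diff I (n + 1) \<cdot> (k n \<cdot> j (n + 1))"]
      by (simp add: add.assoc)
  qed
  define h where "h n = k (n - 1) \<cdot> j n" for n
  have [simp]: "h n \<in> Arr A" "Dom A (h n) = Obj Y n" "Cod A (h n) = Obj I n" for n by (simp_all add: h_def)
  have h: "chmap Y h I"
  proof (rule chmapI)
    fix n show "Diff I n \<cdot> h n = h (n + 1) \<cdot> Diff Y n"
      using eqj[of "n - 1"] by (simp add: h_def algebra_simps)
  qed simp_all
  have "htp X (\<lambda>n. h n \<cdot> s n) g I"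
  proof (rule htpI[where k = "\<lambda>n. k (n - 1) \<cdot> i n"])
    fix n
    have "g (n + 1) = Neg A (Diff I n \<cdot> (k (n - 1) \<cdot> i n)) \<oplus>
      (Neg A (k n \<cdot> (i (n + 1) \<cdot> Diff X (n + 1))) \<oplus> h (n + 1) \<cdot> s (n + 1))"
      using eqi[of "n - 1"] by (simp add: h_def algebra_simps)
    then show "h (n + 1) \<cdot> s (n + 1) =
       g (n + 1) \<oplus> (Diff I n \<cdot> (k (n - 1) \<cdot> i n) \<oplus> (k (n + 1 - 1) \<cdot> i (n + 1)) \<cdot> Diff X (n + 1))"
      by (simp add: add.assoc Add_ac)
  qed simp_all
  then show thesis using that h by blast
qed

lemma qi_htp_cancel:
  assumes s: "chmap X s Y" and qi: "qi X s Y" and h: "chmap Y h I" and h': "chmap Y h' I"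
    and inj: "\<And>n. injective_object A (Obj I n)" and ht: "htp X (\<lambda>n. h n \<cdot> s n) (\<lambda>n. h' n \<cdot> s n) I"
  shows "htp Y h h' I"
proof -
  obtain K i j p q where c: "is_mapping_cone A X s Y K i j p q" using ex_cone[OF s] .
  note K = coneD(2)[OF c] and b = coneD(3)[OF c] and d = coneD[OF c]
  note [simp] = chm[OF s] chm[OF h] chm[OF h'] cpx[OF chm(1)[OF s]] cpx[OF chm(2)[OF s]] cpx[OF chm(2)[OF h]] cpx[OF K]
    biprod_simps[OF b] biprod_simps[OF b[of "_ + 1"], simplified]
  obtain a where a [simp]: "\<And>n. a n \<in> Arr A" "\<And>n. Dom A (a n) = Obj X (n + 1)" "\<And>n. Cod A (a n) = Obj I n"
    and eq: "\<And>n. h (n + 1) \<cdot> s (n + 1) = h' (n + 1) \<cdot> s (n + 1) \<oplus> (Diff I n \<cdot> a n \<oplus> a (n + 1) \<cdot> Diff X (n + 1))"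
    using ht by (rule htpE) blast
  define \<delta> where "\<delta> n = h n \<oplus> Neg A (h' n)" for n
  have \<delta>: "chmap Y \<delta> I" unfolding \<delta>_def by (rule chmap_add[OF h chmap_neg[OF h']])
  note [simp] = chm[OF \<delta>]
  have "\<delta> (n + 1) \<cdot> s (n + 1) = h (n + 1) \<cdot> s (n + 1) \<oplus> Neg A (h' (n + 1) \<cdot> s (n + 1))" for n
    by (simp add: \<delta>_def)
  then have \<delta>s: "\<delta> (n + 1) \<cdot> s (n + 1) = Diff I n \<cdot> a n \<oplus> a (n + 1) \<cdot> Diff X (n + 1)" for n
    using eq[of n] Add_eq_iff[of "h (n + 1) \<cdot> s (n + 1)" "h' (n + 1) \<cdot> s (n + 1)"
      "Diff I n \<cdot> a n \<oplus> a (n + 1) \<cdot> Diff X (n + 1)"] by (simp add: add.assoc)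
  define \<phi> where "\<phi> n = \<delta> n \<cdot> q n \<oplus> a n \<cdot> p n" for n
  have \<phi>: "chmap K \<phi> I"
  proof (rule chmapI)
    fix n
    have e: "\<delta> (n + 1) \<cdot> (s (n + 1) \<cdot> p n) = Diff I n \<cdot> (a n \<cdot> p n) \<oplus> a (n + 1) \<cdot> (Diff X (n + 1) \<cdot> p n)"
      using arg_cong[OF \<delta>s[of n], of "\<lambda>u. u \<cdot> p n"] by (simp add: add.assoc)
    have "\<phi> (n + 1) \<cdot> Diff K n = \<delta> (n + 1) \<cdot> (q (n + 1) \<cdot> Diff K n) \<oplus> a (n + 1) \<cdot> (p (n + 1) \<cdot> Diff K n)"
      by (simp add: \<phi>_def add.assoc)
    also have "\<dots> = Diff I n \<cdot> \<phi> n"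
      unfolding d(6,7) by (simp add: e \<phi>_def add.assoc Add_ac)
    finally show "Diff I n \<cdot> \<phi> n = \<phi> (n + 1) \<cdot> Diff K n" by simp
  qed (simp_all add: \<phi>_def K)
  from null_homotopic[OF \<phi> qi_cone_exact[OF c qi] inj] obtain k where
    k [simp]: "\<And>n. k n \<in> Arr A" "\<And>n. Dom A (k n) = Obj K (n + 1)" "\<And>n. Cod A (k n) = Obj I n" and
    kz: "\<And>n. \<phi> (n + 1) = Zero A (Obj K (n + 1)) (Obj I (n + 1)) \<oplus> (Diff I n \<cdot> k n \<oplus> k (n + 1) \<cdot> Diff K (n + 1))"
    by (rule htpE) blast
  show ?thesis
  proof (rule htpI[where k = "\<lambda>n. k n \<cdot> j (n + 1)"])
    fix n
    have "\<delta> (n + 1) = \<phi> (n + 1) \<cdot> j (n + 1)" by (simp add: \<phi>_def add.assoc)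
    also have "\<dots> = Diff I n \<cdot> (k n \<cdot> j (n + 1)) \<oplus> k (n + 1) \<cdot> (j (n + 2) \<cdot> Diff Y (n + 1))"
      unfolding kz using d(5)[of "n + 1"] by (simp add: add.assoc)
    finally show "h (n + 1) = h' (n + 1) \<oplus> (Diff I n \<cdot> (k n \<cdot> j (n + 1)) \<oplus> (k (n + 1) \<cdot> j (n + 1 + 1)) \<cdot> Diff Y (n + 1))"
      by (subst Add_eq_iff) (simp_all add: \<delta>_def add.assoc)
  qed (simp_all add: add.assoc)
qed

section \<open>Resolutions and cohomology\<close>

lemma zero_injective: "is_zero_object A Z \<Longrightarrow> injective_object A Z"
  unfolding injective_object_def
proof (intro conjI allI impI)
  assume Z: "is_zero_object A Z"
  then show "Z \<in> Ob A" by simp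
  fix m f assume mf: "is_mono A m \<and> f \<in> Hom A (Dom A m) Z"
  have "f = Zero A (Dom A m) Z" by (rule to_zero_object[OF Z]) (use mf in auto)
  then show "\<exists>g\<in>Hom A (Cod A m) Z. g \<cdot> m = f"
    using mf Z by (intro bexI[of _ "Zero A (Cod A m) Z"]) auto
qed

text \<open>One step of the resolution: the new term is an injective object containing the cokernel of
  (x, y) \<mapsto> (d x, r x + d y).\<close>

lemma resolution_step:
  assumes enough: "\<And>M. M \<in> Ob A \<Longrightarrow> \<exists>m. is_mono A m \<and> Dom A m = M \<and> injective_object A (Cod A m)"
    and X: "cplx X" and d [simp]: "d \<in> Arr A"
    and r: "r \<in> Arr A" "Dom A r = Obj X n" "Cod A r = Cod A d"
  shows "\<exists>d' r'. d' \<in> Arr A \<and> Dom A d' = Cod A d \<and> r' \<in> Arr A \<and> Dom A r' = Obj X (n + 1) \<and> Cod A r' = Cod A d' \<and>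
     injective_object A (Cod A d') \<and> d' \<cdot> d = Zero A (Dom A d) (Cod A d') \<and> d' \<cdot> r = r' \<cdot> Diff X n \<and>
     (\<forall>W x y. x \<in> Hom A W (Obj X (n + 1)) \<longrightarrow> y \<in> Hom A W (Cod A d) \<longrightarrow> r' \<cdot> x = d' \<cdot> y \<longrightarrow>
        (covered (Diff X n) r d (Obj X n) (Dom A d) W x y))"
proof -
  note [simp] = cpx[OF X] r
  obtain B i0 j0 p0 q0 where b0: "biprod B i0 j0 p0 q0 (Obj X n) (Dom A d)"
    using ex_biprod[OF cpx(1)[OF X] Dom_Ob[OF d]] .
  obtain P i1 j1 p1 q1 where b1: "biprod P i1 j1 p1 q1 (Obj X (n + 1)) (Cod A d)"
    using ex_biprod[OF cpx(1)[OF X] Cod_Ob[OF d]] .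
  note [simp] = biprod_simps[OF b0] biprod_simps[OF b1]
  define D where "D = i1 \<cdot> (Diff X n \<cdot> p0) \<oplus> j1 \<cdot> (r \<cdot> p0 \<oplus> d \<cdot> q0)"
  have D [simp]: "D \<in> Arr A" "Dom A D = B" "Cod A D = P" by (simp_all add: D_def)
  have Di: "D \<cdot> i0 = i1 \<cdot> Diff X n \<oplus> j1 \<cdot> r" and Dj: "D \<cdot> j0 = j1 \<cdot> d"
    and pD: "p1 \<cdot> D = Diff X n \<cdot> p0" and qD: "q1 \<cdot> D = r \<cdot> p0 \<oplus> d \<cdot> q0"
    by (simp_all add: D_def)
  obtain c where c: "is_cokernel A c D" using ex_cokernel[OF D(1)] by blast
  note cD = cokernelD[OF c]
  obtain m where m: "is_mono A m" "Dom A m = Cod A c" "injective_object A (Cod A m)"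
    using enough[of "Cod A c"] cD(2) by auto
  have [simp]: "m \<in> Arr A" "Dom A m = Cod A c" "c \<in> Arr A" "Dom A c = P" using m cD by auto
  define h where "h = m \<cdot> c"
  have [simp]: "h \<in> Arr A" "Dom A h = P" "Cod A h = Cod A m" by (simp_all add: h_def)
  have hD: "h \<cdot> D = Zero A B (Cod A m)" unfolding h_def using cD(4) by simp
  have "h \<cdot> (D \<cdot> j0) = (h \<cdot> D) \<cdot> j0" "h \<cdot> (D \<cdot> i0) = (h \<cdot> D) \<cdot> i0" by simp_all
  then have hj: "h \<cdot> (j1 \<cdot> d) = Zero A (Dom A d) (Cod A m)"
    and "h \<cdot> (i1 \<cdot> Diff X n) \<oplus> h \<cdot> (j1 \<cdot> r) = Zero A (Obj X n) (Cod A m)"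
    unfolding hD Di Dj by simp_all
  then have hi: "Neg A (h \<cdot> (j1 \<cdot> r)) = h \<cdot> (i1 \<cdot> Diff X n)"
    by (intro Neg_unique) (simp_all add: Add_commute')
  have E: "covered (Diff X n) r d (Obj X n) (Dom A d) W x y"
    if xy: "x \<in> Hom A W (Obj X (n + 1))" "y \<in> Hom A W (Cod A d)" "(h \<cdot> i1) \<cdot> x = Neg A (h \<cdot> j1) \<cdot> y" for W x y
  proof -
    note [simp] = xy(1,2)[simplified]
    let ?v = "i1 \<cdot> x \<oplus> j1 \<cdot> y"
    have "m \<cdot> (c \<cdot> ?v) = h \<cdot> (i1 \<cdot> x) \<oplus> h \<cdot> (j1 \<cdot> y)" by (simp add: h_def)
    also have "\<dots> = Zero A W (Cod A m)" using xy(3) by simp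
    finally have "c \<cdot> ?v = Zero A W (Cod A c)" using mono_Zero[OF m(1), of "c \<cdot> ?v" W] by simp
    moreover have "?v \<in> Hom A W (Cod A D)" by simp
    ultimately obtain V e z where e: "e \<in> Hom A V W" "is_epi A e" "z \<in> Hom A V (Dom A D)" "D \<cdot> z = ?v \<cdot> e"
      using exact_cover[OF c] by metis
    note [simp] = e(1,3)[simplified]
    have "Diff X n \<cdot> (p0 \<cdot> z) = (p1 \<cdot> D) \<cdot> z" unfolding pD by simp
    also have "\<dots> = p1 \<cdot> (?v \<cdot> e)" unfolding e(4)[symmetric] by simp
    also have "\<dots> = x \<cdot> e" using Hom_Ob[OF e(1)] by simp
    finally have 1: "Diff X n \<cdot> (p0 \<cdot> z) = x \<cdot> e" .
    have "r \<cdot> (p0 \<cdot> z) \<oplus> d \<cdot> (q0 \<cdot> z) = (q1 \<cdot> D) \<cdot> z" unfolding qD by simp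
    also have "\<dots> = q1 \<cdot> (?v \<cdot> e)" unfolding e(4)[symmetric] by simp
    also have "\<dots> = y \<cdot> e" using Hom_Ob[OF e(1)] by simp
    finally show ?thesis using e(2) 1
      by (intro exI[of _ e] exI[of _ "p0 \<cdot> z"] exI[of _ "q0 \<cdot> z"]) simp
  qed
  show ?thesis
    by (rule exI[of _ "Neg A (h \<cdot> j1)"], rule exI[of _ "h \<cdot> i1"], intro conjI)
      (use hj hi m(3) E in simp_all)
qed

lemma injective_resolution:
  assumes enough: "\<And>M. M \<in> Ob A \<Longrightarrow> \<exists>m. is_mono A m \<and> Dom A m = M \<and> injective_object A (Cod A m)"
    and X: "cplx X"
  obtains I r where "chmap X r I" "qi X r I" "\<And>n. injective_object A (Obj I n)"
proof -
  note [simp] = X cpx[OF X]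
  obtain N where N: "\<And>n. n < N \<Longrightarrow> is_zero_object A (Obj X n)"
    using X unfolding left_bounded_complex_def by blast
  define n0 where "n0 = N - 1"
  obtain Z where Z: "is_zero_object A Z" using ex_zero_object by blast
  have [simp]: "Z \<in> Ob A" using Z by simp
  define good where "good m s \<longleftrightarrow> fst s \<in> Arr A \<and> snd s \<in> Arr A \<and> Dom A (snd s) = Obj X (n0 + int m) \<and>
     Cod A (snd s) = Cod A (fst s) \<and> injective_object A (Cod A (fst s)) \<and> (m = 0 \<longrightarrow> fst s = Zero A Z Z)" for m s
  define nxt where "nxt m s s' \<longleftrightarrow> Dom A (fst s') = Cod A (fst s) \<and>
     fst s' \<cdot> fst s = Zero A (Dom A (fst s)) (Cod A (fst s')) \<and> fst s' \<cdot> snd s = snd s' \<cdot> Diff X (n0 + int m) \<and>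
     (\<forall>W x y. x \<in> Hom A W (Obj X (n0 + int m + 1)) \<longrightarrow> y \<in> Hom A W (Cod A (fst s)) \<longrightarrow> snd s' \<cdot> x = fst s' \<cdot> y \<longrightarrow>
        (covered (Diff X (n0 + int m)) (snd s) (fst s) (Obj X (n0 + int m)) (Dom A (fst s)) W x y))" for m s s'
  have "\<exists>s. \<forall>m. good m (s m) \<and> nxt m (s m) (s (Suc m))"
  proof (intro dependent_nat_choice)
    show "\<exists>s. good 0 s" using zero_injective[OF Z]
      by (intro exI[of _ "(Zero A Z Z, Zero A (Obj X n0) Z)"]) (simp add: good_def)
    fix s m assume g: "good m s"
    have "\<exists>d' r'. d' \<in> Arr A \<and> Dom A d' = Cod A (fst s) \<and> r' \<in> Arr A \<and> Dom A r' = Obj X (n0 + int m + 1) \<and>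
       Cod A r' = Cod A d' \<and> injective_object A (Cod A d') \<and> d' \<cdot> fst s = Zero A (Dom A (fst s)) (Cod A d') \<and>
       d' \<cdot> snd s = r' \<cdot> Diff X (n0 + int m) \<and>
       (\<forall>W x y. x \<in> Hom A W (Obj X (n0 + int m + 1)) \<longrightarrow> y \<in> Hom A W (Cod A (fst s)) \<longrightarrow> r' \<cdot> x = d' \<cdot> y \<longrightarrow>
        (covered (Diff X (n0 + int m)) (snd s) (fst s) (Obj X (n0 + int m)) (Dom A (fst s)) W x y))"
      by (rule resolution_step[OF enough X]) (use g in \<open>auto simp: good_def\<close>)
    then obtain d' r' where "d' \<in> Arr A \<and> Dom A d' = Cod A (fst s) \<and> r' \<in> Arr A \<and> Dom A r' = Obj X (n0 + int m + 1) \<and>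
       Cod A r' = Cod A d' \<and> injective_object A (Cod A d')" "nxt m s (d', r')"
      unfolding nxt_def fst_conv snd_conv by blast
    moreover have e: "n0 + int (Suc m) = n0 + int m + 1" by simp
    ultimately show "\<exists>s'. good (Suc m) s' \<and> nxt m s s'"
      unfolding good_def e by (intro exI[of _ "(d', r')"]) simp
  qed
  then obtain s where good: "\<And>m. good m (s m)" and nxt: "\<And>m. nxt m (s m) (s (Suc m))" by blast
  define J where "J n = Cod A (fst (s (nat (n - n0))))" for n
  define d where "d n = (if n < n0 then Zero A (J n) (J (n + 1)) else fst (s (Suc (nat (n - n0)))))" for n
  define r where "r n = (if n < n0 then Zero A (Obj X n) (J n) else snd (s (nat (n - n0))))" for n
  have sA [simp]: "fst (s m) \<in> Arr A" "snd (s m) \<in> Arr A" "Cod A (snd (s m)) = Cod A (fst (s m))" for m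
    using good[of m] by (auto simp: good_def)
  have s0: "fst (s 0) = Zero A Z Z" using good[of 0] by (simp add: good_def)
  have sd: "Dom A (snd (s m)) = Obj X (n0 + int m)" for m using good[of m] by (simp add: good_def)
  have dS: "Dom A (fst (s (Suc m))) = Cod A (fst (s m))" for m using nxt[of m] by (simp add: nxt_def)
  have [simp]: "J n \<in> Ob A" for n by (simp add: J_def)
  have nS: "nat (n + 1 - n0) = Suc (nat (n - n0))" if "\<not> n < n0" for n using that by simp
  have J0: "J n = Z" if "n \<le> n0" for n using that s0 by (simp add: J_def)
  have dA [simp]: "d n \<in> Arr A" "Dom A (d n) = J n" "Cod A (d n) = J (n + 1)" for n
    using nS[of n] by (simp_all add: d_def dS) (simp_all add: J_def)
  have rA [simp]: "r n \<in> Arr A" "Dom A (r n) = Obj X n" "Cod A (r n) = J n" for n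
    by (simp_all add: r_def sd) (simp_all add: J_def)
  have dd: "d (n + 1) \<cdot> d n = Zero A (J n) (J (n + 2))" for n
  proof (cases "n < n0")
    case True then show ?thesis by (simp add: d_def[of n] add.assoc)
  next
    case False
    then have "d (n + 1) = fst (s (Suc (Suc (nat (n - n0)))))" "d n = fst (s (Suc (nat (n - n0))))"
      by (simp_all add: d_def flip: nS)
    moreover have "nat (n + 2 - n0) = Suc (Suc (nat (n - n0)))" using False by simp
    ultimately show ?thesis using nxt[of "Suc (nat (n - n0))"] by (simp add: nxt_def dS J_def)
  qed
  define I where "I = \<lparr>Obj = J, Diff = d\<rparr>"
  have [simp]: "Obj I n = J n" "Diff I n = d n" for n by (simp_all add: I_def)
  have I: "cplx I"
    unfolding left_bounded_complex_def using dd J0 Z by (auto simp: intro!: exI[of _ n0])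
  have "chmap X r I"
  proof (rule chmapI[OF X I])
    fix n show "Diff I n \<cdot> r n = r (n + 1) \<cdot> Diff X n"
    proof (cases "n < n0")
      case True
      then have z: "is_zero_object A (Obj X n)" by (intro N) (simp add: n0_def)
      have "Diff I n \<cdot> r n = Zero A (Obj X n) (J (n + 1))" "r (n + 1) \<cdot> Diff X n = Zero A (Obj X n) (J (n + 1))"
        by (rule from_zero_object[OF z]; simp)+
      then show ?thesis by simp
    next
      case False
      then show ?thesis
        using nxt[of "nat (n - n0)"] nS[of n] by (simp add: nxt_def d_def r_def)
    qed
  qed simp_all
  moreover have "qi X r I"
  proof (rule qiI)
    fix n W x y
    assume x [simp]: "x \<in> Arr A" "Dom A x = W" "Cod A x = Obj X (n + 2)"
      and y [simp]: "y \<in> Arr A" "Dom A y = W" "Cod A y = Obj I (n + 1)"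
      and eq: "r (n + 2) \<cdot> x = Diff I (n + 1) \<cdot> y"
    have W: "W \<in> Ob A" using Dom_Ob[OF x(1)] by simp
    show "covered (Diff X (n + 1)) (r (n + 1)) (Diff I n) (Obj X (n + 1)) (Obj I n) W x y"
    proof (cases "n + 1 < n0")
      case True
      then have "is_zero_object A (Obj X (n + 2))" "is_zero_object A (J (n + 1))"
        using J0[of "n + 1"] Z by (auto intro: N simp: n0_def)
      then have "x = Zero A W (Obj X (n + 2))" "y = Zero A W (J (n + 1))"
        by (auto intro: to_zero_object)
      then show ?thesis using W
        by (intro exI[of _ "Id A W"] exI[of _ "Zero A W (Obj X (n + 1))"] exI[of _ "Zero A W (J n)"])
          (simp add: add.assoc)
    next
      case False
      define m where "m = nat (n + 1 - n0)"
      have m: "n0 + int m = n + 1" "n0 + int m + 1 = n + 2" using False by (auto simp: m_def)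
      have sm: "r (n + 1) = snd (s m)" "r (n + 2) = snd (s (Suc m))" "d (n + 1) = fst (s (Suc m))" "J (n + 1) = Cod A (fst (s m))"
        using False by (auto simp: r_def d_def J_def m_def nat_add_distrib nat_diff_distrib Suc_nat_eq_nat_zadd1 algebra_simps)
      have dn: "d n = fst (s m)"
      proof (cases "n < n0")
        case True
        then have "m = 0" using False by (simp add: m_def)
        then show ?thesis using True J0[of n] J0[of "n + 1"] s0 by (simp add: d_def)
      next
        case False then show ?thesis by (simp add: d_def m_def nS del: nat_diff_distrib)
      qed
      have "x \<in> Hom A W (Obj X (n + 2))" "y \<in> Hom A W (Cod A (fst (s m)))" "snd (s (Suc m)) \<cdot> x = fst (s (Suc m)) \<cdot> y"
        using eq x y sm by simp_all
      then obtain e x' y' where e: "is_epi A e" "Cod A e = W" "x' \<in> Hom A (Dom A e) (Obj X (n + 1))"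
         "y' \<in> Hom A (Dom A e) (Dom A (fst (s m)))"
         "Diff X (n + 1) \<cdot> x' = x \<cdot> e" "snd (s m) \<cdot> x' \<oplus> fst (s m) \<cdot> y' = y \<cdot> e"
        using nxt[of m] unfolding nxt_def m(1) by (simp only: add.assoc one_add_one) blast
      have "Dom A (fst (s m)) = J n" using dA(2)[of n] dn by simp
      then show ?thesis using e sm dn
        by (intro exI[of _ e] exI[of _ x'] exI[of _ y']) simp
    qed
  qed
  moreover have "injective_object A (Obj I n)" for n using good[of "nat (n - n0)"] by (simp add: J_def good_def)
  ultimately show thesis using that by blast
qed

definition coh :: "('a, 'b) cpx \<Rightarrow> int \<Rightarrow> 'b \<Rightarrow> 'b \<Rightarrow> 'b \<Rightarrow> bool" where
  "coh X n z b c \<longleftrightarrow> is_kernel A z (Diff X (n + 1)) \<and> is_cokernel A c b \<and> b \<in> Hom A (Obj X n) (Dom A z) \<and>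
     z \<in> Hom A (Dom A z) (Obj X (n + 1)) \<and> c \<in> Hom A (Dom A z) (Cod A c) \<and> z \<cdot> b = Diff X n \<and>
     Diff X (n + 1) \<cdot> z = Zero A (Dom A z) (Obj X (n + 2)) \<and> c \<cdot> b = Zero A (Obj X n) (Cod A c)"

lemma cohD:
  assumes "coh X n z b c"
  shows "is_kernel A z (Diff X (n + 1))" "is_cokernel A c b" "z \<cdot> b = Diff X n"
    "Diff X (n + 1) \<cdot> z = Zero A (Dom A z) (Obj X (n + 2))" "c \<cdot> b = Zero A (Obj X n) (Cod A c)"
    "b \<in> Arr A" "Dom A b = Obj X n" "Cod A b = Dom A z" "z \<in> Arr A" "Cod A z = Obj X (n + 1)" "c \<in> Arr A" "Dom A c = Dom A z"
  using assms by (simp_all add: coh_def)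

lemma cohI:
  assumes X: "cplx X" and c: "is_cohomology A X (n + 1) z c" obtains b where "coh X n z b c"
proof -
  note [simp] = cpx[OF X]
  obtain b where b: "is_kernel A z (Diff X (n + 1))" "b \<in> Hom A (Obj X n) (Dom A z)" "z \<cdot> b = Diff X n"
    "is_cokernel A c b" using c unfolding is_cohomology_def by auto
  show thesis using that[of b] b kernelD[OF b(1)] cokernelD[OF b(4)] by (simp add: coh_def add.assoc)
qed

lemma ex_coh:
  assumes X: "cplx X" obtains z b c where "is_cohomology A X (n + 1) z c" "coh X n z b c"
proof -
  note [simp] = cpx[OF X]
  obtain z where z: "is_kernel A z (Diff X (n + 1))" using ex_kernel[of "Diff X (n + 1)"] by auto
  obtain b where b: "b \<in> Hom A (Obj X n) (Dom A z)" "z \<cdot> b = Diff X n"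
    by (rule kernel_lift[OF z, of "Diff X n" "Obj X n"]) (simp_all add: add.assoc)
  obtain c where "is_cokernel A c b" using ex_cokernel b(1) by auto
  then have "is_cohomology A X (n + 1) z c" using z b unfolding is_cohomology_def by fastforce
  then show thesis using that cohI[OF X] by blast
qed

lemma coh_lift:
  assumes "coh X n z b c" "x \<in> Hom A W (Obj X (n + 1))" "Diff X (n + 1) \<cdot> x = Zero A W (Obj X (n + 2))" and X: "cplx X"
  obtains t where "t \<in> Arr A" "Dom A t = W" "Cod A t = Dom A z" "z \<cdot> t = x"
  by (rule kernel_lift[OF cohD(1)[OF assms(1)], of x W]) (use assms(2,3) cpx[OF X] that in \<open>auto simp: add.assoc\<close>)

lemma cohomology_map:
  assumes f: "chmap X f Y" and c: "coh X n z b c" and c': "coh Y n z' b' c'"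
  obtains u h where "u \<in> Hom A (Dom A z) (Dom A z')" "z' \<cdot> u = f (n + 1) \<cdot> z"
    "h \<in> Hom A (Cod A c) (Cod A c')" "h \<cdot> c = c' \<cdot> u"
proof -
  note [simp] = chm[OF f] cpx[OF chm(1)[OF f]] cpx[OF chm(2)[OF f]] cohD(6-12)[OF c] cohD(6-12)[OF c']
  have "f (n + 1) \<cdot> z \<in> Hom A (Dom A z) (Obj Y (n + 1))" "Diff Y (n + 1) \<cdot> (f (n + 1) \<cdot> z) = Zero A (Dom A z) (Obj Y (n + 2))"
    using cohD(4)[OF c] by (simp_all add: add.assoc)
  then obtain u where u [simp]: "u \<in> Arr A" "Dom A u = Dom A z" "Cod A u = Dom A z'" and zu: "z' \<cdot> u = f (n + 1) \<cdot> z"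
    using coh_lift[OF c'] by (metis chm(2)[OF f])
  have "z' \<cdot> (u \<cdot> b) = (z' \<cdot> u) \<cdot> b" by simp
  also have "\<dots> = f (n + 1) \<cdot> (z \<cdot> b)" unfolding zu by simp
  also have "\<dots> = (z' \<cdot> b') \<cdot> f n" unfolding cohD(3)[OF c] cohD(3)[OF c'] by simp
  also have "\<dots> = z' \<cdot> (b' \<cdot> f n)" by simp
  finally have ub: "u \<cdot> b = b' \<cdot> f n" by - (rule monoD[OF kernel_mono[OF cohD(1)[OF c']]], simp_all)
  have "(c' \<cdot> u) \<cdot> b = (c' \<cdot> b') \<cdot> f n" using ub by simp
  then have "(c' \<cdot> u) \<cdot> b = Zero A (Dom A b) (Cod A c')" unfolding cohD(5)[OF c'] by simp
  then obtain h where "h \<in> Hom A (Cod A c) (Cod A c')" "h \<cdot> c = c' \<cdot> u"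
    using cokernel_desc[OF cohD(2)[OF c], of "c' \<cdot> u" "Cod A c'"] by auto
  then show thesis using that[of u h] zu by simp
qed

lemma all_int_Suc: "(\<forall>n :: int. P n) \<longleftrightarrow> (\<forall>n. P (n + 1))"
  by (metis diff_add_cancel)

theorem quasi_isos_iff: "(X, f, Y) \<in> quasi_isos A \<longleftrightarrow> chmap X f Y \<and> qi X f Y"
proof
  assume "(X, f, Y) \<in> quasi_isos A"
  then have f: "chmap X f Y" and iso: "\<And>n z c z' c' u h. is_cohomology A X n z c \<Longrightarrow> is_cohomology A Y n z' c' \<Longrightarrow>
        u \<in> Hom A (Dom A z) (Dom A z') \<Longrightarrow> z' \<cdot> u = f n \<cdot> z \<Longrightarrow>
        h \<in> Hom A (Cod A c) (Cod A c') \<Longrightarrow> h \<cdot> c = c' \<cdot> u \<Longrightarrow> is_iso A h"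
    unfolding quasi_isos_def chmap_iff by blast+
  note fX = chm(1)[OF f] and fY = chm(2)[OF f]
  note [simp] = chm[OF f] cpx[OF fX] cpx[OF fY]
  have coh_iso: "\<exists>z b c z' b' c' u h. coh X n z b c \<and> coh Y n z' b' c' \<and> u \<in> Hom A (Dom A z) (Dom A z') \<and>
      z' \<cdot> u = f (n + 1) \<cdot> z \<and> is_iso A h \<and> Dom A h = Cod A c \<and> Cod A h = Cod A c' \<and> h \<cdot> c = c' \<cdot> u" for n
  proof -
    obtain z b c where c: "is_cohomology A X (n + 1) z c" "coh X n z b c" using ex_coh[OF fX] .
    obtain z' b' c' where c': "is_cohomology A Y (n + 1) z' c'" "coh Y n z' b' c'" using ex_coh[OF fY] .
    obtain u h where u: "u \<in> Hom A (Dom A z) (Dom A z')" "z' \<cdot> u = f (n + 1) \<cdot> z"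
      and h: "h \<in> Hom A (Cod A c) (Cod A c')" "h \<cdot> c = c' \<cdot> u" using cohomology_map[OF f c(2) c'(2)] .
    have "is_iso A h" using iso[OF c(1) c'(1) u h] .
    moreover have "Dom A h = Cod A c" "Cod A h = Cod A c'" using h(1) by simp_all
    ultimately show ?thesis using c(2) c'(2) u h(2) by blast
  qed
  have inj: "\<exists>e x'. is_epi A e \<and> Cod A e = W \<and> x' \<in> Hom A (Dom A e) (Obj X n) \<and> Diff X n \<cdot> x' = x \<cdot> e"
    if x: "x \<in> Hom A W (Obj X (n + 1))" "Diff X (n + 1) \<cdot> x = Zero A W (Obj X (n + 2))"
      and y: "y \<in> Hom A W (Obj Y n)" "f (n + 1) \<cdot> x = Diff Y n \<cdot> y" for n W x y
  proof -
    obtain z b c z' b' c' u h where c: "coh X n z b c" and c': "coh Y n z' b' c'"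
      and u: "u \<in> Hom A (Dom A z) (Dom A z')" "z' \<cdot> u = f (n + 1) \<cdot> z"
      and h: "is_iso A h" "Dom A h = Cod A c" "Cod A h = Cod A c'" "h \<cdot> c = c' \<cdot> u" using coh_iso[of n] by blast
    obtain t where t: "t \<in> Arr A" "Dom A t = W" "Cod A t = Dom A z" "z \<cdot> t = x" using coh_lift[OF c x fX] .
    note [simp] = cohD(6-12)[OF c] cohD(6-12)[OF c'] t(1-3) u(1)[simplified] h(1-3) y(1)[simplified]
    have "z' \<cdot> (u \<cdot> t) = (z' \<cdot> u) \<cdot> t" by simp
    also have "\<dots> = f (n + 1) \<cdot> (z \<cdot> t)" unfolding u(2) by simp
    also have "\<dots> = (z' \<cdot> b') \<cdot> y" unfolding t(4) y(2) cohD(3)[OF c'] ..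
    also have "\<dots> = z' \<cdot> (b' \<cdot> y)" by simp
    finally have ut: "u \<cdot> t = b' \<cdot> y" by - (rule monoD[OF kernel_mono[OF cohD(1)[OF c']]], simp_all)
    have "h \<cdot> (c \<cdot> t) = (h \<cdot> c) \<cdot> t" by simp
    also have "\<dots> = (c' \<cdot> b') \<cdot> y" unfolding h(4) using ut by simp
    also have "\<dots> = Zero A W (Cod A h)" unfolding cohD(5)[OF c'] by simp
    finally have "c \<cdot> t = Zero A W (Dom A h)" by - (rule mono_Zero[OF iso_is_mono[OF h(1)]], simp_all)
    then obtain V e y' where e: "e \<in> Hom A V W" "is_epi A e" "y' \<in> Hom A V (Dom A b)" "b \<cdot> y' = t \<cdot> e"
      using exact_cover[OF cohD(2)[OF c], of t W] by auto
    note [simp] = e(1,3)[simplified]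
    have "Diff X n \<cdot> y' = z \<cdot> (b \<cdot> y')" unfolding cohD(3)[OF c, symmetric] by simp
    also have "\<dots> = x \<cdot> e" unfolding e(4) t(4)[symmetric] by simp
    finally show ?thesis using e(2) by (intro exI[of _ e] exI[of _ y']) simp
  qed
  have surj: "\<exists>e x' y'. is_epi A e \<and> Cod A e = W \<and> x' \<in> Hom A (Dom A e) (Obj X (n + 1)) \<and> y' \<in> Hom A (Dom A e) (Obj Y n) \<and>
      Diff X (n + 1) \<cdot> x' = Zero A (Dom A e) (Obj X (n + 2)) \<and> f (n + 1) \<cdot> x' \<oplus> Diff Y n \<cdot> y' = y \<cdot> e"
    if y: "y \<in> Hom A W (Obj Y (n + 1))" "Diff Y (n + 1) \<cdot> y = Zero A W (Obj Y (n + 2))" for n W y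
  proof -
    obtain z b c z' b' c' u h where c: "coh X n z b c" and c': "coh Y n z' b' c'"
      and u: "u \<in> Hom A (Dom A z) (Dom A z')" "z' \<cdot> u = f (n + 1) \<cdot> z"
      and h: "is_iso A h" "Dom A h = Cod A c" "Cod A h = Cod A c'" "h \<cdot> c = c' \<cdot> u" using coh_iso[of n] by blast
    obtain t where t: "t \<in> Arr A" "Dom A t = W" "Cod A t = Dom A z'" "z' \<cdot> t = y" using coh_lift[OF c' y fY] .
    note [simp] = cohD(6-12)[OF c] cohD(6-12)[OF c'] t(1-3) u(1)[simplified] h(1-3) y(1)[simplified]
    have "inv_arr A h \<cdot> (c' \<cdot> t) \<in> Hom A W (Cod A c)" by simp
    from epi_cover[OF cokernel_epi[OF cohD(2)[OF c]] this] obtain V e x where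
      e: "e \<in> Hom A V W" "is_epi A e" "x \<in> Hom A V (Dom A c)" "c \<cdot> x = (inv_arr A h \<cdot> (c' \<cdot> t)) \<cdot> e" by metis
    note [simp] = e(1,3)[simplified]
    have "c' \<cdot> (u \<cdot> x) = (h \<cdot> c) \<cdot> x" unfolding h(4) by simp
    also have "\<dots> = h \<cdot> (c \<cdot> x)" by simp
    also have "\<dots> = c' \<cdot> (t \<cdot> e)" unfolding e(4) by simp
    finally have cu: "c' \<cdot> (u \<cdot> x) = c' \<cdot> (t \<cdot> e)" .
    let ?w = "t \<cdot> e \<oplus> Neg A (u \<cdot> x)"
    have "c' \<cdot> ?w = Zero A V (Cod A c')" using cu by simp
    then obtain V' e' y' where e': "e' \<in> Hom A V' V" "is_epi A e'" "y' \<in> Hom A V' (Dom A b')" "b' \<cdot> y' = ?w \<cdot> e'"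
      using exact_cover[OF cohD(2)[OF c'], of ?w V] by auto
    note [simp] = e'(1,3)[simplified]
    have "f (n + 1) \<cdot> (z \<cdot> (x \<cdot> e')) = (z' \<cdot> u) \<cdot> (x \<cdot> e')" unfolding u(2) by simp
    moreover have "Diff Y n \<cdot> y' = z' \<cdot> (?w \<cdot> e')" unfolding cohD(3)[OF c', symmetric] e'(4)[symmetric] by simp
    ultimately have "f (n + 1) \<cdot> (z \<cdot> (x \<cdot> e')) \<oplus> Diff Y n \<cdot> y' = (z' \<cdot> t) \<cdot> (e \<cdot> e')"
      by (simp add: Add_left_commute[of "z' \<cdot> (u \<cdot> (x \<cdot> e'))"])
    then have 1: "f (n + 1) \<cdot> (z \<cdot> (x \<cdot> e')) \<oplus> Diff Y n \<cdot> y' = y \<cdot> (e \<cdot> e')" unfolding t(4) .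
    have "Diff X (n + 1) \<cdot> (z \<cdot> (x \<cdot> e')) = (Diff X (n + 1) \<cdot> z) \<cdot> (x \<cdot> e')" by simp
    then have 2: "Diff X (n + 1) \<cdot> (z \<cdot> (x \<cdot> e')) = Zero A V' (Obj X (n + 2))" unfolding cohD(4)[OF c] by simp
    have "is_epi A (e \<cdot> e')" using e(2) e'(2) by (intro is_epi_Comp) simp_all
    then show ?thesis using 1 2
      by (intro exI[of _ "e \<cdot> e'"] exI[of _ "z \<cdot> (x \<cdot> e')"] exI[of _ y']) simp
  qed
  have "qi X f Y"
  proof (rule qiI)
    fix n W x y
    assume x [simp]: "x \<in> Arr A" "Dom A x = W" "Cod A x = Obj X (n + 2)"
      and y [simp]: "y \<in> Arr A" "Dom A y = W" "Cod A y = Obj Y (n + 1)"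
      and dx: "Diff X (n + 2) \<cdot> x = Zero A W (Obj X (n + 3))" and eq: "f (n + 2) \<cdot> x = Diff Y (n + 1) \<cdot> y"
    have "\<exists>e x'. is_epi A e \<and> Cod A e = W \<and> x' \<in> Hom A (Dom A e) (Obj X (n + 1)) \<and> Diff X (n + 1) \<cdot> x' = x \<cdot> e"
      by (rule inj[of x W "n + 1" y]) (use dx eq in \<open>simp_all add: add.assoc\<close>)
    then obtain e x1 where e [simp]: "is_epi A e" "Cod A e = W" "x1 \<in> Arr A" "Dom A x1 = Dom A e" "Cod A x1 = Obj X (n + 1)"
      and x1: "Diff X (n + 1) \<cdot> x1 = x \<cdot> e" by auto
    have eA [simp]: "e \<in> Arr A" by simp
    let ?y = "y \<cdot> e \<oplus> Neg A (f (n + 1) \<cdot> x1)"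
    have "Diff Y (n + 1) \<cdot> ?y = (Diff Y (n + 1) \<cdot> y) \<cdot> e \<oplus> Neg A (f (n + 2) \<cdot> (Diff X (n + 1) \<cdot> x1))"
      by (simp add: add.assoc)
    also have "\<dots> = Zero A (Dom A e) (Obj Y (n + 2))" unfolding x1 eq[symmetric] by (simp add: add.assoc)
    finally have "\<exists>e' x' y'. is_epi A e' \<and> Cod A e' = Dom A e \<and> x' \<in> Hom A (Dom A e') (Obj X (n + 1)) \<and>
      y' \<in> Hom A (Dom A e') (Obj Y n) \<and> Diff X (n + 1) \<cdot> x' = Zero A (Dom A e') (Obj X (n + 2)) \<and>
      f (n + 1) \<cdot> x' \<oplus> Diff Y n \<cdot> y' = ?y \<cdot> e'"
      by (intro surj) simp_all
    then obtain e' x2 y2 where e' [simp]: "is_epi A e'" "Cod A e' = Dom A e" "x2 \<in> Arr A" "Dom A x2 = Dom A e'"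
      "Cod A x2 = Obj X (n + 1)" "y2 \<in> Arr A" "Dom A y2 = Dom A e'" "Cod A y2 = Obj Y n"
      and x2: "Diff X (n + 1) \<cdot> x2 = Zero A (Dom A e') (Obj X (n + 2))"
      and y2: "f (n + 1) \<cdot> x2 \<oplus> Diff Y n \<cdot> y2 = ?y \<cdot> e'" by auto
    have eA' [simp]: "e' \<in> Arr A" by simp
    have "f (n + 1) \<cdot> (x1 \<cdot> e' \<oplus> x2) \<oplus> Diff Y n \<cdot> y2 = f (n + 1) \<cdot> (x1 \<cdot> e') \<oplus> (f (n + 1) \<cdot> x2 \<oplus> Diff Y n \<cdot> y2)" by simp
    also have "\<dots> = y \<cdot> (e \<cdot> e')" unfolding y2 by (simp add: Add_left_commute[of "f (n + 1) \<cdot> (x1 \<cdot> e')"])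
    finally have 1: "f (n + 1) \<cdot> (x1 \<cdot> e' \<oplus> x2) \<oplus> Diff Y n \<cdot> y2 = y \<cdot> (e \<cdot> e')" .
    have "Diff X (n + 1) \<cdot> (x1 \<cdot> e' \<oplus> x2) = (Diff X (n + 1) \<cdot> x1) \<cdot> e'" using x2 by (simp add: add.assoc)
    then have 2: "Diff X (n + 1) \<cdot> (x1 \<cdot> e' \<oplus> x2) = x \<cdot> (e \<cdot> e')" unfolding x1 by simp
    have "is_epi A (e \<cdot> e')" by (intro is_epi_Comp) simp_all
    then show "covered (Diff X (n + 1)) (f (n + 1)) (Diff Y n) (Obj X (n + 1)) (Obj Y n) W x y"
      using 1 2 by (intro exI[of _ "e \<cdot> e'"] exI[of _ "x1 \<cdot> e' \<oplus> x2"] exI[of _ y2]) simp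
  qed
  then show "chmap X f Y \<and> qi X f Y" using f by blast
next
  assume "chmap X f Y \<and> qi X f Y"
  then have f: "chmap X f Y" and qi: "qi X f Y" by auto
  note fX = chm(1)[OF f] and fY = chm(2)[OF f]
  note [simp] = chm[OF f] cpx[OF fX] cpx[OF fY]
  have "is_iso A h"
    if hc: "is_cohomology A X (n + 1) z c" "is_cohomology A Y (n + 1) z' c'"
      and u: "u \<in> Hom A (Dom A z) (Dom A z')" "z' \<cdot> u = f (n + 1) \<cdot> z"
      and h: "h \<in> Hom A (Cod A c) (Cod A c')" "h \<cdot> c = c' \<cdot> u" for n z c z' c' u h
  proof (rule mono_epi_iso)
    obtain b where c: "coh X n z b c" using cohI[OF fX hc(1)] .
    obtain b' where c': "coh Y n z' b' c'" using cohI[OF fY hc(2)] .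
    note [simp] = cohD(6-12)[OF c] cohD(6-12)[OF c'] u(1)[simplified] h(1)[simplified]
    show "is_epi A h"
    proof (rule is_epiI)
      fix t assume t [simp]: "t \<in> Arr A" "Dom A t = Cod A h" and th: "t \<cdot> h = Zero A (Dom A h) (Cod A t)"
      let ?W = "Dom A z'"
      obtain V e x' y' where e [simp]: "is_epi A e" "Dom A e = V" "Cod A e = ?W"
        "x' \<in> Arr A" "Dom A x' = V" "Cod A x' = Obj X (n + 1)" "y' \<in> Arr A" "Dom A y' = V" "Cod A y' = Obj Y n"
        and eq: "Diff X (n + 1) \<cdot> x' = Zero A ?W (Obj X (n + 2)) \<cdot> e" "f (n + 1) \<cdot> x' \<oplus> Diff Y n \<cdot> y' = z' \<cdot> e"
        by (rule qiD[OF qi, of "Zero A ?W (Obj X (n + 2))" ?W n z']) (simp_all add: cohD(4)[OF c'] add.assoc)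
      have eA [simp]: "e \<in> Arr A" by simp
      obtain s where s: "s \<in> Hom A V (Dom A z)" "z \<cdot> s = x'"
        by (rule kernel_lift[OF cohD(1)[OF c], of x' V]) (use eq(1) in \<open>simp_all add: add.assoc\<close>)
      note [simp] = s(1)[simplified]
      have V [simp]: "V \<in> Ob A" using Dom_Ob[of s] by simp
      have "z' \<cdot> e = (f (n + 1) \<cdot> z) \<cdot> s \<oplus> (z' \<cdot> b') \<cdot> y'" unfolding eq(2)[symmetric] s(2)[symmetric] cohD(3)[OF c'] by simp
      also have "\<dots> = z' \<cdot> (u \<cdot> s \<oplus> b' \<cdot> y')" unfolding u(2)[symmetric] by simp
      finally have ee: "e = u \<cdot> s \<oplus> b' \<cdot> y'" by - (rule monoD[OF kernel_mono[OF cohD(1)[OF c']]], simp_all)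
      have "(t \<cdot> c') \<cdot> e = t \<cdot> ((c' \<cdot> u) \<cdot> s) \<oplus> t \<cdot> ((c' \<cdot> b') \<cdot> y')" unfolding ee by simp
      also have "\<dots> = (t \<cdot> h) \<cdot> (c \<cdot> s)" unfolding h(2)[symmetric] cohD(5)[OF c'] by simp
      also have "\<dots> = Zero A V (Cod A t)" unfolding th by simp
      finally have z1: "(t \<cdot> c') \<cdot> e = Zero A V (Cod A t)" .
      have "t \<cdot> c' = Zero A (Cod A e) (Cod A t)" by (rule epi_Zero[OF e(1)]) (use z1 in simp_all)
      then have "t \<cdot> c' = Zero A (Dom A c') (Cod A t)" by simp
      then have "t = Zero A (Cod A c') (Cod A t)" by - (rule epi_Zero[OF cokernel_epi[OF cohD(2)[OF c']]], simp_all)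
      then show "t = Zero A (Cod A h) (Cod A t)" by simp
    qed simp
    show "is_mono A h"
    proof (rule is_monoI)
      fix t assume t [simp]: "t \<in> Arr A" "Cod A t = Dom A h" and ht: "h \<cdot> t = Zero A (Dom A t) (Cod A h)"
      have "t \<in> Hom A (Dom A t) (Cod A c)" by simp
      from epi_cover[OF cokernel_epi[OF cohD(2)[OF c]] this] obtain V e x where
        e: "e \<in> Hom A V (Dom A t)" "is_epi A e" "x \<in> Hom A V (Dom A c)" "c \<cdot> x = t \<cdot> e" by metis
      note [simp] = e(1,3)[simplified]
      have V [simp]: "V \<in> Ob A" using Dom_Ob[of x] by simp
      have "c' \<cdot> (u \<cdot> x) = (h \<cdot> c) \<cdot> x" unfolding h(2) by simp
      also have "\<dots> = h \<cdot> (c \<cdot> x)" by simp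
      also have "\<dots> = (h \<cdot> t) \<cdot> e" unfolding e(4) by simp
      also have "\<dots> = Zero A V (Cod A c')" unfolding ht by simp
      finally obtain V2 e2 y where e2: "e2 \<in> Hom A V2 V" "is_epi A e2" "y \<in> Hom A V2 (Dom A b')" "b' \<cdot> y = (u \<cdot> x) \<cdot> e2"
        using exact_cover[OF cohD(2)[OF c'], of "u \<cdot> x" V] by auto
      note [simp] = e2(1,3)[simplified]
      have m: "n - 1 + 1 = n" "n - 1 + 2 = n + 1" "n - 1 + 3 = n + 2" by simp_all
      have zd: "Diff X (n + 1) \<cdot> (z \<cdot> (x \<cdot> e2)) = Zero A V2 (Obj X (n + 2))"
      proof -
        have "Diff X (n + 1) \<cdot> (z \<cdot> (x \<cdot> e2)) = (Diff X (n + 1) \<cdot> z) \<cdot> (x \<cdot> e2)" by simp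
        then show ?thesis unfolding cohD(4)[OF c] by simp
      qed
      have fz: "f (n + 1) \<cdot> (z \<cdot> (x \<cdot> e2)) = Diff Y n \<cdot> y"
      proof -
        have "f (n + 1) \<cdot> (z \<cdot> (x \<cdot> e2)) = (f (n + 1) \<cdot> z) \<cdot> (x \<cdot> e2)" by simp
        also have "\<dots> = z' \<cdot> ((u \<cdot> x) \<cdot> e2)" unfolding u(2)[symmetric] by simp
        also have "\<dots> = (z' \<cdot> b') \<cdot> y" unfolding e2(4)[symmetric] by simp
        finally show ?thesis unfolding cohD(3)[OF c'] .
      qed
      obtain V3 e3 x' where e3 [simp]: "is_epi A e3" "Dom A e3 = V3" "Cod A e3 = V2"
        "x' \<in> Arr A" "Dom A x' = V3" "Cod A x' = Obj X n" and eq: "Diff X n \<cdot> x' = (z \<cdot> (x \<cdot> e2)) \<cdot> e3"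
        using zd fz by - (rule qiD[OF qi, of "z \<cdot> (x \<cdot> e2)" V2 "n - 1" y, unfolded m], auto)
      have [simp]: "e3 \<in> Arr A" by simp
      have V3 [simp]: "V3 \<in> Ob A" using Dom_Ob[of x'] by simp
      have "z \<cdot> (b \<cdot> x') = z \<cdot> (x \<cdot> (e2 \<cdot> e3))"
      proof -
        have "z \<cdot> (b \<cdot> x') = (z \<cdot> b) \<cdot> x'" by simp
        then show ?thesis unfolding cohD(3)[OF c] eq by simp
      qed
      then have bx: "b \<cdot> x' = x \<cdot> (e2 \<cdot> e3)" by - (rule monoD[OF kernel_mono[OF cohD(1)[OF c]]], simp_all)
      have "t \<cdot> (e \<cdot> (e2 \<cdot> e3)) = (c \<cdot> x) \<cdot> (e2 \<cdot> e3)" unfolding e(4) by simp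
      also have "\<dots> = (c \<cdot> b) \<cdot> x'" using bx by simp
      also have "\<dots> = Zero A V3 (Cod A c)" unfolding cohD(5)[OF c] by simp
      finally have z3: "t \<cdot> (e \<cdot> (e2 \<cdot> e3)) = Zero A V3 (Cod A c)" .
      have "is_epi A (e \<cdot> (e2 \<cdot> e3))" using e(2) e2(2) by (intro is_epi_Comp) simp_all
      then have "t = Zero A (Cod A (e \<cdot> (e2 \<cdot> e3))) (Cod A c)" by (rule epi_Zero) (use z3 in simp_all)
      then show "t = Zero A (Dom A t) (Dom A h)" by simp
    qed simp
  qed
  then have "\<forall>n z c z' c' u h.
        is_cohomology A X n z c \<and> is_cohomology A Y n z' c' \<and>
        u \<in> Hom A (Dom A z) (Dom A z') \<and> z' \<cdot> u = f n \<cdot> z \<and>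
        h \<in> Hom A (Cod A c) (Cod A c') \<and> h \<cdot> c = c' \<cdot> u \<longrightarrow> is_iso A h"
    by (subst all_int_Suc) blast
  then show "(X, f, Y) \<in> quasi_isos A" unfolding quasi_isos_def chmap_iff using f by blast
qed

lemma biprod_zero:
  assumes b: "biprod P i j p q X Y" and z: "is_zero_object A X" "is_zero_object A Y"
  shows "is_zero_object A P"
proof -
  note [simp] = biprod_simps[OF b]
  have "i = Zero A X P" "j = Zero A Y P" by (rule from_zero_object[OF z(1)]; simp) (rule from_zero_object[OF z(2)]; simp)
  then have "Id A P = Zero A P P" using b unfolding biprod_def by auto
  then show ?thesis by (simp add: zero_object_iff)
qed

text \<open>The cylinder \<open>P\<close> is \<open>X\<close> plus the cone of its identity.\<close>

lemma ex_cylinder: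
  assumes f: "chmap X f Y" and g: "chmap X g Y" and ht: "htp X f g Y"
  obtains P w a b h where "chmap P w X" "qi P w X" "chmap X a P" "chmap X b P" "chmap P h Y"
    "\<And>n. w n \<cdot> a n = Id A (Obj X n)" "\<And>n. w n \<cdot> b n = Id A (Obj X n)"
    "\<And>n. h n \<cdot> a n = f n" "\<And>n. h n \<cdot> b n = g n"
proof -
  note X = chm(1)[OF f] and Y = chm(2)[OF f]
  note [simp] = X Y chm[OF f] chm[OF g] cpx[OF X] cpx[OF Y]
  have id: "chmap X (\<lambda>n. Id A (Obj X n)) X" by (rule chmap_Id[OF X])
  obtain K i j p q where c: "is_mapping_cone A X (\<lambda>n. Id A (Obj X n)) X K i j p q" using ex_cone[OF id] .
  note K = coneD(2)[OF c] and b = coneD(3)[OF c] and d = coneD[OF c]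
  have "qi X (\<lambda>n. Id A (Obj X n)) X"
  proof (rule qiI)
    fix n W x y
    assume "x \<in> Arr A" "Dom A x = W" "Cod A x = Obj X (n + 2)" "y \<in> Arr A" "Dom A y = W" "Cod A y = Obj X (n + 1)"
      "Id A (Obj X (n + 2)) \<cdot> x = Diff X (n + 1) \<cdot> y"
    then show "covered (Diff X (n + 1)) (Id A (Obj X (n + 1))) (Diff X n) (Obj X (n + 1)) (Obj X n) W x y"
      using Dom_Ob[of y] by (intro exI[of _ "Id A W"] exI[of _ y] exI[of _ "Zero A W (Obj X n)"]) simp
  qed
  then have ex: "exact_cpx K" by (rule qi_cone_exact[OF c])
  note [simp] = K cpx[OF K] biprod_simps[OF b] biprod_simps[OF b[of "_ + 1"], simplified]
  have "\<exists>P i j p q. biprod P i j p q (Obj X n) (Obj K n)" for n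
    using ex_biprod[OF cpx(1)[OF X] cpx(1)[OF K]] by metis
  then obtain P iS jS pS qS where bS: "\<And>n. biprod (P n) (iS n) (jS n) (pS n) (qS n) (Obj X n) (Obj K n)" by metis
  note [simp] = biprod_simps[OF bS]
  define D where "D n = iS (n + 1) \<cdot> (Diff X n \<cdot> pS n) \<oplus> jS (n + 1) \<cdot> (Diff K n \<cdot> qS n)" for n
  define Q where "Q = \<lparr>Obj = P, Diff = D\<rparr>"
  have [simp]: "Obj Q n = P n" "Diff Q n = D n" "D n \<in> Arr A" "Dom A (D n) = P n" "Cod A (D n) = P (n + 1)" for n
    by (simp_all add: Q_def D_def)
  have pD: "pS (n + 1) \<cdot> D n = Diff X n \<cdot> pS n" "qS (n + 1) \<cdot> D n = Diff K n \<cdot> qS n"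
    "D n \<cdot> iS n = iS (n + 1) \<cdot> Diff X n" "D n \<cdot> jS n = jS (n + 1) \<cdot> Diff K n" for n by (simp_all add: D_def)
  have Q: "cplx Q"
  proof -
    obtain N where N: "\<And>n. n < N \<Longrightarrow> is_zero_object A (Obj X n)"
      using X unfolding left_bounded_complex_def by blast
    obtain N' where N': "\<And>n. n < N' \<Longrightarrow> is_zero_object A (Obj K n)"
      using K unfolding left_bounded_complex_def by blast
    have "is_zero_object A (P n)" if "n < min N N'" for n using biprod_zero[OF bS] N N' that by simp
    moreover have "D (n + 1) \<cdot> D n = Zero A (P n) (P (n + 2))" for n by (simp add: D_def add.assoc)
    ultimately show ?thesis unfolding left_bounded_complex_def
      by (auto simp: intro!: exI[of _ "min N N'"])
  qed
  note [simp] = Q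
  obtain k where k [simp]: "\<And>n. k n \<in> Arr A" "\<And>n. Dom A (k n) = Obj X (n + 1)" "\<And>n. Cod A (k n) = Obj Y n"
    and eq: "\<And>n. f (n + 1) = g (n + 1) \<oplus> (Diff Y n \<cdot> k n \<oplus> k (n + 1) \<cdot> Diff X (n + 1))"
    using ht by (rule htpE) blast
  define \<delta> where "\<delta> n = f n \<oplus> Neg A (g n)" for n
  have \<delta>: "chmap X \<delta> Y" unfolding \<delta>_def by (rule chmap_add[OF f chmap_neg[OF g]])
  note [simp] = chm[OF \<delta>]
  have \<delta>e: "\<delta> (n + 1) = Diff Y n \<cdot> k n \<oplus> k (n + 1) \<cdot> Diff X (n + 1)" for n
    using eq[of n] Add_eq_iff[of "f (n + 1)" "g (n + 1)" "Diff Y n \<cdot> k n \<oplus> k (n + 1) \<cdot> Diff X (n + 1)"]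
    by (simp add: \<delta>_def add.assoc)
  define h where "h n = k n \<cdot> p n \<oplus> \<delta> n \<cdot> q n" for n
  have h: "chmap K h Y"
  proof (rule chmapI)
    fix n
    have "\<delta> (n + 1) \<cdot> p n = Diff Y n \<cdot> (k n \<cdot> p n) \<oplus> k (n + 1) \<cdot> (Diff X (n + 1) \<cdot> p n)"
      unfolding \<delta>e by (simp add: add.assoc)
    moreover have "h (n + 1) \<cdot> Diff K n = k (n + 1) \<cdot> (p (n + 1) \<cdot> Diff K n) \<oplus> \<delta> (n + 1) \<cdot> (q (n + 1) \<cdot> Diff K n)"
      by (simp add: h_def add.assoc)
    ultimately show "Diff Y n \<cdot> h n = h (n + 1) \<cdot> Diff K n"
      unfolding d(6,7) by (simp add: h_def add.assoc Add_ac)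
  qed (simp_all add: h_def)
  note [simp] = chm[OF h]
  have "chmap Q (\<lambda>n. g n \<cdot> pS n \<oplus> h n \<cdot> qS n) Y"
    by (rule chmapI) (simp_all add: D_def)
  moreover have "chmap Q pS X" by (rule chmapI) (simp_all add: pD)
  moreover have "chmap X iS Q" by (rule chmapI) (simp_all add: pD)
  moreover have "chmap X (\<lambda>n. iS n \<oplus> jS n \<cdot> j n) Q"
  proof (rule chmapI)
    fix n show "Diff Q n \<cdot> (iS n \<oplus> jS n \<cdot> j n) = (iS (n + 1) \<oplus> jS (n + 1) \<cdot> j (n + 1)) \<cdot> Diff X n"
      using d(5)[of n] by (simp add: D_def)
  qed simp_all
  moreover have "qi Q pS X"
  proof (rule qiI)
    fix n W x y
    assume x [simp]: "x \<in> Arr A" "Dom A x = W" "Cod A x = Obj Q (n + 2)" "y \<in> Arr A" "Dom A y = W" "Cod A y = Obj X (n + 1)"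
      and dx: "Diff Q (n + 2) \<cdot> x = Zero A W (Obj Q (n + 3))" and xy: "pS (n + 2) \<cdot> x = Diff X (n + 1) \<cdot> y"
    have W [simp]: "W \<in> Ob A" using Dom_Ob[OF x(1)] by simp
    have "Diff K (n + 2) \<cdot> (qS (n + 2) \<cdot> x) = (qS (n + 2 + 1) \<cdot> D (n + 2)) \<cdot> x" unfolding pD(2) by simp
    also have "\<dots> = Zero A W (Obj K (n + 3))" using dx by (simp add: add.assoc)
    finally have "Diff K (n + 1 + 1) \<cdot> (qS (n + 2) \<cdot> x) = Zero A W (Obj K (n + 1 + 2))" by (simp add: add.assoc)
    moreover have "qS (n + 2) \<cdot> x \<in> Hom A W (Obj K (n + 1 + 1))" by (simp add: add.assoc)
    ultimately obtain V e w where e: "e \<in> Hom A V W" "is_epi A e" "w \<in> Hom A V (Obj K (n + 1))"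
      "Diff K (n + 1) \<cdot> w = (qS (n + 2) \<cdot> x) \<cdot> e"
      using ex unfolding exact_cpx_def by blast
    note [simp] = e(1,3)[simplified]
    have V [simp]: "V \<in> Ob A" using Dom_Ob[of w] by simp
    let ?x = "iS (n + 1) \<cdot> (y \<cdot> e) \<oplus> jS (n + 1) \<cdot> w"
    have "D (n + 1) \<cdot> ?x = iS (n + 2) \<cdot> ((Diff X (n + 1) \<cdot> y) \<cdot> e) \<oplus> jS (n + 2) \<cdot> (Diff K (n + 1) \<cdot> w)"
      by (simp add: D_def add.assoc)
    also have "\<dots> = iS (n + 2) \<cdot> (pS (n + 2) \<cdot> (x \<cdot> e)) \<oplus> jS (n + 2) \<cdot> (qS (n + 2) \<cdot> (x \<cdot> e))"
      unfolding e(4) xy[symmetric] by simp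
    also have "\<dots> = x \<cdot> e" by (rule biprod_decompose_into[OF bS]) simp_all
    finally have "Diff Q (n + 1) \<cdot> ?x = x \<cdot> e" by simp
    then show "covered (Diff Q (n + 1)) (pS (n + 1)) (Diff X n) (Obj Q (n + 1)) (Obj X n) W x y"
      using e(2) by (intro exI[of _ e] exI[of _ ?x] exI[of _ "Zero A V (Obj X n)"]) simp
  qed
  moreover have "(g n \<cdot> pS n \<oplus> h n \<cdot> qS n) \<cdot> (iS n \<oplus> jS n \<cdot> j n) = f n" for n
    by (simp add: h_def \<delta>_def Add_left_commute[of "g n"])
  moreover have "(g n \<cdot> pS n \<oplus> h n \<cdot> qS n) \<cdot> iS n = g n" "pS n \<cdot> iS n = Id A (Obj X n)"
     "pS n \<cdot> (iS n \<oplus> jS n \<cdot> j n) = Id A (Obj X n)" for n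
    by simp_all
  ultimately show thesis
    by (intro that[of Q pS "\<lambda>n. iS n \<oplus> jS n \<cdot> j n" iS "\<lambda>n. g n \<cdot> pS n \<oplus> h n \<cdot> qS n"])
qed

lemma cone_map:
  assumes c: "is_mapping_cone A X f Y K i j p q" and c': "is_mapping_cone A X' f' Y' K' i' j' p' q'"
    and \<alpha>: "chmap X \<alpha> X'" "qi X \<alpha> X'" and \<beta>: "chmap Y \<beta> Y'" "qi Y \<beta> Y'"
    and ht: "htp X (\<lambda>n. \<beta> n \<cdot> f n) (\<lambda>n. f' n \<cdot> \<alpha> n) Y'"
  obtains \<theta> where "chmap K \<theta> K'" "qi K \<theta> K'" "\<And>n. \<theta> n \<cdot> j n = j' n \<cdot> \<beta> n" "\<And>n. p' n \<cdot> \<theta> n = \<alpha> (n + 1) \<cdot> p n"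
proof -
  note f = coneD(1)[OF c] and K = coneD(2)[OF c] and b = coneD(3)[OF c] and d = coneD[OF c]
  note f' = coneD(1)[OF c'] and K' = coneD(2)[OF c'] and b' = coneD(3)[OF c'] and d' = coneD[OF c']
  note [simp] = chm[OF f] cpx[OF chm(1)[OF f]] cpx[OF chm(2)[OF f]] K cpx[OF K] biprod_simps[OF b]
    chm[OF f'] cpx[OF chm(1)[OF f']] cpx[OF chm(2)[OF f']] K' cpx[OF K'] biprod_simps[OF b'] chm[OF \<alpha>(1)] chm[OF \<beta>(1)]
  note [simp] = biprod_simps[OF b[of "_ + 1"], simplified] biprod_simps[OF b'[of "_ + 1"], simplified]
  obtain s where s [simp]: "\<And>n. s n \<in> Arr A" "\<And>n. Dom A (s n) = Obj X (n + 1)" "\<And>n. Cod A (s n) = Obj Y' n"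
    and seq: "\<And>n. \<beta> (n + 1) \<cdot> f (n + 1) = f' (n + 1) \<cdot> \<alpha> (n + 1) \<oplus> (Diff Y' n \<cdot> s n \<oplus> s (n + 1) \<cdot> Diff X (n + 1))"
    using ht by (rule htpE) blast
  have seqx: "\<beta> (n + 1) \<cdot> (f (n + 1) \<cdot> x) =
      f' (n + 1) \<cdot> (\<alpha> (n + 1) \<cdot> x) \<oplus> (Diff Y' n \<cdot> (s n \<cdot> x) \<oplus> s (n + 1) \<cdot> (Diff X (n + 1) \<cdot> x))"
    if "x \<in> Arr A" "Cod A x = Obj X (n + 1)" for x n
    using arg_cong[OF seq[of n], of "\<lambda>u. u \<cdot> x"] that by (simp add: add.assoc)
  define \<theta> where "\<theta> n = i' n \<cdot> (\<alpha> (n + 1) \<cdot> p n) \<oplus> j' n \<cdot> (s n \<cdot> p n \<oplus> \<beta> n \<cdot> q n)" for n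
  have \<theta>A [simp]: "\<theta> n \<in> Arr A" "Dom A (\<theta> n) = Obj K n" "Cod A (\<theta> n) = Obj K' n" for n by (simp_all add: \<theta>_def)
  have p\<theta>: "p' n \<cdot> \<theta> n = \<alpha> (n + 1) \<cdot> p n" "q' n \<cdot> \<theta> n = s n \<cdot> p n \<oplus> \<beta> n \<cdot> q n" "\<theta> n \<cdot> j n = j' n \<cdot> \<beta> n" for n
    by (simp_all add: \<theta>_def)
  have \<theta>: "chmap K \<theta> K'"
  proof (rule chmapI)
    fix n
    show "Diff K' n \<cdot> \<theta> n = \<theta> (n + 1) \<cdot> Diff K n"
    proof (rule biprod_ext_into[OF b'[of "n + 1"]])
      have "p' (n + 1) \<cdot> (Diff K' n \<cdot> \<theta> n) = Neg A (Diff X' (n + 1) \<cdot> (p' n \<cdot> \<theta> n))" by (rule d'(10)) simp_all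
      moreover have "p' (n + 1) \<cdot> (\<theta> (n + 1) \<cdot> Diff K n) = (p' (n + 1) \<cdot> \<theta> (n + 1)) \<cdot> Diff K n" by simp
      moreover have "\<dots> = \<alpha> (n + 1 + 1) \<cdot> (p (n + 1) \<cdot> Diff K n)" unfolding p\<theta> by (simp add: add.assoc)
      ultimately show "p' (n + 1) \<cdot> (Diff K' n \<cdot> \<theta> n) = p' (n + 1) \<cdot> (\<theta> (n + 1) \<cdot> Diff K n)"
        unfolding p\<theta> d(6) by (simp add: add.assoc)
      have "q' (n + 1) \<cdot> (Diff K' n \<cdot> \<theta> n) = f' (n + 1) \<cdot> (p' n \<cdot> \<theta> n) \<oplus> Diff Y' n \<cdot> (q' n \<cdot> \<theta> n)" by (rule d'(11)) simp_all
      moreover have "q' (n + 1) \<cdot> (\<theta> (n + 1) \<cdot> Diff K n) = (q' (n + 1) \<cdot> \<theta> (n + 1)) \<cdot> Diff K n" by simp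
      moreover have "\<dots> = s (n + 1) \<cdot> (p (n + 1) \<cdot> Diff K n) \<oplus> \<beta> (n + 1) \<cdot> (q (n + 1) \<cdot> Diff K n)"
        unfolding p\<theta> by (simp add: add.assoc)
      ultimately show "q' (n + 1) \<cdot> (Diff K' n \<cdot> \<theta> n) = q' (n + 1) \<cdot> (\<theta> (n + 1) \<cdot> Diff K n)"
        unfolding p\<theta> d(6,7) by (simp add: seqx add.assoc Add_ac)
    qed simp_all
  qed simp_all
  have "qi K \<theta> K'"
  proof (rule qiI)
    fix n W u v
    assume u [simp]: "u \<in> Arr A" "Dom A u = W" "Cod A u = Obj K (n + 2)" "v \<in> Arr A" "Dom A v = W" "Cod A v = Obj K' (n + 1)"
      and du: "Diff K (n + 2) \<cdot> u = Zero A W (Obj K (n + 3))" and uv: "\<theta> (n + 2) \<cdot> u = Diff K' (n + 1) \<cdot> v"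
    have W [simp]: "W \<in> Ob A" using Dom_Ob[OF u(1)] by simp
    note [simp] = biprod_simps[OF b[of "n + 2"], simplified] biprod_simps[OF b'[of "n + 2"], simplified]
      biprod_simps[OF b[of "n + 3"], simplified]
    define x y x' y' where "x = p (n + 2) \<cdot> u" and "y = q (n + 2) \<cdot> u" and "x' = p' (n + 1) \<cdot> v" and "y' = q' (n + 1) \<cdot> v"
    have [simp]: "x \<in> Arr A" "Dom A x = W" "Cod A x = Obj X (n + 3)" "y \<in> Arr A" "Dom A y = W" "Cod A y = Obj Y (n + 2)"
      "x' \<in> Arr A" "Dom A x' = W" "Cod A x' = Obj X' (n + 2)" "y' \<in> Arr A" "Dom A y' = W" "Cod A y' = Obj Y' (n + 1)"
      by (simp_all add: x_def y_def x'_def y'_def add.assoc)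
    have "Neg A (Diff X (n + 3) \<cdot> x) = p (n + 3) \<cdot> (Diff K (n + 2) \<cdot> u)"
      using d(10)[of u "n + 2"] by (simp add: x_def add.assoc)
    also have "\<dots> = Zero A W (Obj X (n + 4))" unfolding du by (simp add: add.assoc)
    finally have "Neg A (Neg A (Diff X (n + 3) \<cdot> x)) = Zero A W (Obj X (n + 4))" by (simp only: Neg_Zero[OF W cpx(1)[OF chm(1)[OF f]]])
    then have dx: "Diff X (n + 3) \<cdot> x = Zero A W (Obj X (n + 4))" by (simp add: add.assoc)
    have fx: "f (n + 3) \<cdot> x \<oplus> Diff Y (n + 2) \<cdot> y = Zero A W (Obj Y (n + 3))"
    proof -
      have "f (n + 3) \<cdot> x \<oplus> Diff Y (n + 2) \<cdot> y = q (n + 3) \<cdot> (Diff K (n + 2) \<cdot> u)"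
        using d(11)[of u "n + 2"] by (simp add: x_def y_def add.assoc)
      then show ?thesis unfolding du by (simp add: add.assoc)
    qed
    have ax: "\<alpha> (n + 3) \<cdot> x = Neg A (Diff X' (n + 2) \<cdot> x')"
    proof -
      have "\<alpha> (n + 3) \<cdot> x = (\<alpha> (n + 2 + 1) \<cdot> p (n + 2)) \<cdot> u" by (simp add: x_def add.assoc)
      also have "\<dots> = p' (n + 2) \<cdot> (\<theta> (n + 2) \<cdot> u)" unfolding p\<theta>[symmetric] by simp
      also have "\<dots> = Neg A (Diff X' (n + 2) \<cdot> x')" unfolding uv using d'(10)[of v "n + 1"] by (simp add: x'_def add.assoc)
      finally show ?thesis .
    qed
    have bx: "s (n + 2) \<cdot> x \<oplus> \<beta> (n + 2) \<cdot> y = f' (n + 2) \<cdot> x' \<oplus> Diff Y' (n + 1) \<cdot> y'"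
    proof -
      have "s (n + 2) \<cdot> x \<oplus> \<beta> (n + 2) \<cdot> y = (s (n + 2) \<cdot> p (n + 2) \<oplus> \<beta> (n + 2) \<cdot> q (n + 2)) \<cdot> u"
        by (simp add: x_def y_def add.assoc)
      also have "\<dots> = q' (n + 2) \<cdot> (\<theta> (n + 2) \<cdot> u)" unfolding p\<theta>[symmetric] by simp
      also have "\<dots> = f' (n + 2) \<cdot> x' \<oplus> Diff Y' (n + 1) \<cdot> y'"
        unfolding uv using d'(11)[of v "n + 1"] by (simp add: x'_def y'_def add.assoc)
      finally show ?thesis .
    qed
    have m: "n + 1 + 1 = n + 2" "n + 1 + 2 = n + 3" "n + 1 + 3 = n + 4" by simp_all
    obtain V e x1 x1' where e [simp]: "is_epi A e" "Dom A e = V" "Cod A e = W"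
      "x1 \<in> Arr A" "Dom A x1 = V" "Cod A x1 = Obj X (n + 2)" "x1' \<in> Arr A" "Dom A x1' = V" "Cod A x1' = Obj X' (n + 1)"
      and dx1: "Diff X (n + 2) \<cdot> x1 = x \<cdot> e" and ax1: "\<alpha> (n + 2) \<cdot> x1 \<oplus> Diff X' (n + 1) \<cdot> x1' = Neg A x' \<cdot> e"
      using dx ax by - (rule qiD[OF \<alpha>(2), of x W "n + 1" "Neg A x'", unfolded m], auto)
    have [simp]: "e \<in> Arr A" by simp
    have V [simp]: "V \<in> Ob A" using Dom_Ob[of x1] by simp
    define y2 z2 where "y2 = y \<cdot> e \<oplus> f (n + 2) \<cdot> x1" and "z2 = y' \<cdot> e \<oplus> (s (n + 1) \<cdot> x1 \<oplus> Neg A (f' (n + 1) \<cdot> x1'))"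
    have [simp]: "y2 \<in> Arr A" "Dom A y2 = V" "Cod A y2 = Obj Y (n + 2)" "z2 \<in> Arr A" "Dom A z2 = V" "Cod A z2 = Obj Y' (n + 1)"
      by (simp_all add: y2_def z2_def add.assoc)
    have "Diff Y (n + 2) \<cdot> y2 = (f (n + 3) \<cdot> x \<oplus> Diff Y (n + 2) \<cdot> y) \<cdot> e"
      using dx1 by (simp add: y2_def add.assoc Add_ac)
    then have dy2: "Diff Y (n + 2) \<cdot> y2 = Zero A V (Obj Y (n + 3))" unfolding fx by (simp add: add.assoc)
    have by2: "\<beta> (n + 2) \<cdot> y2 = Diff Y' (n + 1) \<cdot> z2"
    proof -
      have "s (n + 2) \<cdot> (x \<cdot> e) \<oplus> \<beta> (n + 2) \<cdot> y2 =
         (s (n + 2) \<cdot> x \<oplus> \<beta> (n + 2) \<cdot> y) \<cdot> e \<oplus> \<beta> (n + 2) \<cdot> (f (n + 2) \<cdot> x1)"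
        by (simp add: y2_def add.assoc)
      also have "\<beta> (n + 2) \<cdot> (f (n + 2) \<cdot> x1) =
         f' (n + 2) \<cdot> (\<alpha> (n + 2) \<cdot> x1) \<oplus> (Diff Y' (n + 1) \<cdot> (s (n + 1) \<cdot> x1) \<oplus> s (n + 2) \<cdot> (x \<cdot> e))"
        using seqx[of x1 "n + 1"] dx1 by (simp add: add.assoc)
      also have "\<alpha> (n + 2) \<cdot> x1 = Neg A x' \<cdot> e \<oplus> Neg A (Diff X' (n + 1) \<cdot> x1')"
        unfolding ax1[symmetric] by (simp add: add.assoc)
      also have "(s (n + 2) \<cdot> x \<oplus> \<beta> (n + 2) \<cdot> y) \<cdot> e \<oplus>
         (f' (n + 2) \<cdot> (Neg A x' \<cdot> e \<oplus> Neg A (Diff X' (n + 1) \<cdot> x1')) \<oplus>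
         (Diff Y' (n + 1) \<cdot> (s (n + 1) \<cdot> x1) \<oplus> s (n + 2) \<cdot> (x \<cdot> e))) =
         s (n + 2) \<cdot> (x \<cdot> e) \<oplus> Diff Y' (n + 1) \<cdot> z2"
        unfolding bx by (simp add: z2_def add.assoc Add_ac)
      finally show ?thesis by - (rule Add_left_cancel[of "s (n + 2) \<cdot> (x \<cdot> e)"], simp_all add: add.assoc)
    qed
    obtain V2 e2 y3 y3' where e2 [simp]: "is_epi A e2" "Dom A e2 = V2" "Cod A e2 = V"
      "y3 \<in> Arr A" "Dom A y3 = V2" "Cod A y3 = Obj Y (n + 1)" "y3' \<in> Arr A" "Dom A y3' = V2" "Cod A y3' = Obj Y' n"
      and dy3: "Diff Y (n + 1) \<cdot> y3 = y2 \<cdot> e2" and by3: "\<beta> (n + 1) \<cdot> y3 \<oplus> Diff Y' n \<cdot> y3' = z2 \<cdot> e2"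
      using dy2 by2 by - (rule qiD[OF \<beta>(2), of y2 V n z2], auto)
    have [simp]: "e2 \<in> Arr A" by simp
    have V2 [simp]: "V2 \<in> Ob A" using Dom_Ob[of y3] by simp
    define u1 v1 where "u1 = i (n + 1) \<cdot> Neg A (x1 \<cdot> e2) \<oplus> j (n + 1) \<cdot> y3" and "v1 = i' n \<cdot> (x1' \<cdot> e2) \<oplus> j' n \<cdot> y3'"
    have [simp]: "u1 \<in> Arr A" "Dom A u1 = V2" "Cod A u1 = Obj K (n + 1)" "v1 \<in> Arr A" "Dom A v1 = V2" "Cod A v1 = Obj K' n"
      by (simp_all add: u1_def v1_def add.assoc)
    have pu: "p (n + 1) \<cdot> u1 = Neg A (x1 \<cdot> e2)" "q (n + 1) \<cdot> u1 = y3" "p' n \<cdot> v1 = x1' \<cdot> e2" "q' n \<cdot> v1 = y3'"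
      by (simp_all add: u1_def v1_def add.assoc)
    have 1: "Diff K (n + 1) \<cdot> u1 = u \<cdot> (e \<cdot> e2)"
    proof (rule biprod_ext_into[OF b[of "n + 2"]])
      have "p (n + 2) \<cdot> (Diff K (n + 1) \<cdot> u1) = (Diff X (n + 2) \<cdot> x1) \<cdot> e2"
        using d(10)[of u1 "n + 1"] pu by (simp add: add.assoc)
      then show "p (n + 2) \<cdot> (Diff K (n + 1) \<cdot> u1) = p (n + 2) \<cdot> (u \<cdot> (e \<cdot> e2))" unfolding dx1 by (simp add: x_def)
      have "q (n + 2) \<cdot> (Diff K (n + 1) \<cdot> u1) = Neg A (f (n + 2) \<cdot> (x1 \<cdot> e2)) \<oplus> Diff Y (n + 1) \<cdot> y3"
        using d(11)[of u1 "n + 1"] pu by (simp add: add.assoc)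
      then show "q (n + 2) \<cdot> (Diff K (n + 1) \<cdot> u1) = q (n + 2) \<cdot> (u \<cdot> (e \<cdot> e2))"
        unfolding dy3 by (simp add: y2_def y_def add.assoc Add_ac)
    qed (simp_all add: add.assoc)
    have 2: "\<theta> (n + 1) \<cdot> u1 \<oplus> Diff K' n \<cdot> v1 = v \<cdot> (e \<cdot> e2)"
    proof (rule biprod_ext_into[OF b'[of "n + 1"]])
      have "p' (n + 1) \<cdot> (\<theta> (n + 1) \<cdot> u1) = (p' (n + 1) \<cdot> \<theta> (n + 1)) \<cdot> u1" by simp
      also have "\<dots> = Neg A ((\<alpha> (n + 2) \<cdot> x1) \<cdot> e2)" unfolding p\<theta> using pu by (simp add: add.assoc)
      finally have "p' (n + 1) \<cdot> (\<theta> (n + 1) \<cdot> u1 \<oplus> Diff K' n \<cdot> v1) = Neg A ((\<alpha> (n + 2) \<cdot> x1 \<oplus> Diff X' (n + 1) \<cdot> x1') \<cdot> e2)"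
        using d'(10)[of v1 n] pu by (simp add: add.assoc)
      then show "p' (n + 1) \<cdot> (\<theta> (n + 1) \<cdot> u1 \<oplus> Diff K' n \<cdot> v1) = p' (n + 1) \<cdot> (v \<cdot> (e \<cdot> e2))"
        unfolding ax1 by (simp add: x'_def)
      have "q' (n + 1) \<cdot> (\<theta> (n + 1) \<cdot> u1) = (q' (n + 1) \<cdot> \<theta> (n + 1)) \<cdot> u1" by simp
      also have "\<dots> = Neg A (s (n + 1) \<cdot> (x1 \<cdot> e2)) \<oplus> \<beta> (n + 1) \<cdot> y3" unfolding p\<theta> using pu by (simp add: add.assoc)
      finally have "q' (n + 1) \<cdot> (\<theta> (n + 1) \<cdot> u1 \<oplus> Diff K' n \<cdot> v1) =
          Neg A (s (n + 1) \<cdot> (x1 \<cdot> e2)) \<oplus> f' (n + 1) \<cdot> (x1' \<cdot> e2) \<oplus> (\<beta> (n + 1) \<cdot> y3 \<oplus> Diff Y' n \<cdot> y3')"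
        using d'(11)[of v1 n] pu by (simp add: add.assoc Add_ac)
      then show "q' (n + 1) \<cdot> (\<theta> (n + 1) \<cdot> u1 \<oplus> Diff K' n \<cdot> v1) = q' (n + 1) \<cdot> (v \<cdot> (e \<cdot> e2))"
        unfolding by3 by (simp add: z2_def y'_def add.assoc Add_ac)
    qed (simp_all add: add.assoc)
    have "is_epi A (e \<cdot> e2)" by (intro is_epi_Comp) simp_all
    then show "covered (Diff K (n + 1)) (\<theta> (n + 1)) (Diff K' n) (Obj K (n + 1)) (Obj K' n) W u v"
      using 1 2 by (intro exI[of _ "e \<cdot> e2"] exI[of _ u1] exI[of _ v1]) simp
  qed
  then show thesis using that \<theta> p\<theta> by blast
qed

end

locale additive_endofunctor = abelian_category A for A :: "('o, 'm) abcat" (structure) +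
  fixes F :: "('o, 'm, 'o, 'm) fctr"
  assumes additive: "additive_functor A A F"
begin

sublocale cat_functor A A F using additive unfolding additive_functor_def by blast

lemmas FArr_Comp_simp [simp] = FArr_Comp'

lemma F_Id [simp]: "X \<in> Ob A \<Longrightarrow> FArr F (Id A X) = Id A (FOb F X)"
  by (rule FArr_Id)

lemma F_Ob [simp]: "X \<in> Ob A \<Longrightarrow> FOb F X \<in> Ob A"
  by (rule FOb_Ob)

lemma F_Add [simp]:
  assumes "f \<in> Arr A" "g \<in> Arr A" "Dom A f = Dom A g" "Cod A f = Cod A g"
  shows "FArr F (f \<oplus> g) = FArr F f \<oplus> FArr F g"
proof -
  have "is_sum_of_arrows A f g (f \<oplus> g)"
    by (rule Add_sum_of_arrows[of _ "Dom A g" "Cod A g"]) (use assms in simp_all)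
  then have "is_sum_of_arrows A (FArr F f) (FArr F g) (FArr F (f \<oplus> g))"
    using additive unfolding additive_functor_def by blast
  then show ?thesis by (rule sum_of_arrows_Add)
qed

lemma F_Zero [simp]:
  assumes "X \<in> Ob A" "Y \<in> Ob A" shows "FArr F (Zero A X Y) = Zero A (FOb F X) (FOb F Y)"
proof -
  have "FArr F (Zero A X Y) \<oplus> FArr F (Zero A X Y) = FArr F (Zero A X Y)" using assms by (simp flip: F_Add)
  then show ?thesis using idem_Zero[of "FArr F (Zero A X Y)"] assms by simp
qed

lemma F_Neg [simp]: "f \<in> Arr A \<Longrightarrow> FArr F (Neg A f) = Neg A (FArr F f)"
  by (rule Neg_unique[symmetric]) (simp_all flip: F_Add)

lemma F_zero_object: "is_zero_object A Z \<Longrightarrow> is_zero_object A (FOb F Z)"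
proof -
  assume Z: "is_zero_object A Z"
  then have "Id A Z = Zero A Z Z" using zero_object_iff zero_object_Ob by blast
  then have "FArr F (Id A Z) = FArr F (Zero A Z Z)" by (simp only:)
  then show ?thesis using Z by (simp add: zero_object_iff)
qed

lemma F_biprod:
  assumes b: "biprod P i j p q X Y"
  shows "biprod (FOb F P) (FArr F i) (FArr F j) (FArr F p) (FArr F q) (FOb F X) (FOb F Y)"
proof -
  note [simp] = biprod_simps[OF b]
  have "FArr F i \<cdot> FArr F p \<oplus> FArr F j \<cdot> FArr F q = FArr F (i \<cdot> p \<oplus> j \<cdot> q)" by simp
  also have "\<dots> = Id A (FOb F P)" using b by (simp add: biprod_def del: F_Add)
  finally show ?thesis unfolding biprod_def by (simp add: flip: FArr_Comp')
qed

abbreviation "FC \<equiv> FOb (Cplus_functor F)"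

lemma FC_simps [simp]: "Obj (FC X) n = FOb F (Obj X n)" "Diff (FC X) n = FArr F (Diff X n)"
  by (simp_all add: Cplus_functor_def Let_def)

lemma Cplus_functor_FArr: "FArr (Cplus_functor F) (X, f, Y) = (FC X, \<lambda>n. FArr F (f n), FC Y)"
  by (simp add: Cplus_functor_def Let_def)

lemma F_cpx: assumes X: "cplx X" shows "cplx (FC X)"
proof -
  note [simp] = cpx[OF X]
  have "FArr F (Diff X (n + 1)) \<cdot> FArr F (Diff X n) = Zero A (FOb F (Obj X n)) (FOb F (Obj X (n + 2)))" for n
    by (simp flip: FArr_Comp')
  moreover obtain N where "\<And>n. n < N \<Longrightarrow> is_zero_object A (Obj X n)" using X unfolding left_bounded_complex_def by blast
  ultimately show ?thesis unfolding left_bounded_complex_def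
    using F_zero_object by (auto simp: intro!: exI[of _ N])
qed

lemma F_chmap: assumes f: "chmap X f Y" shows "chmap (FC X) (\<lambda>n. FArr F (f n)) (FC Y)"
proof -
  note [simp] = chm[OF f] cpx[OF chm(1)[OF f]] cpx[OF chm(2)[OF f]]
  show ?thesis by (rule chmapI) (simp_all add: F_cpx flip: FArr_Comp')
qed

lemma F_htp:
  assumes f: "chmap X f Y" and g: "chmap X g Y" and ht: "htp X f g Y"
  shows "htp (FC X) (\<lambda>n. FArr F (f n)) (\<lambda>n. FArr F (g n)) (FC Y)"
proof -
  note [simp] = chm[OF f] chm[OF g] cpx[OF chm(1)[OF f]] cpx[OF chm(2)[OF f]]
  obtain k where [simp]: "\<And>n. k n \<in> Arr A" "\<And>n. Dom A (k n) = Obj X (n + 1)" "\<And>n. Cod A (k n) = Obj Y n"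
    and eq: "\<And>n. f (n + 1) = g (n + 1) \<oplus> (Diff Y n \<cdot> k n \<oplus> k (n + 1) \<cdot> Diff X (n + 1))"
    using ht by (rule htpE) blast
  show ?thesis by (rule htpI[where k = "\<lambda>n. FArr F (k n)"]) (simp_all add: eq add.assoc)
qed

lemma F_shift: assumes X: "cplx X" shows "FC (shift_cpx A X) = shift_cpx A (FC X)"
  using cpx[OF X] by (simp add: Cplus_functor_def Let_def shift_cpx_def)

lemma F_cone:
  assumes c: "is_mapping_cone A X f Y K i j p q"
  shows "is_mapping_cone A (FC X) (\<lambda>n. FArr F (f n)) (FC Y) (FC K)
    (\<lambda>n. FArr F (i n)) (\<lambda>n. FArr F (j n)) (\<lambda>n. FArr F (p n)) (\<lambda>n. FArr F (q n))"
proof -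
  note f = coneD(1)[OF c] and K = coneD(2)[OF c] and b = coneD(3)[OF c]
  note [simp] = chm[OF f] cpx[OF chm(1)[OF f]] cpx[OF chm(2)[OF f]] biprod_simps[OF b] biprod_simps[OF b[of "_ + 1"], simplified]
  have "Diff K n = (i (n + 1) \<cdot> Neg A (Diff X (n + 1)) \<cdot> p n) \<oplus> (j (n + 1) \<cdot> f (n + 1) \<cdot> p n)
                   \<oplus> (j (n + 1) \<cdot> Diff Y n \<cdot> q n)" for n
    using c unfolding is_mapping_cone_def by blast
  then have "FArr F (Diff K n) = (FArr F (i (n + 1)) \<cdot> Neg A (FArr F (Diff X (n + 1))) \<cdot> FArr F (p n)) \<oplus>
      (FArr F (j (n + 1)) \<cdot> FArr F (f (n + 1)) \<cdot> FArr F (p n)) \<oplus>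
      (FArr F (j (n + 1)) \<cdot> FArr F (Diff Y n) \<cdot> FArr F (q n))" for n
    by simp
  then show ?thesis
    unfolding is_mapping_cone_def chmap_iff biproduct_iff using F_chmap[OF f] F_cpx[OF K] F_biprod[OF b] by simp
qed

end

section \<open>Localization of a category\<close>

locale localized_category = category C for C :: "('o, 'm) cat" (structure) +
  fixes W :: "'m set"
  assumes W_Arr: "W \<subseteq> Arr C"
begin

abbreviation "L \<equiv> localization C W"
abbreviation "zz \<equiv> is_zigzag C W"
abbreviation "ze \<equiv> zigzag_equiv C W"
abbreviation "Q \<equiv> FArr (loc_functor C W)"

definition cl :: "'o \<Rightarrow> 'm letter list \<Rightarrow> 'o \<Rightarrow> ('o, 'm) larr" where
  "cl X a Y = (X, zigzag_class C W X a Y, Y)"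

lemma letter_Ob: "is_letter C W l X Y \<Longrightarrow> X \<in> Ob C \<and> Y \<in> Ob C"
  by (cases l) (auto dest: Hom_Ob)

lemma zz_Ob: "zz X a Y \<Longrightarrow> X \<in> Ob C \<and> Y \<in> Ob C"
  by (induction a arbitrary: X) (auto dest: letter_Ob)

lemma zz_append: "zz X (a @ b) Z \<longleftrightarrow> (\<exists>Y. zz X a Y \<and> zz Y b Z)"
  by (induction a arbitrary: X) (auto dest: zz_Ob)

lemma ze_zz: "ze X Y a b \<Longrightarrow> zz X a Y \<and> zz X b Y"
  by (induction rule: zigzag_equiv.induct) auto

lemma ze_append_left: "ze Y Z a b \<Longrightarrow> zz X c Y \<Longrightarrow> ze X Z (c @ a) (c @ b)"
proof (induction rule: zigzag_equiv.induct)
  case (zigzag_step a l b r)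
  then have "zz X ((c @ a) @ l @ b) Z" "zz X ((c @ a) @ r @ b) Z" by (auto simp: zz_append)
  from zigzag_equiv.zigzag_step[OF this zigzag_step(3)] show ?case by simp
next
  case (zigzag_trans a b c)
  then show ?case by (blast intro: zigzag_equiv.zigzag_trans)
next
  case (zigzag_refl a)
  then show ?case by (intro zigzag_equiv.zigzag_refl) (auto simp: zz_append)
qed (blast intro: zigzag_equiv.zigzag_sym)

lemma ze_append_right: "ze X Y a b \<Longrightarrow> zz Y c Z \<Longrightarrow> ze X Z (a @ c) (b @ c)"
proof (induction rule: zigzag_equiv.induct)
  case (zigzag_step a l b r)
  then have "zz X (a @ l @ (b @ c)) Z" "zz X (a @ r @ (b @ c)) Z" by (auto simp: zz_append)
  from zigzag_equiv.zigzag_step[OF this zigzag_step(3)] show ?case by simp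
next
  case (zigzag_trans a b c)
  then show ?case by (blast intro: zigzag_equiv.zigzag_trans)
next
  case (zigzag_refl a)
  then show ?case by (intro zigzag_equiv.zigzag_refl) (auto simp: zz_append)
qed (blast intro: zigzag_equiv.zigzag_sym)

lemma ze_append: "ze X Y a a' \<Longrightarrow> ze Y Z b b' \<Longrightarrow> ze X Z (a @ b) (a' @ b')"
  using ze_append_right[of X Y a a' b Z] ze_append_left[of Y Z b b' X a'] ze_zz
  by (blast intro: zigzag_equiv.zigzag_trans)

lemma class_eqI: "ze X Y a b \<Longrightarrow> zigzag_class C W X a Y = zigzag_class C W X b Y"
  unfolding zigzag_class_def by (auto intro: zigzag_equiv.zigzag_trans zigzag_equiv.zigzag_sym)

lemma cl_eq_iff: "zz X a Y \<Longrightarrow> cl X a Y = cl X b Y \<longleftrightarrow> ze X Y a b"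
proof
  assume "zz X a Y" "cl X a Y = cl X b Y"
  then have "a \<in> zigzag_class C W X b Y"
    using zigzag_equiv.zigzag_refl[of C W X a Y] unfolding cl_def zigzag_class_def by auto
  then show "ze X Y a b" unfolding zigzag_class_def by (auto intro: zigzag_equiv.zigzag_sym)
qed (simp add: cl_def class_eqI)

lemma L_simps:
  "Ob L = Ob C" "Arr L = {cl X a Y |X a Y. zz X a Y}" "Dom L (cl X a Y) = X" "Cod L (cl X a Y) = Y"
  "Id L X = cl X [] X"
  by (simp_all add: localization_def cl_def)

lemma L_comp:
  assumes "zz X a Y" "zz Y b Z" shows "cl Y b Z \<cdot>\<^bsub>L\<^esub> cl X a Y = cl X (a @ b) Z"
proof -
  have "zigzag_class C W X (a' @ b') Z = zigzag_class C W X (a @ b) Z"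
    if "a' \<in> zigzag_class C W X a Y" "b' \<in> zigzag_class C W Y b Z" for a' b'
  proof -
    have "ze X Y a a'" "ze Y Z b b'" using that unfolding zigzag_class_def by simp_all
    from class_eqI[OF zigzag_equiv.zigzag_sym[OF ze_append[OF this]]] show ?thesis .
  qed
  moreover have "a \<in> zigzag_class C W X a Y" "b \<in> zigzag_class C W Y b Z"
    using assms unfolding zigzag_class_def by (auto intro: zigzag_equiv.zigzag_refl)
  ultimately have "(\<Union>a' \<in> zigzag_class C W X a Y. \<Union>b' \<in> zigzag_class C W Y b Z. zigzag_class C W X (a' @ b') Z)
      = zigzag_class C W X (a @ b) Z" by blast
  then show ?thesis by (simp add: localization_def cl_def)
qed

lemma L_HomE:
  assumes "x \<in> Hom L X Y" obtains a where "zz X a Y" "x = cl X a Y"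
proof -
  obtain X' a Y' where a: "x = cl X' a Y'" "zz X' a Y'" using assms unfolding Hom_def L_simps(2) by blast
  moreover have "X' = X" "Y' = Y" using assms L_simps(3,4) unfolding a(1) Hom_def by simp_all
  ultimately show thesis using that by blast
qed

lemma L_HomI: "zz X a Y \<Longrightarrow> cl X a Y \<in> Hom L X Y"
  unfolding Hom_def L_simps(2) using L_simps(3,4) by blast

lemma category_L: "category L"
proof
  show "Dom L f \<in> Ob L" "Cod L f \<in> Ob L" if "f \<in> Arr L" for f
    using that by (auto simp: L_simps dest: zz_Ob)
  show "Id L X \<in> Hom L X X" if "X \<in> Ob L" for X
    using that unfolding L_simps by (intro L_HomI) simp
  show "g \<cdot>\<^bsub>L\<^esub> f \<in> Hom L X Z" if "f \<in> Hom L X Y" "g \<in> Hom L Y Z" for f g X Y Z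
    using that by (elim L_HomE) (auto simp: L_comp zz_append simp del: Hom_def intro!: L_HomI)
  show "f \<cdot>\<^bsub>L\<^esub> Id L X = f" if f: "f \<in> Hom L X Y" for f X Y
  proof -
    obtain a where a: "zz X a Y" "f = cl X a Y" using f by (rule L_HomE)
    have "zz X [] X" using zz_Ob[OF a(1)] by simp
    from L_comp[OF this a(1)] show ?thesis unfolding a(2) L_simps by simp
  qed
  show "Id L Y \<cdot>\<^bsub>L\<^esub> f = f" if f: "f \<in> Hom L X Y" for f X Y
  proof -
    obtain a where a: "zz X a Y" "f = cl X a Y" using f by (rule L_HomE)
    have "zz Y [] Y" using zz_Ob[OF a(1)] by simp
    from L_comp[OF a(1) this] show ?thesis unfolding a(2) L_simps by simp
  qed
  show "(h \<cdot>\<^bsub>L\<^esub> g) \<cdot>\<^bsub>L\<^esub> f = h \<cdot>\<^bsub>L\<^esub> (g \<cdot>\<^bsub>L\<^esub> f)" if fgh: "f \<in> Hom L V X" "g \<in> Hom L X Y" "h \<in> Hom L Y Z" for f g h V X Y Z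
  proof -
    obtain a b c where abc: "zz V a X" "zz X b Y" "zz Y c Z" "f = cl V a X" "g = cl X b Y" "h = cl Y c Z"
      using fgh by (elim L_HomE) blast
    have "zz V (a @ b) Y" "zz X (b @ c) Z" using abc by (auto simp: zz_append)
    then show ?thesis using abc by (simp add: L_comp)
  qed
qed

sublocale L: category L by (rule category_L)

lemma Q_cl: "f \<in> Hom C X Y \<Longrightarrow> Q f = cl X [Fwd f] Y"
  by (simp add: loc_functor_def cl_def)

lemma zz_Fwd: "f \<in> Hom C X Y \<Longrightarrow> zz X [Fwd f] Y"
  using Hom_Ob by auto

lemma cat_functor_Q: "cat_functor C L (loc_functor C W)"
proof (intro cat_functor.intro cat_functor_axioms.intro)
  show "category C" "category L" by unfold_locales
  show "FOb (loc_functor C W) X \<in> Ob L" if "X \<in> Ob C" for X using that by (simp add: loc_functor_def L_simps)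
  show "Q f \<in> Hom L (FOb (loc_functor C W) X) (FOb (loc_functor C W) Y)" if "f \<in> Hom C X Y" for f X Y
    using that Q_cl[OF that] L_HomI[OF zz_Fwd[OF that]] by (simp add: loc_functor_def)
  show "Q (Id C X) = Id L (FOb (loc_functor C W) X)" if "X \<in> Ob C" for X
  proof -
    have "zigzag_rel C W [Fwd (Id C X)] []" using that by (rule zigzag_rel.intros)
    then have "ze X X [Fwd (Id C X)] []"
      using zigzag_equiv.zigzag_step[of C W X "[]" "[Fwd (Id C X)]" "[]" X "[]"] that zz_Fwd[OF Id_Hom[OF that]] by simp
    then have "cl X [Fwd (Id C X)] X = cl X [] X" using cl_eq_iff[OF zz_Fwd[OF Id_Hom[OF that]]] by blast
    then show ?thesis using Q_cl[OF Id_Hom[OF that]] by (simp add: loc_functor_def L_simps)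
  qed
  show "Q (g \<cdot> f) = Q g \<cdot>\<^bsub>L\<^esub> Q f" if f: "f \<in> Hom C X Y" and g: "g \<in> Hom C Y Z" for f g X Y Z
  proof -
    have gf: "g \<cdot> f \<in> Hom C X Z" using f g by (rule Comp_Hom)
    have "zigzag_rel C W [Fwd f, Fwd g] [Fwd (g \<cdot> f)]" using f g by (rule zigzag_rel.intros)
    moreover have z: "zz X [Fwd f, Fwd g] Z" using f g Hom_Ob by auto
    ultimately have "ze X Z [Fwd f, Fwd g] [Fwd (g \<cdot> f)]"
      using zigzag_equiv.zigzag_step[of C W X "[]" "[Fwd f, Fwd g]" "[]" Z "[Fwd (g \<cdot> f)]"] zz_Fwd[OF gf] by simp
    then have "cl X [Fwd f, Fwd g] Z = cl X [Fwd (g \<cdot> f)] Z" using cl_eq_iff[OF z] by blast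
    then show ?thesis using Q_cl f g gf L_comp[OF zz_Fwd[OF f] zz_Fwd[OF g]] by simp
  qed
qed

lemma Bwd_inverse:
  assumes w: "w \<in> W" "w \<in> Hom C X Y"
  shows "cl Y [Bwd w] X \<in> Hom L Y X" "cl Y [Bwd w] X \<cdot>\<^bsub>L\<^esub> Q w = Id L X" "Q w \<cdot>\<^bsub>L\<^esub> cl Y [Bwd w] X = Id L Y"
proof -
  have Ob: "X \<in> Ob C" "Y \<in> Ob C" using w Hom_Ob by blast+
  have z: "zz Y [Bwd w] X" "zz X [Fwd w, Bwd w] X" "zz Y [Bwd w, Fwd w] Y" using w Ob by auto
  show "cl Y [Bwd w] X \<in> Hom L Y X" using L_HomI[OF z(1)] .
  have "ze X X [Fwd w, Bwd w] []"
    using zigzag_equiv.zigzag_step[of C W X "[]" "[Fwd w, Bwd w]" "[]" X "[]"] z(2) Ob zigzag_rel.intros(3)[where C = C, OF w(1)] by simp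
  then have "cl X [Fwd w, Bwd w] X = cl X [] X" using cl_eq_iff[OF z(2)] by blast
  then show "cl Y [Bwd w] X \<cdot>\<^bsub>L\<^esub> Q w = Id L X" using Q_cl[OF w(2)] L_comp[OF zz_Fwd[OF w(2)] z(1)] by (simp add: L_simps)
  have "ze Y Y [Bwd w, Fwd w] []"
    using zigzag_equiv.zigzag_step[of C W Y "[]" "[Bwd w, Fwd w]" "[]" Y "[]"] z(3) Ob zigzag_rel.intros(4)[where C = C, OF w(1)] by simp
  then have "cl Y [Bwd w, Fwd w] Y = cl Y [] Y" using cl_eq_iff[OF z(3)] by blast
  then show "Q w \<cdot>\<^bsub>L\<^esub> cl Y [Bwd w] X = Id L Y" using Q_cl[OF w(2)] L_comp[OF z(1) zz_Fwd[OF w(2)]] by (simp add: L_simps)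
qed

lemma Q_Hom: "f \<in> Hom C X Y \<Longrightarrow> Q f \<in> Hom L X Y"
  using cat_functor.FArr_Hom[OF cat_functor_Q, of f X Y] by (simp add: loc_functor_def)

lemma Q_comp: "f \<in> Hom C X Y \<Longrightarrow> g \<in> Hom C Y Z \<Longrightarrow> Q (g \<cdot> f) = Q g \<cdot>\<^bsub>L\<^esub> Q f"
  by (rule cat_functor.FArr_Comp[OF cat_functor_Q])

lemma Q_Id: "X \<in> Ob C \<Longrightarrow> Q (Id C X) = Id L X"
  using cat_functor.FArr_Id[OF cat_functor_Q, of X] by (simp add: loc_functor_def)

lemma Q_iso:
  assumes "w \<in> W" shows "is_iso L (Q w)"
proof -
  have w: "w \<in> Hom C (Dom C w) (Cod C w)" using assms W_Arr by auto
  show ?thesis by (rule L.is_isoI[OF Q_Hom[OF w] Bwd_inverse[OF assms w]])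
qed

lemma Q_full:
  assumes ext: "\<And>w g. w \<in> W \<Longrightarrow> g \<in> Hom C (Dom C w) I \<Longrightarrow> \<exists>f\<in>Hom C (Cod C w) I. Q (f \<cdot> w) = Q g"
    and x: "x \<in> Hom L X I"
  shows "\<exists>f\<in>Hom C X I. x = Q f"
proof -
  have "\<exists>f\<in>Hom C X I. Q g \<cdot>\<^bsub>L\<^esub> cl X a Y = Q f" if "zz X a Y" "g \<in> Hom C Y I" for X a Y g
    using that
  proof (induction a arbitrary: X)
    case Nil
    have "cl X [] Y = Id L Y" using Nil by (simp add: L_simps)
    then show ?case using Nil Q_Hom[OF Nil(2)] L.Comp_Id by auto
  next
    case (Cons l ls)
    then obtain V where V: "is_letter C W l X V" "zz V ls Y" by auto
    obtain f where f: "f \<in> Hom C V I" "Q g \<cdot>\<^bsub>L\<^esub> cl V ls Y = Q f" using Cons.IH[OF V(2) Cons.prems(2)] by blast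
    have zl: "zz X [l] V" using V(1) letter_Ob by auto
    have "cl X (l # ls) Y = cl V ls Y \<cdot>\<^bsub>L\<^esub> cl X [l] V" using L_comp[OF zl V(2)] by simp
    then have eq: "Q g \<cdot>\<^bsub>L\<^esub> cl X (l # ls) Y = Q f \<cdot>\<^bsub>L\<^esub> cl X [l] V"
      using L.Comp_assoc[OF L_HomI[OF zl] L_HomI[OF V(2)] Q_Hom[OF Cons.prems(2)]] f(2) by simp
    show ?case
    proof (cases l)
      case (Fwd u)
      then have u: "u \<in> Hom C X V" using V(1) by simp
      then show ?thesis using eq Fwd Q_cl[OF u] Q_comp[OF u f(1)] Comp_Hom[OF u f(1)]
        by (intro bexI[of _ "f \<cdot> u"]) simp_all
    next
      case (Bwd w)
      then have w: "w \<in> W" "w \<in> Hom C V X" using V(1) by auto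
      then obtain h where h: "h \<in> Hom C X I" "Q (h \<cdot> w) = Q f" using ext[OF w(1), of f] f(1) by auto
      have "Q f \<cdot>\<^bsub>L\<^esub> cl X [l] V = (Q h \<cdot>\<^bsub>L\<^esub> Q w) \<cdot>\<^bsub>L\<^esub> cl X [Bwd w] V"
        using h Q_comp[OF w(2) h(1)] Bwd by simp
      also have "\<dots> = Q h"
        using L.Comp_assoc[OF Bwd_inverse(1)[OF w] Q_Hom[OF w(2)] Q_Hom[OF h(1)]] Bwd_inverse(3)[OF w]
          L.Comp_Id[OF Q_Hom[OF h(1)]] by simp
      finally show ?thesis using eq h(1) by auto
    qed
  qed
  moreover obtain a where a: "zz X a I" "x = cl X a I" using x by (rule L_HomE)
  moreover have I: "I \<in> Ob C" using zz_Ob[OF a(1)] by blast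
  ultimately show ?thesis using Id_Hom[OF I] Q_Id[OF I] L.Id_Comp[OF x] by metis
qed

text \<open>A presheaf that turns the arrows in W into bijections is a presheaf on the localization; hence
  arrows that become equal there act in the same way.\<close>

lemma Q_faithful:
  fixes H :: "'o \<Rightarrow> 's set" and act :: "'m \<Rightarrow> 's \<Rightarrow> 's"
  assumes act: "\<And>f X Y p. f \<in> Hom C X Y \<Longrightarrow> p \<in> H Y \<Longrightarrow> act f p \<in> H X"
    and act_Id: "\<And>X p. X \<in> Ob C \<Longrightarrow> p \<in> H X \<Longrightarrow> act (Id C X) p = p"
    and act_comp: "\<And>f g X Y Z p. f \<in> Hom C X Y \<Longrightarrow> g \<in> Hom C Y Z \<Longrightarrow> p \<in> H Z \<Longrightarrow> act (g \<cdot> f) p = act f (act g p)"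
    and bij: "\<And>w. w \<in> W \<Longrightarrow> bij_betw (act w) (H (Cod C w)) (H (Dom C w))"
    and f: "f \<in> Hom C X Y" and g: "g \<in> Hom C X Y" and Q: "Q f = Q g" and p: "p \<in> H Y"
  shows "act f p = act g p"
proof -
  define lact where "lact l p = (case l of Fwd f \<Rightarrow> act f p | Bwd w \<Rightarrow> the_inv_into (H (Cod C w)) (act w) p)" for l p
  define zact where "zact a p = foldr lact a p" for a p
  have lact: "lact l p \<in> H X" if "is_letter C W l X Y" "p \<in> H Y" for l X Y p
  proof (cases l)
    case (Fwd f) then show ?thesis using that act by (auto simp: lact_def)
  next
    case (Bwd w)
    then have "w \<in> W" "Dom C w = Y" "Cod C w = X" using that(1) by auto
    then show ?thesis using bij_betwE[OF bij_betw_the_inv_into[OF bij, of w]] that(2) Bwd by (simp add: lact_def)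
  qed
  have zact: "zact a p \<in> H X" if "zz X a Y" "p \<in> H Y" for a X Y p
    using that by (induction a arbitrary: X) (auto simp: zact_def intro: lact)
  have zapp: "zact (a @ b) p = zact a (zact b p)" for a b p by (simp add: zact_def)
  have rel: "zact l p = zact r p" if "zigzag_rel C W l r" "zz X l Y" "p \<in> H Y" for l r X Y p
    using that
  proof (induction rule: zigzag_rel.induct)
    case (1 V) then show ?case using act_Id by (auto simp: zact_def lact_def)
  next
    case (2 f V V' g V'')
    then have "V'' = Y" by auto
    then show ?case using act_comp[OF 2(1,2)] 2(4) by (simp add: zact_def lact_def)
  next
    case (3 w)
    then have "Dom C w = Y" by auto
    then show ?case using f_the_inv_into_f_bij_betw[OF bij[OF 3(1)]] 3 by (simp add: zact_def lact_def)
  next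
    case (4 w)
    then have "Cod C w = Y" by auto
    then show ?case using the_inv_into_f_f[of "act w" "H (Cod C w)" p] bij[OF 4(1)] 4(3)
      by (simp add: zact_def lact_def bij_betw_def)
  qed
  have "zact a p = zact b p" if "ze X Y a b" "p \<in> H Y" for a b p
    using that
  proof (induction rule: zigzag_equiv.induct)
    case (zigzag_step a l b r)
    then obtain V V' where V: "zz V l V'" "zz V' b Y" by (auto simp: zz_append)
    then show ?case using rel[OF zigzag_step(3) V(1) zact[OF V(2) zigzag_step(4)]] by (simp add: zapp)
  qed auto
  moreover have "ze X Y [Fwd f] [Fwd g]" using Q cl_eq_iff[OF zz_Fwd[OF f]] Q_cl[OF f] Q_cl[OF g] by simp
  ultimately have "zact [Fwd f] p = zact [Fwd g] p" using p by blast
  then show ?thesis by (simp add: zact_def lact_def)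
qed

lemma localized_functor:
  assumes F: "cat_functor C C F" and FW: "\<And>w. w \<in> W \<Longrightarrow> FArr F w \<in> W"
  shows "cat_functor L L (localized_functor C W F)"
    "\<And>f. f \<in> Arr C \<Longrightarrow> FArr (localized_functor C W F) (Q f) = Q (FArr F f)"
proof -
  interpret F: cat_functor C C F by (rule F)
  let ?m = "map (map_letter (FArr F))" and ?LF = "localized_functor C W F"
  have letter: "is_letter C W (map_letter (FArr F) l) (FOb F X) (FOb F Y)" if "is_letter C W l X Y" for l X Y
    using that F.FArr_Hom FW by (cases l) auto
  have zz: "zz (FOb F X) (?m a) (FOb F Y)" if "zz X a Y" for X a Y
    using that by (induction a arbitrary: X) (auto intro: letter F.FOb_Ob)
  have rel: "zigzag_rel C W (?m l) (?m r)" if "zigzag_rel C W l r" for l r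
    using that
  proof (induction rule: zigzag_rel.induct)
    case (1 X) then show ?case using zigzag_rel.intros(1)[OF F.FOb_Ob] F.FArr_Id by simp
  next
    case (2 f X Y g Z)
    then show ?case using zigzag_rel.intros(2)[OF F.FArr_Hom[OF 2(1)] F.FArr_Hom[OF 2(2)]] F.FArr_Comp[OF 2] by simp
  qed (simp_all add: zigzag_rel.intros FW)
  have ze: "ze (FOb F X) (FOb F Y) (?m a) (?m b)" if "ze X Y a b" for X Y a b
    using that
  proof (induction rule: zigzag_equiv.induct)
    case (zigzag_step a l b r)
    then show ?case
      using zigzag_equiv.zigzag_step[of C W "FOb F X" "?m a" "?m l" "?m b" "FOb F Y" "?m r"]
        zz[OF zigzag_step(1)] zz[OF zigzag_step(2)] rel by simp
  qed (auto intro: zigzag_equiv.zigzag_refl zz zigzag_equiv.zigzag_sym zigzag_equiv.zigzag_trans)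
  have LF: "FArr ?LF (cl X a Y) = cl (FOb F X) (?m a) (FOb F Y)" if "zz X a Y" for X a Y
  proof -
    have "zigzag_class C W (FOb F X) (?m b) (FOb F Y) = zigzag_class C W (FOb F X) (?m a) (FOb F Y)"
      if "b \<in> zigzag_class C W X a Y" for b
    proof -
      have "ze X Y a b" using that unfolding zigzag_class_def by simp
      from class_eqI[OF zigzag_equiv.zigzag_sym[OF ze[OF this]]] show ?thesis .
    qed
    moreover have "a \<in> zigzag_class C W X a Y" using that unfolding zigzag_class_def by (auto intro: zigzag_equiv.zigzag_refl)
    ultimately have "(\<Union>b \<in> zigzag_class C W X a Y. zigzag_class C W (FOb F X) (?m b) (FOb F Y))
        = zigzag_class C W (FOb F X) (?m a) (FOb F Y)" by blast
    then show ?thesis by (simp add: localized_functor_def cl_def)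
  qed
  have FOb: "FOb ?LF X = FOb F X" for X by (simp add: localized_functor_def)
  show "cat_functor L L ?LF"
  proof (intro cat_functor.intro cat_functor_axioms.intro)
    show "category L" "category L" by unfold_locales
    show "FOb ?LF X \<in> Ob L" if "X \<in> Ob L" for X using that F.FOb_Ob by (simp add: FOb L_simps)
    show "FArr ?LF f \<in> Hom L (FOb ?LF X) (FOb ?LF Y)" if "f \<in> Hom L X Y" for f X Y
      using that by (elim L_HomE) (auto simp: LF FOb simp del: Hom_def intro: L_HomI zz)
    show "FArr ?LF (Id L X) = Id L (FOb ?LF X)" if "X \<in> Ob L" for X
      using that LF[of X "[]" X] by (simp add: FOb L_simps)
    show "FArr ?LF (g \<cdot>\<^bsub>L\<^esub> f) = FArr ?LF g \<cdot>\<^bsub>L\<^esub> FArr ?LF f" if fg: "f \<in> Hom L X Y" "g \<in> Hom L Y Z" for f g X Y Z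
    proof -
      obtain a b where ab: "zz X a Y" "zz Y b Z" "f = cl X a Y" "g = cl Y b Z" using fg by (elim L_HomE) blast
      have "zz X (a @ b) Z" using ab by (auto simp: zz_append)
      then show ?thesis using ab by (simp add: L_comp LF zz)
    qed
  qed
  show "FArr ?LF (Q f) = Q (FArr F f)" if "f \<in> Arr C" for f
  proof -
    have f: "f \<in> Hom C (Dom C f) (Cod C f)" using that by simp
    show ?thesis using LF[OF zz_Fwd[OF f]] Q_cl[OF f] Q_cl[OF F.FArr_Hom[OF f]] by simp
  qed
qed

end

section \<open>The derived category\<close>

context abelian_category
begin

lemma Cplus_simps [simp]:
  "Ob (Cplus A) = {X. cplx X}" "Dom (Cplus A) (X, f, Y) = X" "Cod (Cplus A) (X, f, Y) = Y"
  "Id (Cplus A) X = (X, \<lambda>n. Id A (Obj X n), X)" "(Y', g, Z) \<cdot>\<^bsub>Cplus A\<^esub> (X, f, Y) = (X, \<lambda>n. g n \<cdot> f n, Z)"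
  by (simp_all add: Cplus_def)

declare chmap_iff [simp]

lemma Cplus_Hom: "u \<in> Hom (Cplus A) X Y \<longleftrightarrow> (\<exists>f. u = (X, f, Y) \<and> chmap X f Y)"
  by (cases u) (auto simp: chmap_iff Cplus_simps)

lemma category_Cplus: "category (Cplus A)"
proof
  show "Dom (Cplus A) u \<in> Ob (Cplus A)" "Cod (Cplus A) u \<in> Ob (Cplus A)" if "u \<in> Arr (Cplus A)" for u
    using that by (cases u; auto simp: chmap_iff Cplus_simps chm)+
  show "Id (Cplus A) X \<in> Hom (Cplus A) X X" if "X \<in> Ob (Cplus A)" for X
    using that chmap_Id by (simp add: Cplus_Hom Cplus_simps)
  show "g \<cdot>\<^bsub>Cplus A\<^esub> f \<in> Hom (Cplus A) X Z" if "f \<in> Hom (Cplus A) X Y" "g \<in> Hom (Cplus A) Y Z" for f g X Y Z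
    using that chmap_comp by (auto simp del: Hom_def simp: Cplus_Hom Cplus_simps)
  show "f \<cdot>\<^bsub>Cplus A\<^esub> Id (Cplus A) X = f" "Id (Cplus A) Y \<cdot>\<^bsub>Cplus A\<^esub> f = f" if "f \<in> Hom (Cplus A) X Y" for f X Y
    using that by (auto simp del: Hom_def simp: Cplus_Hom Cplus_simps chm)
  show "(h \<cdot>\<^bsub>Cplus A\<^esub> g) \<cdot>\<^bsub>Cplus A\<^esub> f = h \<cdot>\<^bsub>Cplus A\<^esub> (g \<cdot>\<^bsub>Cplus A\<^esub> f)"
    if "f \<in> Hom (Cplus A) V X" "g \<in> Hom (Cplus A) X Y" "h \<in> Hom (Cplus A) Y Z" for f g h V X Y Z
    using that by (auto simp del: Hom_def simp: Cplus_Hom Cplus_simps chm)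
qed

sublocale Cp: category "Cplus A" by (rule category_Cplus)

sublocale Dp: localized_category "Cplus A" "quasi_isos A"
  by unfold_locales (auto simp: quasi_isos_def)

abbreviation "D \<equiv> Dplus A"
abbreviation "sh \<equiv> FArr (Dplus_shift A)"

abbreviation Comp_Dplus (infixl \<open>\<bullet>\<close> 70) where "g \<bullet> f \<equiv> g \<cdot>\<^bsub>D\<^esub> f"

definition Qm :: "('a, 'b) cpx \<Rightarrow> (int \<Rightarrow> 'b) \<Rightarrow> ('a, 'b) cpx \<Rightarrow> ('a, 'b) darr" where
  "Qm X f Y = FArr (Dplus_loc A) (X, f, Y)"

sublocale D: category "Dplus A"
  using Dp.category_L by (simp add: Dplus_def)

lemma D_Ob [simp]: "Ob D = {X. cplx X}"
  by (simp add: Dplus_def localization_def Cplus_def)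

lemma Dplus_loc_functor: "cat_functor (Cplus A) D (Dplus_loc A)"
  using Dp.cat_functor_Q by (simp add: Dplus_def Dplus_loc_def)

lemma Dplus_loc_FOb [simp]: "FOb (Dplus_loc A) X = X"
  by (simp add: Dplus_loc_def loc_functor_def)

lemma Qm_Hom: "chmap X f Y \<Longrightarrow> Qm X f Y \<in> Hom D X Y"
  using Dp.Q_Hom[of "(X, f, Y)" X Y] by (simp add: Qm_def Dplus_def Dplus_loc_def Cplus_Hom)

lemma Qm_simps [simp]:
  assumes "chmap X f Y" shows "Qm X f Y \<in> Arr D" "Dom D (Qm X f Y) = X" "Cod D (Qm X f Y) = Y"
  using Qm_Hom[OF assms] by auto

lemma Qm_comp: "chmap X f Y \<Longrightarrow> chmap Y g Z \<Longrightarrow> Qm Y g Z \<bullet> Qm X f Y = Qm X (\<lambda>n. g n \<cdot> f n) Z"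
  using Dp.Q_comp[of "(X, f, Y)" X Y "(Y, g, Z)" Z]
  by (simp add: Qm_def Dplus_def Dplus_loc_def Cplus_Hom Cplus_simps)

lemma Qm_Id: "cplx X \<Longrightarrow> Qm X (\<lambda>n. Id A (Obj X n)) X = Id D X"
  using Dp.Q_Id[of X] by (simp add: Qm_def Dplus_def Dplus_loc_def Cplus_simps)

lemma Qm_iso: "chmap X f Y \<Longrightarrow> qi X f Y \<Longrightarrow> is_iso D (Qm X f Y)"
  using Dp.Q_iso[of "(X, f, Y)"] by (simp add: Qm_def Dplus_def Dplus_loc_def quasi_isos_iff)

lemma Qm_htp:
  assumes f: "chmap X f Y" and g: "chmap X g Y" and ht: "htp X f g Y"
  shows "Qm X f Y = Qm X g Y"
proof -
  obtain P w a b h where P: "chmap P w X" "qi P w X" "chmap X a P" "chmap X b P" "chmap P h Y"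
    "\<And>n. w n \<cdot> a n = Id A (Obj X n)" "\<And>n. w n \<cdot> b n = Id A (Obj X n)"
    "\<And>n. h n \<cdot> a n = f n" "\<And>n. h n \<cdot> b n = g n"
    using ex_cylinder[OF f g ht] by blast
  have "Qm P w X \<bullet> Qm X a P = Qm P w X \<bullet> Qm X b P"
    using P(6,7) by (simp add: Qm_comp[OF P(3,1)] Qm_comp[OF P(4,1)])
  then have "Qm X a P = Qm X b P"
    using P(1,3,4) by - (rule D.iso_cancel_left[OF Qm_iso[OF P(1,2)]], simp_all)
  then have "Qm P h Y \<bullet> Qm X a P = Qm P h Y \<bullet> Qm X b P" by simp
  then show ?thesis using P(8,9) by (simp add: Qm_comp[OF P(3,5)] Qm_comp[OF P(4,5)])
qed

definition inj_cpx :: "('a, 'b) cpx \<Rightarrow> bool" where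
  "inj_cpx I \<longleftrightarrow> cplx I \<and> (\<forall>n. injective_object A (Obj I n))"

lemma inj_cpxD: "inj_cpx I \<Longrightarrow> cplx I" "inj_cpx I \<Longrightarrow> injective_object A (Obj I n)"
  by (simp_all add: inj_cpx_def)

lemma Qm_full:
  assumes I: "inj_cpx I" and x: "x \<in> Hom D X I"
  obtains f where "chmap X f I" "x = Qm X f I"
proof -
  have "\<exists>f\<in>Hom (Cplus A) X I. x = Dp.Q f"
  proof (rule Dp.Q_full)
    show "x \<in> Hom Dp.L X I" using x by (simp add: Dplus_def)
    fix w u assume w: "w \<in> quasi_isos A" and u: "u \<in> Hom (Cplus A) (Dom (Cplus A) w) I"
    obtain Y s Z where ws: "w = (Y, s, Z)" by (cases w)
    then have s: "chmap Y s Z" "qi Y s Z" using w quasi_isos_iff by blast+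
    obtain g where g: "u = (Y, g, I)" "chmap Y g I" using u ws by (auto simp del: Hom_def simp: Cplus_Hom Cplus_simps)
    obtain h where h: "chmap Z h I" "htp Y (\<lambda>n. h n \<cdot> s n) g I"
      using qi_extend[OF s g(2) inj_cpxD(2)[OF I]] by blast
    have "Qm Y (\<lambda>n. h n \<cdot> s n) I = Qm Y g I" by (rule Qm_htp[OF chmap_comp[OF s(1) h(1)] g(2) h(2)])
    then show "\<exists>f\<in>Hom (Cplus A) (Cod (Cplus A) w) I. Dp.Q (f \<cdot>\<^bsub>Cplus A\<^esub> w) = Dp.Q u"
      using ws g h(1) by (intro bexI[of _ "(Z, h, I)"]) (simp_all add: Qm_def Dplus_loc_def Cplus_simps Cplus_Hom)
  qed
  then obtain f where "f \<in> Hom (Cplus A) X I" "x = Dp.Q f" by blast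
  then show thesis using that by (auto simp del: Hom_def simp: Cplus_Hom Qm_def Dplus_loc_def)
qed

lemma Qm_eq_iff:
  assumes I: "inj_cpx I" and f: "chmap X f I" and g: "chmap X g I"
  shows "Qm X f I = Qm X g I \<longleftrightarrow> htp X f g I"
proof
  assume eq: "Qm X f I = Qm X g I"
  define hc where "hc V u = {v. chmap V v I \<and> htp V u v I}" for V u
  define H where "H V = {hc V u |u. chmap V u I}" for V
  define act where "act w P = (\<Union>v\<in>P. hc (fst w) (\<lambda>n. v n \<cdot> fst (snd w) n))" for w :: "('a, 'b) cmap" and P
  have self: "u \<in> hc V u" if "chmap V u I" for V u using that htp_refl by (simp add: hc_def)
  have hc_eq: "hc V u = hc V v" if "chmap V u I" "chmap V v I" "htp V u v I" for V u v
    unfolding hc_def using htp_trans[OF that(2,1)] htp_trans[OF that(1,2)] htp_sym[OF that] that(3) by blast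
  have act_hc: "act (V, s, Z) (hc Z u) = hc V (\<lambda>n. u n \<cdot> s n)" if s: "chmap V s Z" and u: "chmap Z u I" for V s Z u
  proof -
    have eq: "hc V (\<lambda>n. v n \<cdot> s n) = hc V (\<lambda>n. u n \<cdot> s n)" if "v \<in> hc Z u" for v
    proof -
      have v: "chmap Z v I" "htp Z u v I" using that by (auto simp: hc_def)
      show ?thesis
        by (rule hc_eq[symmetric, OF chmap_comp[OF s u] chmap_comp[OF s v(1)] htp_comp_right[OF u v(1) s v(2)]])
    qed
    have "hc Z u \<noteq> {}" using self[OF u] by blast
    then have "(\<Union>v\<in>hc Z u. hc V (\<lambda>n. v n \<cdot> s n)) = hc V (\<lambda>n. u n \<cdot> s n)"
      by (rule SUP_eq_const) (rule eq)
    then show ?thesis by (simp only: act_def fst_conv snd_conv)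
  qed
  have "act (X, f, I) (hc I (\<lambda>n. Id A (Obj I n))) = act (X, g, I) (hc I (\<lambda>n. Id A (Obj I n)))"
  proof (rule Dp.Q_faithful[of H act])
    show "(X, f, I) \<in> Hom (Cplus A) X I" "(X, g, I) \<in> Hom (Cplus A) X I" using f g by (simp_all add: Cplus_Hom)
    show "Dp.Q (X, f, I) = Dp.Q (X, g, I)" using eq by (simp add: Qm_def Dplus_loc_def)
    show "hc I (\<lambda>n. Id A (Obj I n)) \<in> H I" unfolding H_def using chmap_Id[OF inj_cpxD(1)[OF I]] by blast
  next
    fix w V Z P assume "w \<in> Hom (Cplus A) V Z" "P \<in> H Z"
    then obtain s u where "w = (V, s, Z)" "chmap V s Z" "P = hc Z u" "chmap Z u I" by (auto simp del: Hom_def simp: Cplus_Hom H_def)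
    then show "act w P \<in> H V" using act_hc chmap_comp by (auto simp: H_def)
  next
    fix V P assume V: "V \<in> Ob (Cplus A)" and "P \<in> H V"
    then obtain u where u: "P = hc V u" "chmap V u I" by (auto simp: H_def)
    then show "act (Id (Cplus A) V) P = P"
      using act_hc[OF chmap_Id u(2)] V by (simp add: Cplus_simps chm[OF u(2)])
  next
    fix w w' V Z Z' P assume "w \<in> Hom (Cplus A) V Z" "w' \<in> Hom (Cplus A) Z Z'" "P \<in> H Z'"
    then obtain s s' u where w: "w = (V, s, Z)" "chmap V s Z" "w' = (Z, s', Z')" "chmap Z s' Z'" "P = hc Z' u" "chmap Z' u I"
      by (auto simp del: Hom_def simp: Cplus_Hom H_def)
    have "act (w' \<cdot>\<^bsub>Cplus A\<^esub> w) P = hc V (\<lambda>n. u n \<cdot> (s' n \<cdot> s n))"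
      using act_hc[OF chmap_comp[OF w(2,4)] w(6)] w by (simp add: Cplus_simps)
    also have "\<dots> = hc V (\<lambda>n. (u n \<cdot> s' n) \<cdot> s n)" using chm[OF w(2)] chm[OF w(4)] chm[OF w(6)] by simp
    also have "\<dots> = act w (act w' P)" using act_hc[OF w(2) chmap_comp[OF w(4,6)]] act_hc[OF w(4,6)] w by simp
    finally show "act (w' \<cdot>\<^bsub>Cplus A\<^esub> w) P = act w (act w' P)" .
  next
    fix w assume w: "w \<in> quasi_isos A"
    obtain Y s Z where ws: "w = (Y, s, Z)" by (cases w)
    then have s: "chmap Y s Z" "qi Y s Z" using w quasi_isos_iff by blast+
    have inj: "hc Z u = hc Z v"
      if u: "chmap Z u I" "chmap Z v I" and eq: "hc Y (\<lambda>n. u n \<cdot> s n) = hc Y (\<lambda>n. v n \<cdot> s n)" for u v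
    proof -
      have "htp Y (\<lambda>n. u n \<cdot> s n) (\<lambda>n. v n \<cdot> s n) I"
        using self[OF chmap_comp[OF s(1) u(2)]] unfolding eq[symmetric] by (simp add: hc_def)
      then show ?thesis using hc_eq[OF u] qi_htp_cancel[OF s u inj_cpxD(2)[OF I]] by blast
    qed
    have "inj_on (act w) (H Z)"
    proof (rule inj_onI)
      fix P P' assume "P \<in> H Z" "P' \<in> H Z" "act w P = act w P'"
      then obtain u v where uv: "P = hc Z u" "chmap Z u I" "P' = hc Z v" "chmap Z v I" by (auto simp: H_def)
      have "hc Y (\<lambda>n. u n \<cdot> s n) = hc Y (\<lambda>n. v n \<cdot> s n)"
        using \<open>act w P = act w P'\<close> unfolding uv(1,3) ws act_hc[OF s(1) uv(2)] act_hc[OF s(1) uv(4)] .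
      then show "P = P'" unfolding uv(1,3) by (rule inj[OF uv(2,4)])
    qed
    moreover have "act w ` H Z = H Y"
    proof
      show "act w ` H Z \<subseteq> H Y" using act_hc[OF s(1)] chmap_comp[OF s(1)] ws by (auto simp: H_def)
      show "H Y \<subseteq> act w ` H Z"
      proof
        fix P assume "P \<in> H Y"
        then obtain g where g: "P = hc Y g" "chmap Y g I" by (auto simp: H_def)
        obtain h where h: "chmap Z h I" "htp Y (\<lambda>n. h n \<cdot> s n) g I"
          using qi_extend[OF s g(2) inj_cpxD(2)[OF I]] by blast
        have "P = act w (hc Z h)"
          unfolding g(1) using hc_eq[OF chmap_comp[OF s(1) h(1)] g(2) h(2)] act_hc[OF s(1) h(1)] ws by simp
        then show "P \<in> act w ` H Z" unfolding H_def using h(1) by blast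
      qed
    qed
    ultimately show "bij_betw (act w) (H (Cod (Cplus A) w)) (H (Dom (Cplus A) w))"
      using ws by (simp add: bij_betw_def Cplus_simps)
  qed
  then have "hc X f = hc X g"
    using act_hc[OF f chmap_Id[OF inj_cpxD(1)[OF I]]] act_hc[OF g chmap_Id[OF inj_cpxD(1)[OF I]]]
    by (simp add: chm[OF f] chm[OF g])
  then show "htp X f g I" using self[OF g] by (auto simp: hc_def)
qed (rule Qm_htp[OF f g])

lemma Cplus_shift_functor: "cat_functor (Cplus A) (Cplus A) (Cplus_shift A)"
proof (intro cat_functor.intro cat_functor_axioms.intro)
  show "category (Cplus A)" "category (Cplus A)" by (rule category_Cplus)+
  show "FOb (Cplus_shift A) X \<in> Ob (Cplus A)" if "X \<in> Ob (Cplus A)" for X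
    using that shift_cpx by (simp add: Cplus_shift_def Cplus_simps)
  show "FArr (Cplus_shift A) f \<in> Hom (Cplus A) (FOb (Cplus_shift A) X) (FOb (Cplus_shift A) Y)"
    if "f \<in> Hom (Cplus A) X Y" for f X Y
    using that chmap_shift by (auto simp del: Hom_def simp: Cplus_Hom Cplus_shift_def)
  show "FArr (Cplus_shift A) (Id (Cplus A) X) = Id (Cplus A) (FOb (Cplus_shift A) X)" for X
    by (simp add: Cplus_shift_def Cplus_simps)
  show "FArr (Cplus_shift A) (g \<cdot>\<^bsub>Cplus A\<^esub> f) = FArr (Cplus_shift A) g \<cdot>\<^bsub>Cplus A\<^esub> FArr (Cplus_shift A) f"
    if "f \<in> Hom (Cplus A) X Y" "g \<in> Hom (Cplus A) Y Z" for f g X Y Z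
    using that by (auto simp del: Hom_def simp: Cplus_Hom Cplus_shift_def Cplus_simps)
qed

lemma shift_quasi_iso: "w \<in> quasi_isos A \<Longrightarrow> FArr (Cplus_shift A) w \<in> quasi_isos A"
  by (cases w) (auto simp: Cplus_shift_def quasi_isos_iff intro: chmap_shift qi_shift)

sublocale sh: cat_functor "Dplus A" "Dplus A" "Dplus_shift A"
  using Dp.localized_functor(1)[OF Cplus_shift_functor shift_quasi_iso] by (simp add: Dplus_def Dplus_shift_def)

lemma shift_FOb [simp]: "FOb (Dplus_shift A) X = shift_cpx A X"
  by (simp add: Dplus_shift_def localized_functor_def Cplus_shift_def)

lemma shift_Qm: "chmap X f Y \<Longrightarrow> sh (Qm X f Y) = Qm (shift_cpx A X) (\<lambda>n. f (n + 1)) (shift_cpx A Y)"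
  using Dp.localized_functor(2)[OF Cplus_shift_functor shift_quasi_iso, of "(X, f, Y)"]
  by (simp add: Dplus_shift_def Qm_def Dplus_loc_def Cplus_shift_def chmap_iff)

lemma inj_cpx_shift: "inj_cpx I \<Longrightarrow> inj_cpx (shift_cpx A I)"
  by (simp add: inj_cpx_def shift_cpx)

end

locale enough_injectives = abelian_category A for A :: "('o, 'm) abcat" (structure) +
  assumes enough: "M \<in> Ob A \<Longrightarrow> \<exists>m. is_mono A m \<and> Dom A m = M \<and> injective_object A (Cod A m)"
begin

definition res :: "('o, 'm) cpx \<Rightarrow> ('o, 'm) cpx \<times> (int \<Rightarrow> 'm)" where
  "res X = (SOME (I, r). chmap X r I \<and> qi X r I \<and> inj_cpx I)"

abbreviation "inj_res X \<equiv> fst (res X)"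

definition rho :: "('o, 'm) cpx \<Rightarrow> ('o, 'm) darr" where
  "rho X = Qm X (snd (res X)) (inj_res X)"

lemma res:
  assumes "cplx X"
  shows "chmap X (snd (res X)) (inj_res X)" "qi X (snd (res X)) (inj_res X)" "inj_cpx (inj_res X)"
proof -
  obtain I r where r: "chmap X r I" "qi X r I" "\<And>n. injective_object A (Obj I n)"
    using injective_resolution[OF enough assms] by blast
  then have "case (I, r) of (I, r) \<Rightarrow> chmap X r I \<and> qi X r I \<and> inj_cpx I" using chm(2) by (simp add: inj_cpx_def)
  then have "case res X of (I, r) \<Rightarrow> chmap X r I \<and> qi X r I \<and> inj_cpx I" unfolding res_def by (rule someI)
  then show "chmap X (snd (res X)) (inj_res X)" "qi X (snd (res X)) (inj_res X)" "inj_cpx (inj_res X)"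
    by (auto simp: case_prod_beta)
qed

lemma rho [simp]:
  assumes "cplx X"
  shows "is_iso D (rho X)" "Dom D (rho X) = X" "Cod D (rho X) = inj_res X" "cplx (inj_res X)"
    "inj_cpx (inj_res X)"
  using res[OF assms] Qm_iso inj_cpxD(1) by (auto simp: rho_def)

lemma D_lift:
  assumes a: "a \<in> Hom D X Y"
  obtains f where "chmap (inj_res X) f (inj_res Y)"
    "rho Y \<bullet> a = Qm (inj_res X) f (inj_res Y) \<bullet> rho X"
proof -
  have XY: "cplx X" "cplx Y" using D.Hom_Ob[OF a] by auto
  have "rho Y \<bullet> (a \<bullet> inv_arr D (rho X)) \<in> Hom D (inj_res X) (inj_res Y)"
    using a XY by simp
  then obtain f where f: "chmap (inj_res X) f (inj_res Y)"
    "rho Y \<bullet> (a \<bullet> inv_arr D (rho X)) = Qm (inj_res X) f (inj_res Y)"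
    using Qm_full[OF rho(5)[OF XY(2)]] by blast
  have "Qm (inj_res X) f (inj_res Y) \<bullet> rho X = rho Y \<bullet> a"
    unfolding f(2)[symmetric] using a XY by simp
  then show thesis using that[OF f(1)] by simp
qed

subsection \<open>The additive structure of the derived category\<close>

definition D_add :: "('o, 'm) darr \<Rightarrow> ('o, 'm) darr \<Rightarrow> ('o, 'm) darr" where
  "D_add a b = (SOME c. \<exists>f g. chmap (Dom D a) f (inj_res (Cod D a)) \<and> chmap (Dom D a) g (inj_res (Cod D a)) \<and>
     rho (Cod D a) \<bullet> a = Qm (Dom D a) f (inj_res (Cod D a)) \<and>
     rho (Cod D a) \<bullet> b = Qm (Dom D a) g (inj_res (Cod D a)) \<and> c \<in> Hom D (Dom D a) (Cod D a) \<and>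
     rho (Cod D a) \<bullet> c = Qm (Dom D a) (\<lambda>n. f n \<oplus> g n) (inj_res (Cod D a)))"

definition D_neg :: "('o, 'm) darr \<Rightarrow> ('o, 'm) darr" where
  "D_neg a = (SOME c. c \<in> Hom D (Dom D a) (Cod D a) \<and>
     D_add a c = inv_arr D (rho (Cod D a)) \<bullet>
       Qm (Dom D a) (\<lambda>n. Zero A (Obj (Dom D a) n) (Obj (inj_res (Cod D a)) n)) (inj_res (Cod D a)))"

lemma rho_Qm:
  assumes a: "a \<in> Hom D X Y" obtains f where "chmap X f (inj_res Y)" "rho Y \<bullet> a = Qm X f (inj_res Y)"
proof -
  have Y: "cplx Y" using D.Hom_Ob[OF a] by auto
  have "rho Y \<bullet> a \<in> Hom D X (inj_res Y)" using a Y by simp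
  then show thesis using Qm_full[OF rho(5)[OF Y]] that by blast
qed

lemma D_add:
  assumes a: "a \<in> Hom D X Y" and b: "b \<in> Hom D X Y"
    and f: "chmap X f (inj_res Y)" "rho Y \<bullet> a = Qm X f (inj_res Y)"
    and g: "chmap X g (inj_res Y)" "rho Y \<bullet> b = Qm X g (inj_res Y)"
  shows "D_add a b \<in> Hom D X Y" "rho Y \<bullet> D_add a b = Qm X (\<lambda>n. f n \<oplus> g n) (inj_res Y)"
proof -
  have Y: "cplx Y" using D.Hom_Ob[OF a] by auto
  note I = rho(5)[OF Y]
  have fg: "chmap X (\<lambda>n. f n \<oplus> g n) (inj_res Y)" using f(1) g(1) by (rule chmap_add)
  let ?c = "inv_arr D (rho Y) \<bullet> Qm X (\<lambda>n. f n \<oplus> g n) (inj_res Y)"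
  have "?c \<in> Hom D X Y" "rho Y \<bullet> ?c = Qm X (\<lambda>n. f n \<oplus> g n) (inj_res Y)"
    using fg Y by simp_all
  moreover have "Dom D a = X" "Cod D a = Y" using a by auto
  ultimately have "\<exists>c. \<exists>f g. chmap X f (inj_res Y) \<and> chmap X g (inj_res Y) \<and>
     rho Y \<bullet> a = Qm X f (inj_res Y) \<and> rho Y \<bullet> b = Qm X g (inj_res Y) \<and> c \<in> Hom D X Y \<and>
     rho Y \<bullet> c = Qm X (\<lambda>n. f n \<oplus> g n) (inj_res Y)" using f g by blast
  from someI_ex[OF this] obtain f' g' where *: "chmap X f' (inj_res Y)" "chmap X g' (inj_res Y)"
     "rho Y \<bullet> a = Qm X f' (inj_res Y)" "rho Y \<bullet> b = Qm X g' (inj_res Y)" "D_add a b \<in> Hom D X Y"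
     "rho Y \<bullet> D_add a b = Qm X (\<lambda>n. f' n \<oplus> g' n) (inj_res Y)"
    using \<open>Dom D a = X\<close> \<open>Cod D a = Y\<close> unfolding D_add_def by auto
  show "D_add a b \<in> Hom D X Y" by (rule *(5))
  have "htp X f' f (inj_res Y)" "htp X g' g (inj_res Y)"
    using Qm_eq_iff[OF I *(1) f(1)] Qm_eq_iff[OF I *(2) g(1)] f(2) g(2) *(3,4) by auto
  then have "htp X (\<lambda>n. f' n \<oplus> g' n) (\<lambda>n. f n \<oplus> g n) (inj_res Y)"
    by (rule htp_add[OF *(1) f(1) *(2) g(1)])
  then show "rho Y \<bullet> D_add a b = Qm X (\<lambda>n. f n \<oplus> g n) (inj_res Y)"
    using Qm_htp[OF chmap_add[OF *(1,2)] fg] *(6) by simp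
qed

lemma D_add_Qm:
  assumes f: "chmap X f Y" and g: "chmap X g Y"
  shows "D_add (Qm X f Y) (Qm X g Y) = Qm X (\<lambda>n. f n \<oplus> g n) Y"
proof -
  note Y = chm(2)[OF f]
  note r = res(1)[OF Y]
  have fg: "chmap X (\<lambda>n. f n \<oplus> g n) Y" using f g by (rule chmap_add)
  note add = D_add[OF Qm_Hom[OF f] Qm_Hom[OF g] chmap_comp[OF f r] _ chmap_comp[OF g r]]
  have "rho Y \<bullet> Qm X (\<lambda>n. f n \<oplus> g n) Y = Qm X (\<lambda>n. snd (res Y) n \<cdot> f n \<oplus> snd (res Y) n \<cdot> g n) (inj_res Y)"
    unfolding rho_def Qm_comp[OF fg r] using chm[OF f] chm[OF g] chm[OF r] by simp
  moreover have "rho Y \<bullet> Qm X f Y = Qm X (\<lambda>n. snd (res Y) n \<cdot> f n) (inj_res Y)"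
    "rho Y \<bullet> Qm X g Y = Qm X (\<lambda>n. snd (res Y) n \<cdot> g n) (inj_res Y)"
    unfolding rho_def using Qm_comp[OF f r] Qm_comp[OF g r] by auto
  ultimately show ?thesis
    using add fg Y by - (rule D.iso_cancel_left[OF rho(1)[OF Y]], auto)
qed

lemma rho_cancel:
  assumes "a \<in> Hom D X Y" "b \<in> Hom D X Y" "rho Y \<bullet> a = rho Y \<bullet> b" shows "a = b"
proof -
  have "cplx Y" using D.Hom_Ob[OF assms(1)] by auto
  then show ?thesis using assms by - (rule D.iso_cancel_left[OF rho(1)], auto)
qed

definition DA :: "(('o, 'm) cpx, ('o, 'm) darr) abcat" where
  "DA = \<lparr>Ob = Ob D, Arr = Arr D, Dom = Dom D, Cod = Cod D, Id = Id D, Comp = Comp D,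
     Add = D_add,
     Zero = (\<lambda>X Y. inv_arr D (rho Y) \<bullet> Qm X (\<lambda>n. Zero A (Obj X n) (Obj (inj_res Y) n)) (inj_res Y)),
     Neg = D_neg\<rparr>"

lemma DA_simps: "Hom DA = Hom D" "Ob DA = Ob D" "Arr DA = Arr D" "Dom DA = Dom D" "Cod DA = Cod D" "Comp DA = Comp D" "Id DA = Id D"
  "Add DA = D_add" "Neg DA = D_neg"
  by (simp_all add: DA_def fun_eq_iff)

lemma rho_Zero:
  assumes "cplx X" "cplx Y"
  shows "rho Y \<bullet> Zero DA X Y = Qm X (\<lambda>n. Zero A (Obj X n) (Obj (inj_res Y) n)) (inj_res Y)" "Zero DA X Y \<in> Hom D X Y"
  using assms chmap_zero[OF assms(1) rho(4)[OF assms(2)]] by (simp_all add: DA_def)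

lemma D_add_comp_left:
  assumes a: "a \<in> Hom D X Y" and b: "b \<in> Hom D X Y" and h: "h \<in> Hom D Y Z"
  shows "h \<bullet> D_add a b = D_add (h \<bullet> a) (h \<bullet> b)"
proof -
  have XYZ: "cplx X" "cplx Y" "cplx Z"
    using D.Hom_Ob[OF a] D.Hom_Ob[OF h] by auto
  obtain f where f: "chmap X f (inj_res Y)" "rho Y \<bullet> a = Qm X f (inj_res Y)" using rho_Qm[OF a] .
  obtain g where g: "chmap X g (inj_res Y)" "rho Y \<bullet> b = Qm X g (inj_res Y)" using rho_Qm[OF b] .
  obtain k where k: "chmap (inj_res Y) k (inj_res Z)" "rho Z \<bullet> h = Qm (inj_res Y) k (inj_res Z) \<bullet> rho Y"
    using D_lift[OF h] .
  note ab = D_add[OF a b f g] and fg = chmap_add[OF f(1) g(1)]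
  have comp: "rho Z \<bullet> (h \<bullet> c) = Qm X (\<lambda>n. k n \<cdot> u n) (inj_res Z)"
    if c: "c \<in> Hom D X Y" and u: "chmap X u (inj_res Y)" "rho Y \<bullet> c = Qm X u (inj_res Y)" for c u
  proof -
    have "rho Z \<bullet> (h \<bullet> c) = (rho Z \<bullet> h) \<bullet> c" using c h XYZ by simp
    also have "\<dots> = Qm (inj_res Y) k (inj_res Z) \<bullet> (rho Y \<bullet> c)" unfolding k(2) using c k(1) XYZ by simp
    also have "\<dots> = Qm X (\<lambda>n. k n \<cdot> u n) (inj_res Z)" unfolding u(2) by (rule Qm_comp[OF u(1) k(1)])
    finally show ?thesis .
  qed
  have ha: "h \<bullet> a \<in> Hom D X Z" "h \<bullet> b \<in> Hom D X Z" using a b h D.Comp_Hom by blast+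
  note add = D_add[OF ha chmap_comp[OF f(1) k(1)] comp[OF a f] chmap_comp[OF g(1) k(1)] comp[OF b g]]
  show ?thesis
  proof (rule rho_cancel)
    show "h \<bullet> D_add a b \<in> Hom D X Z" using ab(1) h by (rule D.Comp_Hom)
    show "rho Z \<bullet> (h \<bullet> D_add a b) = rho Z \<bullet> D_add (h \<bullet> a) (h \<bullet> b)"
      unfolding comp[OF ab(1) fg ab(2)] add(2) using chm[OF f(1)] chm[OF g(1)] chm[OF k(1)] by simp
  qed (rule add(1))
qed

lemma D_add_comp_right:
  assumes h: "h \<in> Hom D W X" and a: "a \<in> Hom D X Y" and b: "b \<in> Hom D X Y"
  shows "D_add a b \<bullet> h = D_add (a \<bullet> h) (b \<bullet> h)"
proof -
  have XYZ: "cplx W" "cplx X" "cplx Y"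
    using D.Hom_Ob[OF a] D.Hom_Ob[OF h] by auto
  obtain f where f: "chmap (inj_res X) f (inj_res Y)" "rho Y \<bullet> a = Qm (inj_res X) f (inj_res Y) \<bullet> rho X" using D_lift[OF a] .
  obtain g where g: "chmap (inj_res X) g (inj_res Y)" "rho Y \<bullet> b = Qm (inj_res X) g (inj_res Y) \<bullet> rho X" using D_lift[OF b] .
  obtain k where k: "chmap W k (inj_res X)" "rho X \<bullet> h = Qm W k (inj_res X)" using rho_Qm[OF h] .
  note r = res(1)[OF XYZ(2)]
  have fr: "rho Y \<bullet> a = Qm X (\<lambda>n. f n \<cdot> snd (res X) n) (inj_res Y)" "rho Y \<bullet> b = Qm X (\<lambda>n. g n \<cdot> snd (res X) n) (inj_res Y)"
    using f(2) g(2) Qm_comp[OF r f(1)] Qm_comp[OF r g(1)] by (simp_all add: rho_def)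
  note ab = D_add[OF a b chmap_comp[OF r f(1)] fr(1) chmap_comp[OF r g(1)] fr(2)]
  have fg: "chmap (inj_res X) (\<lambda>n. f n \<oplus> g n) (inj_res Y)" using f(1) g(1) by (rule chmap_add)
  have abr: "rho Y \<bullet> D_add a b = Qm (inj_res X) (\<lambda>n. f n \<oplus> g n) (inj_res Y) \<bullet> rho X"
  proof -
    have "Qm (inj_res X) (\<lambda>n. f n \<oplus> g n) (inj_res Y) \<bullet> rho X = Qm X (\<lambda>n. (f n \<oplus> g n) \<cdot> snd (res X) n) (inj_res Y)"
      unfolding rho_def by (rule Qm_comp[OF r fg])
    then show ?thesis using ab(2) chm[OF f(1)] chm[OF g(1)] chm[OF r] by simp
  qed
  have comp: "rho Y \<bullet> (c \<bullet> h) = Qm W (\<lambda>n. u n \<cdot> k n) (inj_res Y)"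
    if c: "c \<in> Hom D X Y" and u: "chmap (inj_res X) u (inj_res Y)" "rho Y \<bullet> c = Qm (inj_res X) u (inj_res Y) \<bullet> rho X" for c u
  proof -
    have "rho Y \<bullet> (c \<bullet> h) = (rho Y \<bullet> c) \<bullet> h" using c h XYZ by simp
    also have "\<dots> = Qm (inj_res X) u (inj_res Y) \<bullet> (rho X \<bullet> h)" unfolding u(2) using h u(1) XYZ by simp
    also have "\<dots> = Qm W (\<lambda>n. u n \<cdot> k n) (inj_res Y)" unfolding k(2) by (rule Qm_comp[OF k(1) u(1)])
    finally show ?thesis .
  qed
  have ha: "a \<bullet> h \<in> Hom D W Y" "b \<bullet> h \<in> Hom D W Y" using a b h D.Comp_Hom by blast+
  note add = D_add[OF ha chmap_comp[OF k(1) f(1)] comp[OF a f] chmap_comp[OF k(1) g(1)] comp[OF b g]]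
  show ?thesis
  proof (rule rho_cancel)
    show "D_add a b \<bullet> h \<in> Hom D W Y" using h ab(1) by (rule D.Comp_Hom)
    show "rho Y \<bullet> (D_add a b \<bullet> h) = rho Y \<bullet> D_add (a \<bullet> h) (b \<bullet> h)"
      unfolding comp[OF ab(1) fg abr] add(2) using chm[OF f(1)] chm[OF g(1)] chm[OF k(1)] by simp
  qed (rule add(1))
qed

lemma preadditive_DA: "preadditive_category DA"
proof (intro preadditive_category.intro preadditive_category_axioms.intro)
  show "category DA"
    by (rule category.intro; unfold DA_simps)
      (rule D.Dom_Ob D.Cod_Ob D.Id_Hom D.Comp_Hom D.Comp_Id D.Id_Comp D.Comp_assoc; assumption)+
next
  fix f X Y g assume "f \<in> Hom DA X Y" "g \<in> Hom DA X Y"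
  then have ab: "f \<in> Hom D X Y" "g \<in> Hom D X Y" by (simp_all add: DA_simps)
  obtain u where u: "chmap X u (inj_res Y)" "rho Y \<bullet> f = Qm X u (inj_res Y)" using rho_Qm[OF ab(1)] .
  obtain v where v: "chmap X v (inj_res Y)" "rho Y \<bullet> g = Qm X v (inj_res Y)" using rho_Qm[OF ab(2)] .
  note fg = D_add[OF ab u v]
  then show "Add DA f g \<in> Hom DA X Y" by (simp add: DA_simps)
  have "(\<lambda>n. u n \<oplus> v n) = (\<lambda>n. v n \<oplus> u n)" using chm[OF u(1)] chm[OF v(1)] by (intro ext Add_commute') simp_all
  then have "D_add f g = D_add g f"
    using D_add[OF ab(2,1) v u] fg by (intro rho_cancel[OF fg(1)]) simp_all
  then show "Add DA f g = Add DA g f" by (simp add: DA_simps)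
  fix h assume "h \<in> Hom DA X Y"
  then have h: "h \<in> Hom D X Y" by (simp add: DA_simps)
  obtain w where w: "chmap X w (inj_res Y)" "rho Y \<bullet> h = Qm X w (inj_res Y)" using rho_Qm[OF h] .
  note gh = D_add[OF ab(2) h v w]
  note l = D_add[OF fg(1) h chmap_add[OF u(1) v(1)] fg(2) w] and r = D_add[OF ab(1) gh(1) u chmap_add[OF v(1) w(1)] gh(2)]
  have "(\<lambda>n. (u n \<oplus> v n) \<oplus> w n) = (\<lambda>n. u n \<oplus> (v n \<oplus> w n))"
    using chm[OF u(1)] chm[OF v(1)] chm[OF w(1)] by simp
  then have "D_add (D_add f g) h = D_add f (D_add g h)" using l r by (intro rho_cancel[OF l(1)]) simp_all
  then show "Add DA (Add DA f g) h = Add DA f (Add DA g h)" by (simp add: DA_simps)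
next
  fix f X Y assume "f \<in> Hom DA X Y"
  then have f: "f \<in> Hom D X Y" by (simp add: DA_simps)
  have XY: "cplx X" "cplx Y" using D.Hom_Ob[OF f] by auto
  obtain u where u: "chmap X u (inj_res Y)" "rho Y \<bullet> f = Qm X u (inj_res Y)" using rho_Qm[OF f] .
  note z = rho_Zero[OF XY]
  note fz = D_add[OF f z(2) u chmap_zero[OF XY(1) rho(4)[OF XY(2)]] z(1)]
  show "Add DA f (Zero DA X Y) = f"
    unfolding DA_simps using fz(1) by (rule rho_cancel) (use f fz(2) u chm[OF u(1)] in simp_all)
  let ?c = "inv_arr D (rho Y) \<bullet> Qm X (\<lambda>n. Neg A (u n)) (inj_res Y)"
  have nu: "chmap X (\<lambda>n. Neg A (u n)) (inj_res Y)" using u(1) by (rule chmap_neg)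
  have c: "?c \<in> Hom D X Y" "rho Y \<bullet> ?c = Qm X (\<lambda>n. Neg A (u n)) (inj_res Y)"
    using nu XY by simp_all
  note fc = D_add[OF f c(1) u nu c(2)]
  have "D_add f ?c = Zero DA X Y"
    using fc(1) z(2) by (rule rho_cancel) (use fc(2) z(1) chm[OF u(1)] in simp)
  moreover have "Dom D f = X" "Cod D f = Y" using f by auto
  ultimately have "\<exists>c. c \<in> Hom D (Dom D f) (Cod D f) \<and> D_add f c = inv_arr D (rho (Cod D f)) \<bullet>
       Qm (Dom D f) (\<lambda>n. Zero A (Obj (Dom D f) n) (Obj (inj_res (Cod D f)) n)) (inj_res (Cod D f))"
    using c(1) by (intro exI[of _ ?c]) (simp add: DA_def)
  from someI_ex[OF this] have "D_neg f \<in> Hom D X Y \<and> D_add f (D_neg f) = Zero DA X Y"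
    unfolding D_neg_def[symmetric] using \<open>Dom D f = X\<close> \<open>Cod D f = Y\<close> by (simp add: DA_def)
  then show "Neg DA f \<in> Hom DA X Y" "Add DA f (Neg DA f) = Zero DA X Y" by (simp_all add: DA_simps)
next
  show "Zero DA X Y \<in> Hom DA X Y" if "X \<in> Ob DA" "Y \<in> Ob DA" for X Y using that rho_Zero by (simp add: DA_simps)
  show "Comp DA h (Add DA f g) = Add DA (Comp DA h f) (Comp DA h g)"
    if "f \<in> Hom DA X Y" "g \<in> Hom DA X Y" "h \<in> Hom DA Y Z" for f g h X Y Z
    using that D_add_comp_left by (simp add: DA_simps)
  show "Comp DA (Add DA g h) f = Add DA (Comp DA g f) (Comp DA h f)"
    if "f \<in> Hom DA X Y" "g \<in> Hom DA Y Z" "h \<in> Hom DA Y Z" for f g h X Y Z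
    using that D_add_comp_right by (simp add: DA_simps)
qed

sublocale DA: preadditive_category DA by (rule preadditive_DA)

end

section \<open>Right derived functors\<close>

lemma comp_functor_simps [simp]: "FOb (G \<circ>\<^sub>F F) X = FOb G (FOb F X)" "FArr (G \<circ>\<^sub>F F) f = FArr G (FArr F f)"
  by (simp_all add: comp_functor_def)

lemma id_functor_simps [simp]: "FOb id_functor X = X" "FArr id_functor f = f"
  by (simp_all add: id_functor_def)

lemma comp_cat_functor:
  assumes "cat_functor B C F" "cat_functor C E G" shows "cat_functor B E (G \<circ>\<^sub>F F)"
proof -
  interpret F: cat_functor B C F by fact
  interpret G: cat_functor C E G by fact
  show ?thesis
    by unfold_locales (auto intro: F.FOb_Ob G.FOb_Ob F.FArr_Hom G.FArr_Hom simp: F.FOb_Ob F.FArr_Id G.FArr_Id F.FArr_Comp G.FArr_Comp[OF F.FArr_Hom F.FArr_Hom])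
qed

lemma id_cat_functor: "category C \<Longrightarrow> cat_functor C C id_functor"
  by (intro cat_functor.intro cat_functor_axioms.intro) simp_all

lemma nat_transD:
  assumes "nat_trans B E G G' \<tau>"
  shows "cat_functor B E G" "cat_functor B E G'" "X \<in> Ob B \<Longrightarrow> \<tau> X \<in> Hom E (FOb G X) (FOb G' X)"
    "f \<in> Hom B X Y \<Longrightarrow> \<tau> Y \<cdot>\<^bsub>E\<^esub> FArr G f = FArr G' f \<cdot>\<^bsub>E\<^esub> \<tau> X"
  using assms by (auto simp: nat_trans_def)

context enough_injectives
begin

lemma nat_trans_from_injectives:
  assumes G: "cat_functor D D G" and S: "cat_functor D D S"
    and e: "\<And>I. inj_cpx I \<Longrightarrow> e I \<in> Hom D (FOb G I) (FOb S I)"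
    and enat: "\<And>I J f. inj_cpx I \<Longrightarrow> inj_cpx J \<Longrightarrow> chmap I f J \<Longrightarrow>
      e J \<bullet> FArr G (Qm I f J) = FArr S (Qm I f J) \<bullet> e I"
  obtains \<eta> where "nat_trans D D G S \<eta>" "\<And>I. inj_cpx I \<Longrightarrow> \<eta> I = e I"
    "\<And>X. cplx X \<Longrightarrow> is_iso D (e (inj_res X)) \<Longrightarrow> is_iso D (\<eta> X)"
proof -
  interpret G: cat_functor "Dplus A" "Dplus A" G by fact
  interpret S: cat_functor "Dplus A" "Dplus A" S by fact
  note [simp] = e[simplified]
  define \<eta> where "\<eta> X = inv_arr D (FArr S (rho X)) \<bullet> (e (inj_res X) \<bullet> FArr G (rho X))" for X
  have Srho [simp]: "is_iso D (FArr S (rho X))" "is_iso D (FArr G (rho X))" if "cplx X" for X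
    using S.FArr_iso(1) G.FArr_iso(1) that by simp_all
  have eta [simp]: "\<eta> X \<in> Arr D" "Dom D (\<eta> X) = FOb G X" "Cod D (\<eta> X) = FOb S X"
    "FArr S (rho X) \<bullet> \<eta> X = e (inj_res X) \<bullet> FArr G (rho X)" if "cplx X" for X
    using that by (simp_all add: \<eta>_def)
  have "nat_trans D D G S \<eta>"
    unfolding nat_trans_def
  proof (intro conjI ballI G S)
    show "\<eta> X \<in> Hom D (FOb G X) (FOb S X)" if "X \<in> Ob D" for X using that by simp
    fix a assume a: "a \<in> Arr D"
    define X Y where XY: "X = Dom D a" "Y = Cod D a"
    have aH: "a \<in> Hom D X Y" using a XY by simp
    have c: "cplx X" "cplx Y" using D.Hom_Ob[OF aH] by auto
    obtain f where f: "chmap (inj_res X) f (inj_res Y)" "rho Y \<bullet> a = Qm (inj_res X) f (inj_res Y) \<bullet> rho X"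
      using D_lift[OF aH] .
    have [simp]: "Dom D a = X" "Cod D a = Y" by (simp_all add: XY)
    have "FArr S (rho Y) \<bullet> (\<eta> Y \<bullet> FArr G a) = (FArr S (rho Y) \<bullet> \<eta> Y) \<bullet> FArr G a" using a c by (simp del: eta(4))
    also have "\<dots> = e (inj_res Y) \<bullet> FArr G (rho Y \<bullet> a)" using a c by (simp add: G.FArr_Comp')
    also have "\<dots> = (e (inj_res Y) \<bullet> FArr G (Qm (inj_res X) f (inj_res Y))) \<bullet> FArr G (rho X)"
      unfolding f(2) using c f(1) by (simp add: G.FArr_Comp')
    also have "\<dots> = FArr S (Qm (inj_res X) f (inj_res Y)) \<bullet> (FArr S (rho X) \<bullet> \<eta> X)"
      using enat[OF rho(5)[OF c(1)] rho(5)[OF c(2)] f(1)] c f(1) by simp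
    also have "\<dots> = FArr S (rho Y \<bullet> a) \<bullet> \<eta> X" unfolding f(2) using c f(1) by (simp add: S.FArr_Comp' del: eta(4))
    also have "\<dots> = FArr S (rho Y) \<bullet> (FArr S a \<bullet> \<eta> X)" using a c by (simp add: S.FArr_Comp')
    finally have "\<eta> Y \<bullet> FArr G a = FArr S a \<bullet> \<eta> X"
      using a c by - (rule D.iso_cancel_left[OF Srho(1)[OF c(2)]], simp_all)
    then show "\<eta> (Cod D a) \<bullet> FArr G a = FArr S a \<bullet> \<eta> (Dom D a)" by simp
  qed
  moreover have "\<eta> I = e I" if i: "inj_cpx I" for I
  proof -
    have I: "cplx I" by (rule inj_cpxD(1)[OF i])
    have "FArr S (rho I) \<bullet> \<eta> I = FArr S (rho I) \<bullet> e I"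
      using enat[OF i rho(5)[OF I] res(1)[OF I]] I by (simp add: rho_def[symmetric])
    then show ?thesis using I i by - (rule D.iso_cancel_left[OF Srho(1)[OF I]], simp_all)
  qed
  moreover have "is_iso D (\<eta> X)" if "cplx X" "is_iso D (e (inj_res X))" for X
    using that by (simp add: \<eta>_def)
  ultimately show thesis by (rule that)
qed

end

locale derivable = enough_injectives A + additive_endofunctor A F
  for A :: "('o, 'm) abcat" (structure) and F :: "('o, 'm, 'o, 'm) fctr"
begin

lemma Cplus_functor: "cat_functor (Cplus A) (Cplus A) (Cplus_functor F)"
proof (intro cat_functor.intro cat_functor_axioms.intro)
  show "category (Cplus A)" "category (Cplus A)" by (rule category_Cplus)+
  show "FOb (Cplus_functor F) X \<in> Ob (Cplus A)" if "X \<in> Ob (Cplus A)" for X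
    using that F_cpx by (simp add: Cplus_simps)
  show "FArr (Cplus_functor F) f \<in> Hom (Cplus A) (FC X) (FC Y)"
    if "f \<in> Hom (Cplus A) X Y" for f X Y
    using that F_chmap by (auto simp del: Hom_def simp: Cplus_Hom Cplus_functor_FArr)
  show "FArr (Cplus_functor F) (Id (Cplus A) X) = Id (Cplus A) (FC X)" if "X \<in> Ob (Cplus A)" for X
    using that cpx(1) by (simp add: Cplus_simps Cplus_functor_FArr)
  show "FArr (Cplus_functor F) (g \<cdot>\<^bsub>Cplus A\<^esub> f) = FArr (Cplus_functor F) g \<cdot>\<^bsub>Cplus A\<^esub> FArr (Cplus_functor F) f"
    if "f \<in> Hom (Cplus A) X Y" "g \<in> Hom (Cplus A) Y Z" for f g X Y Z
    using that chm by (auto simp del: Hom_def simp: Cplus_Hom Cplus_functor_FArr Cplus_simps)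
qed

abbreviation QF :: "('o, 'm) cpx \<Rightarrow> (int \<Rightarrow> 'm) \<Rightarrow> ('o, 'm) cpx \<Rightarrow> ('o, 'm) darr" where
  "QF X f Y \<equiv> Qm (FC X) (\<lambda>n. FArr F (f n)) (FC Y)"

lemma QF_comp:
  assumes f: "chmap X f Y" and g: "chmap Y g Z"
  shows "QF Y g Z \<bullet> QF X f Y = QF X (\<lambda>n. g n \<cdot> f n) Z"
  using Qm_comp[OF F_chmap[OF f] F_chmap[OF g]] chm[OF f] chm[OF g] by simp

lemma QF_Id: "cplx X \<Longrightarrow> QF X (\<lambda>n. Id A (Obj X n)) X = Id D (FC X)"
  using Qm_Id[OF F_cpx] cpx(1) by simp

lemma QF_cong:
  assumes I: "inj_cpx I" and f: "chmap X f I" and g: "chmap X g I" and eq: "Qm X f I = Qm X g I"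
  shows "QF X f I = QF X g I"
  using Qm_htp[OF F_chmap[OF f] F_chmap[OF g] F_htp[OF f g]] eq Qm_eq_iff[OF I f g] by blast

lemma QF_iso:
  assumes I: "inj_cpx I" and J: "inj_cpx J" and f: "chmap I f J" and iso: "is_iso D (Qm I f J)"
  shows "is_iso D (QF I f J)"
proof -
  have "inv_arr D (Qm I f J) \<in> Hom D J I" using iso f by simp
  then obtain g where g: "chmap J g I" "inv_arr D (Qm I f J) = Qm J g I" using Qm_full[OF I] by blast
  note Ic = inj_cpxD(1)[OF I] and Jc = inj_cpxD(1)[OF J]
  have "Qm J g I \<bullet> Qm I f J = Id D I" "Qm I f J \<bullet> Qm J g I = Id D J"
    using iso f unfolding g(2)[symmetric] by simp_all
  then have "Qm I (\<lambda>n. g n \<cdot> f n) I = Qm I (\<lambda>n. Id A (Obj I n)) I"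
    "Qm J (\<lambda>n. f n \<cdot> g n) J = Qm J (\<lambda>n. Id A (Obj J n)) J"
    using Qm_comp[OF f g(1)] Qm_comp[OF g(1) f] Qm_Id Ic Jc by simp_all
  then have "QF J g I \<bullet> QF I f J = Id D (FC I)" "QF I f J \<bullet> QF J g I = Id D (FC J)"
    unfolding QF_comp[OF f g(1)] QF_comp[OF g(1) f] QF_Id[OF Ic, symmetric] QF_Id[OF Jc, symmetric]
    using QF_cong[OF I chmap_comp[OF f g(1)] chmap_Id[OF Ic]] QF_cong[OF J chmap_comp[OF g(1) f] chmap_Id[OF Jc]] by auto
  then show ?thesis using D.is_isoI[OF Qm_Hom[OF F_chmap[OF f]] Qm_Hom[OF F_chmap[OF g(1)]]] by blast
qed

lemma nat_trans_loc_iff: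
  assumes S: "cat_functor D D S"
  shows "nat_trans (Cplus A) D (Dplus_loc A \<circ>\<^sub>F Cplus_functor F) (S \<circ>\<^sub>F Dplus_loc A) \<zeta> \<longleftrightarrow>
     (\<forall>X. cplx X \<longrightarrow> \<zeta> X \<in> Hom D (FC X) (FOb S X)) \<and>
     (\<forall>X f Y. chmap X f Y \<longrightarrow> \<zeta> Y \<bullet> QF X f Y = FArr S (Qm X f Y) \<bullet> \<zeta> X)"
proof -
  have all: "(\<forall>u\<in>Arr (Cplus A). P u) \<longleftrightarrow> (\<forall>X f Y. chmap X f Y \<longrightarrow> P (X, f, Y))" for P
    by auto
  show ?thesis
    using comp_cat_functor[OF Cplus_functor Dplus_loc_functor] comp_cat_functor[OF Dplus_loc_functor S]
    unfolding nat_trans_def all by (auto simp: Cplus_simps Cplus_functor_FArr Qm_def)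
qed

end

text \<open>By \<open>is_right_derived_functor\<close> and \<open>derived_functorI\<close> below, these pairs \<open>(R, \<xi>)\<close> are exactly the
  right derived functors.\<close>

locale derived_functor = derivable A F + R: cat_functor "Dplus A" "Dplus A" R
  for A :: "('o, 'm) abcat" (structure) and F R +
  fixes \<xi> :: "('o, 'm) cpx \<Rightarrow> ('o, 'm) darr"
  assumes xi_Hom: "cplx X \<Longrightarrow> \<xi> X \<in> Hom D (FC X) (FOb R X)"
    and xi_nat: "chmap X f Y \<Longrightarrow> \<xi> Y \<bullet> QF X f Y = FArr R (Qm X f Y) \<bullet> \<xi> X"
    and xi_iso: "inj_cpx I \<Longrightarrow> is_iso D (\<xi> I)"
begin

lemma xi_simps [simp]:
  assumes "cplx X"
  shows "\<xi> X \<in> Arr D" "Dom D (\<xi> X) = FC X" "Cod D (\<xi> X) = FOb R X"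
  using xi_Hom[OF assms] by auto

lemma nat_trans_eqI:
  assumes n: "nat_trans D D R S \<eta>" "nat_trans D D R S \<eta>'"
    and eq: "\<And>I. inj_cpx I \<Longrightarrow> \<eta> I \<bullet> \<xi> I = \<eta>' I \<bullet> \<xi> I" and X: "cplx X"
  shows "\<eta> X = \<eta>' X"
proof -
  interpret S: cat_functor "Dplus A" "Dplus A" S using nat_transD(2)[OF n(1)] .
  note [simp] = nat_transD(3)[OF n(1), simplified] nat_transD(3)[OF n(2), simplified]
  have I: "\<eta> (inj_res X) = \<eta>' (inj_res X)"
    using eq[OF rho(5)[OF X]] xi_iso[OF rho(5)[OF X]] X by - (rule D.iso_cancel_right[of "\<xi> (inj_res X)"], simp_all)
  have r: "rho X \<in> Hom D X (inj_res X)" using X by simp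
  have "FArr S (rho X) \<bullet> \<eta> X = FArr S (rho X) \<bullet> \<eta>' X"
    using nat_transD(4)[OF n(1) r] nat_transD(4)[OF n(2) r] I by simp
  then show ?thesis
    using X S.FArr_iso(1)[OF rho(1)[OF X]] by - (rule D.iso_cancel_left[of "FArr S (rho X)"], simp_all)
qed

lemma factor:
  assumes S: "cat_functor D D S" and \<zeta>: "nat_trans (Cplus A) D (Dplus_loc A \<circ>\<^sub>F Cplus_functor F) (S \<circ>\<^sub>F Dplus_loc A) \<zeta>"
  obtains \<eta> where "nat_trans D D R S \<eta>" "\<And>X. cplx X \<Longrightarrow> \<zeta> X = \<eta> X \<bullet> \<xi> X"
proof -
  interpret S: cat_functor "Dplus A" "Dplus A" S by fact
  have z: "\<And>X. cplx X \<Longrightarrow> \<zeta> X \<in> Hom D (FC X) (FOb S X)"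
    "\<And>X f Y. chmap X f Y \<Longrightarrow> \<zeta> Y \<bullet> QF X f Y = FArr S (Qm X f Y) \<bullet> \<zeta> X"
    using \<zeta> unfolding nat_trans_loc_iff[OF S] by blast+
  note [simp] = z(1)[simplified]
  define e where "e I = \<zeta> I \<bullet> inv_arr D (\<xi> I)" for I
  have e [simp]: "e I \<in> Arr D" "Dom D (e I) = FOb R I" "Cod D (e I) = FOb S I" "e I \<bullet> \<xi> I = \<zeta> I" if "inj_cpx I" for I
    using that xi_iso[OF that] inj_cpxD(1)[OF that] by (simp_all add: e_def)
  have enat: "e J \<bullet> FArr R (Qm I f J) = FArr S (Qm I f J) \<bullet> e I" if IJ: "inj_cpx I" "inj_cpx J" and f: "chmap I f J" for I f J
  proof (rule D.iso_cancel_right[OF xi_iso[OF IJ(1)]])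
    note c = inj_cpxD(1)[OF IJ(1)] inj_cpxD(1)[OF IJ(2)]
    have "(e J \<bullet> FArr R (Qm I f J)) \<bullet> \<xi> I = e J \<bullet> (\<xi> J \<bullet> QF I f J)"
      using IJ f c by (simp add: xi_nat)
    also have "\<dots> = (e J \<bullet> \<xi> J) \<bullet> QF I f J" using IJ c F_chmap[OF f] by (simp del: e(4))
    also have "\<dots> = FArr S (Qm I f J) \<bullet> \<zeta> I" using IJ z(2)[OF f] by simp
    also have "\<dots> = (FArr S (Qm I f J) \<bullet> e I) \<bullet> \<xi> I" using IJ c f by simp
    finally show "(e J \<bullet> FArr R (Qm I f J)) \<bullet> \<xi> I = (FArr S (Qm I f J) \<bullet> e I) \<bullet> \<xi> I" .
  qed (use IJ f inj_cpxD(1)[OF IJ(1)] in simp_all)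
  have Rf: "cat_functor D D R" by unfold_locales
  have eH: "e I \<in> Hom D (FOb R I) (FOb S I)" if "inj_cpx I" for I using that by simp
  obtain \<eta> where eta: "nat_trans D D R S \<eta>" "\<And>I. inj_cpx I \<Longrightarrow> \<eta> I = e I"
    using nat_trans_from_injectives[OF Rf S eH enat] by blast
  have "\<zeta> X = \<eta> X \<bullet> \<xi> X" if X: "cplx X" for X
  proof -
    note r = res(1)[OF X] and I = rho(5)[OF X]
    have Srho: "is_iso D (FArr S (rho X))" using S.FArr_iso(1) X by simp
    note [simp] = nat_transD(3)[OF eta(1), simplified]
    have rH: "rho X \<in> Hom D X (inj_res X)" using X by simp
    have "FArr S (rho X) \<bullet> (\<eta> X \<bullet> \<xi> X) = (FArr S (rho X) \<bullet> \<eta> X) \<bullet> \<xi> X" using X by simp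
    also have "\<dots> = e (inj_res X) \<bullet> (FArr R (rho X) \<bullet> \<xi> X)"
      unfolding nat_transD(4)[OF eta(1) rH, symmetric] eta(2)[OF I] using X by simp
    also have "\<dots> = (e (inj_res X) \<bullet> \<xi> (inj_res X)) \<bullet> QF X (snd (res X)) (inj_res X)"
      unfolding rho_def xi_nat[OF r, symmetric] using X F_chmap[OF r] by (simp del: e(4))
    also have "\<dots> = FArr S (rho X) \<bullet> \<zeta> X" using z(2)[OF r] X by (simp add: rho_def)
    finally show ?thesis using X by - (rule D.iso_cancel_left[OF Srho], simp_all)
  qed
  then show thesis using that eta(1) by blast
qed

lemma is_right_derived_functor: "is_right_derived_functor A F R \<xi>"
  unfolding is_right_derived_functor_def
proof (intro conjI allI impI)
  show "cat_functor D D R" by unfold_locales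
  then show "nat_trans (Cplus A) D (Dplus_loc A \<circ>\<^sub>F Cplus_functor F) (R \<circ>\<^sub>F Dplus_loc A) \<xi>"
    using nat_trans_loc_iff xi_Hom xi_nat by blast
  fix S \<zeta> assume "cat_functor D D S \<and> nat_trans (Cplus A) D (Dplus_loc A \<circ>\<^sub>F Cplus_functor F) (S \<circ>\<^sub>F Dplus_loc A) \<zeta>"
  then obtain \<eta> where eta: "nat_trans D D R S \<eta>" "\<And>X. cplx X \<Longrightarrow> \<zeta> X = \<eta> X \<bullet> \<xi> X"
    using factor by blast
  show "\<exists>\<eta>. nat_trans D D R S \<eta> \<and> (\<forall>X\<in>Ob (Cplus A). \<zeta> X = \<eta> X \<bullet> \<xi> X) \<and>
      (\<forall>\<eta>'. nat_trans D D R S \<eta>' \<and> (\<forall>X\<in>Ob (Cplus A). \<zeta> X = \<eta>' X \<bullet> \<xi> X) \<longrightarrow> (\<forall>X\<in>Ob D. \<eta>' X = \<eta> X))"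
  proof (intro exI[of _ \<eta>] conjI ballI allI impI)
    show "nat_trans D D R S \<eta>" by fact
    show "\<zeta> X = \<eta> X \<bullet> \<xi> X" if "X \<in> Ob (Cplus A)" for X using that eta(2) by (simp add: Cplus_simps)
    fix \<eta>' X assume n: "nat_trans D D R S \<eta>' \<and> (\<forall>X\<in>Ob (Cplus A). \<zeta> X = \<eta>' X \<bullet> \<xi> X)" and X: "X \<in> Ob D"
    have "\<eta>' I \<bullet> \<xi> I = \<eta> I \<bullet> \<xi> I" if "inj_cpx I" for I
    proof -
      have "cplx I" using inj_cpxD(1)[OF that] .
      then have "\<zeta> I = \<eta>' I \<bullet> \<xi> I" "\<zeta> I = \<eta> I \<bullet> \<xi> I" using eta(2) conjunct2[OF n] by (simp_all add: Cplus_simps)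
      then show ?thesis by (rule subst)
    qed
    then show "\<eta>' X = \<eta> X" using nat_trans_eqI[OF conjunct1[OF n] eta(1)] X by simp
  qed
qed

end

context derivable
begin

definition lift :: "('o, 'm) darr \<Rightarrow> int \<Rightarrow> 'm" where
  "lift a = (SOME f. chmap (inj_res (Dom D a)) f (inj_res (Cod D a)) \<and>
     rho (Cod D a) \<bullet> a = Qm (inj_res (Dom D a)) f (inj_res (Cod D a)) \<bullet> rho (Dom D a))"

definition RF :: "('o, 'm) dfctr" where
  "RF = \<lparr>FOb = (\<lambda>X. FC (inj_res X)), FArr = (\<lambda>a. QF (inj_res (Dom D a)) (lift a) (inj_res (Cod D a)))\<rparr>"

lemma RF_FOb: "FOb RF X = FC (inj_res X)"
  by (simp add: RF_def)

lemma RF_eq: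
  assumes a: "a \<in> Hom D X Y" and f: "chmap (inj_res X) f (inj_res Y)"
    and eq: "rho Y \<bullet> a = Qm (inj_res X) f (inj_res Y) \<bullet> rho X"
  shows "FArr RF a = QF (inj_res X) f (inj_res Y)"
proof -
  have XY: "Dom D a = X" "Cod D a = Y" using a by auto
  have c: "cplx X" "cplx Y" using D.Hom_Ob[OF a] by auto
  have "chmap (inj_res X) (lift a) (inj_res Y) \<and> rho Y \<bullet> a = Qm (inj_res X) (lift a) (inj_res Y) \<bullet> rho X"
    unfolding lift_def XY by (rule someI[of _ f]) (use f eq in simp)
  then have l: "chmap (inj_res X) (lift a) (inj_res Y)"
    and "Qm (inj_res X) (lift a) (inj_res Y) \<bullet> rho X = Qm (inj_res X) f (inj_res Y) \<bullet> rho X" using eq by auto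
  then have "Qm (inj_res X) (lift a) (inj_res Y) = Qm (inj_res X) f (inj_res Y)"
    using c f by - (rule D.iso_cancel_right[OF rho(1)[OF c(1)]], simp_all)
  then have "QF (inj_res X) (lift a) (inj_res Y) = QF (inj_res X) f (inj_res Y)"
    by (rule QF_cong[OF rho(5)[OF c(2)] l f])
  then show ?thesis by (simp add: RF_def XY)
qed

lemma cat_functor_RF: "cat_functor D D RF"
proof (intro cat_functor.intro cat_functor_axioms.intro)
  show "category D" "category D" by unfold_locales
  show "FOb RF X \<in> Ob D" if "X \<in> Ob D" for X using that F_cpx by (simp add: RF_FOb)
  show "FArr RF a \<in> Hom D (FOb RF X) (FOb RF Y)" if a: "a \<in> Hom D X Y" for a X Y
  proof -
    obtain f where f: "chmap (inj_res X) f (inj_res Y)" "rho Y \<bullet> a = Qm (inj_res X) f (inj_res Y) \<bullet> rho X"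
      using D_lift[OF a] .
    show ?thesis using Qm_Hom[OF F_chmap[OF f(1)]] by (simp add: RF_FOb RF_eq[OF a f])
  qed
  show "FArr RF (Id D X) = Id D (FOb RF X)" if "X \<in> Ob D" for X
  proof -
    have X: "cplx X" using that by simp
    have "FArr RF (Id D X) = QF (inj_res X) (\<lambda>n. Id A (Obj (inj_res X) n)) (inj_res X)"
      by (rule RF_eq[OF D.Id_Hom[OF that] chmap_Id[OF rho(4)[OF X]]]) (use X Qm_Id in simp)
    then show ?thesis using QF_Id[OF rho(4)[OF X]] by (simp add: RF_FOb)
  qed
  show "FArr RF (b \<bullet> a) = FArr RF b \<bullet> FArr RF a" if a: "a \<in> Hom D X Y" and b: "b \<in> Hom D Y Z" for a b X Y Z
  proof -
    obtain f where f: "chmap (inj_res X) f (inj_res Y)" "rho Y \<bullet> a = Qm (inj_res X) f (inj_res Y) \<bullet> rho X"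
      using D_lift[OF a] .
    obtain g where g: "chmap (inj_res Y) g (inj_res Z)" "rho Z \<bullet> b = Qm (inj_res Y) g (inj_res Z) \<bullet> rho Y"
      using D_lift[OF b] .
    have c: "cplx X" "cplx Y" "cplx Z"
      using D.Hom_Ob[OF a] D.Hom_Ob[OF b] by auto
    note ab = a[simplified] b[simplified]
    have "rho Z \<bullet> (b \<bullet> a) = (rho Z \<bullet> b) \<bullet> a" using ab c by simp
    also have "\<dots> = Qm (inj_res Y) g (inj_res Z) \<bullet> (rho Y \<bullet> a)" unfolding g(2) using ab c g(1) by simp
    also have "\<dots> = (Qm (inj_res Y) g (inj_res Z) \<bullet> Qm (inj_res X) f (inj_res Y)) \<bullet> rho X"
      unfolding f(2) using c f(1) g(1) by simp
    finally have "rho Z \<bullet> (b \<bullet> a) = Qm (inj_res X) (\<lambda>n. g n \<cdot> f n) (inj_res Z) \<bullet> rho X"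
      unfolding Qm_comp[OF f(1) g(1)] .
    then have "FArr RF (b \<bullet> a) = QF (inj_res X) (\<lambda>n. g n \<cdot> f n) (inj_res Z)"
      by (rule RF_eq[OF D.Comp_Hom[OF a b] chmap_comp[OF f(1) g(1)]])
    then show ?thesis unfolding RF_eq[OF a f] RF_eq[OF b g] QF_comp[OF f(1) g(1)] .
  qed
qed

lemma derived_functor_RF: "derived_functor A F RF (\<lambda>X. QF X (snd (res X)) (inj_res X))"
proof (intro derived_functor.intro derived_functor_axioms.intro)
  show "derivable A F" by unfold_locales
  show "cat_functor D D RF" by (rule cat_functor_RF)
  show "QF X (snd (res X)) (inj_res X) \<in> Hom D (FC X) (FOb RF X)" if "cplx X" for X
    using Qm_Hom[OF F_chmap[OF res(1)[OF that]]] by (simp add: RF_FOb)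
  show "is_iso D (QF I (snd (res I)) (inj_res I))" if I: "inj_cpx I" for I
    using QF_iso[OF I rho(5) res(1)] rho(1) inj_cpxD(1)[OF I] by (simp add: rho_def)
  fix X f Y assume f: "chmap X f Y"
  have c: "cplx X" "cplx Y" using chm[OF f] by auto
  note r = res(1)[OF c(1)] res(1)[OF c(2)]
  obtain g where g: "chmap (inj_res X) g (inj_res Y)" "rho Y \<bullet> Qm X f Y = Qm (inj_res X) g (inj_res Y) \<bullet> rho X"
    using D_lift[OF Qm_Hom[OF f]] .
  have "Qm X (\<lambda>n. snd (res Y) n \<cdot> f n) (inj_res Y) = Qm X (\<lambda>n. g n \<cdot> snd (res X) n) (inj_res Y)"
    using g(2) unfolding rho_def Qm_comp[OF f r(2)] Qm_comp[OF r(1) g(1)] .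
  then have "QF X (\<lambda>n. snd (res Y) n \<cdot> f n) (inj_res Y) = QF X (\<lambda>n. g n \<cdot> snd (res X) n) (inj_res Y)"
    by (rule QF_cong[OF rho(5)[OF c(2)] chmap_comp[OF f r(2)] chmap_comp[OF r(1) g(1)]])
  then show "QF Y (snd (res Y)) (inj_res Y) \<bullet> QF X f Y = FArr RF (Qm X f Y) \<bullet> QF X (snd (res X)) (inj_res X)"
    unfolding RF_eq[OF Qm_Hom[OF f] g] QF_comp[OF f r(2)] QF_comp[OF r(1) g(1)] .
qed

theorem derived_functorI:
  assumes R: "is_right_derived_functor A F R \<xi>"
  shows "derived_functor A F R \<xi>"
proof -
  let ?x = "\<lambda>X. QF X (snd (res X)) (inj_res X)"
  interpret RF: derived_functor A F RF ?x by (rule derived_functor_RF)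
  have RF: "cat_functor D D RF" "nat_trans (Cplus A) D (Dplus_loc A \<circ>\<^sub>F Cplus_functor F) (RF \<circ>\<^sub>F Dplus_loc A) ?x"
    using RF.is_right_derived_functor unfolding is_right_derived_functor_def by - (elim conjE, assumption)+
  have Rf: "cat_functor D D R" and n: "nat_trans (Cplus A) D (Dplus_loc A \<circ>\<^sub>F Cplus_functor F) (R \<circ>\<^sub>F Dplus_loc A) \<xi>"
    using R unfolding is_right_derived_functor_def by - (elim conjE, assumption)+
  note univ = R[unfolded is_right_derived_functor_def, THEN conjunct2, THEN conjunct2, THEN spec, THEN spec, THEN mp]
  interpret R: cat_functor "Dplus A" "Dplus A" R by fact
  obtain e where e: "nat_trans D D RF R e" "\<And>X. cplx X \<Longrightarrow> \<xi> X = e X \<bullet> ?x X"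
    using RF.factor[OF Rf n] by blast
  obtain e' where n': "nat_trans D D R RF e'" and "\<forall>X\<in>Ob (Cplus A). ?x X = e' X \<bullet> \<xi> X"
    using univ[OF conjI[OF RF]] by (elim exE conjE)
  then have "?x X = e' X \<bullet> \<xi> X" if "cplx X" for X using that by (simp add: Cplus_simps)
  note e' = n' this
  have comp: "nat_trans D D G K (\<lambda>X. u X \<bullet> v X)" if v: "nat_trans D D G H v" and u: "nat_trans D D H K u" for G H K u v
  proof -
    interpret G: cat_functor "Dplus A" "Dplus A" G using v by (rule nat_transD(1))
    interpret H: cat_functor "Dplus A" "Dplus A" H using v by (rule nat_transD(2))
    interpret K: cat_functor "Dplus A" "Dplus A" K using u by (rule nat_transD(2))
    note [simp] = nat_transD(3)[OF u, simplified] nat_transD(3)[OF v, simplified]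
    show ?thesis unfolding nat_trans_def
    proof (intro conjI ballI)
      show "cat_functor D D G" "cat_functor D D K" by unfold_locales
      show "u X \<bullet> v X \<in> Hom D (FOb G X) (FOb K X)" if "X \<in> Ob D" for X using that by simp
      fix a assume "a \<in> Arr D"
      then obtain X Y where a: "a \<in> Hom D X Y" "Dom D a = X" "Cod D a = Y" "a \<in> Arr D" by auto
      have c: "cplx X" "cplx Y" using D.Hom_Ob[OF a(1)] by auto
      have "(u Y \<bullet> v Y) \<bullet> FArr G a = u Y \<bullet> (FArr H a \<bullet> v X)"
        using a(2-) c nat_transD(4)[OF v a(1)] by simp
      also have "\<dots> = (u Y \<bullet> FArr H a) \<bullet> v X" using a(2-) c by simp
      also have "\<dots> = FArr K a \<bullet> (u X \<bullet> v X)" unfolding nat_transD(4)[OF u a(1)] using a(2-) c by simp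
      finally show "(u (Cod D a) \<bullet> v (Cod D a)) \<bullet> FArr G a = FArr K a \<bullet> (u (Dom D a) \<bullet> v (Dom D a))"
        using a by simp
    qed
  qed
  have ident: "nat_trans D D G G (\<lambda>X. Id D (FOb G X))" if "cat_functor D D G" for G
  proof -
    interpret G: cat_functor "Dplus A" "Dplus A" G by fact
    show ?thesis unfolding nat_trans_def
    proof (intro conjI ballI that)
      show "Id D (FOb G X) \<in> Hom D (FOb G X) (FOb G X)" if "X \<in> Ob D" for X using D.Id_Hom[OF G.FOb_Ob[OF that]] .
      show "Id D (FOb G (Cod D a)) \<bullet> FArr G a = FArr G a \<bullet> Id D (FOb G (Dom D a))" if "a \<in> Arr D" for a
        using that by simp
    qed
  qed
  have h: "e X \<in> Hom D (FOb RF X) (FOb R X)" "e' X \<in> Hom D (FOb R X) (FOb RF X)"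
    "\<xi> X \<in> Hom D (FC X) (FOb R X)" if "cplx X" for X
    using nat_transD(3)[OF e(1), of X] nat_transD(3)[OF e'(1), of X] nat_trans_loc_iff[OF Rf] n that by auto
  note [simp] = h[simplified]
  have 1: "e' X \<bullet> e X = Id D (FOb RF X)" if X: "cplx X" for X
  proof (rule RF.nat_trans_eqI[OF comp[OF e(1) e'(1)] ident[OF RF(1)] _ X])
    fix I assume "inj_cpx I"
    then have I: "cplx I" by (rule inj_cpxD(1))
    have "(e' I \<bullet> e I) \<bullet> ?x I = e' I \<bullet> \<xi> I" unfolding e(2)[OF I] using I RF.xi_simps[OF I] by simp
    then show "(e' I \<bullet> e I) \<bullet> ?x I = Id D (FOb RF I) \<bullet> ?x I" unfolding e'(2)[OF I, symmetric] using RF.xi_simps[OF I] by simp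
  qed
  obtain \<eta> where uniq: "\<forall>\<eta>'. nat_trans D D R R \<eta>' \<and> (\<forall>X\<in>Ob (Cplus A). \<xi> X = \<eta>' X \<bullet> \<xi> X) \<longrightarrow> (\<forall>X\<in>Ob D. \<eta>' X = \<eta> X)"
    using univ[OF conjI[OF Rf n]] by (elim exE conjE)
  note uniq = uniq[THEN spec, THEN mp, OF conjI]
  have "\<xi> X = (e X \<bullet> e' X) \<bullet> \<xi> X" if X: "cplx X" for X
  proof -
    have "(e X \<bullet> e' X) \<bullet> \<xi> X = e X \<bullet> (e' X \<bullet> \<xi> X)" using X by simp
    also have "\<dots> = \<xi> X" unfolding e'(2)[OF X, symmetric] e(2)[OF X, symmetric] ..
    finally show ?thesis ..
  qed
  then have "\<forall>X\<in>Ob D. e X \<bullet> e' X = \<eta> X"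
    by (intro uniq[OF comp[OF e'(1) e(1)]] ballI) (simp only: Cplus_simps mem_Collect_eq)
  moreover have "\<forall>X\<in>Ob D. Id D (FOb R X) = \<eta> X"
    by (intro uniq[OF ident[OF Rf]] ballI) (simp add: Cplus_simps)
  ultimately have 2: "e X \<bullet> e' X = Id D (FOb R X)" if "cplx X" for X using that by simp
  show ?thesis
  proof (intro derived_functor.intro derived_functor_axioms.intro)
    show "derivable A F" by unfold_locales
    show "cat_functor D D R" by fact
    show "\<xi> X \<in> Hom D (FC X) (FOb R X)" if "cplx X" for X using h(3)[OF that] .
    show "\<xi> Y \<bullet> QF X f Y = FArr R (Qm X f Y) \<bullet> \<xi> X" if "chmap X f Y" for X f Y
      using n that unfolding nat_trans_loc_iff[OF Rf] by blast
    fix I assume i: "inj_cpx I"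
    then have I: "cplx I" by (rule inj_cpxD(1))
    have "is_iso D (e I)" using D.is_isoI[OF h(1,2)] 1 2 I by blast
    then show "is_iso D (\<xi> I)" unfolding e(2)[OF I] using RF.xi_iso[OF i] RF.xi_simps[OF I] I by simp
  qed
qed

end

section \<open>The derived functor is a triangle functor\<close>

context enough_injectives
begin

lemma DA_is_zero_object: "is_zero_object DA = is_zero_object D"
  by (simp add: fun_eq_iff is_zero_object_def DA_simps)

lemma DA_is_biproduct: "is_biproduct DA = is_biproduct D"
  by (simp add: fun_eq_iff is_biproduct_def is_zero_arrow_def DA_is_zero_object DA_simps)

lemma injective_biprod:
  assumes b: "biprod P i j p q X Y" and XY: "injective_object A X" "injective_object A Y"
  shows "injective_object A P"
  unfolding injective_object_def
proof (intro conjI allI impI)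
  note [simp] = biprod_simps[OF b]
  show "P \<in> Ob A" by simp
  fix m f assume "is_mono A m \<and> f \<in> Hom A (Dom A m) P"
  then have m: "is_mono A m" and f: "f \<in> Arr A" "Dom A f = Dom A m" "Cod A f = P" by auto
  have "p \<cdot> f \<in> Hom A (Dom A m) X" "q \<cdot> f \<in> Hom A (Dom A m) Y" using f by simp_all
  then obtain g h where g: "g \<in> Hom A (Cod A m) X" "g \<cdot> m = p \<cdot> f" and h: "h \<in> Hom A (Cod A m) Y" "h \<cdot> m = q \<cdot> f"
    using XY m unfolding injective_object_def by blast
  note gs = g(1)[simplified] h(1)[simplified]
  have "(i \<cdot> g \<oplus> j \<cdot> h) \<cdot> m = f"
    using biprod_decompose_into[OF b f(1,3)] gs g(2) h(2) m by simp
  then show "\<exists>g\<in>Hom A (Cod A m) P. g \<cdot> m = f"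
    using gs m by (intro bexI[of _ "i \<cdot> g \<oplus> j \<cdot> h"]) simp_all
qed

lemma cone_chmap:
  assumes c: "is_mapping_cone A X f Y K i j p q"
  shows "chmap Y j K" "chmap K p (shift_cpx A X)"
proof -
  note f = coneD(1)[OF c] and K = coneD(2)[OF c] and b = biprod_simps[OF coneD(3)[OF c]]
  have X: "cplx X" and Y: "cplx Y" using chm[OF f] by auto
  show "chmap Y j K" by (rule chmapI) (use Y K b coneD(5)[OF c] in simp_all)
  show "chmap K p (shift_cpx A X)"
    by (rule chmapI) (use X K shift_cpx[OF X] b cpx[OF X] coneD(6)[OF c] in simp_all)
qed

lemma inj_cpx_cone:
  assumes c: "is_mapping_cone A X f Y K i j p q" and "inj_cpx X" "inj_cpx Y"
  shows "inj_cpx K"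
  unfolding inj_cpx_def
  using coneD(2)[OF c] injective_biprod[OF coneD(3)[OF c] inj_cpxD(2)[OF assms(2)] inj_cpxD(2)[OF assms(3)]] by blast

lemma distinguished_injective:
  assumes "distinguished_triangle A u v w"
  obtains X' Y' Z' I f J K i j p q \<alpha> \<beta> \<theta> where
    "u \<in> Hom D X' Y'" "v \<in> Hom D Y' Z'" "w \<in> Hom D Z' (shift_cpx A X')"
    "is_mapping_cone A I f J K i j p q" "inj_cpx I" "inj_cpx J"
    "\<alpha> \<in> Hom D X' I" "is_iso D \<alpha>" "\<beta> \<in> Hom D Y' J" "is_iso D \<beta>" "\<theta> \<in> Hom D Z' K" "is_iso D \<theta>"
    "\<beta> \<bullet> u = Qm I f J \<bullet> \<alpha>" "\<theta> \<bullet> v = Qm J j K \<bullet> \<beta>"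
    "sh \<alpha> \<bullet> w = Qm K p (shift_cpx A I) \<bullet> \<theta>"
proof -
  obtain X' Y' Z' X f Y K i j p q \<alpha> \<beta> \<theta> where
    uvw: "u \<in> Hom D X' Y'" "v \<in> Hom D Y' Z'" "w \<in> Hom D Z' (shift_cpx A X')"
    and c: "is_mapping_cone A X f Y K i j p q"
    and iso: "\<alpha> \<in> Hom D X' X" "is_iso D \<alpha>" "\<beta> \<in> Hom D Y' Y" "is_iso D \<beta>" "\<theta> \<in> Hom D Z' K" "is_iso D \<theta>"
    and sq: "\<beta> \<bullet> u = Qm X f Y \<bullet> \<alpha>" "\<theta> \<bullet> v = Qm Y j K \<bullet> \<beta>"
    "sh \<alpha> \<bullet> w = Qm K p (shift_cpx A X) \<bullet> \<theta>"
    using assms unfolding distinguished_triangle_def Qm_def[symmetric] shift_FOb by (elim exE conjE) rule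
  note f = coneD(1)[OF c] and jp = cone_chmap[OF c]
  have XY: "cplx X" "cplx Y" using chm[OF f] by auto
  note rX = res[OF XY(1)] and rY = res[OF XY(2)]
  obtain g where g: "chmap (inj_res X) g (inj_res Y)" "rho Y \<bullet> Qm X f Y = Qm (inj_res X) g (inj_res Y) \<bullet> rho X"
    using D_lift[OF Qm_Hom[OF f]] .
  have "Qm X (\<lambda>n. snd (res Y) n \<cdot> f n) (inj_res Y) = Qm X (\<lambda>n. g n \<cdot> snd (res X) n) (inj_res Y)"
    using g(2) unfolding rho_def Qm_comp[OF f rY(1)] Qm_comp[OF rX(1) g(1)] .
  then have ht: "htp X (\<lambda>n. snd (res Y) n \<cdot> f n) (\<lambda>n. g n \<cdot> snd (res X) n) (inj_res Y)"
    using Qm_eq_iff[OF rY(3) chmap_comp[OF f rY(1)] chmap_comp[OF rX(1) g(1)]] by blast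
  obtain K' i' j' p' q' where c': "is_mapping_cone A (inj_res X) g (inj_res Y) K' i' j' p' q'"
    using ex_cone[OF g(1)] .
  note jp' = cone_chmap[OF c']
  obtain t where t: "chmap K t K'" "qi K t K'" "\<And>n. t n \<cdot> j n = j' n \<cdot> snd (res Y) n"
    "\<And>n. p' n \<cdot> t n = snd (res X) (n + 1) \<cdot> p n"
    by (rule cone_map[OF c c' rX(1,2) rY(1,2) ht]) (rule that)
  note [simp] = uvw[simplified] iso(1,3,5)[simplified]
  have tiso: "is_iso D (Qm K t K')" by (rule Qm_iso[OF t(1,2)])
  show thesis
  proof (rule that[OF uvw c' rX(3) rY(3)])
    show "rho X \<bullet> \<alpha> \<in> Hom D X' (inj_res X)" "is_iso D (rho X \<bullet> \<alpha>)"
      "rho Y \<bullet> \<beta> \<in> Hom D Y' (inj_res Y)" "is_iso D (rho Y \<bullet> \<beta>)"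
      using XY iso(2,4) by simp_all
    show "Qm K t K' \<bullet> \<theta> \<in> Hom D Z' K'" "is_iso D (Qm K t K' \<bullet> \<theta>)"
      using t(1) tiso iso(6) by simp_all
    have "(rho Y \<bullet> \<beta>) \<bullet> u = (rho Y \<bullet> Qm X f Y) \<bullet> \<alpha>" using XY f sq(1) by simp
    then show "(rho Y \<bullet> \<beta>) \<bullet> u = Qm (inj_res X) g (inj_res Y) \<bullet> (rho X \<bullet> \<alpha>)"
      unfolding g(2) using XY g(1) by simp
    have "(Qm K t K' \<bullet> \<theta>) \<bullet> v = (Qm K t K' \<bullet> Qm Y j K) \<bullet> \<beta>" using t(1) jp(1) sq(2) by simp
    also have "\<dots> = (Qm (inj_res Y) j' K' \<bullet> rho Y) \<bullet> \<beta>"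
      unfolding rho_def Qm_comp[OF jp(1) t(1)] Qm_comp[OF rY(1) jp'(1)] t(3) ..
    finally show "(Qm K t K' \<bullet> \<theta>) \<bullet> v = Qm (inj_res Y) j' K' \<bullet> (rho Y \<bullet> \<beta>)" using XY jp'(1) by simp
    have "sh (rho X \<bullet> \<alpha>) \<bullet> w = sh (rho X) \<bullet> (sh \<alpha> \<bullet> w)" using XY by (simp add: sh.FArr_Comp')
    also have "\<dots> = (sh (rho X) \<bullet> Qm K p (shift_cpx A X)) \<bullet> \<theta>" unfolding sq(3) using XY jp(2) by simp
    also have "sh (rho X) \<bullet> Qm K p (shift_cpx A X) = Qm K' p' (shift_cpx A (inj_res X)) \<bullet> Qm K t K'"
      unfolding rho_def shift_Qm[OF rX(1)] Qm_comp[OF jp(2) chmap_shift[OF rX(1)]] Qm_comp[OF t(1) jp'(2)] t(4) ..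
    finally show "sh (rho X \<bullet> \<alpha>) \<bullet> w = Qm K' p' (shift_cpx A (inj_res X)) \<bullet> (Qm K t K' \<bullet> \<theta>)"
      using t(1) jp'(2) by simp
  qed
qed

end

context derived_functor
begin

lemma xi_inv_nat:
  assumes X: "is_iso D (\<xi> X)" and Y: "is_iso D (\<xi> Y)" and f: "chmap X f Y"
  shows "inv_arr D (\<xi> Y) \<bullet> FArr R (Qm X f Y) = QF X f Y \<bullet> inv_arr D (\<xi> X)"
proof -
  have [simp]: "cplx X" "cplx Y" using chm[OF f] by auto
  note Ff = F_chmap[OF f]
  have "\<xi> Y \<bullet> (inv_arr D (\<xi> Y) \<bullet> FArr R (Qm X f Y)) = FArr R (Qm X f Y)" using X Y f by simp
  also have "\<dots> = (FArr R (Qm X f Y) \<bullet> \<xi> X) \<bullet> inv_arr D (\<xi> X)" using X f by simp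
  also have "\<dots> = \<xi> Y \<bullet> (QF X f Y \<bullet> inv_arr D (\<xi> X))" unfolding xi_nat[OF f, symmetric] using X Y Ff by simp
  finally show ?thesis using X Y f Ff by - (rule D.iso_cancel_left[OF Y], simp_all)
qed

lemma R_add_injective:
  assumes I: "inj_cpx I" and J: "inj_cpx J" and f: "chmap I f J" and g: "chmap I g J"
  shows "FArr R (Qm I (\<lambda>n. f n \<oplus> g n) J) = D_add (FArr R (Qm I f J)) (FArr R (Qm I g J))"
proof -
  note c [simp] = inj_cpxD(1)[OF I] inj_cpxD(1)[OF J] and x [simp] = xi_iso[OF I] xi_iso[OF J]
  have fg: "chmap I (\<lambda>n. f n \<oplus> g n) J" using f g by (rule chmap_add)
  have R: "FArr R (Qm I h J) = \<xi> J \<bullet> (QF I h J \<bullet> inv_arr D (\<xi> I))" if h: "chmap I h J" for h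
    unfolding xi_inv_nat[OF x h, symmetric] using h by simp
  have H: "QF I h J \<bullet> inv_arr D (\<xi> I) \<in> Hom D (FOb R I) (FC J)" if h: "chmap I h J" for h
    using F_chmap[OF h] by simp
  have "QF I (\<lambda>n. f n \<oplus> g n) J = D_add (QF I f J) (QF I g J)"
    unfolding D_add_Qm[OF F_chmap[OF f] F_chmap[OF g]] using chm[OF f] chm[OF g] by simp
  then have "QF I (\<lambda>n. f n \<oplus> g n) J \<bullet> inv_arr D (\<xi> I)
      = D_add (QF I f J \<bullet> inv_arr D (\<xi> I)) (QF I g J \<bullet> inv_arr D (\<xi> I))"
    using D_add_comp_right[OF _ Qm_Hom[OF F_chmap[OF f]] Qm_Hom[OF F_chmap[OF g]], of "inv_arr D (\<xi> I)"] by simp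
  then show ?thesis
    unfolding R[OF f] R[OF g] R[OF fg] using D_add_comp_left[OF H[OF f] H[OF g] xi_Hom[OF c(2)]] by simp
qed

lemma R_add:
  assumes a: "a \<in> Hom D X Y" and b: "b \<in> Hom D X Y"
  shows "FArr R (D_add a b) = D_add (FArr R a) (FArr R b)"
proof -
  have c [simp]: "cplx X" "cplx Y" using D.Hom_Ob[OF a] by auto
  obtain f where f: "chmap (inj_res X) f (inj_res Y)" "rho Y \<bullet> a = Qm (inj_res X) f (inj_res Y) \<bullet> rho X"
    using D_lift[OF a] .
  obtain g where g: "chmap (inj_res X) g (inj_res Y)" "rho Y \<bullet> b = Qm (inj_res X) g (inj_res Y) \<bullet> rho X"
    using D_lift[OF b] .
  let ?Q = "\<lambda>h. Qm (inj_res X) h (inj_res Y)"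
  have fg: "chmap (inj_res X) (\<lambda>n. f n \<oplus> g n) (inj_res Y)" using f(1) g(1) by (rule chmap_add)
  have r: "rho X \<in> Hom D X (inj_res X)" "rho Y \<in> Hom D Y (inj_res Y)" by simp_all
  have ab: "D_add a b \<in> Hom D X Y" using DA.Add_Hom[of a X Y b] a b by (simp add: DA_simps)
  note [simp] = a[simplified] b[simplified] ab[simplified]
  have "rho Y \<bullet> D_add a b = D_add (?Q f \<bullet> rho X) (?Q g \<bullet> rho X)"
    unfolding f(2)[symmetric] g(2)[symmetric] by (rule D_add_comp_left[OF a b r(2)])
  also have "\<dots> = ?Q (\<lambda>n. f n \<oplus> g n) \<bullet> rho X"
    unfolding D_add_Qm[OF f(1) g(1), symmetric] by (rule D_add_comp_right[OF r(1) Qm_Hom[OF f(1)] Qm_Hom[OF g(1)], symmetric])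
  finally have sum: "rho Y \<bullet> D_add a b = ?Q (\<lambda>n. f n \<oplus> g n) \<bullet> rho X" .
  have "FArr R (rho Y) \<bullet> FArr R (D_add a b) = FArr R (rho Y \<bullet> D_add a b)" by (simp add: R.FArr_Comp')
  also have "\<dots> = FArr R (?Q (\<lambda>n. f n \<oplus> g n)) \<bullet> FArr R (rho X)" unfolding sum using fg by (simp add: R.FArr_Comp')
  also have "\<dots> = D_add (FArr R (?Q f) \<bullet> FArr R (rho X)) (FArr R (?Q g) \<bullet> FArr R (rho X))"
    unfolding R_add_injective[OF rho(5)[OF c(1)] rho(5)[OF c(2)] f(1) g(1)]
    by (rule D_add_comp_right[OF R.FArr_Hom[OF r(1)] R.FArr_Hom[OF Qm_Hom[OF f(1)]] R.FArr_Hom[OF Qm_Hom[OF g(1)]]])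
  also have "\<dots> = D_add (FArr R (rho Y \<bullet> a)) (FArr R (rho Y \<bullet> b))"
    unfolding f(2) g(2) using f(1) g(1) by (simp add: R.FArr_Comp')
  also have "\<dots> = FArr R (rho Y) \<bullet> D_add (FArr R a) (FArr R b)"
    using D_add_comp_left[OF R.FArr_Hom[OF a] R.FArr_Hom[OF b] R.FArr_Hom[OF r(2)]] by (simp add: R.FArr_Comp')
  finally show ?thesis
    using DA.Add_Hom[of "FArr R a" "FOb R X" "FOb R Y" "FArr R b"] R.FArr_Hom[OF a] R.FArr_Hom[OF b]
    by - (rule D.iso_cancel_left[OF R.FArr_iso(1)[OF rho(1)[OF c(2)]]], auto simp: DA_simps)
qed

lemma R_zero:
  assumes "X \<in> Ob D" "Y \<in> Ob D" shows "FArr R (Zero DA X Y) = Zero DA (FOb R X) (FOb R Y)"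
proof -
  have z: "Zero DA X Y \<in> Hom D X Y" using DA.Zero_Hom assms by (simp add: DA_simps)
  then have "D_add (Zero DA X Y) (Zero DA X Y) = Zero DA X Y" using DA.Add_Zero[of "Zero DA X Y"] by (simp add: DA_simps)
  then have "D_add (FArr R (Zero DA X Y)) (FArr R (Zero DA X Y)) = FArr R (Zero DA X Y)" using R_add[OF z z] by simp
  then show ?thesis
    using DA.idem_Zero[of "FArr R (Zero DA X Y)"] R.FArr_Hom[OF z] by (auto simp: DA_simps)
qed

lemma R_zero_object: assumes Z: "is_zero_object D Z" shows "is_zero_object D (FOb R Z)"
proof -
  have "Z \<in> Ob D" using Z by (simp add: is_zero_object_def)
  moreover from this have "Id D Z = Zero DA Z Z" using Z DA.zero_object_iff[of Z] unfolding DA_is_zero_object by (simp add: DA_simps)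
  ultimately have "Id D (FOb R Z) = Zero DA (FOb R Z) (FOb R Z)" using R.FArr_Id[of Z] R_zero by simp
  then show ?thesis using DA.zero_object_iff[of "FOb R Z"] R.FOb_Ob \<open>Z \<in> Ob D\<close> unfolding DA_is_zero_object by (simp add: DA_simps)
qed

lemma R_zero_arrow:
  assumes "is_zero_arrow D a" "a \<in> Arr D" shows "is_zero_arrow D (FArr R a)"
proof -
  obtain Z g h where z: "is_zero_object D Z" "g \<in> Hom D (Dom D a) Z" "h \<in> Hom D Z (Cod D a)" "a = h \<bullet> g"
    using assms(1) unfolding is_zero_arrow_def by blast
  have "FArr R a = FArr R h \<bullet> FArr R g" using R.FArr_Comp[OF z(2,3)] z(4) by simp
  then show ?thesis
    unfolding is_zero_arrow_def R.FArr_simps(2)[OF assms(2)] R.FArr_simps(3)[OF assms(2)]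
    using R_zero_object[OF z(1)] R.FArr_Hom[OF z(2)] R.FArr_Hom[OF z(3)] by blast
qed

lemma R_biproduct:
  assumes b: "is_biproduct D P i j p q X Y"
  shows "is_biproduct D (FOb R P) (FArr R i) (FArr R j) (FArr R p) (FArr R q) (FOb R X) (FOb R Y)"
proof -
  have b': "DA.biprod P i j p q X Y" using b DA.biproduct_biprod unfolding DA_is_biproduct by blast
  note s = DA.biprod_simps[OF b', unfolded DA_simps]
  have h: "i \<in> Hom D X P" "j \<in> Hom D Y P" "p \<in> Hom D P X" "q \<in> Hom D P Y" using s by simp_all
  have sum: "D_add (i \<bullet> p) (j \<bullet> q) = Id D P" using b' unfolding DA.biprod_def by (simp add: DA_simps)
  have "DA.biprod (FOb R P) (FArr R i) (FArr R j) (FArr R p) (FArr R q) (FOb R X) (FOb R Y)"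
    unfolding DA.biprod_def DA_simps
    using R.FArr_Hom[OF h(1)] R.FArr_Hom[OF h(2)] R.FArr_Hom[OF h(3)] R.FArr_Hom[OF h(4)]
      R.FArr_Comp[OF h(1,3), symmetric] R.FArr_Comp[OF h(2,4), symmetric] R.FArr_Comp[OF h(2,3), symmetric] R.FArr_Comp[OF h(1,4), symmetric]
      R_add[OF D.Comp_Hom[OF h(3,1)] D.Comp_Hom[OF h(4,2)]] R.FArr_Comp[OF h(3,1)] R.FArr_Comp[OF h(4,2)]
      sum R.FArr_Id R_zero s by simp
  moreover have "is_zero_arrow D (FArr R p \<bullet> FArr R j)" "is_zero_arrow D (FArr R q \<bullet> FArr R i)"
  proof -
    have "is_zero_arrow D (p \<bullet> j)" "is_zero_arrow D (q \<bullet> i)" using b unfolding is_biproduct_def by - (elim conjE, assumption)+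
    then show "is_zero_arrow D (FArr R p \<bullet> FArr R j)" "is_zero_arrow D (FArr R q \<bullet> FArr R i)"
      unfolding R.FArr_Comp[OF h(2,3), symmetric] R.FArr_Comp[OF h(1,4), symmetric]
      using D.Comp_Hom[OF h(2,3)] D.Comp_Hom[OF h(1,4)] by (auto intro!: R_zero_arrow simp: Hom_def)
  qed
  moreover have "is_zero_arrow DA = is_zero_arrow D" by (simp add: fun_eq_iff is_zero_arrow_def DA_is_zero_object DA_simps)
  ultimately show ?thesis using DA.biprod_biproduct unfolding DA_is_biproduct DA_simps by metis
qed

lemma additive_functor_R: "additive_functor D D R"
  unfolding additive_functor_def
proof (intro conjI allI impI)
  show "cat_functor D D R" by unfold_locales
  fix f g h assume "is_sum_of_arrows D f g h"
  then obtain X Y P i j p q u s where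
    fg: "f \<in> Hom D X Y" "g \<in> Hom D X Y" and b: "is_biproduct D P i j p q Y Y" and
    u: "u \<in> Hom D X P" "p \<bullet> u = f" "q \<bullet> u = g" and
    s: "s \<in> Hom D P Y" "s \<bullet> i = Id D Y" "s \<bullet> j = Id D Y" "h = s \<bullet> u"
    unfolding is_sum_of_arrows_def by (elim exE conjE)
  have h: "i \<in> Hom D Y P" "j \<in> Hom D Y P" "p \<in> Hom D P Y" "q \<in> Hom D P Y" using b unfolding is_biproduct_def by simp_all
  show "is_sum_of_arrows D (FArr R f) (FArr R g) (FArr R h)"
    unfolding is_sum_of_arrows_def
  proof (intro exI conjI)
    show "FArr R f \<in> Hom D (FOb R X) (FOb R Y)" "FArr R g \<in> Hom D (FOb R X) (FOb R Y)" using fg R.FArr_Hom by blast+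
    show "is_biproduct D (FOb R P) (FArr R i) (FArr R j) (FArr R p) (FArr R q) (FOb R Y) (FOb R Y)" by (rule R_biproduct[OF b])
    show "FArr R u \<in> Hom D (FOb R X) (FOb R P)" by (rule R.FArr_Hom[OF u(1)])
    show "FArr R p \<bullet> FArr R u = FArr R f" "FArr R q \<bullet> FArr R u = FArr R g"
      using R.FArr_Comp[OF u(1) h(3)] R.FArr_Comp[OF u(1) h(4)] u(2,3) by simp_all
    show "FArr R s \<in> Hom D (FOb R P) (FOb R Y)" by (rule R.FArr_Hom[OF s(1)])
    have "Y \<in> Ob D" using D.Hom_Ob[OF fg(1)] by simp
    then show "FArr R s \<bullet> FArr R i = Id D (FOb R Y)" "FArr R s \<bullet> FArr R j = Id D (FOb R Y)"
      using R.FArr_Comp[OF h(1) s(1)] R.FArr_Comp[OF h(2) s(1)] s(2,3) R.FArr_Id by simp_all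
    show "FArr R h = FArr R s \<bullet> FArr R u" unfolding s(4) by (rule R.FArr_Comp[OF u(1) s(1)])
  qed
qed

lemma shift_comparison:
  obtains \<phi> where "nat_iso D D (R \<circ>\<^sub>F Dplus_shift A) (Dplus_shift A \<circ>\<^sub>F R) \<phi>"
    "\<And>I. inj_cpx I \<Longrightarrow> \<phi> I = sh (\<xi> I) \<bullet> inv_arr D (\<xi> (shift_cpx A I))"
proof -
  define e where "e I = sh (\<xi> I) \<bullet> inv_arr D (\<xi> (shift_cpx A I))" for I
  have Rf: "cat_functor D D R" and shf: "cat_functor D D (Dplus_shift A)" by unfold_locales
  note G = comp_cat_functor[OF shf Rf] and S = comp_cat_functor[OF Rf shf]
  have e: "e I \<in> Hom D (FOb (R \<circ>\<^sub>F Dplus_shift A) I) (FOb (Dplus_shift A \<circ>\<^sub>F R) I)" "is_iso D (e I)" if I: "inj_cpx I" for I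
  proof -
    note [simp] = xi_iso[OF I] xi_iso[OF inj_cpx_shift[OF I]] inj_cpxD(1)[OF I] inj_cpxD(1)[OF inj_cpx_shift[OF I]]
    have [simp]: "is_iso D (sh (\<xi> I))" by (simp add: sh.FArr_iso(1))
    show "e I \<in> Hom D (FOb (R \<circ>\<^sub>F Dplus_shift A) I) (FOb (Dplus_shift A \<circ>\<^sub>F R) I)" "is_iso D (e I)"
      by (simp_all add: e_def F_shift)
  qed
  have "e J \<bullet> FArr (R \<circ>\<^sub>F Dplus_shift A) (Qm I f J) = FArr (Dplus_shift A \<circ>\<^sub>F R) (Qm I f J) \<bullet> e I"
    if I: "inj_cpx I" and J: "inj_cpx J" and f: "chmap I f J" for I J f
  proof -
    note [simp] = xi_iso[OF I] xi_iso[OF inj_cpx_shift[OF I]] inj_cpxD(1)[OF I] inj_cpxD(1)[OF inj_cpx_shift[OF I]]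
      xi_iso[OF J] xi_iso[OF inj_cpx_shift[OF J]] inj_cpxD(1)[OF J] inj_cpxD(1)[OF inj_cpx_shift[OF J]]
    note f' = chmap_shift[OF f] and Ff = F_chmap[OF f]
    note Ff' = F_chmap[OF f']
    let ?Qf = "Qm (shift_cpx A I) (\<lambda>n. f (n + 1)) (shift_cpx A J)"
    have "e J \<bullet> FArr R ?Qf = sh (\<xi> J) \<bullet> (inv_arr D (\<xi> (shift_cpx A J)) \<bullet> FArr R ?Qf)"
      using f' by (simp add: e_def F_shift)
    also have "\<dots> = (sh (\<xi> J) \<bullet> QF (shift_cpx A I) (\<lambda>n. f (n + 1)) (shift_cpx A J)) \<bullet> inv_arr D (\<xi> (shift_cpx A I))"
      unfolding xi_inv_nat[OF xi_iso[OF inj_cpx_shift[OF I]] xi_iso[OF inj_cpx_shift[OF J]] f'] using Ff' by (simp add: F_shift)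
    also have "QF (shift_cpx A I) (\<lambda>n. f (n + 1)) (shift_cpx A J) = sh (QF I f J)"
      unfolding shift_Qm[OF Ff] by (simp add: F_shift)
    also have "sh (\<xi> J) \<bullet> sh (QF I f J) = sh (FArr R (Qm I f J)) \<bullet> sh (\<xi> I)"
      using sh.FArr_Comp'[of "QF I f J" "\<xi> J"] sh.FArr_Comp'[of "\<xi> I" "FArr R (Qm I f J)"] xi_nat[OF f] Ff f by simp
    finally have "e J \<bullet> FArr R ?Qf = sh (FArr R (Qm I f J)) \<bullet> e I" using f by (simp add: e_def F_shift)
    then show ?thesis by (simp add: shift_Qm[OF f])
  qed
  then obtain \<phi> where p: "nat_trans D D (R \<circ>\<^sub>F Dplus_shift A) (Dplus_shift A \<circ>\<^sub>F R) \<phi>" "\<And>I. inj_cpx I \<Longrightarrow> \<phi> I = e I"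
    "\<And>X. cplx X \<Longrightarrow> is_iso D (e (inj_res X)) \<Longrightarrow> is_iso D (\<phi> X)"
    using nat_trans_from_injectives[OF G S e(1)] by blast
  have "nat_iso D D (R \<circ>\<^sub>F Dplus_shift A) (Dplus_shift A \<circ>\<^sub>F R) \<phi>"
    unfolding nat_iso_def using p(1,3) e(2) rho(5) by simp
  then show thesis using that p(2) unfolding e_def by blast
qed

theorem triangle_functor_R: "triangle_functor A R"
  unfolding triangle_functor_def
proof
  show "additive_functor D D R" by (rule additive_functor_R)
  obtain \<phi> where phi: "nat_iso D D (R \<circ>\<^sub>F Dplus_shift A) (Dplus_shift A \<circ>\<^sub>F R) \<phi>"
    "\<And>I. inj_cpx I \<Longrightarrow> \<phi> I = sh (\<xi> I) \<bullet> inv_arr D (\<xi> (shift_cpx A I))"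
    by (rule shift_comparison) (rule that)
  note n = conjunct1[OF phi(1)[unfolded nat_iso_def]]
  have ph [simp]: "\<phi> X \<in> Arr D" "Dom D (\<phi> X) = FOb R (shift_cpx A X)" "Cod D (\<phi> X) = shift_cpx A (FOb R X)"
    if "cplx X" for X
    using nat_transD(3)[OF n, of X] that by auto
  have "distinguished_triangle A (FArr R u) (FArr R v) (\<phi> (Dom D u) \<bullet> FArr R w)"
    if tri: "distinguished_triangle A u v w" for u v w
  proof -
    obtain X' Y' Z' I f J K i j p q \<alpha> \<beta> \<theta> where
      uvw: "u \<in> Hom D X' Y'" "v \<in> Hom D Y' Z'" "w \<in> Hom D Z' (shift_cpx A X')" and
      c: "is_mapping_cone A I f J K i j p q" and I: "inj_cpx I" and J: "inj_cpx J" and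
      iso: "\<alpha> \<in> Hom D X' I" "is_iso D \<alpha>" "\<beta> \<in> Hom D Y' J" "is_iso D \<beta>" "\<theta> \<in> Hom D Z' K" "is_iso D \<theta>" and
      sq: "\<beta> \<bullet> u = Qm I f J \<bullet> \<alpha>" "\<theta> \<bullet> v = Qm J j K \<bullet> \<beta>"
      "sh \<alpha> \<bullet> w = Qm K p (shift_cpx A I) \<bullet> \<theta>"
      using distinguished_injective[OF tri] .
    note K = inj_cpx_cone[OF c I J] and jp = cone_chmap[OF c] and f = coneD(1)[OF c] and sI = inj_cpx_shift[OF I]
    note x [simp] = xi_iso[OF I] xi_iso[OF J] xi_iso[OF K] xi_iso[OF sI]
    note [simp] = inj_cpxD(1)[OF I] inj_cpxD(1)[OF J] inj_cpxD(1)[OF K] inj_cpxD(1)[OF sI]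
    note [simp] = uvw[simplified] iso(1,3,5)[simplified]
    have [simp]: "cplx X'" using D.Hom_Ob[OF uvw(1)] by auto
    have Riso [simp]: "is_iso D (FArr R \<alpha>)" "is_iso D (FArr R \<beta>)" "is_iso D (FArr R \<theta>)" using iso R.FArr_iso(1) by blast+
    let ?a = "inv_arr D (\<xi> I) \<bullet> FArr R \<alpha>" and ?b = "inv_arr D (\<xi> J) \<bullet> FArr R \<beta>" and ?t = "inv_arr D (\<xi> K) \<bullet> FArr R \<theta>"
    have sq': "(inv_arr D (\<xi> T) \<bullet> FArr R b) \<bullet> FArr R x = QF S g T \<bullet> (inv_arr D (\<xi> S) \<bullet> FArr R a)"
      if ST: "is_iso D (\<xi> S)" "is_iso D (\<xi> T)" "chmap S g T" and x: "x \<in> Arr D" "a \<in> Arr D" "b \<in> Arr D"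
      "Dom D b = Cod D x" "Cod D b = T" "Dom D a = Dom D x" "Cod D a = S" and eq: "b \<bullet> x = Qm S g T \<bullet> a" for S T g a b x
    proof -
      have [simp]: "cplx S" "cplx T" using chm[OF ST(3)] by auto
      have "(inv_arr D (\<xi> T) \<bullet> FArr R b) \<bullet> FArr R x = inv_arr D (\<xi> T) \<bullet> FArr R (b \<bullet> x)"
        using ST x by (simp add: R.FArr_Comp')
      also have "\<dots> = (inv_arr D (\<xi> T) \<bullet> FArr R (Qm S g T)) \<bullet> FArr R a"
        unfolding eq using ST x by (simp add: R.FArr_Comp')
      also have "\<dots> = QF S g T \<bullet> (inv_arr D (\<xi> S) \<bullet> FArr R a)"
        unfolding xi_inv_nat[OF ST] using ST x F_chmap[OF ST(3)] by simp
      finally show ?thesis .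
    qed
    have s1: "?b \<bullet> FArr R u = QF I f J \<bullet> ?a" by (rule sq'[OF x(1,2) f]) (simp_all add: sq)
    have s2: "?t \<bullet> FArr R v = QF J j K \<bullet> ?b" by (rule sq'[OF x(2,3) jp(1)]) (simp_all add: sq)
    have "(inv_arr D (\<xi> (shift_cpx A I)) \<bullet> FArr R (sh \<alpha>)) \<bullet> FArr R w = QF K p (shift_cpx A I) \<bullet> ?t"
      by (rule sq'[OF x(3,4) jp(2)]) (simp_all add: sq)
    moreover have "sh ?a \<bullet> \<phi> X' = inv_arr D (\<xi> (shift_cpx A I)) \<bullet> FArr R (sh \<alpha>)"
    proof -
      have xs: "sh (\<xi> I) \<bullet> sh ?a = sh (FArr R \<alpha>)" using sh.FArr_Comp'[of ?a "\<xi> I"] by simp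
      have shx: "is_iso D (sh (\<xi> I))" by (rule sh.FArr_iso(1)[OF x(1)])
      have "sh (\<xi> I) \<bullet> (sh ?a \<bullet> \<phi> X') = (sh (\<xi> I) \<bullet> sh ?a) \<bullet> \<phi> X'" by simp
      also have "\<dots> = \<phi> I \<bullet> FArr R (sh \<alpha>)" unfolding xs using nat_transD(4)[OF n iso(1)] by simp
      also have "\<dots> = sh (\<xi> I) \<bullet> (inv_arr D (\<xi> (shift_cpx A I)) \<bullet> FArr R (sh \<alpha>))"
        unfolding phi(2)[OF I] by (simp add: F_shift)
      finally show ?thesis by - (rule D.iso_cancel_left[OF shx], simp_all add: F_shift)
    qed
    ultimately have s3: "sh ?a \<bullet> (\<phi> X' \<bullet> FArr R w) = QF K p (shift_cpx A I) \<bullet> ?t"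
      using D.assoc[of "FArr R w" "\<phi> X'" "sh ?a"] by simp
    show ?thesis
      unfolding distinguished_triangle_def Qm_def[symmetric] shift_FOb
    proof (intro exI conjI)
      show "FArr R u \<in> Hom D (FOb R X') (FOb R Y')" "FArr R v \<in> Hom D (FOb R Y') (FOb R Z')"
        "\<phi> (Dom D u) \<bullet> FArr R w \<in> Hom D (FOb R Z') (shift_cpx A (FOb R X'))" by simp_all
      show "is_mapping_cone A (FC I) (\<lambda>n. FArr F (f n)) (FC J) (FC K)
          (\<lambda>n. FArr F (i n)) (\<lambda>n. FArr F (j n)) (\<lambda>n. FArr F (p n)) (\<lambda>n. FArr F (q n))" by (rule F_cone[OF c])
      show "?a \<in> Hom D (FOb R X') (FC I)" "is_iso D ?a" "?b \<in> Hom D (FOb R Y') (FC J)" "is_iso D ?b"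
        "?t \<in> Hom D (FOb R Z') (FC K)" "is_iso D ?t" by simp_all
      show "?b \<bullet> FArr R u = QF I f J \<bullet> ?a" by (rule s1)
      show "?t \<bullet> FArr R v = QF J j K \<bullet> ?b" by (rule s2)
      show "sh ?a \<bullet> (\<phi> (Dom D u) \<bullet> FArr R w) = Qm (FC K) (\<lambda>n. FArr F (p n)) (shift_cpx A (FC I)) \<bullet> ?t"
        using s3 by (simp add: F_shift)
    qed
  qed
  then show "\<exists>\<phi>. nat_iso D D (R \<circ>\<^sub>F Dplus_shift A) (Dplus_shift A \<circ>\<^sub>F R) \<phi> \<and>
     (\<forall>u v w. distinguished_triangle A u v w \<longrightarrow>
        distinguished_triangle A (FArr R u) (FArr R v) (\<phi> (Dom D u) \<bullet> FArr R w))"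
    using phi(1) by blast
qed

end

section \<open>Derived functors of left exact radicals\<close>

lemma (in abelian_category) chain_iso:
  assumes f: "chmap X f Y" and iso: "\<And>n. is_iso A (f n)"
  shows "is_iso D (Qm X f Y)"
proof -
  note c = chm(1,2)[OF f]
  note [simp] = cpx[OF c(1)] cpx[OF c(2)] chm(3-5)[OF f] iso
  have g: "chmap Y (\<lambda>n. inv_arr A (f n)) X"
  proof (rule chmapI)
    fix n
    have "f (n + 1) \<cdot> (Diff X n \<cdot> inv_arr A (f n)) = (f (n + 1) \<cdot> Diff X n) \<cdot> inv_arr A (f n)" by simp
    also have "\<dots> = f (n + 1) \<cdot> (inv_arr A (f (n + 1)) \<cdot> Diff Y n)" unfolding chm(6)[OF f, symmetric] by simp
    finally show "Diff X n \<cdot> inv_arr A (f n) = inv_arr A (f (n + 1)) \<cdot> Diff Y n"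
      by - (rule iso_cancel_left[OF iso[of "n + 1"]], simp_all)
  qed (use c in simp_all)
  show ?thesis
    by (rule D.is_isoI[OF Qm_Hom[OF f] Qm_Hom[OF g]])
      (simp_all add: Qm_comp[OF f g] Qm_comp[OF g f] Qm_Id c)
qed

lemma nat_trans_iso_transfer:
  assumes n: "nat_trans B E G G' \<tau>" and a: "is_iso B a" "a \<in> Hom B X Y" and iso: "is_iso E (\<tau> Y)"
  shows "is_iso E (\<tau> X)"
proof -
  interpret G: cat_functor B E G by (rule nat_transD(1)[OF n])
  interpret G': cat_functor B E G' by (rule nat_transD(2)[OF n])
  have X: "X \<in> Ob B" "Y \<in> Ob B" using a(2) G.C.Hom_Ob by blast+
  have t: "\<tau> X \<in> Hom E (FOb G X) (FOb G' X)" "\<tau> Y \<in> Hom E (FOb G Y) (FOb G' Y)" using nat_transD(3)[OF n] X by blast+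
  have "is_iso E (\<tau> Y \<cdot>\<^bsub>E\<^esub> FArr G a)"
    using iso t a(2) G.FArr_iso(1)[OF a(1)] by (intro G.D.is_iso_Comp) auto
  then have "is_iso E (FArr G' a \<cdot>\<^bsub>E\<^esub> \<tau> X)" unfolding nat_transD(4)[OF n a(2)] .
  then show ?thesis
    by (rule G.D.is_iso_right_factor) (use G'.FArr_iso(1)[OF a(1)] t a(2) in auto)
qed

locale derived_radical = derived_functor A F R \<xi>
  for A :: "('o, 'm) abcat" (structure) and F R \<xi> +
  fixes \<iota> :: "'o \<Rightarrow> 'm"
  assumes radical: "radical_functor A F \<iota>" and left_exact: "left_exact_functor A F"
    and preserves_injectives: "preserves_injectives A F"
begin

lemma iota:
  assumes "M \<in> Ob A"
  shows "is_mono A (\<iota> M)" "\<iota> M \<in> Arr A" "Dom A (\<iota> M) = FOb F M" "Cod A (\<iota> M) = M"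
  using assms radical unfolding radical_functor_def preradical_functor_def nat_trans_def by auto

lemma iota_nat: "f \<in> Arr A \<Longrightarrow> \<iota> (Cod A f) \<cdot> FArr F f = f \<cdot> \<iota> (Dom A f)"
  using radical unfolding radical_functor_def preradical_functor_def nat_trans_def by simp

lemma iota_idem:
  assumes M: "M \<in> Ob A" shows "is_iso A (FArr F (\<iota> M))" "FArr F (\<iota> M) = \<iota> (FOb F M)"
proof -
  note i = iota[OF M]
  obtain c where c: "is_cokernel A c (\<iota> M)" using ex_cokernel[OF i(2)] by blast
  note cD = cokernelD[OF c]
  have z: "is_zero_object A (FOb F (Cod A c))" using radical c M unfolding radical_functor_def by blast
  have k: "is_kernel A (FArr F (\<iota> M)) (FArr F c)"
    using left_exact mono_kernel_coker[OF i(1) c] unfolding left_exact_functor_def by blast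
  note kD = kernelD[OF k]
  have cz: "FArr F c = Zero A (FOb F M) (FOb F (Cod A c))"
    using z by (rule to_zero_object) (use cD i in simp_all)
  obtain u where u: "u \<in> Hom A (FOb F M) (FOb F (FOb F M))" "FArr F (\<iota> M) \<cdot> u = Id A (FOb F M)"
    using kernel_lift[OF k, of "Id A (FOb F M)" "FOb F M"] Id_Hom[OF F_Ob[OF M]] cz cD i M z by auto
  note us = u(1)[simplified]
  have Fi: "FArr F (\<iota> M) \<in> Hom A (FOb F (FOb F M)) (FOb F M)" using i by simp
  have "u \<cdot> FArr F (\<iota> M) = Id A (FOb F (FOb F M))"
  proof (rule monoD[OF kernel_mono[OF k]])
    have "FArr F (\<iota> M) \<cdot> (u \<cdot> FArr F (\<iota> M)) = (FArr F (\<iota> M) \<cdot> u) \<cdot> FArr F (\<iota> M)" using us i by simp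
    then show "FArr F (\<iota> M) \<cdot> (u \<cdot> FArr F (\<iota> M)) = FArr F (\<iota> M) \<cdot> Id A (FOb F (FOb F M))" unfolding u(2) using i M by simp
  qed (use us i M in simp_all)
  then show "is_iso A (FArr F (\<iota> M))" using is_isoI[OF Fi u(1)] u(2) by blast
  show "FArr F (\<iota> M) = \<iota> (FOb F M)"
    using iota_nat[OF i(2)] i iota[OF F_Ob[OF M]] by - (rule monoD[OF i(1)], simp_all)
qed

lemma iota_chmap: "cplx X \<Longrightarrow> chmap (FC X) (\<lambda>n. \<iota> (Obj X n)) X"
  using F_cpx iota cpx iota_nat[of "Diff X _"] by (intro chmapI) simp_all

lemma inj_cpx_FC: "inj_cpx I \<Longrightarrow> inj_cpx (FC I)"
  using F_cpx preserves_injectives unfolding inj_cpx_def preserves_injectives_def by simp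

text \<open>The inclusions \<open>\<iota>\<close> induce a natural transformation \<open>\<epsilon> : R \<rightarrow> id\<close> for which \<open>R\<close> is an idempotent comonad.\<close>

lemma counit:
  obtains \<epsilon> where "nat_trans D D R id_functor \<epsilon>"
    "\<And>X. cplx X \<Longrightarrow> Qm (FC X) (\<lambda>n. \<iota> (Obj X n)) X = \<epsilon> X \<bullet> \<xi> X"
    "\<And>X. cplx X \<Longrightarrow> is_iso D (\<epsilon> (FOb R X))"
    "\<And>X. cplx X \<Longrightarrow> is_iso D (FArr R (\<epsilon> X))"
proof -
  let ?z = "\<lambda>X. Qm (FC X) (\<lambda>n. \<iota> (Obj X n)) X"
  have idf: "cat_functor D D id_functor" by (rule id_cat_functor) unfold_locales
  have Rf: "cat_functor D D R" by unfold_locales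
  have "nat_trans (Cplus A) D (Dplus_loc A \<circ>\<^sub>F Cplus_functor F) (id_functor \<circ>\<^sub>F Dplus_loc A) ?z"
    unfolding nat_trans_loc_iff[OF idf]
  proof (intro conjI allI impI)
    show "?z X \<in> Hom D (FC X) (FOb id_functor X)" if "cplx X" for X
      using Qm_Hom[OF iota_chmap[OF that]] by simp
    fix X f Y assume f: "chmap X f Y"
    note c = chm(1,2)[OF f]
    have "(\<lambda>n. \<iota> (Obj Y n) \<cdot> FArr F (f n)) = (\<lambda>n. f n \<cdot> \<iota> (Obj X n))" using iota_nat[of "f _"] chm[OF f] by simp
    then show "?z Y \<bullet> QF X f Y = FArr id_functor (Qm X f Y) \<bullet> ?z X"
      by (simp add: Qm_comp[OF F_chmap[OF f] iota_chmap[OF c(2)]] Qm_comp[OF iota_chmap[OF c(1)] f])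
  qed
  then obtain \<epsilon> where n: "nat_trans D D R id_functor \<epsilon>" and ez: "\<And>X. cplx X \<Longrightarrow> ?z X = \<epsilon> X \<bullet> \<xi> X"
    by (rule factor[OF idf]) (rule that)
  have eH: "\<epsilon> X \<in> Hom D (FOb R X) X" if "cplx X" for X using nat_transD(3)[OF n, of X] that by simp
  note [simp] = eH[simplified]
  have Rc [simp]: "cplx (FOb R X)" if "cplx X" for X using R.FOb_Ob that by simp
  have 1: "is_iso D (\<epsilon> (FOb R X))" if X: "cplx X" for X
  proof -
    note I = rho(5)[OF X] note Ic = inj_cpxD(1)[OF I] and FI = inj_cpx_FC[OF I]
    note FIc = inj_cpxD(1)[OF FI]
    have "is_iso D (\<epsilon> (FC (inj_res X)) \<bullet> \<xi> (FC (inj_res X)))"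
      unfolding ez[OF FIc, symmetric]
      by (rule chain_iso[OF iota_chmap[OF FIc]]) (use iota_idem cpx(1)[OF Ic] in auto)
    then have 2: "is_iso D (\<epsilon> (FC (inj_res X)))"
      by (rule D.is_iso_left_factor) (use xi_iso[OF FI] FIc in simp_all)
    have "inv_arr D (\<xi> (inj_res X)) \<in> Hom D (FOb R (inj_res X)) (FC (inj_res X))" using xi_iso[OF I] Ic by simp
    then have 3: "is_iso D (\<epsilon> (FOb R (inj_res X)))"
      using nat_trans_iso_transfer[OF n D.is_iso_inv[OF xi_iso[OF I]] _ 2] by blast
    have "FArr R (rho X) \<in> Hom D (FOb R X) (FOb R (inj_res X))" using X by simp
    then show ?thesis using nat_trans_iso_transfer[OF n R.FArr_iso(1)[OF rho(1)[OF X]] _ 3] by blast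
  qed
  have 2: "is_iso D (FArr R (\<epsilon> X))" if X: "cplx X" for X
  proof -
    note I = rho(5)[OF X] note Ic = inj_cpxD(1)[OF I] and FI = inj_cpx_FC[OF I]
    note FIc = inj_cpxD(1)[OF FI] and ic = iota_chmap[OF Ic]
    have "is_iso D (QF (FC (inj_res X)) (\<lambda>n. \<iota> (Obj (inj_res X) n)) (inj_res X))"
      by (rule chain_iso[OF F_chmap[OF ic]]) (use iota_idem cpx(1)[OF Ic] in auto)
    then have "is_iso D (\<xi> (inj_res X) \<bullet> QF (FC (inj_res X)) (\<lambda>n. \<iota> (Obj (inj_res X) n)) (inj_res X))"
      using xi_iso[OF I] Ic F_chmap[OF ic] by simp
    then have "is_iso D (FArr R (?z (inj_res X)) \<bullet> \<xi> (FC (inj_res X)))" unfolding xi_nat[OF ic] .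
    then have "is_iso D (FArr R (?z (inj_res X)))"
      by (rule D.is_iso_left_factor) (use xi_iso[OF FI] FIc ic in simp_all)
    then have "is_iso D (FArr R (\<epsilon> (inj_res X)) \<bullet> FArr R (\<xi> (inj_res X)))"
      unfolding ez[OF Ic] using Ic by (simp add: R.FArr_Comp')
    then have 3: "is_iso D (FArr R (\<epsilon> (inj_res X)))"
      by (rule D.is_iso_left_factor) (use R.FArr_iso(1)[OF xi_iso[OF I]] Ic in simp_all)
    have r: "rho X \<in> Hom D X (inj_res X)" using X by simp
    have "\<epsilon> (inj_res X) \<bullet> FArr R (rho X) = rho X \<bullet> \<epsilon> X" using nat_transD(4)[OF n r] by simp
    then have "FArr R (\<epsilon> (inj_res X)) \<bullet> FArr R (FArr R (rho X)) = FArr R (rho X) \<bullet> FArr R (\<epsilon> X)"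
      using R.FArr_Comp'[of "FArr R (rho X)" "\<epsilon> (inj_res X)"] R.FArr_Comp'[of "\<epsilon> X" "rho X"] X by simp
    moreover have "is_iso D (FArr R (\<epsilon> (inj_res X)) \<bullet> FArr R (FArr R (rho X)))"
      using 3 R.FArr_iso(1)[OF R.FArr_iso(1)[OF rho(1)[OF X]]] X by simp
    ultimately have "is_iso D (FArr R (rho X) \<bullet> FArr R (\<epsilon> X))" by simp
    then show ?thesis by (rule D.is_iso_right_factor) (use R.FArr_iso(1)[OF rho(1)[OF X]] X in simp_all)
  qed
  show thesis by (rule that[OF n ez 1 2])
qed

lemma right_adjoint: "is_right_adjoint (Im_category A R) D id_functor R"
proof -
  obtain \<epsilon> where n: "nat_trans D D R id_functor \<epsilon>"
    and e1: "\<And>X. cplx X \<Longrightarrow> is_iso D (\<epsilon> (FOb R X))"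
    and e2: "\<And>X. cplx X \<Longrightarrow> is_iso D (FArr R (\<epsilon> X))"
    by (rule counit) (rule that)
  let ?C = "Im_category A R" and ?S = "Im_objects A R"
  have eH: "\<epsilon> X \<in> Hom D (FOb R X) X" if "cplx X" for X using nat_transD(3)[OF n, of X] that by simp
  note [simp] = eH[simplified]
  have Rc [simp]: "cplx (FOb R X)" if "cplx X" for X using R.FOb_Ob that by simp
  have Sc: "cplx X" if "X \<in> ?S" for X using that by (simp add: Im_objects_def)
  have RS: "FOb R X \<in> ?S" if "cplx X" for X
  proof -
    have "isomorphic D (FOb R X) (FOb R X)"
      unfolding isomorphic_def using that by (intro bexI[of _ "Id D (FOb R X)"] D.Id_Hom D.is_iso_Id) simp_all
    then show ?thesis using that by (auto simp: Im_objects_def simp del: Rc intro: Rc)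
  qed
  have eS [simp]: "is_iso D (\<epsilon> X)" if "X \<in> ?S" for X
  proof -
    obtain Y a where Y: "cplx Y" "a \<in> Hom D X (FOb R Y)" "is_iso D a"
      using \<open>X \<in> ?S\<close> by (auto simp: Im_objects_def isomorphic_def)
    show ?thesis by (rule nat_trans_iso_transfer[OF n Y(3,2) e1[OF Y(1)]])
  qed
  have C: "Ob ?C = ?S" "Id ?C = Id D" "Comp ?C = Comp D" "Dom ?C = Dom D" "Cod ?C = Cod D"
    "Arr ?C = {f \<in> Arr D. Dom D f \<in> ?S \<and> Cod D f \<in> ?S}"
    by (auto simp: Im_category_def full_subcategory_def Im_objects_def)
  have CH: "Hom ?C X Y = {f \<in> Hom D X Y. X \<in> ?S \<and> Y \<in> ?S}" for X Y by (auto simp: C)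
  have catC: "category ?C"
    by (rule category.intro; unfold C CH)
      (auto simp: D.Id_Hom Sc intro: D.Comp_Hom D.Comp_Id D.Id_Comp D.Comp_assoc)
  have catD: "category D" by unfold_locales
  have Rf: "cat_functor D D R" by unfold_locales
  have RC: "cat_functor D ?C R"
  proof (intro cat_functor.intro cat_functor_axioms.intro catC catD; unfold C CH)
    show "FOb R X \<in> ?S" if "X \<in> Ob D" for X using that RS by simp
    show "FArr R f \<in> {f \<in> Hom D (FOb R X) (FOb R Y). FOb R X \<in> ?S \<and> FOb R Y \<in> ?S}" if f: "f \<in> Hom D X Y" for f X Y
      using R.FArr_Hom[OF f] D.Hom_Ob[OF f] RS by simp
  qed (rule R.FArr_Id R.FArr_Comp; assumption)+
  have iD: "cat_functor ?C D id_functor"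
    using Sc by (intro cat_functor.intro cat_functor_axioms.intro catC catD; unfold C CH) auto
  have RCC: "cat_functor ?C ?C (R \<circ>\<^sub>F id_functor)" by (rule comp_cat_functor[OF iD RC])
  have RDD: "cat_functor D D (id_functor \<circ>\<^sub>F R)" by (rule comp_cat_functor[OF RC iD])
  have enat: "\<epsilon> (Cod D f) \<bullet> FArr R f = f \<bullet> \<epsilon> (Dom D f)" if "f \<in> Arr D" for f
    using nat_transD(4)[OF n D.Arr_Hom[OF that]] by simp
  define \<eta> where "\<eta> X = inv_arr D (\<epsilon> X)" for X
  have Re: "FArr R (\<epsilon> Y) = \<epsilon> (FOb R Y)" if Y: "cplx Y" for Y
  proof -
    let ?a = "FArr R (\<epsilon> Y)" and ?b = "\<epsilon> (FOb R Y)"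
    have eq: "\<epsilon> Y \<bullet> ?a = \<epsilon> Y \<bullet> ?b" using enat[of "\<epsilon> Y"] Y by simp
    have "?a \<bullet> FArr R ?a = ?a \<bullet> FArr R ?b"
      using R.FArr_Comp'[of ?a "\<epsilon> Y"] R.FArr_Comp'[of ?b "\<epsilon> Y"] eq Y by simp
    then have "FArr R ?a = FArr R ?b" using Y by - (rule D.iso_cancel_left[OF e2[OF Y]], simp_all)
    then have "?a \<bullet> \<epsilon> (FOb R (FOb R Y)) = ?b \<bullet> \<epsilon> (FOb R (FOb R Y))"
      using enat[of ?a] enat[of ?b] Y by simp
    then show ?thesis using Y by - (rule D.iso_cancel_right[OF e1[of "FOb R Y"]], simp_all)
  qed
  have etanat: "\<eta> (Cod D f) \<bullet> f = FArr R f \<bullet> \<eta> (Dom D f)" if f: "f \<in> Arr D" "Dom D f \<in> ?S" "Cod D f \<in> ?S" for f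
  proof -
    note [simp] = f Sc[OF f(2)] Sc[OF f(3)]
    have "\<epsilon> (Cod D f) \<bullet> (FArr R f \<bullet> \<eta> (Dom D f)) = (\<epsilon> (Cod D f) \<bullet> FArr R f) \<bullet> \<eta> (Dom D f)" by (simp add: \<eta>_def)
    also have "\<dots> = \<epsilon> (Cod D f) \<bullet> (\<eta> (Cod D f) \<bullet> f)" unfolding enat[OF f(1)] by (simp add: \<eta>_def)
    finally show ?thesis by - (rule D.iso_cancel_left[OF eS[OF f(3)], symmetric], simp_all add: \<eta>_def)
  qed
  have "nat_trans ?C ?C id_functor (R \<circ>\<^sub>F id_functor) \<eta>"
    unfolding nat_trans_def C CH using id_cat_functor[OF catC] RCC etanat RS Sc by (auto simp: \<eta>_def Hom_def)
  moreover have "nat_trans D D (id_functor \<circ>\<^sub>F R) id_functor \<epsilon>"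
    unfolding nat_trans_def using id_cat_functor[OF catD] RDD enat eH by auto
  moreover have "\<epsilon> (FOb id_functor X) \<bullet> FArr id_functor (\<eta> X) = Id D (FOb id_functor X)" if "X \<in> Ob ?C" for X
    using that Sc[of X] unfolding C by (simp add: \<eta>_def)
  moreover have "FArr R (\<epsilon> Y) \<cdot>\<^bsub>?C\<^esub> \<eta> (FOb R Y) = Id ?C (FOb R Y)" if "Y \<in> Ob D" for Y
    using that Re[of Y] e1[of Y] by (simp add: C \<eta>_def)
  ultimately show ?thesis unfolding is_right_adjoint_def by blast
qed

lemma iota_zero_or_iso:
  assumes E: "injective_object A E" "indecomposable_object A E"
  shows "is_zero_object A (FOb F E) \<or> is_iso A (\<iota> E)"
proof -
  have EO [simp]: "E \<in> Ob A" using E(1) by (simp add: injective_object_def)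
  note i = iota[OF EO]
  have "injective_object A (FOb F E)" using E(1) preserves_injectives by (simp add: preserves_injectives_def)
  then have "\<exists>g\<in>Hom A (Cod A (\<iota> E)) (FOb F E). g \<cdot> \<iota> E = Id A (FOb F E)"
    unfolding injective_object_def using i(1,3) Id_Hom[OF F_Ob[OF EO]] by simp
  then obtain g where g: "g \<in> Hom A E (FOb F E)" "g \<cdot> \<iota> E = Id A (FOb F E)" using i(4) by auto
  note gs = g(1)[simplified]
  obtain k where k: "is_kernel A k g" using ex_kernel gs by blast
  note kD = kernelD[OF k]
  let ?d = "Id A E \<oplus> Neg A (\<iota> E \<cdot> g)"
  have ig: "g \<cdot> (\<iota> E \<cdot> x) = x" if "x \<in> Arr A" "Cod A x = FOb F E" for x
    using reassoc[OF g(2), of x] gs i that by simp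
  have gd: "g \<cdot> ?d = Zero A E (FOb F E)" using gs i ig[of g] by simp
  obtain q where q: "q \<in> Hom A E (Dom A k)" "k \<cdot> q = ?d"
    using kernel_lift[OF k, of ?d E] gd gs i by auto
  note qs = q(1)[simplified]
  have kq: "k \<cdot> (q \<cdot> x) = x \<oplus> Neg A (\<iota> E \<cdot> (g \<cdot> x))" if "x \<in> Arr A" "Cod A x = E" for x
    using reassoc[OF q(2), of x] gs qs kD i that by simp
  note km = kernel_mono[OF k]
  have "q \<cdot> k = Id A (Dom A k)"
    using kq[of k] qs kD gs i by - (rule monoD[OF km], simp_all)
  moreover have "q \<cdot> \<iota> E = Zero A (FOb F E) (Dom A k)"
    using kq[of "\<iota> E"] qs kD gs i g(2) by - (rule mono_Zero[OF km], simp_all)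
  moreover have "(\<iota> E \<cdot> g) \<oplus> (k \<cdot> q) = Id A E"
    unfolding q(2) using gs i Add_left_commute[of "\<iota> E \<cdot> g" "Id A E" "Neg A (\<iota> E \<cdot> g)"] by simp
  ultimately have b: "biprod E (\<iota> E) k g q (FOb F E) (Dom A k)"
    unfolding biprod_def using gs qs kD i g(2) by simp
  then have "is_zero_object A (FOb F E) \<or> is_zero_object A (Dom A k)"
    using E(2) unfolding indecomposable_object_def biproduct_iff by blast
  moreover have "is_iso A (\<iota> E)" if z: "is_zero_object A (Dom A k)"
  proof -
    have "k = Zero A (Dom A k) E" using z by (rule from_zero_object) (use kD gs in simp_all)
    then have "k \<cdot> q = Zero A E E" using qs Zero_Comp[of q E "Dom A k"] by simp
    then have "\<iota> E \<cdot> g = Id A E" using q(2) eq_iff_diff[of "Id A E" "\<iota> E \<cdot> g"] gs i by simp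
    then show ?thesis using is_isoI[of "\<iota> E" "FOb F E" E g] g i by simp
  qed
  ultimately show ?thesis by blast
qed

lemma zero_cpx:
  assumes Z: "cplx Z" and zero: "\<And>n. is_zero_object A (Obj Z n)"
  shows "is_zero_object D Z"
proof -
  have "Id A (Obj Z n) = Id A (Obj Z n) \<oplus> Id A (Obj Z n)" for n
    using zero_object_iff[of "Obj Z n"] zero[of n] cpx(1)[OF Z] by simp
  then have "D_add (Id D Z) (Id D Z) = Id D Z"
    using D_add_Qm[OF chmap_Id[OF Z] chmap_Id[OF Z]] Qm_Id[OF Z] by simp
  then have "Id D Z = Zero DA Z Z" using DA.idem_Zero[of "Id D Z"] Z by (simp add: DA_simps)
  then show ?thesis using DA.zero_object_iff[of Z] Z unfolding DA_is_zero_object by (simp add: DA_simps)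
qed

lemma stalk_Im_or_Ker:
  assumes E: "injective_object A E" "indecomposable_object A E" and X: "is_stalk_complex A E X"
  shows "X \<in> Im_objects A R \<or> X \<in> Ker_objects A R"
proof -
  have c [simp]: "cplx X" and X0: "Obj X 0 = E" and Xn: "\<And>n. n \<noteq> 0 \<Longrightarrow> is_zero_object A (Obj X n)"
    using X by (simp_all add: is_stalk_complex_def)
  have "injective_object A (Obj X n)" for n using zero_injective[OF Xn, of n] E(1) X0 by (cases "n = 0") simp_all
  then have I: "inj_cpx X" by (simp add: inj_cpx_def)
  note x = xi_iso[OF I]
  from iota_zero_or_iso[OF E] show ?thesis
  proof
    assume z: "is_zero_object A (FOb F E)"
    have "is_zero_object A (Obj (FC X) n)" for n using F_zero_object[OF Xn, of n] z X0 by (cases "n = 0") simp_all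
    then have "is_zero_object D (FC X)" using zero_cpx F_cpx[OF c] by blast
    then have iz: "Id D (FC X) = Zero DA (FC X) (FC X)"
      using DA.zero_object_iff[of "FC X"] F_cpx[OF c] unfolding DA_is_zero_object by (simp add: DA_simps)
    have Rc: "cplx (FOb R X)" using R.FOb_Ob[of X] by simp
    have "Id D (FOb R X) = \<xi> X \<bullet> (Id D (FC X) \<bullet> inv_arr D (\<xi> X))" using x F_cpx[OF c] by simp
    also have "\<dots> = Zero DA (FOb R X) (FOb R X)"
      unfolding iz using DA.Zero_Comp[of "inv_arr D (\<xi> X)" "FC X" "FC X"] DA.Comp_Zero[of "\<xi> X" "FOb R X" "FC X"] x F_cpx[OF c] Rc
      by (simp add: DA_simps)
    finally have "is_zero_object D (FOb R X)"
      using DA.zero_object_iff[of "FOb R X"] Rc unfolding DA_is_zero_object by (simp add: DA_simps)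
    then show ?thesis by (simp add: Ker_objects_def)
  next
    assume i: "is_iso A (\<iota> E)"
    have ii: "is_iso A (\<iota> (Obj X n))" for n
    proof (cases "n = 0")
      case False
      note z = Xn[OF False] note Fz = F_zero_object[OF z]
      note t = iota[OF zero_object_Ob[OF z]]
      have e: "Id A (Obj X n) = Zero A (Obj X n) (Obj X n)" "Id A (FOb F (Obj X n)) = Zero A (FOb F (Obj X n)) (FOb F (Obj X n))"
        using z Fz zero_object_iff zero_object_Ob by blast+
      show ?thesis
        by (rule is_isoI[of _ "FOb F (Obj X n)" "Obj X n" "Zero A (Obj X n) (FOb F (Obj X n))"])
          (use t z Fz in \<open>simp_all add: e\<close>)
    qed (use i X0 in simp)
    have z: "is_iso D (Qm (FC X) (\<lambda>n. \<iota> (Obj X n)) X)" by (rule chain_iso[OF iota_chmap[OF c] ii])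
    have "isomorphic D X (FOb R X)"
      unfolding isomorphic_def
      by (rule bexI[of _ "\<xi> X \<bullet> inv_arr D (Qm (FC X) (\<lambda>n. \<iota> (Obj X n)) X)"])
        (use x z iota_chmap[OF c] in simp_all)
    then have "X \<in> Im_objects A R" unfolding Im_objects_def by (auto intro: exI[of _ X])
    then show ?thesis ..
  qed
qed

theorem abstract_local_cohomology: "abstract_local_cohomology_functor A R"
proof -
  have "nat_iso D D R (id_functor \<circ>\<^sub>F R) (\<lambda>X. Id D (FOb R X))"
  proof -
    have Rf: "cat_functor D D R" by unfold_locales
    have idf: "cat_functor D D id_functor" by (rule id_cat_functor) unfold_locales
    have "FOb R X \<in> Ob D" if "X \<in> Ob D" for X using R.FOb_Ob that .
    then show ?thesis
      unfolding nat_iso_def nat_trans_def using Rf comp_cat_functor[OF Rf idf] D.Id_Hom D.Dom_Ob D.Cod_Ob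
      by simp
  qed
  then show ?thesis
    unfolding abstract_local_cohomology_functor_def naturally_isomorphic_def
    using triangle_functor_R right_adjoint stalk_Im_or_Ker by blast
qed

end

theorem proposition5p4:
  fixes A :: "('o, 'm) abcat"
    and \<gamma> :: "('o, 'm, 'o, 'm) fctr"
    and \<iota> :: "'o \<Rightarrow> 'm"
  assumes "universe_type TYPE('u)"
    and "locally_noetherian_grothendieck_category TYPE('u) A"
    and "radical_functor A \<gamma> \<iota>"
    and "left_exact_functor A \<gamma>"
    and "preserves_injectives A \<gamma>"
  shows "(\<exists>R \<xi>. is_right_derived_functor A \<gamma> R \<xi>) \<and>
    (\<forall>R \<xi>. is_right_derived_functor A \<gamma> R \<xi> \<longrightarrow> abstract_local_cohomology_functor A R)"
proof -
  interpret L: locally_noetherian_category A "TYPE('u)"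
    using assms(1,2) unfolding locally_noetherian_category_def locally_noetherian_category_axioms_def
      locally_noetherian_grothendieck_category_def grothendieck_category_def by blast
  interpret derivable A \<gamma>
  proof (unfold_locales)
    show "additive_functor A A \<gamma>" using assms(4) by (simp add: left_exact_functor_def)
    show "\<exists>m. is_mono A m \<and> Dom A m = M \<and> injective_object A (Cod A m)" if "M \<in> Ob A" for M
      using L.enough_injectives[OF that] by blast
  qed
  have "abstract_local_cohomology_functor A R" if "is_right_derived_functor A \<gamma> R \<xi>" for R \<xi>
  proof -
    have "derived_radical A \<gamma> R \<xi> \<iota>"
      using derived_functorI[OF that] assms(3-5) by (simp add: derived_radical_def derived_radical_axioms_def)
    then show ?thesis by (rule derived_radical.abstract_local_cohomology)
  qed
  then show ?thesis using derived_functor.is_right_derived_functor[OF derived_functor_RF] by blast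
qed

end
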